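(* Let $n\ge 1$ and let $\tilde c\in L^\infty(D_2)$ be a nilpotent symbol, $\tilde c(\zeta_1,\zeta_2)=c(\operatorname{Im}\zeta_1,\operatorname{Im}\zeta_2-|\zeta_1|^2)$ with $c:\mathbb{R}\times\mathbb{R}_+\to\mathbb{C}$. Then the Toeplitz operator $T_c$ acting on the poly-Bergman-type space $\mathcal{A}^2_{(1,n)}(D_2)$ is unitarily equivalent to the multiplication operator $M_{\gamma^c}$ on $(L^2(\mathbb{R}\times\mathbb{R}_+))^n$; in fact $M_{\gamma^c}=R_{(1,n)}T_cR_{(1,n)}^*$, where the matrix-valued function $\gamma^c:\mathbb{R}\times\mathbb{R}_+\to M_n(\mathbb{C})$ is given by $$\gamma^c(x_1,x_2)=\int_{\mathbb{R}}\int_{\mathbb{R}_+}c\left(\frac{-x_1+y_1}{2\sqrt{x_2}},\frac{y_2}{2x_2}\right)(h_0(y_1))^2\,N(y_2)[N(y_2)]^T\,dy_2\,dy_1 .$$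
   Context: Notation: $\mathbb{R}_+=(0,\infty)$, $\Pi=\mathbb{R}\times\mathbb{R}_+$ (identified with the upper half-plane). All $L^2$ spaces are with respect to Lebesgue measure. The Siegel domain is $D_2=\{(\zeta_1,\zeta_2)\in\mathbb{C}^2:\operatorname{Im}\zeta_2-|\zeta_1|^2>0\}$. For $(l_1,l_2)\in\mathbb{N}^2$ (positive integers), $\mathcal{A}^2_{(l_1,l_2)}(D_2)$ is the closed subspace of $L^2(D_2)$ of all $f\in C^\infty(D_2)\cap L^2(D_2)$ with $\left(\frac{\partial}{\partial\bar\zeta_1}-2i\zeta_1\frac{\partial}{\partial\bar\zeta_2}\right)^{l_1}f=0$ and $\left(\frac{\partial}{\partial\bar\zeta_2}\right)^{l_2}f=0$. Let $B_{(1,n)}$ be the orthogonal projection of $L^2(D_2)$ onto $\mathcal{A}^2_{(1,n)}(D_2)$, and $T_cf=B_{(1,n)}(\tilde c f)$ for $f\in\mathcal{A}^2_{(1,n)}(D_2)$. Hermite functions: $h_m(y)=(2^m\sqrt\pi\,m!)^{-1/2}H_m(y)e^{-y^2/2}$, $H_m(y)=(-1)^me^{y^2}\frac{d^m}{dy^m}e^{-y^2}$. Laguerre functions: $\ell_m(y)=(-1)^mL_m(y)e^{-y/2}$, $L_m(y)=\frac{e^y}{m!}\frac{d^m}{dy^m}(e^{-y}y^m)$. $N(y)=(\ell_0(y),\dots,\ell_{n-1}(y))^T$. Let $\mathcal{D}=\mathbb{C}\times\Pi$. Define unitary operators as follows. (i) $U_0:L^2(D_2)\to L^2(\mathcal{D})$,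 $(U_0f)(w)=f(\kappa(w))$, $\kappa(w_1,w_2)=(w_1,w_2+i|w_1|^2)$. (ii) Writing $w_m=u_m+iv_m$ and $L^2(\mathcal{D})=L^2(\mathbb{R},du_1)\otimes L^2(\mathbb{R},dv_1)\otimes L^2(\mathbb{R},du_2)\otimes L^2(\mathbb{R}_+,dv_2)$, $U_1=F\otimes I\otimes F\otimes I$ with $(Fg)(t)=\frac1{\sqrt{2\pi}}\int_{\mathbb{R}}g(x)e^{-itx}dx$. (iii) $(V_1f)(\xi)=(2|t_2|)^{-1/2}f(\psi_1(\xi))$, where $\psi_1(\xi_1,t_2+is_2)=\left(\xi_1,t_2+i\frac{s_2}{2|t_2|}\right)$. (iv) $(V_2g)(z)=g(\psi_2(z))$, where for $z=(x_1+iy_1,z_2)$, $z_2=x_2+iy_2$, $\psi_2(z)=\left(\sqrt{|x_2|}(x_1+y_1)+i\frac{-x_1+y_1}{2\sqrt{|x_2|}},\,z_2\right)$. Put $U=V_2V_1U_1U_0:L^2(D_2)\to L^2(\mathcal{D})$. Define the isometric embedding $R_{0(1,n)}:(L^2(\mathbb{R}\times\mathbb{R}_+))^n\to L^2(\mathcal{D})$ by $(R_{0(1,n)}g)(x_1,y_1,x_2,y_2)=\chi_{\mathbb{R}_+}(x_2)h_0(y_1)[N(y_2)]^Tg(x_1,x_2)$, and $R_{(1,n)}=R_{0(1,n)}^*U:L^2(D_2)\to(L^2(\mathbb{R}\times\mathbb{R}_+))^n$. It is known that $U$ maps $\mathcal{A}^2_{(1,n)}(D_2)$ isometrically onto the range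 of $R_{0(1,n)}$, so that $R_{(1,n)}R_{(1,n)}^*=I$ and $R_{(1,n)}^*R_{(1,n)}=B_{(1,n)}$. $M_{\gamma}$ denotes the operator $g\mapsto\gamma g$ of multiplication by the matrix-valued function $\gamma$. *)

theory Defs
  imports "HOL-Analysis.Analysis"
begin

section \<open>Hilbert spaces given by representatives\<close>

text \<open>
  Elements of \<open>L\<^sup>2\<close>-spaces are represented by functions, so a space consists of a set of
  representatives, an inner product (conjugate-linear in the second argument) and the
  equality of the represented elements.  Operators are functions on representatives; every
  equation between elements is stated with \<open>eqv\<close>.
\<close>

record 'a ip_space =
  carr :: "'a set"
  ip :: "'a \<Rightarrow> 'a \<Rightarrow> complex"
  eqv :: "'a \<Rightarrow> 'a \<Rightarrow> bool"

definition L2 :: "'a::euclidean_space set \<Rightarrow> ('a \<Rightarrow> complex) ip_space" where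
  "L2 S = \<lparr>
     carr = {f. f \<in> borel_measurable (lebesgue_on S) \<and>
                integrable (lebesgue_on S) (\<lambda>x. (cmod (f x))\<^sup>2)},
     ip = (\<lambda>f g. LINT x|lebesgue_on S. f x * cnj (g x)),
     eqv = (\<lambda>f g. AE x in lebesgue_on S. f x = g x) \<rparr>"

text \<open>The \<open>n\<close>-th power of \<open>L\<^sup>2(S)\<close>; the components of \<open>g\<close> are \<open>g 0, \<dots>, g (n - 1)\<close>.\<close>

definition L2_pow :: "nat \<Rightarrow> 'a::euclidean_space set \<Rightarrow> (nat \<Rightarrow> 'a \<Rightarrow> complex) ip_space" where
  "L2_pow n S = \<lparr>
     carr = {g. \<forall>k<n. g k \<in> carr (L2 S)},
     ip = (\<lambda>g g'. \<Sum>k<n. ip (L2 S) (g k) (g' k)),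
     eqv = (\<lambda>g g'. \<forall>k<n. eqv (L2 S) (g k) (g' k)) \<rparr>"

definition Linf :: "'a::euclidean_space set \<Rightarrow> ('a \<Rightarrow> complex) set" where
  "Linf S = {f. f \<in> borel_measurable (lebesgue_on S) \<and>
                (\<exists>C. AE x in lebesgue_on S. cmod (f x) \<le> C)}"

text \<open>
  A surjective map preserving inner products is automatically linear and compatible with
  \<open>eqv\<close>, so neither is required separately.
\<close>

definition unitary_map :: "'a ip_space \<Rightarrow> 'b ip_space \<Rightarrow> ('a \<Rightarrow> 'b) \<Rightarrow> bool" where
  "unitary_map X Y W \<longleftrightarrow>
     (\<forall>x\<in>carr X. W x \<in> carr Y) \<and>
     (\<forall>x\<in>carr X. \<forall>x'\<in>carr X. ip Y (W x) (W x') = ip X x x') \<and>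
     (\<forall>y\<in>carr Y. \<exists>x\<in>carr X. eqv Y (W x) y)"

definition unitarily_equivalent ::
  "'a ip_space \<Rightarrow> ('a \<Rightarrow> 'a) \<Rightarrow> 'b ip_space \<Rightarrow> ('b \<Rightarrow> 'b) \<Rightarrow> bool" where
  "unitarily_equivalent X S Y T \<longleftrightarrow>
     (\<forall>x\<in>carr X. S x \<in> carr X) \<and> (\<forall>y\<in>carr Y. T y \<in> carr Y) \<and>
     (\<exists>W. unitary_map X Y W \<and> (\<forall>x\<in>carr X. eqv Y (W (S x)) (T (W x))))"

definition adj :: "'a ip_space \<Rightarrow> 'b ip_space \<Rightarrow> ('a \<Rightarrow> 'b) \<Rightarrow> 'b \<Rightarrow> 'a" where
  "adj X Y T y = (SOME x. x \<in> carr X \<and> (\<forall>x'\<in>carr X. ip Y (T x') y = ip X x' x))"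

text \<open>Orthogonal projection of \<open>X\<close> onto the subspace represented by \<open>S\<close>.\<close>

definition orth_proj :: "('a \<Rightarrow> complex) ip_space \<Rightarrow> ('a \<Rightarrow> complex) set
    \<Rightarrow> ('a \<Rightarrow> complex) \<Rightarrow> ('a \<Rightarrow> complex)" where
  "orth_proj X S f = (SOME p. p \<in> S \<and> (\<forall>q\<in>S. ip X (\<lambda>x. f x - p x) q = 0))"


section \<open>Smooth functions and poly-Bergman-type spaces on the Siegel domain\<close>

definition siegel :: "(complex \<times> complex) set" where
  "siegel = {(\<zeta>1, \<zeta>2). Im \<zeta>2 - (cmod \<zeta>1)\<^sup>2 > 0}"

text \<open>\<open>Ck_on k S f\<close>: on the open set \<open>S\<close>, \<open>f\<close> is of class \<open>C\<^sup>k\<close> in the real sense.\<close>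

primrec Ck_on :: "nat \<Rightarrow> 'a::real_normed_vector set \<Rightarrow> ('a \<Rightarrow> 'b::real_normed_vector) \<Rightarrow> bool" where
  "Ck_on 0 S f \<longleftrightarrow> continuous_on S f"
| "Ck_on (Suc k) S f \<longleftrightarrow> (\<forall>x\<in>S. f differentiable (at x)) \<and>
     (\<forall>v. Ck_on k S (\<lambda>x. frechet_derivative f (at x) v))"

definition smooth_on :: "'a::real_normed_vector set \<Rightarrow> ('a \<Rightarrow> 'b::real_normed_vector) \<Rightarrow> bool" where
  "smooth_on S f \<longleftrightarrow> (\<forall>k. Ck_on k S f)"

definition dbar1 :: "(complex \<times> complex \<Rightarrow> complex) \<Rightarrow> complex \<times> complex \<Rightarrow> complex" where
  "dbar1 f \<zeta> = (frechet_derivative f (at \<zeta>) (1, 0) + \<i> * frechet_derivative f (at \<zeta>) (\<i>, 0)) / 2"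

definition dbar2 :: "(complex \<times> complex \<Rightarrow> complex) \<Rightarrow> complex \<times> complex \<Rightarrow> complex" where
  "dbar2 f \<zeta> = (frechet_derivative f (at \<zeta>) (0, 1) + \<i> * frechet_derivative f (at \<zeta>) (0, \<i>)) / 2"

definition dbar_tangential :: "(complex \<times> complex \<Rightarrow> complex) \<Rightarrow> complex \<times> complex \<Rightarrow> complex" where
  "dbar_tangential f \<zeta> = dbar1 f \<zeta> - 2 * \<i> * fst \<zeta> * dbar2 f \<zeta>"

definition poly_bergman :: "nat \<Rightarrow> nat \<Rightarrow> (complex \<times> complex \<Rightarrow> complex) ip_space" where
  "poly_bergman l1 l2 = L2 siegel \<lparr> carr :=
     {f \<in> carr (L2 siegel). smooth_on siegel f \<and>
        (\<forall>\<zeta>\<in>siegel. (dbar_tangential ^^ l1) f \<zeta> = 0 \<and> (dbar2 ^^ l2) f \<zeta> = 0)} \<rparr>"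

definition bergman_proj :: "nat \<Rightarrow> (complex \<times> complex \<Rightarrow> complex) \<Rightarrow> (complex \<times> complex \<Rightarrow> complex)" where
  "bergman_proj n = orth_proj (L2 siegel) (carr (poly_bergman 1 n))"

definition toeplitz :: "nat \<Rightarrow> (complex \<times> complex \<Rightarrow> complex)
    \<Rightarrow> (complex \<times> complex \<Rightarrow> complex) \<Rightarrow> (complex \<times> complex \<Rightarrow> complex)" where
  "toeplitz n a f = bergman_proj n (\<lambda>\<zeta>. a \<zeta> * f \<zeta>)"


section \<open>Hermite and Laguerre functions\<close>

definition hermite_poly :: "nat \<Rightarrow> real \<Rightarrow> real" where
  "hermite_poly m y = (-1) ^ m * exp (y\<^sup>2) * (deriv ^^ m) (\<lambda>t. exp (- (t\<^sup>2))) y"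

definition hermite_fun :: "nat \<Rightarrow> real \<Rightarrow> real" where
  "hermite_fun m y = hermite_poly m y * exp (- (y\<^sup>2) / 2) / sqrt (2 ^ m * sqrt pi * fact m)"

definition laguerre_poly :: "nat \<Rightarrow> real \<Rightarrow> real" where
  "laguerre_poly m y = exp y / fact m * (deriv ^^ m) (\<lambda>t. exp (- t) * t ^ m) y"

definition laguerre_fun :: "nat \<Rightarrow> real \<Rightarrow> real" where
  "laguerre_fun m y = (-1) ^ m * laguerre_poly m y * exp (- y / 2)"


section \<open>The unitary operator \<open>U\<close>\<close>

text \<open>\<open>\<complex> \<times> \<Pi>\<close>, where \<open>\<Pi>\<close> is the upper half-plane.\<close>

definition CPi :: "(complex \<times> complex) set" where
  "CPi = {(w1, w2). Im w2 > 0}"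

definition kappa :: "complex \<times> complex \<Rightarrow> complex \<times> complex" where
  "kappa = (\<lambda>(w1, w2). (w1, w2 + \<i> * complex_of_real ((cmod w1)\<^sup>2)))"

definition U0 :: "(complex \<times> complex \<Rightarrow> complex) \<Rightarrow> (complex \<times> complex \<Rightarrow> complex)" where
  "U0 f w = f (kappa w)"

text \<open>
  The integral defines the Fourier transform on \<open>L\<^sup>1 \<inter> L\<^sup>2\<close>; on \<open>L\<^sup>2(\<real>)\<close> it is
  the unitary extension (Plancherel).
\<close>

definition fourier_integral :: "(real \<Rightarrow> complex) \<Rightarrow> real \<Rightarrow> complex" where
  "fourier_integral g t =
     complex_of_real (1 / sqrt (2 * pi)) * (LINT x|lebesgue. g x * exp (- \<i> * complex_of_real (t * x)))"

definition fourier_L2 :: "(real \<Rightarrow> complex) \<Rightarrow> (real \<Rightarrow> complex)" where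
  "fourier_L2 = (SOME T. unitary_map (L2 UNIV) (L2 UNIV) T \<and>
     (\<forall>g\<in>carr (L2 UNIV). integrable lebesgue g \<longrightarrow> eqv (L2 UNIV) (T g) (fourier_integral g)))"

text \<open>
  Elementary tensors for
  \<open>L\<^sup>2(\<complex> \<times> \<Pi>) = L\<^sup>2(\<real>, du1) \<otimes> L\<^sup>2(\<real>, dv1) \<otimes> L\<^sup>2(\<real>, du2) \<otimes> L\<^sup>2(\<real>\<^sub>+, dv2)\<close>,
  and the tensor product of unitary operators, which is the unitary operator acting
  factorwise on elementary tensors (unique because these span a dense subspace).
\<close>

definition tens :: "(real \<Rightarrow> complex) \<Rightarrow> (real \<Rightarrow> complex) \<Rightarrow> (real \<Rightarrow> complex) \<Rightarrow> (real \<Rightarrow> complex)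
    \<Rightarrow> (complex \<times> complex \<Rightarrow> complex)" where
  "tens f1 f2 f3 f4 = (\<lambda>(w1, w2). f1 (Re w1) * f2 (Im w1) * f3 (Re w2) * f4 (Im w2))"

definition tens_op :: "((real \<Rightarrow> complex) \<Rightarrow> (real \<Rightarrow> complex)) \<Rightarrow> ((real \<Rightarrow> complex) \<Rightarrow> (real \<Rightarrow> complex))
    \<Rightarrow> ((real \<Rightarrow> complex) \<Rightarrow> (real \<Rightarrow> complex)) \<Rightarrow> ((real \<Rightarrow> complex) \<Rightarrow> (real \<Rightarrow> complex))
    \<Rightarrow> (complex \<times> complex \<Rightarrow> complex) \<Rightarrow> (complex \<times> complex \<Rightarrow> complex)" where
  "tens_op A1 A2 A3 A4 = (SOME T. unitary_map (L2 CPi) (L2 CPi) T \<and>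
     (\<forall>f1\<in>carr (L2 UNIV). \<forall>f2\<in>carr (L2 UNIV). \<forall>f3\<in>carr (L2 UNIV). \<forall>f4\<in>carr (L2 {0<..}).
        eqv (L2 CPi) (T (tens f1 f2 f3 f4)) (tens (A1 f1) (A2 f2) (A3 f3) (A4 f4))))"

definition U1 :: "(complex \<times> complex \<Rightarrow> complex) \<Rightarrow> (complex \<times> complex \<Rightarrow> complex)" where
  "U1 = tens_op fourier_L2 (\<lambda>f. f) fourier_L2 (\<lambda>f. f)"

text \<open>
  \<open>psi1\<close> and \<open>psi2\<close> are meaningful off the null sets \<open>Re \<xi>2 = 0\<close> and \<open>Re z2 = 0\<close>.
\<close>

definition psi1 :: "complex \<times> complex \<Rightarrow> complex \<times> complex" where
  "psi1 = (\<lambda>(\<xi>1, \<xi>2). (\<xi>1, Complex (Re \<xi>2) (Im \<xi>2 / (2 * \<bar>Re \<xi>2\<bar>))))"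

definition V1 :: "(complex \<times> complex \<Rightarrow> complex) \<Rightarrow> (complex \<times> complex \<Rightarrow> complex)" where
  "V1 f \<xi> = complex_of_real (1 / sqrt (2 * \<bar>Re (snd \<xi>)\<bar>)) * f (psi1 \<xi>)"

definition psi2 :: "complex \<times> complex \<Rightarrow> complex \<times> complex" where
  "psi2 = (\<lambda>(z1, z2).
     (Complex (sqrt \<bar>Re z2\<bar> * (Re z1 + Im z1)) ((- Re z1 + Im z1) / (2 * sqrt \<bar>Re z2\<bar>)), z2))"

definition V2 :: "(complex \<times> complex \<Rightarrow> complex) \<Rightarrow> (complex \<times> complex \<Rightarrow> complex)" where
  "V2 g z = g (psi2 z)"

definition U :: "(complex \<times> complex \<Rightarrow> complex) \<Rightarrow> (complex \<times> complex \<Rightarrow> complex)" where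
  "U f = V2 (V1 (U1 (U0 f)))"


section \<open>The operators \<open>R\<close> and the spectral matrix\<close>

definition RRp :: "(real \<times> real) set" where
  "RRp = UNIV \<times> {0<..}"

text \<open>The variables are \<open>z1 = x1 + \<i> y1\<close>, \<open>z2 = x2 + \<i> y2\<close>.\<close>

definition R0 :: "nat \<Rightarrow> (nat \<Rightarrow> real \<times> real \<Rightarrow> complex) \<Rightarrow> (complex \<times> complex \<Rightarrow> complex)" where
  "R0 n g = (\<lambda>(z1, z2). indicator {0<..} (Re z2) * complex_of_real (hermite_fun 0 (Im z1)) *
     (\<Sum>k<n. complex_of_real (laguerre_fun k (Im z2)) * g k (Re z1, Re z2)))"

definition R :: "nat \<Rightarrow> (complex \<times> complex \<Rightarrow> complex) \<Rightarrow> (nat \<Rightarrow> real \<times> real \<Rightarrow> complex)" where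
  "R n f = adj (L2_pow n RRp) (L2 CPi) (R0 n) (U f)"

definition R_star :: "nat \<Rightarrow> (nat \<Rightarrow> real \<times> real \<Rightarrow> complex) \<Rightarrow> (complex \<times> complex \<Rightarrow> complex)" where
  "R_star n = adj (L2 siegel) (L2_pow n RRp) (R n)"

text \<open>
  The \<open>(j, k)\<close> entry, \<open>j, k < n\<close>, of the matrix-valued function; the entries do not depend
  on \<open>n\<close>.
\<close>

definition gamma_c :: "(real \<times> real \<Rightarrow> complex) \<Rightarrow> real \<times> real \<Rightarrow> nat \<Rightarrow> nat \<Rightarrow> complex" where
  "gamma_c c = (\<lambda>(x1, x2) j k.
     LINT y1|lebesgue. LINT y2|lebesgue_on {0<..}.
       c ((- x1 + y1) / (2 * sqrt x2), y2 / (2 * x2)) *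
       complex_of_real ((hermite_fun 0 y1)\<^sup>2 * (laguerre_fun j y2 * laguerre_fun k y2)))"

definition mult_op :: "nat \<Rightarrow> ('a \<Rightarrow> nat \<Rightarrow> nat \<Rightarrow> complex)
    \<Rightarrow> (nat \<Rightarrow> 'a \<Rightarrow> complex) \<Rightarrow> (nat \<Rightarrow> 'a \<Rightarrow> complex)" where
  "mult_op n \<gamma> g = (\<lambda>j x. \<Sum>k<n. \<gamma> x j k * g k x)"

end

theory Submission
 imports Defs "HOL-Probability.Probability" "HOL-Complex_Analysis.Complex_Analysis"
  "HOL-Computational_Algebra.Fundamental_Theorem_Algebra"
begin

text \<open>Everything is carried to real coordinates \<open>((u\<^sub>1, u\<^sub>2), (v\<^sub>1, v\<^sub>2))\<close>, in which \<open>\<kappa>\<close> is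
 volume preserving and \<open>U\<^sub>1\<close> becomes a partial Fourier transform in \<open>u\<close>, characterised by its values
 on Gaussians times indicators. For \<open>f\<close> in the poly-Bergman-type space with transform \<open>\<Phi>\<close>,
 integrating the two \<open>\<partial>\<close>-bar equations by parts against holomorphic Gaussian weights times cutoffs in \<open>v\<close>
 shows that, after the shear \<open>\<xi> - 2 t v\<^sub>1\<close> of the first frequency and up to an explicit exponential weight,
 \<open>\<Phi>\<close> is independent of \<open>v\<^sub>1\<close> and polynomial of degree less than \<open>n\<close> in \<open>v\<^sub>2\<close>; square integrability
 excludes \<open>t < 0\<close>. Hence \<open>U f\<close> lies in the range of \<open>R\<^sub>0\<close>. Conversely, preimages of that range are
 finite sums of powers of \<open>v\<^sub>2\<close> times Laplace integrals, which are holomorphic. Since a nilpotent symbol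
 depends on \<open>v\<close> only, it commutes with the partial Fourier transform, and the compression to the range of \<open>R\<^sub>0\<close>
 is multiplication by \<open>\<gamma>\<^sup>c\<close>.\<close>

text \<open>The Fourier operator, \<open>U1\<close>, the adjoints and the projection are choices
  (\<open>SOME\<close>), so nothing can be said about them before a witness exists. For the
  transforms the witness comes from Gaussians with a complex parameter, whose transforms and Gram
  matrix are explicit. Elements of the poly-Bergman-type space are merely square integrable, with no
  decay of derivatives, so the differential equations cannot be transformed directly; they are only
  tested. The weights are Gaussians in zeta1 and zeta2 - i zeta1^2, and these coordinates explain
  the constants. In the chart the second one is (u2 + 2 u1 v1) + i (v2 + 2 v1^2). Its real part is
  dual to the shear, since xi u1 + t u2 = (xi - 2 t v1) u1 + t (u2 + 2 u1 v1). Its imaginary part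
  produces the exponential weight, and the Siegel domain is mapped into the region Im b > 2 (Im a)^2
  on which the Laplace integrals converge.\<close>

abbreviation ff :: "('a \<times> 'b) \<times> 'c => 'a" where "ff x \<equiv> fst (fst x)"
abbreviation sf :: "('a \<times> 'b) \<times> 'c => 'b" where "sf x \<equiv> snd (fst x)"
abbreviation fs :: "'a \<times> 'b \<times> 'c => 'b" where "fs x \<equiv> fst (snd x)"
abbreviation ss :: "'a \<times> 'b \<times> 'c => 'c" where "ss x \<equiv> snd (snd x)"
abbreviation cr :: "real => complex" where "cr \<equiv> complex_of_real"
abbreviation BM :: "('a::topological_space => 'b::topological_space) set" where "BM \<equiv> borel_measurable borel"
abbreviation intg :: "('a::euclidean_space => 'b::{banach, second_countable_topology}) => bool" where "intg \<equiv> integrable lborel"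
abbreviation lbi :: "('a::euclidean_space => 'b::{banach, second_countable_topology}) => 'b" (binder "LB " 10) where "lbi f \<equiv> integral\<^sup>L lborel f"
abbreviation nni :: "('a::euclidean_space => ennreal) => ennreal" (binder "NN " 10) where "nni f \<equiv> integral\<^sup>N lborel f"
abbreviation aeb :: "('a::euclidean_space => bool) => bool" (binder "AB " 10) where "aeb P \<equiv> almost_everywhere lborel P"

lemmas integrable_add_B = Bochner_Integration.integrable_add
lemmas integrable_bd = Bochner_Integration.integrable_bound
lemmas integrable_diff_B = Bochner_Integration.integrable_diff
lemmas integrable_sum_B = Bochner_Integration.integrable_sum
lemmas int_add = Bochner_Integration.integral_add
lemmas int_cnj = Bochner_Integration.integral_cnj
lemmas int_cong = Bochner_Integration.integral_cong
lemmas int_diff = Bochner_Integration.integral_diff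
lemmas int_sum = Bochner_Integration.integral_sum

section \<open>Square integrable functions over an arbitrary measure\<close>

definition L2s :: "'a measure => ('a => complex) set" where
 "L2s M = {f. f \<in> borel_measurable M \<and> integrable M (%x. (cmod (f x))^2)}"

abbreviation L2b :: "('a::euclidean_space => complex) set" where "L2b \<equiv> L2s lborel"

definition inn :: "'a measure => ('a => complex) => ('a => complex) => complex" where
 "inn M f g = (LINT x|M. f x * cnj (g x))"

abbreviation innb :: "('a::euclidean_space => complex) => _" where "innb \<equiv> inn lborel"

definition n2 :: "'a measure => ('a => complex) => real" where
 "n2 M f = (LINT x|M. (cmod (f x))^2)"

lemma borel_measurable_cnj[measurable]: "cnj \<in> BM"
 by (intro borel_measurable_continuous_onI continuous_intros)

lemma L2sD: "f \<in> L2s M ==> f \<in> borel_measurable M" "f \<in> L2s M ==> integrable M (%x. (cmod (f x))^2)"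
 by (auto simp: L2s_def)

lemma L2s_bound:
 assumes "f \<in> borel_measurable M" "integrable M g" "AE x in M. (cmod (f x))^2 \<le> g x"
 shows "f \<in> L2s M"
 unfolding L2s_def using assms
 by (auto intro!: integrable_bd[OF assms(2)] elim!: eventually_mono)

lemma L2s_integrable_mult:
 assumes "f \<in> L2s M" "g \<in> L2s M"
 shows "integrable M (%x. f x * g x)"
proof (rule integrable_bd)
 show "integrable M (%x. (cmod (f x))^2 + (cmod (g x))^2)"
  using assms by (auto simp: L2s_def)
 show "(%x. f x * g x) \<in> borel_measurable M"
  using assms by (auto simp: L2s_def)
 have "cmod (f x) * cmod (g x) \<le> (cmod (f x))^2 + (cmod (g x))^2" for x
  using sum_squares_bound[of "cmod (f x)" "cmod (g x)"] zero_le_power2[of "cmod (f x)"]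
   zero_le_power2[of "cmod (g x)"] by linarith
 then show "AE x in M. norm (f x * g x) \<le> norm ((cmod (f x))^2 + (cmod (g x))^2)"
  by (auto simp: norm_mult)
qed

lemma L2s_cnj: "f \<in> L2s M ==> (%x. cnj (f x)) \<in> L2s M"
 by (auto simp: L2s_def intro: measurable_compose[OF _ borel_measurable_cnj])

lemma L2s_integrable_inn: "f \<in> L2s M ==> g \<in> L2s M ==> integrable M (%x. f x * cnj (g x))"
 using L2s_integrable_mult[OF _ L2s_cnj] by blast

lemma cmod_add_sq: "(cmod (a + b))\<^sup>2 \<le> 2 * (cmod a)\<^sup>2 + 2 * (cmod b)\<^sup>2"
proof -
 have "(cmod (a + b))\<^sup>2 \<le> (cmod a + cmod b)\<^sup>2"
  by (intro power_mono norm_triangle_ineq) auto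
 also have "... \<le> 2 * (cmod a)\<^sup>2 + 2 * (cmod b)\<^sup>2"
  using sum_squares_bound[of "cmod a" "cmod b"] by (simp add: power2_sum)
 finally show ?thesis .
qed

lemma L2s_add:
 assumes "f \<in> L2s M" "g \<in> L2s M" shows "(%x. f x + g x) \<in> L2s M"
 using assms cmod_add_sq
 by (intro L2s_bound[where g = "%x. 2 * (cmod (f x))^2 + 2 * (cmod (g x))^2"]) (auto simp: L2s_def)

lemma L2s_scale: "f \<in> L2s M ==> (%x. c * f x) \<in> L2s M"
 by (auto simp: L2s_def norm_mult power_mult_distrib)

lemma L2s_diff:
 assumes "f \<in> L2s M" "g \<in> L2s M" shows "(%x. f x - g x) \<in> L2s M"
 using L2s_add[OF assms(1) L2s_scale[OF assms(2), of "-1"]] by simp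

lemma L2s_zero: "(%x. 0) \<in> L2s M" by (auto simp: L2s_def)

lemma L2s_sum: "(!!i. i \<in> A ==> f i \<in> L2s M) ==> (%x. \<Sum>i\<in>A. f i x) \<in> L2s M"
 by (induction A rule: infinite_finite_induct) (auto intro: L2s_zero L2s_add)

lemma L2s_bounded_mult:
 assumes f: "f \<in> L2s M" and a: "a \<in> borel_measurable M" and b: "AE x in M. cmod (a x) \<le> C"
 shows "(%x. a x * f x) \<in> L2s M"
proof (rule L2s_bound)
 show "integrable M (%x. C\<^sup>2 * (cmod (f x))^2)" using f by (auto simp: L2s_def)
 show "AE x in M. (cmod (a x * f x))^2 \<le> C\<^sup>2 * (cmod (f x))^2"
  using b by eventually_elim (auto simp: norm_mult power_mult_distrib intro!: mult_right_mono power_mono)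
qed (use f a in \<open>auto simp: L2s_def\<close>)

lemma n2_nonneg: "0 \<le> n2 M f" unfolding n2_def by (rule integral_nonneg_AE) auto

lemma inn_self: "inn M f f = cr (n2 M f)"
 unfolding inn_def n2_def complex_norm_square[symmetric] of_real_power[symmetric] integral_complex_of_real ..

lemma inn_cnj: "cnj (inn M f g) = inn M g f"
 unfolding inn_def by (subst int_cnj[symmetric]) (simp add: mult.commute)

lemma inn_add_left: "f \<in> L2s M ==> g \<in> L2s M ==> h \<in> L2s M ==>
  inn M (%x. f x + g x) h = inn M f h + inn M g h"
 unfolding inn_def by (subst int_add[symmetric])
  (auto simp: algebra_simps intro: L2s_integrable_inn)

lemma inn_diff_left: "f \<in> L2s M ==> g \<in> L2s M ==> h \<in> L2s M ==>
  inn M (%x. f x - g x) h = inn M f h - inn M g h"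
 unfolding inn_def by (subst int_diff[symmetric])
  (auto simp: algebra_simps intro: L2s_integrable_inn)

lemma inn_scale_left: "inn M (%x. c * f x) h = c * inn M f h"
 unfolding inn_def by (simp add: mult.assoc)

lemma inn_scale_right: "inn M f (%x. c * h x) = cnj c * inn M f h"
 using inn_cnj[of M "%x. c * h x" f] by (simp add: inn_scale_left inn_cnj)

lemma inn_diff_right: "f \<in> L2s M ==> g \<in> L2s M ==> h \<in> L2s M ==>
  inn M h (%x. f x - g x) = inn M h f - inn M h g"
 using inn_cnj[of M "%x. f x - g x" h] by (simp add: inn_diff_left inn_cnj)

lemma inn_cong_AE:
 assumes "f \<in> borel_measurable M" "f' \<in> borel_measurable M" "g \<in> borel_measurable M" "g' \<in> borel_measurable M"
  "AE x in M. f x = f' x" "AE x in M. g x = g' x"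
 shows "inn M f g = inn M f' g'"
 unfolding inn_def using assms by (intro integral_cong_AE) (measurable, auto)

lemma n2_zeroD:
 assumes "f \<in> L2s M" "n2 M f = 0" shows "AE x in M. f x = 0"
 using integral_nonneg_eq_0_iff_AE[of M "%x. (cmod (f x))^2"] assms by (auto simp: L2s_def n2_def)

lemma n2_diff_scale:
 assumes f: "f \<in> L2s M" and g: "g \<in> L2s M"
 shows "n2 M (%x. f x - a * g x) = n2 M f - 2 * Re (cnj a * inn M f g) + (cmod a)\<^sup>2 * n2 M g"
proof -
 have i: "integrable M (%x. Re (cnj a * (f x * cnj (g x))))"
  by (rule integrable_Re, rule integrable_mult_right, rule L2s_integrable_inn[OF f g])
 have "(cmod (f x - a * g x))\<^sup>2 = (cmod (f x))^2 - 2 * Re (cnj a * (f x * cnj (g x))) + (cmod a)\<^sup>2 * (cmod (g x))^2" for x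
  unfolding cmod_power2 by (simp add: power2_eq_square algebra_simps)
 then have "n2 M (%x. f x - a * g x) = (LINT x|M. (cmod (f x))^2 - 2 * Re (cnj a * (f x * cnj (g x))) + (cmod a)\<^sup>2 * (cmod (g x))^2)"
  unfolding n2_def by presburger
 also have "... = n2 M f - 2 * (LINT x|M. Re (cnj a * (f x * cnj (g x)))) + (cmod a)\<^sup>2 * n2 M g"
  using L2sD(2)[OF f] L2sD(2)[OF g] i unfolding n2_def
  by (subst int_add[OF integrable_diff_B[OF _ integrable_mult_right] integrable_mult_right],
    simp_all only: int_diff[OF _ integrable_mult_right] integral_mult_right_zero)
 also have "(LINT x|M. Re (cnj a * (f x * cnj (g x)))) = Re (cnj a * inn M f g)"
  unfolding inn_def integral_mult_right_zero[symmetric]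
  by (rule integral_Re[OF integrable_mult_right[OF L2s_integrable_inn[OF f g]]])
 finally show ?thesis .
qed

lemma n2_scale: "n2 M (%x. c * f x) = (cmod c)\<^sup>2 * n2 M f"
 unfolding n2_def by (simp add: norm_mult power_mult_distrib)

lemma n2_add_le:
 assumes f: "f \<in> L2s M" and g: "g \<in> L2s M"
 shows "n2 M (%x. f x + g x) \<le> 2 * n2 M f + 2 * n2 M g"
proof -
 have "n2 M (%x. f x + g x) \<le> (LINT x|M. 2 * (cmod (f x))^2 + 2 * (cmod (g x))^2)"
  unfolding n2_def using L2s_add[OF f g] f g
  by (intro integral_mono) (auto simp: L2s_def cmod_add_sq)
 also have "... = 2 * n2 M f + 2 * n2 M g" using f g by (simp add: n2_def L2s_def)
 finally show ?thesis .
qed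

lemma parallelogram:
 assumes f: "f \<in> L2s M" and g: "g \<in> L2s M"
 shows "n2 M (%x. f x + g x) + n2 M (%x. f x - g x) = 2 * n2 M f + 2 * n2 M g"
 using n2_diff_scale[OF f g, of "1"] n2_diff_scale[OF f g, of "-1"] by simp

lemma Re_scaled_square:
 assumes "(N::real) > 0"
 shows "Re (cnj (b / of_real N) * b) = (cmod b)\<^sup>2 / N" "(cmod (b / of_real N))\<^sup>2 = (cmod b)\<^sup>2 / N\<^sup>2"
proof -
 have "cnj (b / of_real N) * b = (b * cnj b) / of_real N" by (simp add: mult.commute)
 also have "... = of_real ((cmod b)\<^sup>2 / N)" by (simp add: complex_norm_square[symmetric])
 finally show "Re (cnj (b / of_real N) * b) = (cmod b)\<^sup>2 / N" by (simp only: Re_complex_of_real)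
 show "(cmod (b / of_real N))\<^sup>2 = (cmod b)\<^sup>2 / N\<^sup>2" using assms by (simp add: norm_divide power_divide)
qed

text \<open>Cauchy-Schwarz with \<open>n2 M g + 1\<close> in place of \<open>n2 M g\<close>: the
  denominator of the optimal multiple of \<open>g\<close> is then never zero, and the weaker
  constant suffices for continuity of the inner product and for bounds on slices.\<close>

lemma inn_bound:
 assumes f: "f \<in> L2s M" and g: "g \<in> L2s M"
 shows "(cmod (inn M f g))\<^sup>2 \<le> n2 M f * (n2 M g + 1)"
proof -
 define b where "b = inn M f g"
 define N where "N = n2 M g + 1"
 have N: "N > 0" using n2_nonneg[of M g] by (simp add: N_def)
 have "0 \<le> n2 M (%x. f x - (b / N) * g x)" by (rule n2_nonneg)
 also have "... = n2 M f - 2 * ((cmod b)\<^sup>2 / N) + (cmod b)\<^sup>2 / N\<^sup>2 * (N - 1)"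
  unfolding n2_diff_scale[OF f g, folded b_def] Re_scaled_square[OF N]
  by (simp add: N_def)
 also have "(cmod b)\<^sup>2 / N\<^sup>2 * (N - 1) \<le> (cmod b)\<^sup>2 / N\<^sup>2 * N"
  using N by (intro mult_left_mono) auto
 also have "(cmod b)\<^sup>2 / N\<^sup>2 * N = (cmod b)\<^sup>2 / N" using N by (simp add: power2_eq_square)
 finally have "(cmod b)\<^sup>2 / N \<le> n2 M f" by simp
 then have "(cmod b)\<^sup>2 \<le> n2 M f * N" using N by (simp add: field_simps)
 then show ?thesis unfolding b_def N_def .
qed

lemma inn_tendsto:
 assumes "!!n. s n \<in> L2s M" "f \<in> L2s M" "g \<in> L2s M" "(%n. n2 M (%x. s n x - f x)) \<longlonglongrightarrow> 0"
 shows "(%n. inn M (s n) g) \<longlonglongrightarrow> inn M f g"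
proof -
 have "(%n. inn M (%x. s n x - f x) g) \<longlonglongrightarrow> 0"
 proof (rule tendsto_norm_zero_cancel, rule tendsto_0_le)
  show "(%n. sqrt (n2 M (%x. s n x - f x))) \<longlonglongrightarrow> 0"
   using tendsto_real_sqrt[OF assms(4)] by simp
  show "\<forall>\<^sub>F n in sequentially. norm (norm (inn M (%x. s n x - f x) g)) \<le> norm (sqrt (n2 M (%x. s n x - f x))) * sqrt (n2 M g + 1)"
  proof (rule always_eventually, intro allI)
   fix n
   have "sqrt ((cmod (inn M (%x. s n x - f x) g))^2) \<le> sqrt (n2 M (%x. s n x - f x) * (n2 M g + 1))"
    by (intro real_sqrt_le_mono inn_bound L2s_diff assms)
   then show "norm (norm (inn M (%x. s n x - f x) g)) \<le> norm (sqrt (n2 M (%x. s n x - f x))) * sqrt (n2 M g + 1)"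
    using n2_nonneg[of M "%x. s n x - f x"] by (simp add: real_sqrt_mult)
  qed
 qed
 then have "(%n. inn M (s n) g - inn M f g) \<longlonglongrightarrow> 0"
  using assms by (simp add: inn_diff_left)
 then show ?thesis by (simp add: LIM_zero_iff)
qed

lemma n2_ennreal: "f \<in> L2s M ==> (\<integral>\<^sup>+x. ennreal ((cmod (f x))^2) \<partial>M) = ennreal (n2 M f)"
 unfolding n2_def by (rule nn_integral_eq_integral) (auto simp: L2s_def)

lemma L2s_nn: "f \<in> L2s M \<longleftrightarrow> f \<in> borel_measurable M \<and> (\<integral>\<^sup>+x. ennreal ((cmod (f x))^2) \<partial>M) < \<infinity>"
 unfolding L2s_def by (auto simp: integrable_iff_bounded)

text \<open>Riesz-Fischer. Along indices with squared increments below 4^-k the weights 2^k keep the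
  sum of \<open>2^k * (d k x)\<^sup>2\<close> integrable, hence finite almost everywhere; the
  inequality between means then makes the increments themselves summable. Fatou's lemma turns the
  pointwise limit into a limit in norm.\<close>

lemma L2s_complete:
 assumes s: "!!n. s n \<in> L2s M"
  and c: "!!e. e > 0 ==> \<exists>N. \<forall>m\<ge>N. \<forall>n\<ge>N. n2 M (%x. s m x - s n x) < e"
 shows "\<exists>p\<in>L2s M. (%n. n2 M (%x. s n x - p x)) \<longlonglongrightarrow> 0"
proof -
 have "\<forall>k. \<exists>N. \<forall>m\<ge>N. \<forall>n\<ge>N. n2 M (%x. s m x - s n x) < (1/4)^k"
  by (intro allI c) simp
 then obtain N where N: "!!k m n. m \<ge> N k ==> n \<ge> N k ==> n2 M (%x. s m x - s n x) < (1/4)^k"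
  unfolding choice_iff by blast
 \<comment> \<open>The sum dominates every \<open>N i\<close> with i up to k, so \<open>r k\<close>
   and \<open>r (Suc k)\<close> both lie beyond \<open>N k\<close>; the summand k makes
   \<open>r k\<close> tend to infinity.\<close>
 define r where "r k = (\<Sum>i\<le>k. N i) + k" for k
 have rN: "r k \<ge> N k" for k unfolding r_def by (simp add: member_le_sum trans_le_add1)
 have rS: "r (Suc k) \<ge> N k" for k unfolding r_def
  by (rule trans_le_add1, rule order_trans[OF member_le_sum[of k "{..k}" N]]) auto
 have rk: "r k \<ge> k" for k unfolding r_def by simp
 have sm[measurable]: "s n \<in> borel_measurable M" for n using s by (auto simp: L2s_def)
 define d where "d k x = cmod (s (r (Suc k)) x - s (r k) x)" for k x
 have [measurable]: "d k \<in> borel_measurable M" for k unfolding d_def by measurable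
 have "(\<integral>\<^sup>+x. (\<Sum>k. ennreal (2^k * (d k x)\<^sup>2)) \<partial>M) = (\<Sum>k. \<integral>\<^sup>+x. ennreal (2^k * (d k x)\<^sup>2) \<partial>M)"
  by (rule nn_integral_suminf) measurable
 also have "... \<le> (\<Sum>k. ennreal ((1/2)^k))"
 proof (rule suminf_le)
  fix k
  have "(\<integral>\<^sup>+x. ennreal (2^k * (d k x)\<^sup>2) \<partial>M) = ennreal (2^k) * (\<integral>\<^sup>+x. ennreal ((d k x)\<^sup>2) \<partial>M)"
   by (simp add: ennreal_mult nn_integral_cmult)
  also have "... = ennreal (2^k * n2 M (%x. s (r (Suc k)) x - s (r k) x))"
   unfolding d_def by (subst n2_ennreal) (auto intro!: L2s_diff s simp: ennreal_mult n2_nonneg)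
  also have "... \<le> ennreal (2^k * (1/4)^k)"
   using N[OF rS rN, of k] by (intro ennreal_leI mult_left_mono) auto
  also have "2^k * (1/4)^k = (1/2::real)^k" by (simp flip: power_mult_distrib)
  finally show "(\<integral>\<^sup>+x. ennreal (2^k * (d k x)\<^sup>2) \<partial>M) \<le> ennreal ((1/2)^k)" .
 qed auto
 also have "... < \<infinity>"
  by (subst suminf_ennreal2) (auto intro!: summable_geometric)
 finally have fin: "(\<integral>\<^sup>+x. (\<Sum>k. ennreal (2^k * (d k x)\<^sup>2)) \<partial>M) \<noteq> \<infinity>" by simp
 have AEc: "AE x in M. convergent (%k. s (r k) x)"
  using nn_integral_PInf_AE[OF _ fin]
 proof (rule AE_mp, measurable, intro AE_I2 impI)
  fix x assume "(\<Sum>k. ennreal (2^k * (d k x)\<^sup>2)) \<noteq> \<infinity>"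
  then have "summable (%k. 2^k * (d k x)\<^sup>2)"
   by (intro summable_suminf_not_top) auto
  then have "summable (%k. (1/2)^k + 2^k * (d k x)\<^sup>2)"
   by (intro summable_add summable_geometric) auto
  then have "summable (%k. d k x)"
  proof (rule summable_comparison_test'[where N = 0])
   fix k
   have "0 \<le> ((1/2)^k * (1 - 2^k * d k x)\<^sup>2)" by simp
   also have "(1/2)^k * (1 - 2^k * d k x)\<^sup>2 = (1/2)^k - 2 * d k x + 2^k * (d k x)\<^sup>2"
    by (simp add: power2_eq_square algebra_simps power_one_over)
   finally have "2 * d k x \<le> (1/2)^k + 2^k * (d k x)\<^sup>2" by simp
   moreover have "d k x \<ge> 0" by (simp add: d_def)
   ultimately show "norm (d k x) \<le> (1/2)^k + 2^k * (d k x)\<^sup>2" by simp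
  qed
  then have "summable (%k. s (r (Suc k)) x - s (r k) x)"
   unfolding d_def by (rule summable_norm_cancel)
  then have "convergent (%n. \<Sum>k<n. s (r (Suc k)) x - s (r k) x)"
   by (simp add: summable_iff_convergent)
  then have "convergent (%n. s (r n) x - s (r 0) x)"
   unfolding sum_lessThan_telescope[of "%n. s (r n) x"] .
  then show "convergent (%k. s (r k) x)" using convergent_diff_const_right_iff by blast
 qed
 define p where "p x = lim (%k. s (r k) x)" for x
 have pm[measurable]: "p \<in> borel_measurable M" unfolding p_def by (rule borel_measurable_lim_metric) simp
 have AEl: "AE x in M. (%k. s (r k) x) \<longlonglongrightarrow> p x"
  using AEc by eventually_elim (auto simp: p_def convergent_LIMSEQ_iff)
 have fatou: "(\<integral>\<^sup>+x. ennreal ((cmod (s n x - p x))^2) \<partial>M) \<le> ennreal e"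
  if n: "n \<ge> N0" and N0: "!!m n. m \<ge> N0 ==> n \<ge> N0 ==> n2 M (%x. s m x - s n x) < e" for n N0 e
 proof -
  have "(\<integral>\<^sup>+x. ennreal ((cmod (s n x - p x))^2) \<partial>M) \<le> (\<integral>\<^sup>+x. liminf (%k. ennreal ((cmod (s n x - s (r k) x))^2)) \<partial>M)"
  proof (rule nn_integral_mono_AE, use AEl in eventually_elim)
   fix x assume "(%k. s (r k) x) \<longlonglongrightarrow> p x"
   then have "(%k. ennreal ((cmod (s n x - s (r k) x))^2)) \<longlonglongrightarrow> ennreal ((cmod (s n x - p x))^2)"
    by (intro tendsto_ennrealI tendsto_intros)
   from lim_imp_Liminf[OF sequentially_bot this]
   show "ennreal ((cmod (s n x - p x))^2) \<le> liminf (%k. ennreal ((cmod (s n x - s (r k) x))^2))"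
    by (rule eq_refl[OF sym])
  qed
  also have "... \<le> liminf (%k. \<integral>\<^sup>+x. ennreal ((cmod (s n x - s (r k) x))^2) \<partial>M)"
   by (rule nn_integral_liminf) measurable
  also have "... = liminf (%k. ennreal (n2 M (%x. s n x - s (r k) x)))"
   by (subst n2_ennreal) (auto intro!: L2s_diff s)
  also have "... \<le> ennreal e"
  proof (rule Liminf_le)
   have "\<forall>\<^sub>F k in sequentially. k \<ge> N0" by (rule eventually_ge_at_top)
   then show "\<forall>\<^sub>F k in sequentially. ennreal (n2 M (%x. s n x - s (r k) x)) \<le> ennreal e"
   proof eventually_elim
    case (elim k)
    then have "r k \<ge> N0" using rk[of k] by linarith
    then show ?case using N0[OF n, of "r k"] by (intro ennreal_leI) auto
   qed
  qed auto
  finally show ?thesis .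
 qed
 have dL: "(%x. s (N 0) x - p x) \<in> L2s M"
  using fatou[of "N 0" "N 0" 1] N[of 0]
  by (auto simp: L2s_nn intro: le_less_trans)
 have "(%x. s (N 0) x - (s (N 0) x - p x)) \<in> L2s M" by (rule L2s_diff[OF s dL])
 then have pL: "p \<in> L2s M" by simp
 have "(%n. n2 M (%x. s n x - p x)) \<longlonglongrightarrow> 0"
 proof (rule LIMSEQ_I)
  fix e :: real assume e: "e > 0"
  then obtain N0 where N0: "!!m n. m \<ge> N0 ==> n \<ge> N0 ==> n2 M (%x. s m x - s n x) < e/2"
   using c[of "e/2"] by auto
  have "n2 M (%x. s n x - p x) < e" if "n \<ge> N0" for n
   using fatou[OF that N0] e n2_ennreal[OF L2s_diff[OF s pL]] by auto
  then show "\<exists>no. \<forall>n\<ge>no. norm (n2 M (%x. s n x - p x) - 0) < e" by (auto simp: n2_nonneg)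
 qed
 with pL show ?thesis by blast
qed

section \<open>Total families and unitary extension\<close>

definition comb :: "('i => 'a => complex) => (complex \<times> 'i) list => 'a => complex" where
 "comb e xs x = (\<Sum>p\<leftarrow>xs. fst p * e (snd p) x)"

lemma comb_simps: "comb e [] = (%x. 0)" "comb e (p # xs) = (%x. fst p * e (snd p) x + comb e xs x)"
 "comb e (xs @ ys) = (%x. comb e xs x + comb e ys x)"
 by (auto simp: comb_def)

lemma comb_scale: "comb e (map (%p. (c * fst p, snd p)) xs) = (%x. c * comb e xs x)"
 by (induction xs) (auto simp: comb_simps algebra_simps)

lemma comb_L2s: "(!!i. i \<in> I ==> e i \<in> L2s M) ==> snd ` set xs \<subseteq> I ==> comb e xs \<in> L2s M"
 by (induction xs) (auto simp: comb_simps intro!: L2s_zero L2s_add L2s_scale)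

lemma inn_comb_left:
 assumes "!!i. i \<in> I ==> e i \<in> L2s M" "g \<in> L2s M"
 shows "snd ` set xs \<subseteq> I ==> inn M (comb e xs) g = (\<Sum>p\<leftarrow>xs. fst p * inn M (e (snd p)) g)"
proof (induction xs)
 case Nil then show ?case by (simp add: comb_simps inn_def)
next
 case (Cons p xs)
 then have "comb e xs \<in> L2s M" using assms comb_L2s[of I e M xs] by auto
 then show ?case using Cons assms
  by (simp add: comb_simps inn_add_left L2s_scale inn_scale_left)
qed

lemma inn_comb_left':
 assumes "\<forall>i\<in>I. e i \<in> L2s M" "g \<in> L2s M" "snd ` set xs \<subseteq> I"
 shows "inn M (comb e xs) g = sum_list (map (%p. fst p * inn M (e (snd p)) g) xs)"
 by (rule inn_comb_left[of I]) (use assms in auto)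

text \<open>Totality is stated as triviality of the orthogonal complement, the form in which
  uniqueness theorems for integrals deliver it; density of the span is derived in
  \<open>span_dense\<close>.\<close>

definition total :: "'a measure => ('i => 'a => complex) => 'i set => bool" where
 "total M e I \<longleftrightarrow> (\<forall>i\<in>I. e i \<in> L2s M) \<and>
  (\<forall>f\<in>L2s M. (\<forall>i\<in>I. inn M f (e i) = 0) --> (AE x in M. f x = 0))"

lemma total_eqI:
 assumes "total M e I" "f \<in> L2s M" "g \<in> L2s M" "!!i. i \<in> I ==> inn M f (e i) = inn M g (e i)"
 shows "AE x in M. f x = g x"
proof -
 have "AE x in M. f x - g x = 0"
  using assms(1) L2s_diff[OF assms(2,3)] inn_diff_left[OF assms(2,3)] assms(4)
  unfolding total_def by auto
 then show ?thesis by simp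
qed

text \<open>A minimising sequence for the distance from \<open>f\<close> to the span is Cauchy by
  the parallelogram law, because midpoints stay in the span. Its limit \<open>p\<close> leaves a
  residue orthogonal to every \<open>e i\<close>, so totality gives \<open>f = p\<close>.\<close>

lemma span_dense:
 assumes t: "total M e I" and f: "f \<in> L2s M"
 shows "\<exists>xs. (\<forall>n::nat. snd ` set (xs n) \<subseteq> I) \<and> (%n. n2 M (%x. comb e (xs n) x - f x)) \<longlonglongrightarrow> 0"
proof -
 have e: "!!i. i \<in> I ==> e i \<in> L2s M" using t by (auto simp: total_def)
 define D where "D = {n2 M (%x. f x - comb e xs x) | xs. snd ` set xs \<subseteq> I}"
 have D0: "D \<noteq> {}" by (auto simp: D_def intro!: exI[of _ "[]"])
 have Db: "bdd_below D" unfolding D_def using n2_nonneg by (intro bdd_belowI[of _ 0]) auto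
 define d where "d = Inf D"
 have dl: "d \<le> n2 M (%x. f x - comb e xs x)" if "snd ` set xs \<subseteq> I" for xs
  unfolding d_def by (rule cInf_lower[OF _ Db]) (use that in \<open>auto simp: D_def\<close>)
 have "\<exists>xs. snd ` set xs \<subseteq> I \<and> n2 M (%x. f x - comb e xs x) < d + 1 / real (Suc n)" for n
 proof -
  have "\<exists>y\<in>D. y < d + 1 / real (Suc n)"
   unfolding d_def by (subst cInf_less_iff[OF D0 Db, symmetric]) simp
  then show ?thesis by (auto simp: D_def)
 qed
 then have "\<forall>n. \<exists>xs. snd ` set xs \<subseteq> I \<and> n2 M (%x. f x - comb e xs x) < d + 1 / real (Suc n)" by blast
 then obtain xs where "\<forall>n. snd ` set (xs n) \<subseteq> I \<and> n2 M (%x. f x - comb e (xs n) x) < d + 1 / real (Suc n)"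
  unfolding choice_iff by (elim exE)
 then have xs: "!!n. snd ` set (xs n) \<subseteq> I"
  "!!n. n2 M (%x. f x - comb e (xs n) x) < d + 1 / real (Suc n)" by auto
 define c where "c n = comb e (xs n)" for n
 have cL: "c n \<in> L2s M" for n unfolding c_def using comb_L2s[OF e xs(1)] .
 have cd: "n2 M (%x. c m x - c n x) \<le> 2 / real (Suc m) + 2 / real (Suc n)" for m n
 proof -
  have "n2 M (%x. (f x - c n x) + (f x - c m x)) + n2 M (%x. (f x - c n x) - (f x - c m x))
   = 2 * n2 M (%x. f x - c n x) + 2 * n2 M (%x. f x - c m x)"
   by (rule parallelogram) (auto intro: L2s_diff f cL)
  moreover have "n2 M (%x. (f x - c n x) + (f x - c m x)) \<ge> 4 * d"
  proof -
   \<comment> \<open>The midpoint of the two approximants, again a combination over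
     \<open>I\<close>.\<close>
   let ?ys = "map (%p. ((1/2) * fst p, snd p)) (xs n @ xs m)"
   have "d \<le> n2 M (%x. f x - comb e ?ys x)"
    by (rule dl) (use xs(1)[of n] xs(1)[of m] in \<open>auto simp: image_subset_iff\<close>)
   also have "... = n2 M (%x. (1/2) * ((f x - c n x) + (f x - c m x)))"
    unfolding comb_scale comb_simps c_def by (simp add: algebra_simps)
   also have "... = (1/4) * n2 M (%x. (f x - c n x) + (f x - c m x))"
    unfolding n2_scale by (simp add: power2_eq_square norm_divide)
   finally show ?thesis by simp
  qed
  moreover have "n2 M (%x. f x - c n x) < d + 1 / real (Suc n)" "n2 M (%x. f x - c m x) < d + 1 / real (Suc m)"
   using xs(2) by (auto simp: c_def)
  moreover have "n2 M (%x. (f x - c n x) - (f x - c m x)) = n2 M (%x. c m x - c n x)" by simp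
  ultimately show ?thesis by simp
 qed
 have "\<exists>p\<in>L2s M. (%n. n2 M (%x. c n x - p x)) \<longlonglongrightarrow> 0"
 proof (rule L2s_complete[OF cL])
  fix \<epsilon> :: real assume "\<epsilon> > 0"
  then obtain N' where "inverse (real (Suc N')) < \<epsilon> / 4"
   using reals_Archimedean[of "\<epsilon>/4"] by auto
  then obtain N where N: "N > 0" "1 / real N < \<epsilon> / 4"
   by (intro that[of "Suc N'"]) (auto simp: inverse_eq_divide)
  have "n2 M (%x. c m x - c n x) < \<epsilon>" if "m \<ge> N" "n \<ge> N" for m n
  proof -
   have "1 / real (Suc m) \<le> 1 / real N" "1 / real (Suc n) \<le> 1 / real N"
    using that N by (auto intro!: divide_left_mono)
   then show ?thesis using cd[of m n] N by simp
  qed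
  then show "\<exists>N. \<forall>m\<ge>N. \<forall>n\<ge>N. n2 M (%x. c m x - c n x) < \<epsilon>" by blast
 qed
 then obtain p where p: "p \<in> L2s M" "(%n. n2 M (%x. c n x - p x)) \<longlonglongrightarrow> 0" by blast
 have "AE x in M. f x = p x"
 proof (rule total_eqI[OF t f p(1)])
  fix i assume i: "i \<in> I"
  define b where "b n = inn M f (e i) - inn M (c n) (e i)" for n
  define N where "N = n2 M (e i) + 1"
  have N: "N > 0" using n2_nonneg[of M "e i"] by (simp add: N_def)
  have Nm: "n2 M (e i) = N - 1" by (simp add: N_def)
  have bb: "(cmod (b n))\<^sup>2 \<le> N * (1 / real (Suc n))" for n
  proof -
   have b: "b n = inn M (%x. f x - c n x) (e i)" unfolding b_def using inn_diff_left[OF f cL e[OF i]] by simp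
   \<comment> \<open>Adding \<open>b n / N\<close> times \<open>e i\<close> lowers the squared
     distance by at least |b n|^2 / N, while the infimum \<open>d\<close> leaves room for only 1 /
     (n + 1).\<close>
   have "d \<le> n2 M (%x. f x - comb e ((b n / N, i) # xs n) x)"
    by (rule dl) (use xs(1)[of n] i in auto)
   also have "... = n2 M (%x. (f x - c n x) - (b n / N) * e i x)" by (simp add: comb_simps c_def algebra_simps)
   also have "... = n2 M (%x. f x - c n x) - 2 * ((cmod (b n))^2 / N) + (cmod (b n))^2 / N\<^sup>2 * (N - 1)"
    using n2_diff_scale[OF L2s_diff[OF f cL[of n]] e[OF i], of "b n / cr N"]
    unfolding b[symmetric] Re_scaled_square[OF N] Nm by simp
   also have "(cmod (b n))\<^sup>2 / N\<^sup>2 * (N - 1) \<le> (cmod (b n))^2 / N\<^sup>2 * N"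
    using N by (intro mult_left_mono) auto
   also have "(cmod (b n))\<^sup>2 / N\<^sup>2 * N = (cmod (b n))^2 / N" using N by (simp add: power2_eq_square)
   finally have "(cmod (b n))\<^sup>2 / N \<le> 1 / real (Suc n)" using xs(2)[of n] by (simp add: c_def)
   then show ?thesis using N by (simp add: pos_divide_le_eq mult.commute)
  qed
  have "(%n. N * (1 / real (Suc n))) \<longlonglongrightarrow> N * 0"
   by (intro tendsto_intros LIMSEQ_Suc lim_1_over_n)
  then have "(%n. (cmod (b n))^2) \<longlonglongrightarrow> 0"
   using bb by (intro real_tendsto_sandwich[of "%_. 0" "%n. (cmod (b n))^2", OF _ _ tendsto_const, where h = "%n. N * (1 / real (Suc n))"]
    always_eventually) auto
  then have "(%n. sqrt ((cmod (b n))^2)) \<longlonglongrightarrow> sqrt 0" by (rule tendsto_real_sqrt)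
  then have b0: "b \<longlonglongrightarrow> 0" by (simp add: tendsto_norm_zero_iff)
  have "b \<longlonglongrightarrow> inn M f (e i) - inn M p (e i)"
   unfolding b_def by (intro tendsto_intros inn_tendsto cL p e i)
  with b0 show "inn M f (e i) = inn M p (e i)" using LIMSEQ_unique by fastforce
 qed
 then have "n2 M (%x. c n x - p x) = n2 M (%x. c n x - f x)" for n
  unfolding n2_def using cL[of n] p(1) f by (intro integral_cong_AE) (auto simp: L2s_def)
 with p(2) have "(%n. n2 M (%x. c n x - f x)) \<longlonglongrightarrow> 0" by simp
 then show ?thesis using xs(1) unfolding c_def by blast
qed

text \<open>The norm of a combination is a quadratic form in its coefficients given by the Gram
  matrix. Appending the second list with negated coefficients reduces the difference to a single
  combination.\<close>

lemma n2_comb_diff: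
 assumes e: "!!i. i \<in> I ==> e i \<in> L2s M" and e': "!!i. i \<in> I ==> e' i \<in> L2s N"
  and gram: "!!i j. i \<in> I ==> j \<in> I ==> inn N (e' i) (e' j) = inn M (e i) (e j)"
  and xs: "snd ` set xs \<subseteq> I" and ys: "snd ` set ys \<subseteq> I"
 shows "n2 N (%x. comb e' xs x - comb e' ys x) = n2 M (%x. comb e xs x - comb e ys x)"
proof -
 define zs where "zs = xs @ map (%p. ((-1) * fst p, snd p)) ys"
 have zs: "snd ` set zs \<subseteq> I" using xs ys by (auto simp: zs_def)
 have z: "(%x. comb g xs x - comb g ys x) = comb g zs" for g :: "'a => 'z => complex"
  unfolding zs_def comb_simps comb_scale by auto
 have a: "inn M f (comb e zs) = cnj (\<Sum>p\<leftarrow>zs. fst p * cnj (inn M f (e (snd p))))" if "f \<in> L2s M" for f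
  using inn_comb_left[OF e that zs] inn_cnj[of M "comb e zs" f] by (simp add: inn_cnj)
 have a': "inn N f (comb e' zs) = cnj (\<Sum>p\<leftarrow>zs. fst p * cnj (inn N f (e' (snd p))))" if "f \<in> L2s N" for f
  using inn_comb_left[OF e' that zs] inn_cnj[of N "comb e' zs" f] by (simp add: inn_cnj)
 have zi: "snd p \<in> I" if "p \<in> set zs" for p using zs that by auto
 have "inn N (e' i) (comb e' zs) = inn M (e i) (comb e zs)" if "i \<in> I" for i
 proof -
  have "map (%p. fst p * cnj (inn N (e' i) (e' (snd p)))) zs = map (%p. fst p * cnj (inn M (e i) (e (snd p)))) zs"
   by (rule map_cong[OF refl]) (simp add: gram[OF that zi])
  then show ?thesis unfolding a[OF e[OF that]] a'[OF e'[OF that]] by (rule arg_cong)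
 qed
 then have ie: "!!i. i \<in> I ==> inn N (e' i) (comb e' zs) = inn M (e i) (comb e zs)" .
 have A: "inn N (comb e' zs) (comb e' zs) = sum_list (map (%p. fst p * inn N (e' (snd p)) (comb e' zs)) zs)"
  by (rule inn_comb_left'[of I]) (use e' zs comb_L2s[of I e' N zs] in auto)
 have B: "inn M (comb e zs) (comb e zs) = sum_list (map (%p. fst p * inn M (e (snd p)) (comb e zs)) zs)"
  by (rule inn_comb_left'[of I]) (use e zs comb_L2s[of I e M zs] in auto)
 from ie have "map (%p. fst p * inn N (e' (snd p)) (comb e' zs)) zs = map (%p. fst p * inn M (e (snd p)) (comb e zs)) zs"
  using zi by (intro map_cong[OF refl]) simp
 then have "inn N (comb e' zs) (comb e' zs) = inn M (comb e zs) (comb e zs)"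
  unfolding A B by (rule arg_cong)
 then show ?thesis unfolding z inn_self by simp
qed

text \<open>Combinations of \<open>d\<close> that approximate \<open>f\<close> are Cauchy, hence so
  are the same combinations of \<open>d'\<close>; their limit inherits the pairings. The lists are
  part of the conclusion because the isometry is later proved along them.\<close>

lemma transfer_limit:
 assumes t: "total M' d I" and t': "total N' d' I"
  and g: "!!i j. i \<in> I ==> j \<in> I ==> inn N' (d' i) (d' j) = inn M' (d i) (d j)" and f: "f \<in> L2s M'"
 shows "\<exists>y\<in>L2s N'. (\<forall>i\<in>I. inn N' y (d' i) = inn M' f (d i)) \<and>
  (\<exists>xs. (\<forall>n::nat. snd ` set (xs n) \<subseteq> I) \<and> (%n. n2 M' (%x. comb d (xs n) x - f x)) \<longlonglongrightarrow> 0 \<and>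
    (%n. n2 N' (%x. comb d' (xs n) x - y x)) \<longlonglongrightarrow> 0)"
proof -
 have d: "!!i. i \<in> I ==> d i \<in> L2s M'" and d': "!!i. i \<in> I ==> d' i \<in> L2s N'"
  using t t' by (auto simp: total_def)
 obtain xs where xs: "!!n::nat. snd ` set (xs n) \<subseteq> I" "(%n. n2 M' (%x. comb d (xs n) x - f x)) \<longlonglongrightarrow> 0"
  using span_dense[OF t f] by auto
 have cL: "comb d (xs n) \<in> L2s M'" "comb d' (xs n) \<in> L2s N'" for n
  using comb_L2s[OF d xs(1)] comb_L2s[OF d' xs(1)] by auto
 have "\<exists>y\<in>L2s N'. (%n. n2 N' (%x. comb d' (xs n) x - y x)) \<longlonglongrightarrow> 0"
 proof (rule L2s_complete[OF cL(2)])
  fix \<epsilon> :: real assume e: "\<epsilon> > 0"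
  obtain N0 where N0: "!!n. n \<ge> N0 ==> n2 M' (%x. comb d (xs n) x - f x) < \<epsilon> / 4"
   using order_tendstoD(2)[OF xs(2), of "\<epsilon>/4"] e by (auto simp: eventually_sequentially)
  have "n2 N' (%x. comb d' (xs m) x - comb d' (xs n) x) < \<epsilon>" if "m \<ge> N0" "n \<ge> N0" for m n
  proof -
   have "n2 N' (%x. comb d' (xs m) x - comb d' (xs n) x) = n2 M' (%x. comb d (xs m) x - comb d (xs n) x)"
    by (rule n2_comb_diff[OF d d' g xs(1) xs(1)])
   also have "... = n2 M' (%x. (comb d (xs m) x - f x) + (-1) * (comb d (xs n) x - f x))"
    by (simp add: algebra_simps)
   also have "... \<le> 2 * n2 M' (%x. comb d (xs m) x - f x) + 2 * n2 M' (%x. (-1) * (comb d (xs n) x - f x))"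
    by (intro n2_add_le L2s_diff L2s_scale cL f)
   also have "... = 2 * n2 M' (%x. comb d (xs m) x - f x) + 2 * n2 M' (%x. comb d (xs n) x - f x)"
    by (subst n2_scale) simp
   also have "... < \<epsilon>" using N0[OF that(1)] N0[OF that(2)] by simp
   finally show ?thesis .
  qed
  then show "\<exists>N. \<forall>m\<ge>N. \<forall>n\<ge>N. n2 N' (%x. comb d' (xs m) x - comb d' (xs n) x) < \<epsilon>" by blast
 qed
 then obtain y where y: "y \<in> L2s N'" "(%n. n2 N' (%x. comb d' (xs n) x - y x)) \<longlonglongrightarrow> 0" by auto
 have "inn N' y (d' i) = inn M' f (d i)" if i: "i \<in> I" for i
 proof (rule LIMSEQ_unique)
  show "(%n. inn N' (comb d' (xs n)) (d' i)) \<longlonglongrightarrow> inn N' y (d' i)"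
   by (rule inn_tendsto[OF cL(2) y(1) d'[OF i] y(2)])
  have "inn N' (comb d' (xs n)) (d' i) = inn M' (comb d (xs n)) (d i)" for n
  proof -
   have mp: "map (%p. fst p * inn N' (d' (snd p)) (d' i)) (xs n) = map (%p. fst p * inn M' (d (snd p)) (d i)) (xs n)"
    using g[OF _ i] xs(1)[of n] by (intro map_cong[OF refl]) (simp add: image_subset_iff)
   have a: "inn N' (comb d' (xs n)) (d' i) = sum_list (map (%p. fst p * inn N' (d' (snd p)) (d' i)) (xs n))"
    by (rule inn_comb_left'[of I]) (use d' xs(1) i in auto)
   have b: "inn M' (comb d (xs n)) (d i) = sum_list (map (%p. fst p * inn M' (d (snd p)) (d i)) (xs n))"
    by (rule inn_comb_left'[of I]) (use d xs(1) i in auto)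
   show ?thesis unfolding a b mp ..
  qed
  then show "(%n. inn N' (comb d' (xs n)) (d' i)) \<longlonglongrightarrow> inn M' f (d i)"
   using inn_tendsto[OF cL(1) f d[OF i] xs(2)] by simp
 qed
 then show ?thesis using y xs by blast
qed

text \<open>The source of all Fourier-type operators below. Values are prescribed through pairings
  with \<open>e'\<close>, which determine \<open>T f\<close> up to null sets by totality;
  surjectivity is the same construction with the families exchanged.\<close>

lemma unitary_extension:
 assumes te: "total M e I" and te': "total N e' I"
  and gram: "!!i j. i \<in> I ==> j \<in> I ==> inn N (e' i) (e' j) = inn M (e i) (e j)"
 shows "\<exists>T. (\<forall>f\<in>L2s M. T f \<in> L2s N \<and> (\<forall>i\<in>I. inn N (T f) (e' i) = inn M f (e i))) \<and>
  (\<forall>f\<in>L2s M. \<forall>g\<in>L2s M. inn N (T f) (T g) = inn M f g) \<and>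
  (\<forall>g\<in>L2s N. \<exists>f\<in>L2s M. AE x in N. T f x = g x)"
proof -
 have e: "!!i. i \<in> I ==> e i \<in> L2s M" and e': "!!i. i \<in> I ==> e' i \<in> L2s N"
  using te te' by (auto simp: total_def)
 have "\<forall>f. \<exists>y. f \<in> L2s M --> (y \<in> L2s N \<and> (\<forall>i\<in>I. inn N y (e' i) = inn M f (e i)) \<and>
  (\<exists>xs. (\<forall>n::nat. snd ` set (xs n) \<subseteq> I) \<and> (%n. n2 M (%x. comb e (xs n) x - f x)) \<longlonglongrightarrow> 0 \<and>
    (%n. n2 N (%x. comb e' (xs n) x - y x)) \<longlonglongrightarrow> 0))"
 proof
  fix f
  show "\<exists>y. f \<in> L2s M --> (y \<in> L2s N \<and> (\<forall>i\<in>I. inn N y (e' i) = inn M f (e i)) \<and>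
  (\<exists>xs. (\<forall>n::nat. snd ` set (xs n) \<subseteq> I) \<and> (%n. n2 M (%x. comb e (xs n) x - f x)) \<longlonglongrightarrow> 0 \<and>
    (%n. n2 N (%x. comb e' (xs n) x - y x)) \<longlonglongrightarrow> 0))"
   using transfer_limit[OF te te' , of f] gram unfolding Bex_def by blast
 qed
 then obtain T where T: "!!f. f \<in> L2s M ==> T f \<in> L2s N \<and> (\<forall>i\<in>I. inn N (T f) (e' i) = inn M f (e i)) \<and>
  (\<exists>xs. (\<forall>n::nat. snd ` set (xs n) \<subseteq> I) \<and> (%n. n2 M (%x. comb e (xs n) x - f x)) \<longlonglongrightarrow> 0 \<and>
    (%n. n2 N (%x. comb e' (xs n) x - T f x)) \<longlonglongrightarrow> 0)"
  unfolding choice_iff by blast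
 have iso: "inn N (T f) (T g) = inn M f g" if f: "f \<in> L2s M" and g: "g \<in> L2s M" for f g
 proof -
  obtain xs where xs: "!!n::nat. snd ` set (xs n) \<subseteq> I" "(%n. n2 M (%x. comb e (xs n) x - f x)) \<longlonglongrightarrow> 0"
   "(%n. n2 N (%x. comb e' (xs n) x - T f x)) \<longlonglongrightarrow> 0" using T[OF f] by auto
  have Tg: "T g \<in> L2s N" "!!i. i \<in> I ==> inn N (T g) (e' i) = inn M g (e i)" using T[OF g] by auto
  have h: "inn N (e' i) (T g) = inn M (e i) g" if "i \<in> I" for i
   using Tg(2)[OF that] inn_cnj[of N "T g" "e' i"] inn_cnj[of M g "e i"] by simp
  have "inn N (comb e' (xs n)) (T g) = inn M (comb e (xs n)) g" for n
  proof -
   have A: "inn N (comb e' (xs n)) (T g) = sum_list (map (%p. fst p * inn N (e' (snd p)) (T g)) (xs n))"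
    by (rule inn_comb_left'[of I]) (use e' xs(1) Tg(1) in auto)
   have B: "inn M (comb e (xs n)) g = sum_list (map (%p. fst p * inn M (e (snd p)) g) (xs n))"
    by (rule inn_comb_left'[of I]) (use e xs(1) g in auto)
   have "map (%p. fst p * inn N (e' (snd p)) (T g)) (xs n) = map (%p. fst p * inn M (e (snd p)) g) (xs n)"
    using xs(1)[of n] by (intro map_cong[OF refl]) (simp add: h image_subset_iff)
   then show ?thesis
    unfolding A B by (rule arg_cong)
  qed
  moreover have "(%n. inn N (comb e' (xs n)) (T g)) \<longlonglongrightarrow> inn N (T f) (T g)"
   using T[OF f] by (intro inn_tendsto[OF comb_L2s[OF e' xs(1)] _ Tg(1) xs(3)]) auto
  moreover have "(%n. inn M (comb e (xs n)) g) \<longlonglongrightarrow> inn M f g"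
   by (intro inn_tendsto[OF comb_L2s[OF e xs(1)] f g xs(2)]) auto
  ultimately show ?thesis using LIMSEQ_unique by simp
 qed
 have surj: "\<exists>f\<in>L2s M. AE x in N. T f x = g x" if g: "g \<in> L2s N" for g
 proof -
  obtain f where f: "f \<in> L2s M" "!!i. i \<in> I ==> inn M f (e i) = inn N g (e' i)"
   using transfer_limit[OF te' te gram[symmetric] g] by auto
  have "AE x in N. T f x = g x"
   using T[OF f(1)] f(2) by (intro total_eqI[OF te' _ g]) auto
  with f(1) show ?thesis by blast
 qed
 show ?thesis using T iso surj by (intro exI[of _ T]) auto
qed

section \<open>Uniqueness theorems for integrable functions\<close>

lemma L1_zero_generator_real:
 fixes h :: "'a => real"
 assumes h: "integrable M h" and E: "Int_stable E" "E \<subseteq> Pow (space M)" "sets M = sigma_sets (space M) E" "space M \<in> E"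
  and z: "!!X. X \<in> E ==> (LINT x|M. h x * indicator X x) = 0"
 shows "AE x in M. h x = 0"
proof -
 define hp where "hp x = ennreal (h x)" for x
 define hm where "hm x = ennreal (- h x)" for x
 have [measurable]: "h \<in> borel_measurable M" using h by auto
 have [measurable]: "hp \<in> borel_measurable M" "hm \<in> borel_measurable M" unfolding hp_def hm_def by measurable
 have fp: "(\<integral>\<^sup>+x. hp x \<partial>M) \<noteq> \<infinity>" and fm: "(\<integral>\<^sup>+x. hm x \<partial>M) \<noteq> \<infinity>"
  using h unfolding real_integrable_def hp_def hm_def by auto
 have sub: "E \<subseteq> sets M" unfolding E(3) by auto
 have eq: "emeasure (density M hp) X = emeasure (density M hm) X" if X: "X \<in> E" for X
 proof -
  have [measurable]: "X \<in> sets M" using X sub by auto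
  have ih: "integrable M (%x. h x * indicator X x)" by (rule integrable_real_mult_indicator[OF _ h]) simp
  have p: "ennreal (h x * indicator X x) = hp x * indicator X x" "ennreal (- (h x * indicator X x)) = hm x * indicator X x" for x
   by (auto simp: hp_def hm_def indicator_def)
  have le: "(\<integral>\<^sup>+x. hp x * indicator X x \<partial>M) \<le> (\<integral>\<^sup>+x. hp x \<partial>M)" "(\<integral>\<^sup>+x. hm x * indicator X x \<partial>M) \<le> (\<integral>\<^sup>+x. hm x \<partial>M)"
   by (intro nn_integral_mono; simp add: indicator_def)+
  have "enn2real (\<integral>\<^sup>+x. hp x * indicator X x \<partial>M) - enn2real (\<integral>\<^sup>+x. hm x * indicator X x \<partial>M) = 0"
   using z[OF X] unfolding real_lebesgue_integral_def[OF ih] p by simp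
  then have "(\<integral>\<^sup>+x. hp x * indicator X x \<partial>M) = (\<integral>\<^sup>+x. hm x * indicator X x \<partial>M)"
   using le fp fm by (metis ennreal_enn2real_if eq_iff_diff_eq_0 infinity_ennreal_def neq_top_trans)
  then show ?thesis by (simp add: emeasure_density)
 qed
 \<comment> \<open>The positive and negative parts of \<open>h\<close>, taken as densities, give
   finite measures that agree on an intersection-stable generator.\<close>
 have "density M hp = density M hm"
 proof (rule measure_eqI_generator_eq[OF E(1,2), where A = "%_. space M"])
  show "!!X. X \<in> E ==> emeasure (density M hp) X = emeasure (density M hm) X" by (rule eq)
  show "emeasure (density M hp) (space M) \<noteq> \<infinity>" for i :: nat
  proof -
   have "emeasure (density M hp) (space M) = (\<integral>\<^sup>+x. hp x * indicator (space M) x \<partial>M)" by (simp add: emeasure_density)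
   also have "... = (\<integral>\<^sup>+x. hp x \<partial>M)" by (intro nn_integral_cong) simp
   finally show ?thesis using fp by simp
  qed
 qed (use E in auto)
 then have "AE x in M. hp x = hm x"
  by (subst (asm) finite_density_unique) (use fp in auto)
 then show ?thesis
 proof eventually_elim
  case (elim x) then show ?case unfolding hp_def hm_def
   by (cases "h x \<ge> 0") (auto simp: ennreal_neg ennreal_eq_zero_iff dest: sym)
 qed
qed

lemma AE_complex_zeroI:
 "AE x in M. Re (h x) = 0 ==> AE x in M. Im (h x) = 0 ==> AE x in M. h x = 0"
 by (auto elim: eventually_elim2 simp: complex_eq_iff)

lemma L1_zero_generator:
 fixes h :: "'a => complex"
 assumes h: "integrable M h" and E: "Int_stable E" "E \<subseteq> Pow (space M)" "sets M = sigma_sets (space M) E" "space M \<in> E"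
  and z: "!!X. X \<in> E ==> (LINT x|M. h x * indicator X x) = 0"
 shows "AE x in M. h x = 0"
proof (rule AE_complex_zeroI)
 have sub: "E \<subseteq> sets M" unfolding E(3) by auto
 have ih: "integrable M (%x. h x * indicator X x)" if "X \<in> E" for X
 proof -
  have "(%x. h x * indicator X x) = (%x. indicat_real X x *\<^sub>R h x)"
   by (auto simp: indicator_def fun_eq_iff)
  then show ?thesis using integrable_mult_indicator[OF _ h, of X] that sub by auto
 qed
 show "AE x in M. Re (h x) = 0"
 proof (rule L1_zero_generator_real[OF integrable_Re[OF h] E])
  fix X assume X: "X \<in> E"
  have "(LINT x|M. Re (h x) * indicator X x) = (LINT x|M. Re (h x * indicator X x))"
   by (intro int_cong) (auto simp: indicator_def)
  also have "... = Re (LINT x|M. h x * indicator X x)" by (rule integral_Re[OF ih[OF X]])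
  also have "... = 0" using z[OF X] by simp
  finally show "(LINT x|M. Re (h x) * indicator X x) = 0" .
 qed
 show "AE x in M. Im (h x) = 0"
 proof (rule L1_zero_generator_real[OF integrable_Im[OF h] E])
  fix X assume X: "X \<in> E"
  have "(LINT x|M. Im (h x) * indicator X x) = (LINT x|M. Im (h x * indicator X x))"
   by (intro int_cong) (auto simp: indicator_def)
  also have "... = Im (LINT x|M. h x * indicator X x)" by (rule integral_Im[OF ih[OF X]])
  also have "... = 0" using z[OF X] by simp
  finally show "(LINT x|M. Im (h x) * indicator X x) = 0" .
 qed
qed

lemma L1_zero_rectangles:
 fixes h :: "'a \<times> 'b => complex"
 assumes h: "integrable (M1 \<Otimes>\<^sub>M M2) h"
  and z: "!!A B. A \<in> sets M1 ==> B \<in> sets M2 ==>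
   (LINT x|(M1 \<Otimes>\<^sub>M M2). h x * (indicator A (fst x) * indicator B (snd x))) = 0"
 shows "AE x in M1 \<Otimes>\<^sub>M M2. h x = 0"
proof (rule L1_zero_generator[OF h Int_stable_pair_measure_generator[of M1 M2]])
 show "{a \<times> b |a b. a \<in> sets M1 \<and> b \<in> sets M2} \<subseteq> Pow (space (M1 \<Otimes>\<^sub>M M2))"
  unfolding space_pair_measure by (rule pair_measure_closed)
 show "sets (M1 \<Otimes>\<^sub>M M2) = sigma_sets (space (M1 \<Otimes>\<^sub>M M2)) {a \<times> b |a b. a \<in> sets M1 \<and> b \<in> sets M2}"
  unfolding space_pair_measure by (rule sets_pair_measure)
 show "space (M1 \<Otimes>\<^sub>M M2) \<in> {a \<times> b |a b. a \<in> sets M1 \<and> b \<in> sets M2}"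
  unfolding space_pair_measure by blast
 fix X assume "X \<in> {a \<times> b |a b. a \<in> sets M1 \<and> b \<in> sets M2}"
 then obtain A B where X: "X = A \<times> B" "A \<in> sets M1" "B \<in> sets M2" by auto
 have "indicator X x = (indicator A (fst x) * indicator B (snd x) :: complex)" for x
  by (cases x) (auto simp: X(1) indicator_def)
 then show "(LINT x|(M1 \<Otimes>\<^sub>M M2). h x * indicator X x) = 0" using z[OF X(2,3)] by simp
qed

text \<open>After normalisation the positive and negative parts of \<open>h\<close> are probability
  densities with the same characteristic function, so Levy's uniqueness theorem identifies
  them.\<close>

lemma L1_fourier_zero_real:
 fixes h :: "real => real"
 assumes h: "intg h"
  and z: "!!s. (LB x. h x *\<^sub>R exp (\<i> * cr (s * x))) = 0"
 shows "AB x. h x = 0"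
proof -
 define hp where "hp x = max 0 (h x)" for x
 define hm where "hm x = max 0 (- h x)" for x
 have [measurable]: "h \<in> borel_measurable lborel" using h by auto
 have hm[measurable]: "hp \<in> borel_measurable lborel" "hm \<in> borel_measurable lborel" unfolding hp_def hm_def by measurable
 have ip: "intg hp" "intg hm" unfolding hp_def hm_def using h by auto
 have hd: "h x = hp x - hm x" for x by (auto simp: hp_def hm_def)
 have nn: "hp x \<ge> 0" "hm x \<ge> 0" for x by (auto simp: hp_def hm_def)
 have ie: "intg (%x. g x *\<^sub>R exp (\<i> * cr (s * x)))" if "intg g" for g s
  by (rule integrable_bd[OF that]) (use that in \<open>auto simp: norm_exp_eq_Re\<close>)
 have eqs: "(LB x. hp x *\<^sub>R exp (\<i> * cr (s * x))) = (LB x. hm x *\<^sub>R exp (\<i> * cr (s * x)))" for s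
  using z[of s] unfolding hd scaleR_diff_left
  by (subst (asm) int_diff[OF ie ie]) (auto simp: ip)
 \<comment> \<open>At frequency 0 the hypothesis says that both parts have the same mass, so one
   constant normalises both.\<close>
 define m where "m = (LB x. hp x)"
 have "cr m = (LB x. hm x)"
  using eqs[of 0] unfolding m_def by (simp add: scaleR_conv_of_real)
 then have m2: "m = (LB x. hm x)" using of_real_eq_iff by blast
 have m0: "m \<ge> 0" unfolding m_def by (intro integral_nonneg_AE) (auto simp: nn)
 show ?thesis
 proof (cases "m = 0")
  case True
  then have "AB x. hp x = 0" "AB x. hm x = 0"
   using integral_nonneg_eq_0_iff_AE[OF ip(1)] integral_nonneg_eq_0_iff_AE[OF ip(2)] nn m_def m2 by auto
  then show ?thesis by eventually_elim (auto simp: hd)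
 next
  case False
  then have mp: "m > 0" using m0 by simp
  have rd: "real_distribution (density lborel (%x. ennreal (g x / m)))"
   if g: "intg g" "!!x. g x \<ge> 0" "m = (LB x. g x)" for g
  proof -
   have [measurable]: "g \<in> borel_measurable lborel" using g by auto
   have "prob_space (density lborel (%x. ennreal (g x / m)))"
   proof
    have "emeasure (density lborel (%x. ennreal (g x / m))) UNIV = (NN x. ennreal (g x / m))"
     by (subst emeasure_density) auto
    also have "... = ennreal (LB x. g x / m)"
     using g mp by (intro nn_integral_eq_integral) auto
    finally show "emeasure (density lborel (%x. ennreal (g x / m))) (space (density lborel (%x. ennreal (g x / m)))) = 1"
     using mp g(3) by simp
   qed
   then show ?thesis unfolding real_distribution_def real_distribution_axioms_def by simp
  qed
  have ch: "char (density lborel (%x. ennreal (g x / m))) s = (LB x. g x *\<^sub>R exp (\<i> * cr (s * x))) / m"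
   if g: "intg g" "!!x. g x \<ge> 0" for g s
  proof -
   have [measurable]: "g \<in> borel_measurable lborel" using g by auto
   have "char (density lborel (%x. ennreal (g x / m))) s = (LB x. (g x / m) *\<^sub>R exp (\<i> * cr (s * x)))"
    unfolding char_def by (subst integral_density) (use g mp in auto)
   also have "... = (LB x. (g x *\<^sub>R exp (\<i> * cr (s * x))) / m)"
    by (simp add: scaleR_conv_of_real)
   finally show ?thesis by simp
  qed
  have "density lborel (%x. ennreal (hp x / m)) = density lborel (%x. ennreal (hm x / m))"
  proof (rule Levy_uniqueness[OF rd rd])
   show "char (density lborel (%x. ennreal (hp x / m))) = char (density lborel (%x. ennreal (hm x / m)))"
    unfolding fun_eq_iff ch[OF ip(1) nn(1)] ch[OF ip(2) nn(2)] eqs by simp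
  qed (auto simp: ip nn m_def[symmetric] m2[symmetric])
  then have "AB x. ennreal (hp x / m) = ennreal (hm x / m)"
   by (subst (asm) sigma_finite_measure.density_unique_iff[OF sigma_finite_lborel]) auto
  then show ?thesis by eventually_elim (use mp nn in \<open>auto simp: hd\<close>)
 qed
qed

lemma L1_fourier_zero:
 fixes h :: "real => complex"
 assumes h: "intg h"
  and z: "!!s. (LB x. h x * exp (- \<i> * cr (s * x))) = 0"
 shows "AB x. h x = 0"
proof -
 have [measurable]: "h \<in> BM" using h by auto
 have ie: "intg (%x. g x * exp (\<i> * cr (s * x)))" if "intg g" for g s
  by (rule integrable_bd[OF that]) (use that in \<open>auto simp: norm_mult norm_exp_eq_Re\<close>)
 have z1: "(LB x. h x * exp (\<i> * cr (s * x))) = 0" for s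
  using z[of "-s"] by simp
 have "(LB x. cnj (h x) * exp (\<i> * cr (s * x))) = cnj (LB x. h x * exp (- \<i> * cr (s * x)))" for s
  by (subst int_cnj[symmetric]) (simp add: exp_cnj)
 then have z2: "(LB x. cnj (h x) * exp (\<i> * cr (s * x))) = 0" for s using z by simp
 have hc: "intg (%x. cnj (h x))" using h by simp
 show ?thesis
 proof (rule AE_complex_zeroI)
  show "AB x. Re (h x) = 0"
  proof (rule L1_fourier_zero_real)
   fix s
   have "(LB x. Re (h x) *\<^sub>R exp (\<i> * cr (s * x))) =
    (LB x. (1/2) * (h x * exp (\<i> * cr (s * x)) + cnj (h x) * exp (\<i> * cr (s * x))))"
    by (intro int_cong refl) (simp add: scaleR_conv_of_real complex_add_cnj flip: distrib_right)
   also have "... = 0" unfolding integral_mult_right_zero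
    by (subst int_add[OF ie ie]) (use h hc z1 z2 in auto)
   finally show "(LB x. Re (h x) *\<^sub>R exp (\<i> * cr (s * x))) = 0" .
  qed (use h in auto)
  show "AB x. Im (h x) = 0"
  proof (rule L1_fourier_zero_real)
   fix s
   have "(LB x. Im (h x) *\<^sub>R exp (\<i> * cr (s * x))) =
    (LB x. (1/(2*\<i>)) * (h x * exp (\<i> * cr (s * x)) - cnj (h x) * exp (\<i> * cr (s * x))))"
   proof (intro int_cong refl)
    fix x
    have "h x - cnj (h x) = 2*\<i> * cr (Im (h x))" by (simp add: complex_eq_iff)
    then have "(1/(2*\<i>)) * (h x - cnj (h x)) = cr (Im (h x))" by (simp del: complex_cnj_add)
    then have "cr (Im (h x)) * exp (\<i> * cr (s * x)) = (1/(2*\<i>)) * (h x - cnj (h x)) * exp (\<i> * cr (s * x))"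
     by simp
    then show "Im (h x) *\<^sub>R exp (\<i> * cr (s * x)) =
     (1/(2*\<i>)) * (h x * exp (\<i> * cr (s * x)) - cnj (h x) * exp (\<i> * cr (s * x)))"
     unfolding scaleR_conv_of_real by (simp only: left_diff_distrib mult.assoc)
   qed
   also have "... = 0" unfolding integral_mult_right_zero
    by (subst int_diff[OF ie ie]) (use h hc z1 z2 in auto)
   finally show "(LB x. Im (h x) *\<^sub>R exp (\<i> * cr (s * x))) = 0" .
  qed (use h in auto)
 qed
qed

lemma integrable_bounded_mult:
 fixes h g :: "'a => complex"
 assumes "integrable M h" "g \<in> borel_measurable M" "!!x. cmod (g x) \<le> C"
 shows "integrable M (%x. h x * g x)"
proof (rule integrable_bd)
 show "integrable M (%x. C * cmod (h x))" using assms by auto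
 have "0 \<le> C" using assms(3) norm_ge_zero order_trans by blast
 then show "AE x in M. norm (h x * g x) \<le> norm (C * cmod (h x))"
  using assms(3) by (auto simp: norm_mult mult.commute[of "cmod (h _)"] intro!: mult_right_mono)
qed (use assms in auto)

section \<open>Gaussians with a complex parameter\<close>

definition gz :: "complex => real => complex" where
 "gz z x = exp (- (cr x)\<^sup>2 / 2 + z * cr x)"

text \<open>This is exp((z - i t)^2 / 2), the Fourier transform of \<open>gz z\<close>. Writing it
  as a multiple of \<open>gz (- \<i> * z)\<close> lets integrability and totality pass from one
  family to the other.\<close>

definition gh :: "complex => real => complex" where
 "gh z t = exp (z\<^sup>2 / 2) * gz (- \<i> * z) t"

lemma gz_measurable[measurable]: "gz z \<in> BM" "gh z \<in> BM"
 unfolding gz_def gh_def by (intro borel_measurable_continuous_onI continuous_intros; simp)+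

lemma norm_gz: "cmod (gz z x) = exp (- x\<^sup>2 / 2 + Re z * x)"
 unfolding gz_def by (simp add: norm_exp_eq_Re)

lemma gz_imag_integral:
 "intg (gz (\<i> * cr b))"
 "(LB x. gz (\<i> * cr b) x) = sqrt (2 * pi) * exp (- (cr b)\<^sup>2 / 2)"
proof -
 have g: "gz (\<i> * cr b) x = sqrt (2 * pi) * (std_normal_density x *\<^sub>R iexp (b * x))" for x
 proof -
  have "gz (\<i> * cr b) x = cr (exp (- x\<^sup>2 / 2)) * iexp (b * x)"
   unfolding gz_def exp_add by (simp add: exp_of_real[symmetric] mult.assoc)
  then show ?thesis by (simp add: normal_density_def scaleR_conv_of_real)
 qed
 have i: "intg (%x. std_normal_density x *\<^sub>R iexp (b * x))"
  by (rule integrable_bd[OF integrable_normal_density[OF zero_less_one]]) (auto simp: norm_exp_eq_Re)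
 then show "intg (gz (\<i> * cr b))" unfolding g[abs_def] by (rule integrable_mult_right)
 have "(LB x. std_normal_density x *\<^sub>R iexp (b * x)) = char std_normal_distribution b"
  unfolding char_def by (subst integral_density) auto
 also have "... = exp (- (cr b)\<^sup>2 / 2)"
  unfolding char_std_normal_distribution by (simp add: exp_of_real[symmetric])
 finally show "(LB x. gz (\<i> * cr b) x) = sqrt (2 * pi) * exp (- (cr b)\<^sup>2 / 2)"
  unfolding g integral_mult_right_zero by simp
qed

text \<open>The real part of the parameter is removed by completing the square, that is by a real
  translation; the imaginary case is the characteristic function of the normal distribution.\<close>

lemma gz_integral:
 "intg (gz w)"
 "(LB x. gz w x) = cr (sqrt (2 * pi)) * exp (w\<^sup>2 / 2)"
proof -
 define a b where "a = Re w" and "b = Im w"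
 have w: "w = cr a + \<i> * cr b" by (simp add: a_def b_def complex_eq_iff)
 define c where "c = exp ((cr a)\<^sup>2 / 2 + \<i> * cr a * cr b)"
 have g: "gz w x = c * gz (\<i> * cr b) (-a + 1 * x)" for x
  unfolding gz_def c_def w exp_add[symmetric]
  by (intro arg_cong[where f = exp]) (simp add: power2_eq_square field_simps)
 have i: "intg (%x. gz (\<i> * cr b) (-a + 1 * x))"
  by (rule lborel_integrable_real_affine[OF gz_imag_integral(1)]) simp
 then show "intg (gz w)" unfolding g[abs_def] by simp
 have "(LB x. gz w x) = c * (LB x. gz (\<i> * cr b) (-a + 1 * x))"
  unfolding g integral_mult_right_zero ..
 also have "(LB x. gz (\<i> * cr b) (-a + 1 * x)) = (LB x. gz (\<i> * cr b) x)"
  using lborel_integral_real_affine[of 1 "gz (\<i> * cr b)" "-a"] by simp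
 also have "c * ... = cr (sqrt (2 * pi)) * (c * exp (- (cr b)\<^sup>2 / 2))"
  unfolding gz_imag_integral by simp
 also have "c * exp (- (cr b)\<^sup>2 / 2) = exp (w\<^sup>2 / 2)"
  unfolding c_def w exp_add[symmetric]
  by (intro arg_cong[where f = exp]) (simp add: power2_eq_square field_simps)
 finally show "(LB x. gz w x) = cr (sqrt (2 * pi)) * exp (w\<^sup>2 / 2)" .
qed

lemma gz2_integral:
 "intg (%x. exp (- (cr x)\<^sup>2 + w * cr x))"
 "(LB x. exp (- (cr x)\<^sup>2 + w * cr x)) = cr (sqrt pi) * exp (w\<^sup>2 / 4)"
proof -
 have g: "exp (- (cr x)\<^sup>2 + w * cr x) = gz (w / cr (sqrt 2)) (0 + sqrt 2 * x)" for x
  unfolding gz_def by (simp add: power_mult_distrib flip: of_real_power)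
 show "intg (%x. exp (- (cr x)\<^sup>2 + w * cr x))"
  unfolding g by (rule lborel_integrable_real_affine[OF gz_integral(1)]) simp
 have "(LB x. gz (w / cr (sqrt 2)) x) = sqrt 2 *\<^sub>R (LB x. gz (w / cr (sqrt 2)) (0 + sqrt 2 * x))"
  using lborel_integral_real_affine[of "sqrt 2" "gz (w / cr (sqrt 2))" 0] by simp
 then have "(LB x. gz (w / cr (sqrt 2)) (0 + sqrt 2 * x)) = cr (sqrt (2 * pi) / sqrt 2) * exp ((w / cr (sqrt 2))\<^sup>2 / 2)"
  unfolding gz_integral by (simp add: scaleR_conv_of_real field_simps)
 also have "(w / cr (sqrt 2))\<^sup>2 / 2 = w\<^sup>2 / 4"
  by (simp add: power_divide flip: of_real_power)
 also have "sqrt (2 * pi) / sqrt 2 = sqrt pi" by (simp add: real_sqrt_mult)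
 finally show "(LB x. exp (- (cr x)\<^sup>2 + w * cr x)) = cr (sqrt pi) * exp (w\<^sup>2 / 4)"
  unfolding g .
qed

lemma gz_mult: "gz z x * cnj (gz w x) = exp (- (cr x)\<^sup>2 + (z + cnj w) * cr x)"
 unfolding gz_def by (simp add: exp_cnj exp_add[symmetric] algebra_simps)

lemma gz_L2s: "gz z \<in> L2b"
proof -
 have "intg (%x. Re (gz z x * cnj (gz z x)))"
  unfolding gz_mult by (intro integrable_Re gz2_integral)
 moreover have "Re (gz z x * cnj (gz z x)) = (cmod (gz z x))^2" for x
  by (simp only: complex_norm_square[symmetric] Re_complex_of_real flip: of_real_power)
 ultimately show ?thesis unfolding L2s_def by simp
qed

lemma gh_L2s: "gh z \<in> L2b"
 unfolding gh_def[abs_def] by (intro L2s_scale gz_L2s)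

lemma gh_integrable: "intg (gh z)"
 unfolding gh_def[abs_def] by (intro integrable_mult_right gz_integral)

lemma inn_gz: "innb (gz z) (gz w) = cr (sqrt pi) * exp ((z + cnj w)\<^sup>2 / 4)"
 unfolding inn_def gz_mult by (rule gz2_integral)

lemma inn_gh: "innb (gh z) (gh w) = innb (gz z) (gz w)"
proof -
 have "innb (gh z) (gh w) = exp (z\<^sup>2 / 2) * (cnj (exp (w\<^sup>2 / 2)) * (cr (sqrt pi) * exp ((- \<i> * z + cnj (- \<i> * w))\<^sup>2 / 4)))"
  unfolding gh_def[abs_def] inn_scale_left inn_scale_right inn_gz ..
 also have "... = cr (sqrt pi) * (exp (z\<^sup>2 / 2) * exp ((cnj w)\<^sup>2 / 2) * exp ((- \<i> * z + cnj (- \<i> * w))\<^sup>2 / 4))"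
  by (simp add: exp_cnj)
 also have "... = cr (sqrt pi) * exp ((z + cnj w)\<^sup>2 / 4)"
  unfolding exp_add[symmetric] by (intro arg_cong2[where f = "(*)"] arg_cong[where f = exp] refl)
   (simp add: power2_eq_square field_simps)
 finally show ?thesis unfolding inn_gz .
qed

text \<open>For purely imaginary parameters the pairings are Fourier integrals of the integrable
  function \<open>f x * gz 0 x\<close>, and the factor \<open>gz 0\<close> never vanishes.\<close>

lemma total_gz: "total lborel gz UNIV"
 unfolding total_def
proof (intro conjI ballI impI gz_L2s)
 fix f :: "real => complex" assume f: "f \<in> L2b" and z: "\<forall>i\<in>UNIV. innb f (gz i) = 0"
 have "AB x. f x * gz 0 x = 0"
 proof (rule L1_fourier_zero)
  show "intg (%x. f x * gz 0 x)" by (rule L2s_integrable_mult[OF f gz_L2s])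
  fix s
  have e: "f x * gz 0 x * exp (- \<i> * cr (s * x)) = f x * cnj (gz (\<i> * cr s) x)" for x
   unfolding gz_def mult.assoc exp_add[symmetric] exp_cnj
   by (intro arg_cong[where f = exp] arg_cong2[where f = "(*)"] refl) (simp add: algebra_simps)
  show "(LB x. f x * gz 0 x * exp (- \<i> * cr (s * x))) = 0"
   unfolding e using z unfolding inn_def by blast
 qed
 then show "AB x. f x = 0" by (simp add: gz_def)
qed

lemma total_gh: "total lborel gh UNIV"
 unfolding total_def
proof (intro conjI ballI impI gh_L2s)
 fix f :: "real => complex" assume f: "f \<in> L2b" and z: "\<forall>i\<in>UNIV. innb f (gh i) = 0"
 have "innb f (gz w) = 0" for w
  using z[rule_format, of "\<i> * w"] unfolding gh_def[abs_def] inn_scale_right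
  by (simp add: mult.assoc[symmetric])
 then show "AB x. f x = 0" using total_gz f unfolding total_def by blast
qed

section \<open>Borel representatives of Lebesgue measurable functions\<close>

lemma completion_ex_borel_complex:
 fixes f :: "'a => complex"
 assumes f: "f \<in> borel_measurable (completion M)"
 shows "\<exists>g\<in>borel_measurable M. AE x in M. f x = g x"
proof -
 have "(%x. Re (f x)) \<in> borel_measurable (completion M)" "(%x. Im (f x)) \<in> borel_measurable (completion M)"
  using f by simp_all
 from this[THEN completion_ex_borel_measurable_real]
 obtain a b where ab[measurable]: "a \<in> borel_measurable M" "b \<in> borel_measurable M"
  and ae: "AE x in M. Re (f x) = a x" "AE x in M. Im (f x) = b x"
  by (elim bexE) (rule that)
 have "(%x. Complex (a x) (b x)) = (%x. cr (a x) + \<i> * cr (b x))"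
  by (simp add: complex_eq_iff fun_eq_iff)
 then have "(%x. Complex (a x) (b x)) \<in> borel_measurable M" by simp
 moreover have "AE x in M. f x = Complex (a x) (b x)"
  using ae by eventually_elim (simp add: complex_eq_iff)
 ultimately show ?thesis by (intro bexI[of _ "%x. Complex (a x) (b x)"])
qed

lemma completion_AE_measurable:
 fixes f g :: "'a => 'b::topological_space"
 assumes "g \<in> borel_measurable M" "AE x in M. f x = g x"
 shows "f \<in> borel_measurable (completion M)"
proof (rule measurableI)
 fix S :: "'b set" assume S: "S \<in> sets borel"
 have gm: "g \<in> borel_measurable (completion M)" using assms(1) by (rule measurable_completion)
 show "f -` S \<inter> space (completion M) \<in> sets (completion M)"
 proof (rule completion.in_sets_AE)
  show "g -` S \<inter> space (completion M) \<in> sets (completion M)" using measurable_sets[OF gm S] .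
  show "AE x in completion M. x \<in> g -` S \<inter> space (completion M) \<longleftrightarrow> x \<in> f -` S \<inter> space (completion M)"
   using AE_completion[OF assms(2)] by eventually_elim auto
 qed auto
qed auto

lemma L2s_completion_borel:
 assumes f: "f \<in> L2s (completion M)"
 shows "\<exists>g\<in>L2s M. AE x in M. f x = g x"
proof -
 obtain g where g: "g \<in> borel_measurable M" "AE x in M. f x = g x"
  using completion_ex_borel_complex f by (auto simp: L2s_def)
 have "integrable (completion M) (%x. (cmod (g x))^2)"
  by (rule integrable_cong_AE_imp[of _ "%x. (cmod (f x))^2"])
   (use f g AE_completion[OF g(2)] in \<open>auto simp: L2s_def intro!: measurable_completion\<close>)
 then show ?thesis using g by (auto simp: L2s_def integrable_completion intro!: bexI[of _ g])
qed

lemma L2s_completion: "f \<in> L2s M ==> f \<in> L2s (completion M)"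
 by (auto simp: L2s_def integrable_completion measurable_completion)

lemma inn_completion: "f \<in> borel_measurable M ==> g \<in> borel_measurable M ==> inn (completion M) f g = inn M f g"
 unfolding inn_def by (rule integral_completion) (auto intro: borel_measurable_times measurable_compose[OF _ borel_measurable_cnj])

lemma total_completion:
 assumes t: "total M e I" shows "total (completion M) e I"
 unfolding total_def
proof (intro conjI ballI impI)
 show "!!i. i \<in> I ==> e i \<in> L2s (completion M)" using t by (auto simp: total_def intro: L2s_completion)
 fix f assume f: "f \<in> L2s (completion M)" and z: "\<forall>i\<in>I. inn (completion M) f (e i) = 0"
 obtain g where g: "g \<in> L2s M" "AE x in M. f x = g x" using L2s_completion_borel[OF f] by blast
 have "inn M g (e i) = 0" if i: "i \<in> I" for i
 proof -
  have e: "e i \<in> borel_measurable M" using t i by (auto simp: total_def L2s_def)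
  have "inn M g (e i) = inn (completion M) g (e i)" using g e by (auto simp: inn_completion L2s_def)
  also have "... = inn (completion M) f (e i)"
   by (rule inn_cong_AE) (use g f e AE_completion[OF g(2)] in \<open>auto simp: L2s_def intro!: measurable_completion\<close>)
  finally show ?thesis using z i by simp
 qed
 then have "AE x in M. g x = 0" using t g by (auto simp: total_def)
 with g(2) have "AE x in M. f x = 0" by eventually_elim simp
 then show "AE x in completion M. f x = 0" by (rule AE_completion)
qed

lemma L2_sel: "carr (L2 S) = L2s (lebesgue_on S)" "ip (L2 S) = inn (lebesgue_on S)"
 "eqv (L2 S) f g \<longleftrightarrow> (AE x in lebesgue_on S. f x = g x)"
 by (auto simp: L2_def L2s_def inn_def fun_eq_iff)

section \<open>The Fourier operator on the line\<close>

lemma fourier_integral_inn_gh: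
 assumes g: "intg g"
 shows "(LB t. (1 / sqrt (2 * pi) * (LB x. g x * exp (- \<i> * cr (t * x)))) * cnj (gh z t))
  = (LB x. g x * cnj (gz z x))"
proof -
 have [measurable]: "g \<in> BM" using g by auto
 have i2: "integrable (lborel \<Otimes>\<^sub>M lborel) (%p. g (fst p) * cnj (gh z (snd p)))"
  using lborel_pair.Fubini_integrable[of "%p. g (fst p) * cnj (gh z (snd p))"] g gh_integrable[of z]
  by (auto simp: norm_mult)
 have i3: "integrable (lborel \<Otimes>\<^sub>M lborel) (%p. g (fst p) * cnj (gh z (snd p)) * exp (- \<i> * cr (snd p * fst p)))"
  by (rule integrable_bounded_mult[OF i2, where C = 1]) (auto simp: norm_exp_eq_Re)
 \<comment> \<open>The transform is moved from \<open>g\<close> to the Gaussian, where it is an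
   explicit Gaussian integral.\<close>
 have inner: "(LB t. cnj (gh z t) * exp (- \<i> * cr (t * x))) = cr (sqrt (2 * pi)) * cnj (gz z x)" for x
 proof -
  have "gh z t * exp (\<i> * cr (t * x)) = exp (z\<^sup>2 / 2) * gz (- \<i> * z + \<i> * x) t" for t
   unfolding gh_def gz_def mult.assoc exp_add[symmetric] by (intro arg_cong[where f = exp] arg_cong2[where f = "(*)"] refl) (simp add: algebra_simps)
  then have "(LB t. gh z t * exp (\<i> * cr (t * x))) = exp (z\<^sup>2 / 2) * (cr (sqrt (2 * pi)) * exp ((- \<i> * z + \<i> * x)\<^sup>2 / 2))"
   by (simp add: gz_integral)
  also have "... = cr (sqrt (2 * pi)) * (exp (z\<^sup>2 / 2) * exp ((- \<i> * z + \<i> * x)\<^sup>2 / 2))" by simp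
  also have "exp (z\<^sup>2 / 2) * exp ((- \<i> * z + \<i> * x)\<^sup>2 / 2) = gz z x"
   unfolding gz_def exp_add[symmetric] by (intro arg_cong[where f = exp]) (simp add: power2_eq_square field_simps)
  finally have "cnj (LB t. gh z t * exp (\<i> * cr (t * x))) = cr (sqrt (2 * pi)) * cnj (gz z x)" by simp
  then show ?thesis by (subst (asm) int_cnj[symmetric]) (simp add: exp_cnj)
 qed
 have "(LB t. (1 / sqrt (2 * pi) * (LB x. g x * exp (- \<i> * cr (t * x)))) * cnj (gh z t))
  = 1 / sqrt (2 * pi) * (LB t. LB x. g x * cnj (gh z t) * exp (- \<i> * cr (t * x)))"
  unfolding integral_mult_right_zero[symmetric] integral_mult_left_zero[symmetric] by (simp only: mult_ac)
 also have "(LB t. LB x. g x * cnj (gh z t) * exp (- \<i> * cr (t * x)))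
  = (LB x. LB t. g x * cnj (gh z t) * exp (- \<i> * cr (t * x)))"
  by (rule lborel_pair.Fubini_integral) (use i3 in \<open>simp add: case_prod_beta'\<close>)
 also have "... = (LB x. cr (sqrt (2 * pi)) * (g x * cnj (gz z x)))"
 proof (intro int_cong refl)
  fix x
  have "(LB t. g x * cnj (gh z t) * exp (- \<i> * cr (t * x))) = g x * (LB t. cnj (gh z t) * exp (- \<i> * cr (t * x)))"
   unfolding integral_mult_right_zero[symmetric] by (simp only: mult_ac)
  then show "(LB t. g x * cnj (gh z t) * exp (- \<i> * cr (t * x))) = cr (sqrt (2 * pi)) * (g x * cnj (gz z x))"
   unfolding inner by simp
 qed
 finally show ?thesis by (simp add: real_sqrt_mult)
qed

text \<open>The predicate under the choice in \<open>fourier_L2\<close>, named so that its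
  satisfiability can be proved before the chosen operator is used.\<close>

definition fourier_spec :: "((real => complex) => (real => complex)) => bool" where
 "fourier_spec T \<longleftrightarrow> unitary_map (L2 UNIV) (L2 UNIV) T \<and>
  (\<forall>g\<in>carr (L2 UNIV). integrable lebesgue g --> eqv (L2 UNIV) (T g) (fourier_integral g))"

text \<open>A unitary map pairing \<open>gz\<close> with \<open>gh\<close> exists because the Gram
  matrices agree. That it is the Fourier integral on integrable functions is checked by comparing
  pairings with all \<open>gh z\<close>.\<close>

lemma ex_fourier_spec: "\<exists>T. fourier_spec T"
proof -
 have tz: "total lebesgue gz UNIV" and th: "total lebesgue gh UNIV"
  by (intro total_completion total_gz total_gh)+
 have gram: "inn lebesgue (gh i) (gh j) = inn lebesgue (gz i) (gz j)" for i j
  by (simp add: inn_completion inn_gh)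
 from unitary_extension[OF tz th gram] obtain T where T0:
  "(\<forall>f\<in>L2s lebesgue. T f \<in> L2s lebesgue \<and> (\<forall>i\<in>UNIV. inn lebesgue (T f) (gh i) = inn lebesgue f (gz i)))"
  "(\<forall>f\<in>L2s lebesgue. \<forall>g\<in>L2s lebesgue. inn lebesgue (T f) (T g) = inn lebesgue f g)"
  "(\<forall>g\<in>L2s lebesgue. \<exists>f\<in>L2s lebesgue. AE x in lebesgue. T f x = g x)"
  by (elim exE conjE) (rule that)
 then have T: "!!f. f \<in> L2s lebesgue ==> T f \<in> L2s lebesgue"
  "!!f z. f \<in> L2s lebesgue ==> inn lebesgue (T f) (gh z) = inn lebesgue f (gz z)"
  "!!f g. f \<in> L2s lebesgue ==> g \<in> L2s lebesgue ==> inn lebesgue (T f) (T g) = inn lebesgue f g"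
  "!!g. g \<in> L2s lebesgue ==> \<exists>f\<in>L2s lebesgue. AE x in lebesgue. T f x = g x"
  by auto
 have "eqv (L2 UNIV) (T g) (fourier_integral g)" if g: "g \<in> L2s lebesgue" "integrable lebesgue g" for g
 proof -
  obtain g' where g': "g' \<in> L2b" "AB x. g x = g' x" using L2s_completion_borel[OF g(1)] by blast
  have gm[measurable]: "g' \<in> BM" using g' by (auto simp: L2s_def)
  have aeg: "AE x in lebesgue. g x = g' x" by (rule AE_completion[OF g'(2)])
  have g'm: "g' \<in> borel_measurable lebesgue" by (rule measurable_completion) simp
  have "integrable lebesgue g'"
   by (rule integrable_cong_AE_imp[OF g(2)]) (use g'm aeg in auto)
  then have ig': "intg g'" by (simp add: integrable_completion)
  have gme: "g \<in> borel_measurable lebesgue" using g by auto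
  have fi: "fourier_integral g t = cr (1 / sqrt (2 * pi)) * (LB x. g' x * exp (- \<i> * cr (t * x)))" for t
  proof -
   have "(LINT x|lebesgue. g x * exp (- \<i> * cr (t * x))) = (LINT x|lebesgue. g' x * exp (- \<i> * cr (t * x)))"
   proof (rule integral_cong_AE)
    have em: "(%x. exp (- \<i> * cr (t * x))) \<in> borel_measurable lebesgue"
     by (rule measurable_completion) measurable
    show "(%x. g x * exp (- \<i> * cr (t * x))) \<in> borel_measurable lebesgue"
     by (rule borel_measurable_times[OF gme em])
    show "(%x. g' x * exp (- \<i> * cr (t * x))) \<in> borel_measurable lebesgue"
     by (rule borel_measurable_times[OF g'm em])
   qed (use aeg in auto)
   then show ?thesis unfolding fourier_integral_def by (simp add: integral_completion)
  qed
  define F where "F = (%t. cr (1 / sqrt (2 * pi)) * (LB x. g' x * exp (- \<i> * cr (t * x))))"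
  have Fm[measurable]: "F \<in> BM" unfolding F_def
   by (intro borel_measurable_times borel_measurable_const lborel.borel_measurable_lebesgue_integral) measurable
  have Fb: "cmod (F t) \<le> 1 / sqrt (2 * pi) * (LB x. cmod (g' x))" for t
   unfolding F_def norm_mult norm_of_real
   using integral_norm_bound[of lborel "%x. g' x * exp (- \<i> * cr (t * x))"]
   by (intro mult_mono) (auto simp: norm_mult norm_exp_eq_Re)
  obtain h where h: "h \<in> L2b" "AB x. T g x = h x" using L2s_completion_borel[OF T(1)[OF g(1)]] by blast
  have hm[measurable]: "h \<in> BM" using h by (auto simp: L2s_def)
  have hz: "innb h (gh z) = (LB t. F t * cnj (gh z t))" for z
  proof -
   have "innb h (gh z) = inn lebesgue h (gh z)" by (simp add: inn_completion)
   also have "... = inn lebesgue (T g) (gh z)"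
    by (rule inn_cong_AE) (use T(1)[OF g(1)] AE_completion[OF h(2)] in \<open>auto simp: L2s_def intro!: measurable_completion\<close>)
   also have "... = inn lebesgue g (gz z)" by (rule T(2)[OF g(1)])
   also have "... = inn lebesgue g' (gz z)"
    by (rule inn_cong_AE) (use gme aeg in \<open>auto intro!: measurable_completion\<close>)
   also have "... = innb g' (gz z)" by (simp add: inn_completion)
   also have "... = (LB t. F t * cnj (gh z t))"
    unfolding inn_def F_def using fourier_integral_inn_gh[OF ig', of z] by simp
   finally show ?thesis .
  qed
  have iF: "intg (%t. F t * cnj (gh z t))" for z
   using integrable_bounded_mult[of lborel "%t. cnj (gh z t)" F, OF _ _ Fb] gh_integrable[of z] by (simp add: mult.commute)
  have ih: "intg (%t. h t * cnj (gh z t))" for z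
   by (rule L2s_integrable_inn[OF h(1) gh_L2s])
  have e: "(h t - F t) * gz 0 t * exp (- \<i> * cr (s * t)) = cnj (inverse (exp ((cr (-s))\<^sup>2 / 2))) * ((h t - F t) * cnj (gh (cr (-s)) t))" for s t
   unfolding gh_def gz_def by (simp add: exp_cnj exp_add[symmetric] exp_minus[symmetric] algebra_simps)
  \<comment> \<open>\<open>F\<close> is bounded but not yet known to be square integrable, so
    totality of \<open>gh\<close> cannot be applied to the difference. Multiplied by
    \<open>gz 0\<close> it becomes integrable, and Fourier uniqueness applies.\<close>
  have "AB t. (h t - F t) * gz 0 t = 0"
  proof (rule L1_fourier_zero)
   have "intg (%t. h t * cnj (gh 0 t) - F t * cnj (gh 0 t))"
    by (intro integrable_diff_B ih iF)
   moreover have "h t * cnj (gh 0 t) - F t * cnj (gh 0 t) = (h t - F t) * gz 0 t" for t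
    by (simp add: gh_def gz_def exp_cnj algebra_simps)
   ultimately show "intg (%t. (h t - F t) * gz 0 t)" by simp
   fix s
   have "(LB t. (h t - F t) * cnj (gh (cr (-s)) t)) = 0"
    unfolding left_diff_distrib
    by (subst int_diff[OF ih iF]) (use hz in \<open>simp add: inn_def\<close>)
   then show "(LB t. (h t - F t) * gz 0 t * exp (- \<i> * cr (s * t))) = 0"
    unfolding e integral_mult_right_zero by simp
  qed
  then have "AB t. T g t = fourier_integral g t"
   using h(2) by eventually_elim (simp add: gz_def fi F_def)
  then show ?thesis unfolding L2_sel lebesgue_on_UNIV_eq by (rule AE_completion)
 qed
 then have "fourier_spec T"
  unfolding fourier_spec_def unitary_map_def L2_sel lebesgue_on_UNIV_eq using T by auto
 then show ?thesis by blast
qed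

lemma fourier_L2_spec: "fourier_spec fourier_L2"
 using someI_ex[OF ex_fourier_spec] unfolding fourier_L2_def fourier_spec_def by blast

lemma gz_integrable_lebesgue: "integrable lebesgue (gz z)"
 by (simp add: integrable_completion gz_integral)

lemma fourier_integral_gz: "fourier_integral (gz z) = gh z"
proof
 fix t
 have "(LINT x|lebesgue. gz z x * exp (- \<i> * cr (t * x))) = (LB x. gz (z - \<i> * t) x)"
  by (subst integral_completion) (auto simp: gz_def exp_add[symmetric] algebra_simps intro!: int_cong)
 also have "... = cr (sqrt (2 * pi)) * exp ((z - \<i> * t)\<^sup>2 / 2)" by (rule gz_integral)
 also have "exp ((z - \<i> * t)\<^sup>2 / 2) = gh z t"
  unfolding gh_def gz_def exp_add[symmetric] by (intro arg_cong[where f = exp]) (simp add: power2_eq_square field_simps)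
 finally show "fourier_integral (gz z) t = gh z t" unfolding fourier_integral_def by (simp add: real_sqrt_mult)
qed

lemma fourier_L2_gz: "AE x in lebesgue. fourier_L2 (gz z) x = gh z x"
 using fourier_L2_spec gz_integrable_lebesgue[of z] L2s_completion[OF gz_L2s, of z]
 unfolding fourier_spec_def L2_sel lebesgue_on_UNIV_eq fourier_integral_gz[symmetric] by blast

lemma fst_snd_borel[measurable]:
 "fst \<in> borel_measurable (borel :: ('a::euclidean_space \<times> 'b::euclidean_space) measure)"
 "snd \<in> borel_measurable (borel :: ('a::euclidean_space \<times> 'b::euclidean_space) measure)"
 by (intro borel_measurable_continuous_onI continuous_intros)+

lemma Complex_borel[measurable (raw)]:
 assumes [measurable]: "f \<in> borel_measurable M" "g \<in> borel_measurable M"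
 shows "(%x. Complex (f x) (g x)) \<in> borel_measurable M"
 unfolding Complex_eq by measurable

section \<open>Measure preserving charts and representatives\<close>

definition mpiso :: "('a::euclidean_space => 'b::euclidean_space) => ('b => 'a) => bool" where
 "mpiso K K' \<longleftrightarrow> K \<in> BM \<and> K' \<in> BM \<and>
  (\<forall>x. K' (K x) = x) \<and> (\<forall>y. K (K' y) = y) \<and> distr lborel borel K = lborel"

lemma mpiso_sym: assumes "mpiso K K'" shows "mpiso K' K"
proof -
 have [measurable]: "K \<in> BM" "K' \<in> BM" using assms by (auto simp: mpiso_def)
 have "distr lborel borel K' = distr (distr lborel borel K) borel K'" using assms by (simp add: mpiso_def)
 also have "... = distr lborel borel (K' \<circ> K)" by (rule distr_distr) auto
 also have "K' \<circ> K = (%x. x)" using assms by (auto simp: mpiso_def)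
 also have "distr lborel borel (%x. x) = (lborel :: 'a measure)" by (rule distr_id2) simp
 finally show ?thesis using assms by (auto simp: mpiso_def)
qed

lemma mpiso_comp:
 assumes "mpiso K K'" "mpiso L L'" shows "mpiso (%x. L (K x)) (%y. K' (L' y))"
proof -
 have [measurable]: "K \<in> BM" "K' \<in> BM" "L \<in> BM" "L' \<in> BM"
  using assms by (auto simp: mpiso_def)
 have "distr lborel borel (L \<circ> K) = distr (distr lborel borel K) borel L" by (rule distr_distr[symmetric]) auto
 then have "distr lborel borel (%x. L (K x)) = lborel" using assms by (simp add: mpiso_def comp_def)
 then show ?thesis using assms by (auto simp: mpiso_def)
qed

lemma mpisoI:
 assumes [measurable]: "K \<in> BM" "K' \<in> BM"
  and "!!x. K' (K x) = x" "!!y. K (K' y) = y"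
  and nn: "!!F :: 'b::euclidean_space => ennreal. F \<in> BM ==> (NN x. F (K x)) = (NN x. F x)"
 shows "mpiso (K :: 'a::euclidean_space => 'b) K'"
proof -
 have "distr lborel borel K = lborel"
 proof (rule measure_eqI)
  fix A assume "A \<in> sets (distr lborel borel K)"
  then have [measurable]: "A \<in> sets borel" by simp
  have "emeasure (distr lborel borel K) A = (\<integral>\<^sup>+x. indicator A x \<partial>distr lborel borel K)" by simp
  also have "... = (NN x. indicator A (K x))" by (rule nn_integral_distr) auto
  also have "... = emeasure lborel A" by (subst nn) auto
  finally show "emeasure (distr lborel borel K) A = emeasure lborel A" .
 qed simp
 then show ?thesis using assms by (auto simp: mpiso_def)
qed

lemma mpiso_AE:
 assumes "mpiso K K'" "AB y. P y" shows "AB x. P (K x)"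
proof (rule AE_distrD[of K lborel borel])
 have d: "distr lborel borel K = lborel" using assms(1) by (simp add: mpiso_def)
 show "AE x in distr lborel borel K. P x" unfolding d by (rule assms(2))
qed (use assms in \<open>simp add: mpiso_def\<close>)

lemma mpiso_AE_iff:
 assumes "mpiso K K'" shows "(AB x. P (K x)) \<longleftrightarrow> (AB y. P y)"
 using mpiso_AE[OF assms, of P] mpiso_AE[OF mpiso_sym[OF assms], of "%x. P (K x)"] assms
 by (auto simp: mpiso_def)

lemma mpiso_integral:
 fixes F :: "'b::euclidean_space => 'c::{banach, second_countable_topology}"
 assumes "mpiso K K'" "F \<in> BM"
 shows "(LB x. F (K x)) = (LB y. F y)" "intg (%x. F (K x)) \<longleftrightarrow> intg F"
proof -
 have [measurable]: "K \<in> BM" using assms by (auto simp: mpiso_def)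
 have d: "distr lborel borel K = lborel" using assms by (auto simp: mpiso_def)
 show "(LB x. F (K x)) = (LB y. F y)"
  using integral_distr[of K lborel borel F] assms(2) unfolding d by simp
 show "intg (%x. F (K x)) \<longleftrightarrow> intg F"
  using integrable_distr_eq[of K lborel borel F] assms(2) unfolding d by simp
qed

text \<open>\<open>g\<close> is a Borel representative of \<open>f\<close> on \<open>S\<close> in
  the chart \<open>K\<close>. The value 0 at every point outside the preimage of \<open>S\<close>
  turns integrals over \<open>S\<close> into integrals over the whole coordinate space.\<close>

definition rep :: "('a::euclidean_space => 'b::euclidean_space) => 'b set => ('b => complex) => ('a => complex) => bool" where
 "rep K S f g \<longleftrightarrow> g \<in> BM \<and> (\<forall>x. K x \<notin> S --> g x = 0) \<and>
  (AB x. K x \<in> S --> f (K x) = g x)"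

lemma lebesgue_on_AE_iff:
 assumes "S \<in> sets borel"
 shows "(AE w in lebesgue_on S. P w) \<longleftrightarrow> (AB w. w \<in> S --> P w)"
 using assms by (subst AE_restrict_space_iff) (auto simp: AE_completion_iff)

lemma chart_AE_iff:
 assumes "mpiso K K'" "S \<in> sets borel"
 shows "(AE w in lebesgue_on S. P w) \<longleftrightarrow> (AB x. K x \<in> S --> P (K x))"
 unfolding lebesgue_on_AE_iff[OF assms(2)] mpiso_AE_iff[OF assms(1), symmetric, of "%w. w \<in> S --> P w"] ..

lemma rep_ex:
 assumes K: "mpiso K K'" and S[measurable]: "S \<in> sets borel" and f: "f \<in> borel_measurable (lebesgue_on S)"
 shows "\<exists>g. rep K S f g"
proof -
 have [measurable]: "K \<in> BM" using K by (auto simp: mpiso_def)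
 have "(%w. if w \<in> S then f w else 0) \<in> borel_measurable lebesgue"
  using f by (subst (asm) measurable_restrict_space_iff) auto
 then obtain h where h[measurable]: "h \<in> borel_measurable lborel" and ae: "AB w. (if w \<in> S then f w else 0) = h w"
  using completion_ex_borel_complex by blast
 have "AB x. K x \<in> S --> f (K x) = h (K x)"
  using mpiso_AE[OF K ae] by eventually_elim auto
 then show ?thesis unfolding rep_def by (intro exI[of _ "%x. if K x \<in> S then h (K x) else 0"]) (auto elim: eventually_mono)
qed

lemma rep_measurable:
 assumes K: "mpiso K K'" and S[measurable]: "S \<in> sets borel" and r: "rep K S f g"
 shows "f \<in> borel_measurable (lebesgue_on S)"
proof -
 have [measurable]: "K' \<in> BM" "g \<in> BM" using K r by (auto simp: mpiso_def rep_def)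
 have "AB x. K x \<in> S --> f (K x) = g (K' (K x))" using r K by (simp add: rep_def mpiso_def)
 then have "AB w. w \<in> S --> f w = g (K' w)" by (subst (asm) mpiso_AE_iff[OF K, of "%w. w \<in> S --> f w = g (K' w)"])
 then have "AB w. (if w \<in> S then f w else 0) = (if w \<in> S then g (K' w) else 0)" by (auto elim: eventually_mono)
 then have "(%w. if w \<in> S then f w else 0) \<in> borel_measurable lebesgue"
  by (rule completion_AE_measurable[rotated]) measurable
 then show ?thesis by (subst measurable_restrict_space_iff) auto
qed

lemma rep_integral_gen:
 fixes f :: "'b::euclidean_space => 'c::{banach, second_countable_topology}"
 assumes K: "mpiso K K'" and S[measurable]: "S \<in> sets borel" and f: "f \<in> borel_measurable (lebesgue_on S)"
  and g[measurable]: "g \<in> BM" and z: "!!x. K x \<notin> S ==> g x = 0"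
  and ae: "AB x. K x \<in> S --> f (K x) = g x"
 shows "integral\<^sup>L (lebesgue_on S) f = integral\<^sup>L lborel g" "integrable (lebesgue_on S) f \<longleftrightarrow> intg g"
proof -
 have [measurable]: "K' \<in> BM" "K \<in> BM" using K by (auto simp: mpiso_def)
 have fm: "(%w. indicator S w *\<^sub>R f w) \<in> borel_measurable lebesgue"
  using f by (subst (asm) borel_measurable_restrict_space_iff) auto
 have gm: "(%w. g (K' w)) \<in> BM" by measurable
 have gm': "(%w. g (K' w)) \<in> borel_measurable lebesgue" by (rule measurable_completion) simp
 have "AB x. K x \<in> S --> f (K x) = g (K' (K x))" using ae K by (simp add: mpiso_def)
 then have ae2: "AB w. w \<in> S --> f w = g (K' w)" by (subst (asm) mpiso_AE_iff[OF K, of "%w. w \<in> S --> f w = g (K' w)"])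
 have "g (K' w) = 0" if "w \<notin> S" for w using z[of "K' w"] that K by (auto simp: mpiso_def)
 then have ae3: "AE w in lebesgue. indicator S w *\<^sub>R f w = g (K' w)"
  using AE_completion[OF ae2] by (auto simp: indicator_def elim: eventually_mono)
 have "integral\<^sup>L (lebesgue_on S) f = (LINT w|lebesgue. indicator S w *\<^sub>R f w)"
  by (rule integral_restrict_space) simp
 also have "... = (LINT w|lebesgue. g (K' w))" by (rule integral_cong_AE[OF fm gm' ae3])
 also have "... = (LB w. g (K' w))" by (rule integral_completion) simp
 also have "... = integral\<^sup>L lborel g" by (rule mpiso_integral(1)[OF mpiso_sym[OF K] g])
 finally show "integral\<^sup>L (lebesgue_on S) f = integral\<^sup>L lborel g" .
 have "integrable (lebesgue_on S) f \<longleftrightarrow> integrable lebesgue (%w. indicator S w *\<^sub>R f w)"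
  by (rule integrable_restrict_space) simp
 also have "... \<longleftrightarrow> integrable lebesgue (%w. g (K' w))" by (rule integrable_cong_AE[OF fm gm' ae3])
 also have "... \<longleftrightarrow> intg (%w. g (K' w))" by (rule integrable_completion) simp
 also have "... \<longleftrightarrow> intg g" by (rule mpiso_integral(2)[OF mpiso_sym[OF K] g])
 finally show "integrable (lebesgue_on S) f \<longleftrightarrow> intg g" .
qed

lemma rep_L2s_iff:
 assumes K: "mpiso K K'" and S: "S \<in> sets borel" and r: "rep K S f g"
 shows "f \<in> L2s (lebesgue_on S) \<longleftrightarrow> g \<in> L2b"
proof -
 have fm[measurable]: "f \<in> borel_measurable (lebesgue_on S)" by (rule rep_measurable[OF assms])
 have gm[measurable]: "g \<in> BM" using r by (auto simp: rep_def)
 have "integrable (lebesgue_on S) (%x. (cmod (f x))^2) \<longleftrightarrow> intg (%x. (cmod (g x))^2)"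
  by (rule rep_integral_gen(2)[OF K S]) (use r in \<open>auto simp: rep_def elim: eventually_mono\<close>)
 then show ?thesis unfolding L2s_def using fm gm by auto
qed

lemma rep_inn:
 assumes K: "mpiso K K'" and S: "S \<in> sets borel" and r: "rep K S f g" "rep K S f2 g2"
 shows "inn (lebesgue_on S) f f2 = innb g g2"
proof -
 have fm[measurable]: "f \<in> borel_measurable (lebesgue_on S)" "f2 \<in> borel_measurable (lebesgue_on S)"
  using rep_measurable[OF K S] r by auto
 have gm[measurable]: "g \<in> BM" "g2 \<in> BM" using r by (auto simp: rep_def)
 have "AB x. K x \<in> S --> f (K x) = g x" "AB x. K x \<in> S --> f2 (K x) = g2 x" using r by (auto simp: rep_def)
 then have "AB x. K x \<in> S --> f (K x) * cnj (f2 (K x)) = g x * cnj (g2 x)" by eventually_elim auto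
 then show ?thesis unfolding inn_def
  by (intro rep_integral_gen(1)[OF K S]) (use r in \<open>auto simp: rep_def intro: borel_measurable_times measurable_compose[OF _ borel_measurable_cnj]\<close>)
qed

lemma rep_AE_iff:
 assumes K: "mpiso K K'" and S: "S \<in> sets borel" and r: "rep K S f g" "rep K S f2 g2"
 shows "(AE w in lebesgue_on S. f w = f2 w) \<longleftrightarrow> (AB x. g x = g2 x)"
proof -
 have a: "AB x. K x \<in> S --> f (K x) = g x" "AB x. K x \<in> S --> f2 (K x) = g2 x" using r by (auto simp: rep_def)
 have z: "!!x. K x \<notin> S ==> g x = 0" "!!x. K x \<notin> S ==> g2 x = 0" using r by (auto simp: rep_def)
 show ?thesis unfolding chart_AE_iff[OF K S]
 proof
  assume "AB x. K x \<in> S --> f (K x) = f2 (K x)"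
  with a show "AB x. g x = g2 x" by eventually_elim (metis z)
 next
  assume "AB x. g x = g2 x"
  with a show "AB x. K x \<in> S --> f (K x) = f2 (K x)" by eventually_elim auto
 qed
qed

text \<open>In this nesting \<open>ff\<close>, \<open>sf\<close>, \<open>fs\<close>,
  \<open>ss\<close> read off u1, u2, v1, v2. The two variables that are Fourier transformed form the
  first component, so one application of Fubini separates them from v.\<close>

type_synonym r4 = "(real \<times> real) \<times> (real \<times> real)"

lemma nn_R2:
 fixes F :: "real \<times> real => ennreal"
 assumes [measurable]: "F \<in> BM"
 shows "(NN x. F x) = (NN a. NN b. F (a, b))"
 by (subst lborel_prod[symmetric], subst lborel.nn_integral_fst[symmetric]) (auto simp: lborel_prod)

lemma nn_R4:
 fixes F :: "r4 => ennreal"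
 assumes [measurable]: "F \<in> BM"
 shows "(NN x. F x) = (NN a. NN b. NN p. NN q. F ((a, b), (p, q)))"
proof -
 have "(NN x. F x) = (NN u. NN v. F (u, v))"
  by (subst lborel_prod[symmetric], subst lborel.nn_integral_fst[symmetric]) (auto simp: lborel_prod)
 also have "... = (NN u. NN p. NN q. F (u, (p, q)))"
  by (intro nn_integral_cong nn_R2) measurable
 also have "... = (NN a. NN b. NN p. NN q. F ((a, b), (p, q)))"
  by (rule nn_R2) measurable
 finally show ?thesis .
qed

lemma nn_swap:
 fixes F :: "real => real => ennreal"
 assumes "(%x. F (fst x) (snd x)) \<in> BM"
 shows "(NN a. NN b. F a b) = (NN b. NN a. F a b)"
 by (rule lborel_pair.Fubini'[symmetric]) (use assms in \<open>simp add: case_prod_beta' lborel_prod\<close>)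

lemma mpiso_rearrange: "mpiso (%x :: r4. ((ff x, fs x), (sf x, ss x))) (%x :: r4. ((ff x, fs x), (sf x, ss x)))"
proof (rule mpisoI)
 fix F :: "r4 => ennreal" assume [measurable]: "F \<in> BM"
 show "(\<integral>\<^sup>+x. F ((ff x, fs x), (sf x, ss x)) \<partial>(lborel :: r4 measure)) = (NN x. F x)"
 proof -
  have "(\<integral>\<^sup>+x. F ((ff x, fs x), (sf x, ss x)) \<partial>(lborel :: r4 measure)) =
   (NN a. NN b. NN p. NN q. F ((a, p), (b, q)))"
   by (subst nn_R4) simp_all
  also have "... = (NN a. NN p. NN b. NN q. F ((a, p), (b, q)))"
   by (intro nn_integral_cong nn_swap) measurable
  also have "... = (NN x. F x)" by (subst nn_R4) simp_all
  finally show ?thesis .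
 qed
next
 show "(%x :: r4. ((ff x, fs x), (sf x, ss x))) \<in> BM" by measurable
 then show "(%x :: r4. ((ff x, fs x), (sf x, ss x))) \<in> BM" .
qed auto

lemma mpiso_Complex: "mpiso (%x :: real \<times> real. Complex (fst x) (snd x)) (%z. (Re z, Im z))"
proof -
 have "distr lborel borel (%x :: real \<times> real. Complex (fst x) (snd x)) = lborel"
 proof (rule lborel_eqI[symmetric])
  fix l u :: complex assume "!!b. b \<in> Basis ==> l \<bullet> b \<le> u \<bullet> b"
  from this[of 1] this[of \<i>] have le: "Re l \<le> Re u" "Im l \<le> Im u" by (auto simp: Basis_complex_def inner_complex_def)
  have pre: "(%x :: real \<times> real. Complex (fst x) (snd x)) -` box l u = box (Re l, Im l) (Re u, Im u)"
   by (auto simp: box_def Basis_complex_def inner_complex_def Basis_prod_def inner_prod_def)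
  have "emeasure (distr lborel borel (%x :: real \<times> real. Complex (fst x) (snd x))) (box l u) = emeasure lborel (box (Re l, Im l) (Re u, Im u))"
   by (subst emeasure_distr) (auto simp: pre)
  also have "... = ennreal ((Re u - Re l) * (Im u - Im l))"
   by (subst emeasure_lborel_box) (use le in \<open>auto simp: Basis_prod_def inner_prod_def prod.union_disjoint\<close>)
  also have "(Re u - Re l) * (Im u - Im l) = (\<Prod>b\<in>Basis. (u - l) \<bullet> b)"
   by (simp add: Basis_complex_def inner_complex_def)
  finally show "emeasure (distr lborel borel (%x :: real \<times> real. Complex (fst x) (snd x))) (box l u) = (\<Prod>b\<in>Basis. (u - l) \<bullet> b)" .
 qed simp
 then show ?thesis by (auto simp: mpiso_def)
qed

lemma mpiso_pair:
 assumes "mpiso K K'" "mpiso L L'"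
 shows "mpiso (%x. (K (fst x), L (snd x))) (%y. (K' (fst y), L' (snd y)))"
proof -
 have [measurable]: "K \<in> BM" "K' \<in> BM" "L \<in> BM" "L' \<in> BM"
  using assms by (auto simp: mpiso_def)
 have d: "distr lborel borel K = lborel" "distr lborel borel L = lborel" using assms by (auto simp: mpiso_def)
 have "distr lborel borel K \<Otimes>\<^sub>M distr lborel borel L = distr (lborel \<Otimes>\<^sub>M lborel) (borel \<Otimes>\<^sub>M borel) (%(x, y). (K x, L y))"
  by (rule pair_measure_distr) (auto simp: d sigma_finite_lborel)
 then have "distr lborel borel (%x. (K (fst x), L (snd x))) = lborel"
  by (simp add: d lborel_prod borel_prod case_prod_beta')
 then show ?thesis using assms by (auto simp: mpiso_def)
qed

definition J :: "r4 => complex \<times> complex" where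
 "J x = (Complex (ff x) (fs x), Complex (sf x) (ss x))"
definition J' :: "complex \<times> complex => r4" where
 "J' w = ((Re (fst w), Re (snd w)), (Im (fst w), Im (snd w)))"

lemma mpiso_J: "mpiso J J'"
 using mpiso_comp[OF mpiso_rearrange mpiso_pair[OF mpiso_Complex mpiso_Complex]]
 by (simp add: J_def[abs_def] J'_def[abs_def])

definition shear :: "(real \<times> real => real => real) => r4 => r4" where
 "shear s x = (fst x, (fs x, ss x + s (fst x) (fs x)))"

text \<open>For fixed first three coordinates the map translates the last one, so Fubini gives
  invariance of the measure.\<close>

lemma mpiso_shear:
 assumes [measurable]: "(%x. s (fst x) (snd x)) \<in> BM"
 shows "mpiso (shear s) (shear (%u p. - s u p))"
proof (rule mpisoI)
 have "(%x::r4. s (fst x) (fs x)) = (%x. s (fst x) (snd x)) \<circ> (%x. (fst x, fs x))" by auto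
 also have "... \<in> BM" by (rule measurable_comp[of _ _ borel]) measurable
 finally have [measurable]: "(%x::r4. s (fst x) (fs x)) \<in> BM" .
 show [measurable]: "shear s \<in> BM" "shear (%u p. - s u p) \<in> BM"
  unfolding shear_def by measurable
 fix F :: "r4 => ennreal" assume [measurable]: "F \<in> BM"
 have "(NN q. F ((a, b), (p, q + s (a, b) p))) = (NN q. F ((a, b), (p, q)))" for a b p
  by (subst nn_integral_real_affine[of "%q. F ((a, b), (p, q))" 1 "s (a, b) p"]) (auto simp: add.commute)
 then show "(NN x. F (shear s x)) = (NN x. F x)"
  by (subst (1 2) nn_R4) (auto simp: shear_def)
qed (auto simp: shear_def)

text \<open>The chart of the Siegel domain: its last coordinate is Im zeta2 - |zeta1|^2, so the
  domain becomes the half-space v2 > 0.\<close>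

definition Ks :: "r4 => complex \<times> complex" where "Ks x = kappa (J x)"
definition Ks' :: "complex \<times> complex => r4" where "Ks' w = shear (%u p. - ((fst u)\<^sup>2 + p\<^sup>2)) (J' w)"

lemma mpiso_Ks: "mpiso Ks Ks'"
proof -
 have "mpiso (%x. J (shear (%u p. (fst u)\<^sup>2 + p\<^sup>2) x)) (%w. shear (%u p. - ((fst u)\<^sup>2 + p\<^sup>2)) (J' w))"
  by (rule mpiso_comp[OF mpiso_shear mpiso_J]) measurable
 moreover have "J (shear (%u p. (fst u)\<^sup>2 + p\<^sup>2) x) = Ks x" for x
  by (simp add: J_def shear_def Ks_def kappa_def complex_eq_iff cmod_power2)
 ultimately show ?thesis by (simp add: Ks'_def[abs_def])
qed

lemma J_CPi: "J x \<in> CPi \<longleftrightarrow> 0 < ss x" by (simp add: J_def CPi_def)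

lemma Ks_siegel: "Ks x \<in> siegel \<longleftrightarrow> 0 < ss x"
 by (simp add: Ks_def J_def siegel_def kappa_def cmod_power2)

lemma CPi_borel[measurable]: "CPi \<in> sets borel"
proof -
 have "CPi = {w. 0 < Im (snd w)}" by (auto simp: CPi_def)
 also have "open ..." by (intro open_Collect_less continuous_intros)
 finally show ?thesis by simp
qed

lemma open_siegel: "open siegel"
proof -
 have "siegel = {w. 0 < Im (snd w) - (cmod (fst w))\<^sup>2}" by (auto simp: siegel_def)
 also have "open ..." by (intro open_Collect_less continuous_intros)
 finally show ?thesis .
qed

lemma siegel_borel[measurable]: "siegel \<in> sets borel" using open_siegel by simp

text \<open>Since \<open>Ks\<close> is \<open>kappa\<close> after \<open>J\<close>, the operator
  \<open>U0\<close> keeps the representative.\<close>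

lemma rep_U0: "rep Ks siegel f g ==> rep J CPi (U0 f) g"
 unfolding rep_def J_CPi Ks_siegel by (simp add: U0_def Ks_def)

section \<open>Tensor products and separating families of test functions\<close>

definition tp :: "('a => complex) => ('b => complex) => 'a \<times> 'b => complex" where
 "tp f g x = f (fst x) * g (snd x)"

lemma AE_lift_fst:
 assumes "AE a in (lborel :: 'a::euclidean_space measure). P a"
 shows "AE x in (lborel :: ('a \<times> 'b::euclidean_space) measure). P (fst x)"
proof -
 obtain N where N: "N \<in> null_sets lborel" "{a. \<not> P a} \<subseteq> N" using assms by (auto simp: eventually_ae_filter)
 have "N \<times> UNIV \<in> null_sets (lborel \<Otimes>\<^sub>M (lborel :: 'b measure))"
  using N(1) by (intro lborel.times_in_null_sets1) auto
 then show ?thesis using N(2) unfolding lborel_prod by (intro AE_I'[of "N \<times> UNIV"]) auto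
qed

lemma AE_lift_snd:
 assumes "AE a in (lborel :: 'b::euclidean_space measure). P a"
 shows "AE x in (lborel :: ('a::euclidean_space \<times> 'b) measure). P (snd x)"
proof -
 obtain N where N: "N \<in> null_sets lborel" "{a. \<not> P a} \<subseteq> N" using assms by (auto simp: eventually_ae_filter)
 have "UNIV \<times> N \<in> null_sets ((lborel :: 'a measure) \<Otimes>\<^sub>M lborel)"
  using N(1) by (intro lborel.times_in_null_sets2) auto
 then show ?thesis using N(2) unfolding lborel_prod by (intro AE_I'[of "UNIV \<times> N"]) auto
qed

lemma tp_measurable[measurable]:
 fixes f :: "'a::euclidean_space => complex" and g :: "'b::euclidean_space => complex"
 assumes [measurable]: "f \<in> BM" "g \<in> BM"
 shows "tp f g \<in> BM"
 unfolding tp_def by measurable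

lemma tp_integral:
 fixes f :: "'a::euclidean_space => complex" and g :: "'b::euclidean_space => complex"
 assumes f: "intg f" and g: "intg g"
 shows "intg (tp f g)" "(LB x. tp f g x) = (LB x. f x) * (LB x. g x)"
proof -
 have [measurable]: "f \<in> BM" "g \<in> BM" using f g by auto
 have m: "(%x. f (fst x) * g (snd x)) \<in> borel_measurable (lborel \<Otimes>\<^sub>M lborel)" by (simp add: lborel_prod)
 have i: "integrable (lborel \<Otimes>\<^sub>M lborel) (%x. f (fst x) * g (snd x))"
  by (rule lborel_pair.Fubini_integrable[OF m]) (use f g in \<open>auto simp: norm_mult\<close>)
 then show "intg (tp f g)" by (simp add: tp_def[abs_def] lborel_prod)
 show "(LB x. tp f g x) = (LB x. f x) * (LB x. g x)"
  using lborel_pair.integral_fst'[OF i] by (simp add: tp_def[abs_def] lborel_prod)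
qed

lemma tp_L2s:
 fixes f :: "'a::euclidean_space => complex" and g :: "'b::euclidean_space => complex"
 assumes f: "f \<in> L2b" and g: "g \<in> L2b"
 shows "tp f g \<in> L2b"
proof -
 have "intg (%x. cr ((cmod (f x))^2))" "intg (%x. cr ((cmod (g x))^2))"
  using f g by (auto simp: L2s_def simp del: of_real_power)
 then have "intg (%x. Re (tp (%x. cr ((cmod (f x))^2)) (%x. cr ((cmod (g x))^2)) x))"
  by (intro integrable_Re tp_integral)
 then have "intg (%x. (cmod (tp f g x))^2)"
  by (simp add: tp_def norm_mult power_mult_distrib flip: of_real_power)
 moreover have "tp f g \<in> BM" using f g by (intro tp_measurable) (auto simp: L2s_def)
 ultimately show ?thesis by (simp add: L2s_def)
qed

lemma inn_tp:
 fixes f f' :: "'a::euclidean_space => complex" and g g' :: "'b::euclidean_space => complex"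
 assumes "f \<in> L2b" "f' \<in> L2b" "g \<in> L2b" "g' \<in> L2b"
 shows "innb (tp f g) (tp f' g') = innb f f' * innb g g'"
 using tp_integral(2)[OF L2s_integrable_inn[OF assms(1,2)] L2s_integrable_inn[OF assms(3,4)]]
 unfolding inn_def tp_def by (simp add: mult_ac)

lemma indicator_L2s:
 assumes "A \<in> sets borel" "emeasure lborel A < \<infinity>"
 shows "indicator A \<in> L2s (lborel :: 'a::euclidean_space measure)"
proof -
 have "(%x. (cmod (indicator A x))^2) = (indicat_real A :: 'a => real)" by (auto simp: indicator_def fun_eq_iff)
 moreover have "intg (indicat_real A :: 'a => real)" using assms by (simp add: integrable_indicator_iff)
 ultimately show ?thesis using assms by (simp add: L2s_def)
qed

text \<open>Indices of the test functions: Gaussian parameters for the transformed variables u, sets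
  of finite measure for the variables v on which the partial transform does not act.\<close>

definition I4 :: "(complex \<times> complex \<times> real set \<times> real set) set" where
 "I4 = {(z, w, A, B). A \<in> sets borel \<and> B \<in> sets borel \<and> emeasure lborel A < \<infinity> \<and> emeasure lborel B < \<infinity>}"

definition e4 :: "(complex => real => complex) => complex \<times> complex \<times> real set \<times> real set => r4 => complex" where
 "e4 g i = (case i of (z, w, A, B) => tp (tp (g z) (g w)) (tp (indicator A) (indicator B)))"

lemma e4_L2s: "i \<in> I4 ==> e4 gz i \<in> L2b" "i \<in> I4 ==> e4 gh i \<in> L2b"
 by (auto simp: I4_def e4_def intro!: tp_L2s gz_L2s gh_L2s indicator_L2s)

lemma inn_e4: "i \<in> I4 ==> j \<in> I4 ==> innb (e4 gh i) (e4 gh j) = innb (e4 gz i) (e4 gz j)"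
 by (cases i; cases j) (auto simp: I4_def e4_def inn_tp tp_L2s gz_L2s gh_L2s indicator_L2s inn_gh)

lemma inter_I4: "(z, w, A, B) \<in> I4 ==> A' \<in> sets borel ==> B' \<in> sets borel ==> (z, w, A \<inter> A', B \<inter> B') \<in> I4"
 using emeasure_mono[of "A \<inter> A'" A lborel] emeasure_mono[of "B \<inter> B'" B lborel] by (auto simp: I4_def)

lemma integral_mult_snd:
 fixes k :: "'a::euclidean_space \<times> 'b::euclidean_space => complex"
 assumes k: "intg k" and g[measurable]: "g \<in> BM" and b: "!!v. cmod (g v) \<le> B"
 shows "intg (%v. LB u. k (u, v))" "(LB x. k x * g (snd x)) = (LB v. (LB u. k (u, v)) * g v)"
proof -
 have k': "integrable (lborel \<Otimes>\<^sub>M lborel) (%(u, v). k (u, v))" using k by (simp add: lborel_prod)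
 show "intg (%v. LB u. k (u, v))" by (rule lborel_pair.integrable_snd[OF k'])
 have "intg (%x. k x * g (snd x))" by (rule integrable_bounded_mult[OF k]) (use b in auto)
 then have "integrable (lborel \<Otimes>\<^sub>M lborel) (%(u, v). k (u, v) * g v)" by (simp add: lborel_prod case_prod_beta')
 from lborel_pair.integral_snd[OF this]
 show "(LB x. k x * g (snd x)) = (LB v. (LB u. k (u, v)) * g v)" by (simp add: lborel_prod case_prod_beta')
qed

lemma integral_mult_fst:
 fixes k :: "'a::euclidean_space \<times> 'b::euclidean_space => complex"
 assumes k: "intg k" and g[measurable]: "g \<in> BM" and b: "!!v. cmod (g v) \<le> B"
 shows "intg (%u. LB v. k (u, v))" "(LB x. k x * g (fst x)) = (LB u. (LB v. k (u, v)) * g u)"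
proof -
 have k': "integrable (lborel \<Otimes>\<^sub>M lborel) (%(u, v). k (u, v))" using k by (simp add: lborel_prod)
 show "intg (%u. LB v. k (u, v))" by (rule lborel_pair.integrable_fst[OF k'])
 have "intg (%x. k x * g (fst x))" by (rule integrable_bounded_mult[OF k]) (use b in auto)
 then have "integrable (lborel \<Otimes>\<^sub>M lborel) (%(u, v). k (u, v) * g u)" by (simp add: lborel_prod case_prod_beta')
 from lborel_pair.integral_fst[OF this]
 show "(LB x. k x * g (fst x)) = (LB u. (LB v. k (u, v)) * g u)" by (simp add: lborel_prod case_prod_beta')
qed

definition ex :: "real => real => complex" where "ex s x = exp (\<i> * cr (s * x))"

lemma ex_props: "cmod (ex s x) = 1" "continuous_on A (ex s)"
 unfolding ex_def[abs_def] by (auto simp: norm_exp_eq_Re intro!: continuous_intros)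

lemma ex_measurable[measurable]: "ex s \<in> BM"
 using ex_props(2)[of UNIV s] by (rule borel_measurable_continuous_onI)

text \<open>A bounded factor keeps \<open>h\<close> integrable, which is what makes the property
  stable under tensor products.\<close>

definition separating :: "('a::euclidean_space => complex) set => bool" where
 "separating T \<longleftrightarrow> (\<forall>e\<in>T. e \<in> BM \<and> (\<forall>x. cmod (e x) \<le> 1)) \<and>
  (\<forall>h. intg h --> (\<forall>e\<in>T. (LB x. h x * e x) = 0) --> (AB x. h x = 0))"

lemma separating_ex: "separating (range ex)"
proof -
 have "AB x. h x = 0" if "intg h" "\<forall>e\<in>range ex. (LB x. h x * e x) = 0" for h
 proof (rule L1_fourier_zero[OF that(1)])
  have "exp (- \<i> * cr (s * x)) = ex (- s) x" for s x by (simp add: ex_def)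
  then show "(LB x. h x * exp (- \<i> * cr (s * x))) = 0" for s using that(2) by simp
 qed
 then show ?thesis unfolding separating_def by (auto simp: ex_props)
qed

lemma separating_indicator: "separating (indicator ` sets (borel :: 'a::euclidean_space measure))"
proof -
 have "AB x. h x = 0" if h: "intg h" "\<forall>e\<in>indicator ` sets borel. (LB x. h x * e x) = 0" for h :: "'a => complex"
 proof (rule L1_zero_generator[OF h(1), where E = "sets borel"])
  show "sets lborel = sigma_sets (space lborel) (sets (borel :: 'a measure))" using sets.sigma_sets_eq[of "borel :: 'a measure"] by simp
 qed (use h(2) in \<open>auto simp: Int_stable_def\<close>)
 then show ?thesis unfolding separating_def by (auto simp: indicator_def)
qed

text \<open>One variable is integrated out at a time. For a fixed test in the second variable the
  marginal in the first vanishes, so the test in the first may be replaced by an indicator;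
  repeating this in the second variable leaves rectangles, which determine \<open>h\<close>.\<close>

lemma separating_tensor:
 fixes T :: "('a::euclidean_space => complex) set" and T' :: "('b::euclidean_space => complex) set"
 assumes T: "separating T" and T': "separating T'"
 shows "separating {tp e e' | e e'. e \<in> T \<and> e' \<in> T'}"
 unfolding separating_def
proof (intro conjI ballI allI impI)
 have b: "!!e. e \<in> T ==> e \<in> BM" "!!e x. e \<in> T ==> cmod (e x) \<le> 1"
  "!!e. e \<in> T' ==> e \<in> BM" "!!e x. e \<in> T' ==> cmod (e x) \<le> 1" using T T' by (auto simp: separating_def)
 fix e assume "e \<in> {tp e e' | e e'. e \<in> T \<and> e' \<in> T'}"
 then obtain e1 e2 where e: "e = tp e1 e2" "e1 \<in> T" "e2 \<in> T'" by blast
 show "e \<in> BM" unfolding e(1) by (intro tp_measurable b e)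
 show "cmod (e x) \<le> 1" for x unfolding e(1) tp_def norm_mult by (intro mult_le_one b e) auto
next
 fix h :: "'a \<times> 'b => complex" assume h: "intg h" and z: "\<forall>e\<in>{tp e e' | e e'. e \<in> T \<and> e' \<in> T'}. (LB x. h x * e x) = 0"
 have b: "!!e. e \<in> T ==> e \<in> BM" "!!e x. e \<in> T ==> cmod (e x) \<le> 1"
  "!!e. e \<in> T' ==> e \<in> BM" "!!e x. e \<in> T' ==> cmod (e x) \<le> 1" using T T' by (auto simp: separating_def)
 have s: "separating S ==> intg g ==> (!!e. e \<in> S ==> (LB x. g x * e x) = 0) ==> AB x. g x = 0" for g :: "'c::euclidean_space => complex" and S
  unfolding separating_def by blast
 have hm: "intg (%x. h x * a (snd x))" "intg (%x. h x * a' (fst x))"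
  if [measurable]: "a \<in> BM" "a' \<in> BM" and "!!x. cmod (a x) \<le> 1" "!!x. cmod (a' x) \<le> 1" for a a'
  by (rule integrable_bounded_mult[OF h, where C = 1]; use that in simp)+
 note i = indicator_def
 have 1: "(LB x. (h x * indicator A (fst x)) * e' (snd x)) = 0" if A[measurable]: "A \<in> sets borel" and e': "e' \<in> T'" for A e'
 proof -
  have k: "intg (%x. h x * e' (snd x))" by (rule hm(1)[of _ "%_. 0"]) (auto simp: b e')
  have "AB u. (LB v. h (u, v) * e' (snd (u, v))) = 0"
  proof (rule s[OF T integral_mult_fst(1)[OF k, of "%_. 0" 0]])
   fix e assume e: "e \<in> T"
   have "(LB x. (h x * e' (snd x)) * e (fst x)) = 0" 
   proof -
    have "(LB x. h x * tp e e' x) = 0" using z e e' by blast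
    then show ?thesis by (simp add: tp_def mult_ac)
   qed
   then show "(LB u. (LB v. h (u, v) * e' (snd (u, v))) * e u) = 0" using integral_mult_fst(2)[OF k b(1)[OF e] b(2)[OF e]] by simp
  qed auto
  then have "(LB u. (LB v. h (u, v) * e' (snd (u, v))) * indicator A u) = 0"
   by (intro integral_eq_zero_AE) (auto elim: eventually_mono)
  then show ?thesis using integral_mult_fst(2)[OF k, of "indicator A" 1] by (simp add: i mult_ac)
 qed
 have "AE x in lborel \<Otimes>\<^sub>M lborel. h x = 0"
 proof (rule L1_zero_rectangles)
  show "integrable (lborel \<Otimes>\<^sub>M lborel) h" using h by (simp add: lborel_prod)
  fix A B assume "A \<in> sets (lborel :: 'a measure)" "B \<in> sets (lborel :: 'b measure)"
  then have [measurable]: "A \<in> sets borel" "B \<in> sets borel" by auto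
  have k: "intg (%x. h x * indicator A (fst x))" by (rule hm(2)[of "%_. 0"]) (auto simp: i)
  have "AB v. (LB u. h (u, v) * indicator A (fst (u, v))) = 0"
  proof (rule s[OF T' integral_mult_snd(1)[OF k, of "%_. 0" 0]])
   fix e assume e: "e \<in> T'"
   show "(LB v. (LB u. h (u, v) * indicator A (fst (u, v))) * e v) = 0" using integral_mult_snd(2)[OF k b(3)[OF e] b(4)[OF e]] 1[OF _ e, of A] by simp
  qed auto
  then have "(LB v. (LB u. h (u, v) * indicator A (fst (u, v))) * indicator B v) = 0"
   by (intro integral_eq_zero_AE) (auto elim: eventually_mono)
  then show "(LINT x|(lborel \<Otimes>\<^sub>M lborel). h x * (indicator A (fst x) * indicator B (snd x))) = 0"
   using integral_mult_snd(2)[OF k, of "indicator B" 1] by (simp add: i lborel_prod mult.assoc)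
 qed
 then show "AB x. h x = 0" unfolding lborel_prod .
qed

text \<open>Tests by rectangles force the integral of \<open>k\<close> over the first variable to
  vanish for almost every v, and this marginal then annihilates every bounded function of v.\<close>

lemma slice_zero:
 fixes k :: "'a::euclidean_space \<times> (real \<times> real) => complex"
 assumes k: "intg k"
  and z: "!!A B. A \<in> sets borel ==> B \<in> sets borel ==> (LB x. k x * tp (indicator A) (indicator B) (snd x)) = 0"
  and b[measurable]: "b \<in> BM" and bb: "!!v. cmod (b v) \<le> C"
 shows "(LB x. k x * b (snd x)) = 0"
proof -
 have "AB v. (LB u. k (u, v)) = 0"
 proof (rule separating_tensor[OF separating_indicator separating_indicator, unfolded separating_def, THEN conjunct2, rule_format])
  show "intg (%v. LB u. k (u, v))" by (rule integral_mult_snd(1)[OF k b bb])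
  fix e assume "e \<in> {tp e e' | e e'. e \<in> indicator ` sets (borel :: real measure) \<and> e' \<in> indicator ` sets (borel :: real measure)}"
  then obtain A B where e: "e = tp (indicator A) (indicator B)" and [measurable]: "A \<in> sets borel" "B \<in> sets borel" by blast
  have "(LB x. k x * e (snd x)) = (LB v. (LB u. k (u, v)) * e v)"
   unfolding e by (rule integral_mult_snd(2)[OF k, where B = 1]) (auto simp: tp_def indicator_def)
  then show "(LB v. (LB u. k (u, v)) * e v) = 0" using z[of A B] by (simp add: e)
 qed
 then have "(LB v. (LB u. k (u, v)) * b v) = 0" by (intro integral_eq_zero_AE) (auto elim: eventually_mono)
 then show ?thesis using integral_mult_snd(2)[OF k b bb] by simp
qed

lemma L1_fourier_zero_rect:
 fixes h :: "r4 => complex"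
 assumes h: "intg h"
  and z: "!!s r A B. A \<in> sets borel ==> B \<in> sets borel ==> (LB x. h x * (tp (tp (ex s) (ex r)) (tp (indicator A) (indicator B)) x)) = 0"
 shows "AB x. h x = 0"
 using separating_tensor[OF separating_tensor[OF separating_ex separating_ex] separating_tensor[OF separating_indicator separating_indicator]] h z
 unfolding separating_def by blast

lemma gz_imag: "cnj (gz (\<i> * cr (- s)) x) = gz 0 x * ex s x"
 unfolding gz_def ex_def exp_add[symmetric] exp_cnj by (intro arg_cong[where f = exp]) (simp add: algebra_simps)

definition Qk :: "nat => real set" where "Qk k = {- real k..real k}"

lemma Qk: "Qk k \<in> sets borel" "emeasure lborel (Qk k) < \<infinity>" by (auto simp: Qk_def)

lemma Qk_ex: "\<exists>k. x \<in> Qk k"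
 using real_arch_simple[of "\<bar>x\<bar>"] by (auto simp: Qk_def abs_le_iff intro: exI) (metis minus_le_iff)

text \<open>\<open>h\<close> is only required to be integrable after cutting off in the last two variables and
 damping in the first two.\<close>

lemma gaussian_tests_zero:
 fixes h :: "r4 => complex"
 assumes i: "!!k. intg (%x. h x * (tp (gz 0) (gz 0) (fst x) * tp (indicator (Qk k)) (indicator (C k)) (snd x)))"
  and Cm: "!!k. C k \<in> sets borel" "!!k. emeasure lborel (C k) < \<infinity>"
  and z: "!!s r A B k. (\<i> * cr s, \<i> * cr r, A, B) \<in> I4 ==> A \<subseteq> Qk k ==> B \<subseteq> C k ==>
   (LB x. h x * cnj (e4 gz (\<i> * cr s, \<i> * cr r, A, B) x)) = 0"
  and C: "mono C"
 shows "AB x. ss x \<in> (\<Union>k. C k) --> h x = 0"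
proof -
 have "AB x. h x * (tp (gz 0) (gz 0) (fst x) * tp (indicator (Qk k)) (indicator (C k)) (snd x)) = 0" for k
 proof (rule L1_fourier_zero_rect[OF i])
  fix s r :: real and A B :: "real set" assume [measurable]: "A \<in> sets borel" "B \<in> sets borel"
  let ?z = "\<i> * cr (- s)" and ?w = "\<i> * cr (- r)"
  have I: "(?z, ?w, Qk k \<inter> A, C k \<inter> B) \<in> I4"
   by (rule inter_I4) (use Qk Cm in \<open>auto simp: I4_def\<close>)
  \<comment> \<open>Conjugating \<open>gz\<close> at an imaginary parameter produces
    \<open>gz 0\<close> times an exponential, and the cutoffs are absorbed into the sets; so a
    Fourier test of the damped function is one of the permitted tests of \<open>h\<close>.\<close>
  have eq: "h x * (tp (gz 0) (gz 0) (fst x) * tp (indicator (Qk k)) (indicator (C k)) (snd x)) * tp (tp (ex s) (ex r)) (tp (indicator A) (indicator B)) x =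
   h x * cnj (e4 gz (?z, ?w, Qk k \<inter> A, C k \<inter> B) x)" for x
   unfolding e4_def tp_def complex_cnj_mult gz_imag case_prod_conv by (simp add: indicator_def)
  show "(LB x. h x * (tp (gz 0) (gz 0) (fst x) * tp (indicator (Qk k)) (indicator (C k)) (snd x)) * tp (tp (ex s) (ex r)) (tp (indicator A) (indicator B)) x) = 0"
   unfolding eq by (rule z[OF I, of k]) auto
 qed
 then have "AB x. \<forall>k. h x * (tp (gz 0) (gz 0) (fst x) * tp (indicator (Qk k)) (indicator (C k)) (snd x)) = 0"
  unfolding AE_all_countable by blast
 then show ?thesis
 proof eventually_elim
  case (elim x)
  show ?case
  proof
   assume "ss x \<in> (\<Union>k. C k)"
   then obtain k1 where k1: "ss x \<in> C k1" by auto
   obtain k2 where k2: "fs x \<in> Qk k2" using Qk_ex by blast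
   have "ss x \<in> C (max k1 k2)" using k1 monoD[OF C, of k1 "max k1 k2"] by auto
   moreover have "fs x \<in> Qk (max k1 k2)" using k2 by (auto simp: Qk_def)
   ultimately show "h x = 0" using elim[rule_format, of "max k1 k2"] by (simp add: tp_def gz_def)
  qed
 qed
qed

lemma total_e4_gz: "total lborel (e4 gz) I4"
 unfolding total_def
proof (intro conjI ballI impI e4_L2s)
 fix f assume f: "f \<in> L2b" and z: "\<forall>i\<in>I4. innb f (e4 gz i) = 0"
 have "AB x. ss x \<in> (\<Union>k. Qk k) --> f x = 0"
 proof (rule gaussian_tests_zero)
  fix k
  have "tp (tp (gz 0) (gz 0)) (tp (indicator (Qk k)) (indicator (Qk k))) \<in> L2b"
   by (intro tp_L2s gz_L2s indicator_L2s Qk)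
  from L2s_integrable_mult[OF f this]
  show "intg (%x. f x * (tp (gz 0) (gz 0) (fst x) * tp (indicator (Qk k)) (indicator (Qk k)) (snd x)))"
   by (simp add: tp_def[of "tp _ _"])
 next
  show "mono Qk" by (auto simp: mono_def Qk_def)
 qed (use z Qk in \<open>auto simp: inn_def\<close>)
 then show "AB x. f x = 0"
  by (rule eventually_mono) (use Qk_ex in auto)
qed

lemma e4_gh: "e4 gh (z, w, A, B) = (%x. (exp (z\<^sup>2 / 2) * exp (w\<^sup>2 / 2)) * e4 gz (- \<i> * z, - \<i> * w, A, B) x)"
 by (auto simp: e4_def tp_def gh_def fun_eq_iff)

text \<open>Up to a nonzero factor \<open>gh z\<close> is \<open>gz (- \<i> * z)\<close>, so both
  families have the same annihilator.\<close>

lemma total_e4_gh: "total lborel (e4 gh) I4"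
 unfolding total_def
proof (intro conjI ballI impI e4_L2s)
 fix f assume f: "f \<in> L2b" and z: "\<forall>i\<in>I4. innb f (e4 gh i) = 0"
 have "innb f (e4 gz i) = 0" if i: "i \<in> I4" for i
 proof -
  obtain z' w' A B where i': "i = (z', w', A, B)" by (cases i)
  have "(\<i> * z', \<i> * w', A, B) \<in> I4" using i unfolding i' I4_def by simp
  then have "innb f (e4 gh (\<i> * z', \<i> * w', A, B)) = 0" using z by blast
  then show ?thesis unfolding e4_gh inn_scale_right i' by (simp add: mult.assoc[symmetric])
 qed
 then show "AB x. f x = 0" using total_e4_gz f unfolding total_def by blast
qed

section \<open>The operator \<open>U1\<close> and the relation \<open>FT\<close>\<close>

lemma mpiso_id: "mpiso (%x. x) (%x. x)"
 by (rule mpisoI) auto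

lemma rep_tens:
 assumes 1: "g1 \<in> BM" "AB x. f1 x = g1 x" and 2: "g2 \<in> BM" "AB x. f2 x = g2 x"
  and 3: "g3 \<in> BM" "AB x. f3 x = g3 x" and 4: "rep (%x. x) {0<..} f4 g4"
 shows "rep J CPi (tens f1 f2 f3 f4) (tp (tp g1 g3) (tp g2 g4))"
proof -
 have [measurable]: "g1 \<in> BM" "g2 \<in> BM" "g3 \<in> BM" "g4 \<in> BM"
  using 1 2 3 4 by (auto simp: rep_def)
 have a: "AE x in (lborel :: r4 measure). f1 (ff x) = g1 (ff x)" by (rule AE_lift_fst[OF AE_lift_fst[OF 1(2)]])
 have b: "AE x in (lborel :: r4 measure). f2 (fs x) = g2 (fs x)" by (rule AE_lift_snd[OF AE_lift_fst[OF 2(2)]])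
 have c: "AE x in (lborel :: r4 measure). f3 (sf x) = g3 (sf x)" by (rule AE_lift_fst[OF AE_lift_snd[OF 3(2)]])
 have "AB x. x \<in> {0<..} --> f4 x = g4 x" using 4 by (auto simp: rep_def)
 from AE_lift_snd[OF AE_lift_snd[OF this]] have d: "AE x in (lborel :: r4 measure). ss x \<in> {0<..} --> f4 (ss x) = g4 (ss x)" .
 have "AB x. J x \<in> CPi --> tens f1 f2 f3 f4 (J x) = tp (tp g1 g3) (tp g2 g4) x"
  using a b c d by eventually_elim (auto simp: J_CPi tens_def tp_def, auto simp: J_def)
 moreover have "J x \<notin> CPi ==> tp (tp g1 g3) (tp g2 g4) x = 0" for x using 4 by (auto simp: J_CPi tp_def rep_def)
 ultimately show ?thesis unfolding rep_def by auto
qed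

definition et :: "(complex => real => complex) => complex \<times> complex \<times> real set \<times> real set => complex \<times> complex => complex" where
 "et g i = (case i of (z, w, A, B) => tens (g z) (indicator A) (g w) (indicator B))"

text \<open>Intersecting the last set with the positive half-line gives the coordinate function the
  zero values off \<open>CPi\<close> that \<open>rep\<close> demands.\<close>

definition pos4 :: "complex \<times> complex \<times> real set \<times> real set => complex \<times> complex \<times> real set \<times> real set" where
 "pos4 i = (case i of (z, w, A, B) => (z, w, A, B \<inter> {0<..}))"

lemma pos4_I4: "i \<in> I4 ==> pos4 i \<in> I4"
 using inter_I4[of _ _ _ _ UNIV "{0<..}"] by (cases i) (auto simp: pos4_def)

lemma rep_et:
 assumes "i \<in> I4" and [measurable]: "!!z. g z \<in> BM"
 shows "rep J CPi (et g i) (e4 g (pos4 i))"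
proof -
 obtain z w A B where i: "i = (z, w, A, B)" by (cases i)
 have [measurable]: "A \<in> sets borel" "B \<in> sets borel" using assms i by (auto simp: I4_def)
 show ?thesis unfolding i et_def e4_def pos4_def prod.case
  by (rule rep_tens) (auto simp: rep_def indicator_def)
qed

lemma inn_pos4:
 assumes "i \<in> I4" "f \<in> BM" "!!x. J x \<notin> CPi ==> f x = 0"
 shows "innb f (e4 g (pos4 i)) = innb f (e4 g i)"
proof -
 obtain z w A B where i: "i = (z, w, A, B)" by (cases i)
 have "f x * cnj (e4 g (pos4 i) x) = f x * cnj (e4 g i x)" for x
  using assms(3)[of x] by (cases "0 < ss x") (auto simp: J_CPi i e4_def pos4_def tp_def indicator_def)
 then show ?thesis unfolding inn_def by presburger
qed

lemma inn_et:
 assumes "i \<in> I4" "rep J CPi f \<phi>" "!!z. g z \<in> BM"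
 shows "inn (lebesgue_on CPi) f (et g i) = innb \<phi> (e4 g i)"
 using rep_inn[OF mpiso_J CPi_borel assms(2) rep_et[OF assms(1,3)]] inn_pos4[OF assms(1), of \<phi> g] assms(2)
 by (auto simp: rep_def)

lemma total_et:
 assumes t: "total lborel (e4 g) I4" and g: "!!z. g z \<in> BM"
 shows "total (lebesgue_on CPi) (et g) I4"
 unfolding total_def
proof (intro conjI ballI impI)
 fix i assume i: "i \<in> I4"
 have "e4 g (pos4 i) \<in> L2b" using t pos4_I4[OF i] by (auto simp: total_def)
 then show "et g i \<in> L2s (lebesgue_on CPi)" by (subst rep_L2s_iff[OF mpiso_J CPi_borel rep_et[OF i g]])
next
 fix f assume f: "f \<in> L2s (lebesgue_on CPi)" and z: "\<forall>i\<in>I4. inn (lebesgue_on CPi) f (et g i) = 0"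
 obtain \<phi> where r: "rep J CPi f \<phi>" using rep_ex[OF mpiso_J CPi_borel] f by (auto simp: L2s_def)
 have "\<phi> \<in> L2b" using rep_L2s_iff[OF mpiso_J CPi_borel r] f by blast
 moreover have "\<forall>i\<in>I4. innb \<phi> (e4 g i) = 0" using z inn_et[OF _ r g] by auto
 ultimately have "AB x. \<phi> x = 0" using t unfolding total_def by blast
 then show "AE x in lebesgue_on CPi. f x = 0"
  using rep_AE_iff[OF mpiso_J CPi_borel r, of "%_. 0" "%_. 0"] by (auto simp: rep_def)
qed

lemma fourier_inn:
 assumes f: "f \<in> L2s lebesgue"
 shows "fourier_L2 f \<in> L2s lebesgue" "inn lebesgue (fourier_L2 f) (gh z) = inn lebesgue f (gz z)"
proof -
 have s: "unitary_map (L2 UNIV) (L2 UNIV) fourier_L2" using fourier_L2_spec by (simp add: fourier_spec_def)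
 then show F: "fourier_L2 f \<in> L2s lebesgue" using f by (auto simp: unitary_map_def L2_sel lebesgue_on_UNIV_eq)
 have g: "gz z \<in> L2s lebesgue" by (intro L2s_completion gz_L2s)
 have Fg: "fourier_L2 (gz z) \<in> L2s lebesgue" using s g by (auto simp: unitary_map_def L2_sel lebesgue_on_UNIV_eq)
 have "inn lebesgue (fourier_L2 f) (gh z) = inn lebesgue (fourier_L2 f) (fourier_L2 (gz z))"
  by (rule inn_cong_AE) (use F Fg fourier_L2_gz[of z] in \<open>auto simp: L2s_def intro!: measurable_completion\<close>)
 also have "... = inn lebesgue f (gz z)" using s f g by (auto simp: unitary_map_def L2_sel lebesgue_on_UNIV_eq)
 finally show "inn lebesgue (fourier_L2 f) (gh z) = inn lebesgue f (gz z)" .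
qed

lemma fourier_borel:
 assumes f: "f \<in> L2s lebesgue"
 shows "\<exists>g h. g \<in> L2b \<and> h \<in> L2b \<and> (AB x. f x = g x) \<and> (AB x. fourier_L2 f x = h x) \<and>
  (\<forall>z. innb h (gh z) = innb g (gz z))"
proof -
 obtain g where g: "g \<in> L2b" "AB x. f x = g x" using L2s_completion_borel[OF f] by blast
 obtain h where h: "h \<in> L2b" "AB x. fourier_L2 f x = h x" using L2s_completion_borel[OF fourier_inn(1)[OF f]] by blast
 have "innb h (gh z) = innb g (gz z)" for z
 proof -
  have "innb h (gh z) = inn lebesgue h (gh z)" using h by (subst inn_completion) (auto simp: L2s_def)
  also have "... = inn lebesgue (fourier_L2 f) (gh z)"
   by (rule inn_cong_AE) (use h fourier_inn(1)[OF f] AE_completion[OF h(2)] in \<open>auto simp: L2s_def intro!: measurable_completion\<close>)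
  also have "... = inn lebesgue f (gz z)" by (rule fourier_inn(2)[OF f])
  also have "... = inn lebesgue g (gz z)"
   by (rule inn_cong_AE) (use g f AE_completion[OF g(2)] in \<open>auto simp: L2s_def intro!: measurable_completion\<close>)
  also have "... = innb g (gz z)" using g by (subst inn_completion) (auto simp: L2s_def)
  finally show ?thesis .
 qed
 then show ?thesis using g h by blast
qed

definition U1_spec :: "((complex \<times> complex => complex) => (complex \<times> complex => complex)) => bool" where
 "U1_spec T \<longleftrightarrow> unitary_map (L2 CPi) (L2 CPi) T \<and>
  (\<forall>f1\<in>carr (L2 UNIV). \<forall>f2\<in>carr (L2 UNIV). \<forall>f3\<in>carr (L2 UNIV). \<forall>f4\<in>carr (L2 {0<..}).
    eqv (L2 CPi) (T (tens f1 f2 f3 f4)) (tens (fourier_L2 f1) f2 (fourier_L2 f3) f4))"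

text \<open>Satisfiability of the predicate under the choice in \<open>U1\<close>. Equal Gram
  matrices yield a unitary map; its action on an arbitrary elementary tensor is identified by
  pairing with the total family \<open>et gh\<close>, where the inner products factor into
  one-dimensional ones.\<close>

lemma ex_U1_spec: "\<exists>T. U1_spec T"
proof -
 let ?M = "lebesgue_on CPi"
 have tz: "total ?M (et gz) I4" and th: "total ?M (et gh) I4"
  by (intro total_et total_e4_gz total_e4_gh gz_measurable)+
 have gram: "inn ?M (et gh i) (et gh j) = inn ?M (et gz i) (et gz j)" if "i \<in> I4" "j \<in> I4" for i j
  unfolding rep_inn[OF mpiso_J CPi_borel rep_et[OF that(1), of gh] rep_et[OF that(2), of gh], OF gz_measurable(2) gz_measurable(2)]
   rep_inn[OF mpiso_J CPi_borel rep_et[OF that(1), of gz] rep_et[OF that(2), of gz], OF gz_measurable(1) gz_measurable(1)]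
  by (rule inn_e4; intro pos4_I4 that)
 have "\<exists>T. (\<forall>f\<in>L2s ?M. T f \<in> L2s ?M \<and> (\<forall>i\<in>I4. inn ?M (T f) (et gh i) = inn ?M f (et gz i))) \<and>
  (\<forall>f\<in>L2s ?M. \<forall>g\<in>L2s ?M. inn ?M (T f) (T g) = inn ?M f g) \<and>
  (\<forall>g\<in>L2s ?M. \<exists>f\<in>L2s ?M. AE x in ?M. T f x = g x)"
  by (rule unitary_extension[OF tz th gram])
 then obtain T where T: "\<forall>f\<in>L2s ?M. T f \<in> L2s ?M \<and> (\<forall>i\<in>I4. inn ?M (T f) (et gh i) = inn ?M f (et gz i))"
  "(\<forall>f\<in>L2s ?M. \<forall>g\<in>L2s ?M. inn ?M (T f) (T g) = inn ?M f g)"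
  "(\<forall>g\<in>L2s ?M. \<exists>f\<in>L2s ?M. AE x in ?M. T f x = g x)" by (elim exE conjE) (rule that)
 have "AE x in ?M. T (tens f1 f2 f3 f4) x = tens (fourier_L2 f1) f2 (fourier_L2 f3) f4 x"
  if f: "f1 \<in> L2s lebesgue" "f2 \<in> L2s lebesgue" "f3 \<in> L2s lebesgue" "f4 \<in> L2s (lebesgue_on {0<..})" for f1 f2 f3 f4
 proof -
  obtain g1 h1 where 1: "g1 \<in> L2b" "h1 \<in> L2b" "AB x. f1 x = g1 x" "AB x. fourier_L2 f1 x = h1 x"
   "!!z. innb h1 (gh z) = innb g1 (gz z)" using fourier_borel[OF f(1)] by (elim exE conjE) (rule that, auto)
  obtain g3 h3 where 3: "g3 \<in> L2b" "h3 \<in> L2b" "AB x. f3 x = g3 x" "AB x. fourier_L2 f3 x = h3 x"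
   "!!z. innb h3 (gh z) = innb g3 (gz z)" using fourier_borel[OF f(3)] by (elim exE conjE) (rule that, auto)
  obtain g2 where 2: "g2 \<in> L2b" "AB x. f2 x = g2 x" using L2s_completion_borel[OF f(2)] by blast
  obtain g4 where 4: "rep (%x. x) {0<..} f4 g4" using rep_ex[OF mpiso_id, of "{0<..}" f4] f(4) by (auto simp: L2s_def)
  have g4: "g4 \<in> L2b" using rep_L2s_iff[OF mpiso_id _ 4] f(4) by auto
  have r: "rep J CPi (tens f1 f2 f3 f4) (tp (tp g1 g3) (tp g2 g4))"
   by (rule rep_tens) (use 1 2 3 4 in \<open>auto simp: L2s_def\<close>)
  have r': "rep J CPi (tens (fourier_L2 f1) f2 (fourier_L2 f3) f4) (tp (tp h1 h3) (tp g2 g4))"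
   by (rule rep_tens) (use 1 2 3 4 in \<open>auto simp: L2s_def\<close>)
  have l: "tens f1 f2 f3 f4 \<in> L2s ?M" by (subst rep_L2s_iff[OF mpiso_J CPi_borel r]) (intro tp_L2s 1 2 3 g4)
  have l': "tens (fourier_L2 f1) f2 (fourier_L2 f3) f4 \<in> L2s ?M" by (subst rep_L2s_iff[OF mpiso_J CPi_borel r']) (intro tp_L2s 1 2 3 g4)
  show ?thesis
  proof (rule total_eqI[OF th _ l'])
   show "T (tens f1 f2 f3 f4) \<in> L2s ?M" using T(1) l by blast
   fix i assume i: "i \<in> I4"
   obtain z w A B where i': "i = (z, w, A, B)" by (cases i)
   have AB: "indicator A \<in> L2b" "indicator B \<in> L2b" using i unfolding i' I4_def by (auto intro: indicator_L2s)
   have "inn ?M (T (tens f1 f2 f3 f4)) (et gh i) = inn ?M (tens f1 f2 f3 f4) (et gz i)" using T(1) l i by blast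
   also have "... = innb (tp (tp g1 g3) (tp g2 g4)) (e4 gz i)" by (rule inn_et[OF i r gz_measurable(1)])
   also have "... = innb (tp (tp h1 h3) (tp g2 g4)) (e4 gh i)"
    unfolding i' e4_def prod.case by (simp add: inn_tp tp_L2s 1 2 3 g4 AB gz_L2s gh_L2s)
   also have "... = inn ?M (tens (fourier_L2 f1) f2 (fourier_L2 f3) f4) (et gh i)" by (rule inn_et[OF i r' gz_measurable(2), symmetric])
   finally show "inn ?M (T (tens f1 f2 f3 f4)) (et gh i) = inn ?M (tens (fourier_L2 f1) f2 (fourier_L2 f3) f4) (et gh i)" .
  qed
 qed
 then have "U1_spec T" unfolding U1_spec_def unitary_map_def L2_sel lebesgue_on_UNIV_eq using T by blast
 then show ?thesis by blast
qed

lemma U1_spec: "U1_spec U1"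
 using someI_ex[OF ex_U1_spec] unfolding U1_def tens_op_def U1_spec_def by blast

text \<open>\<open>\<Phi>\<close> is the partial Fourier transform of \<open>\<phi>\<close> in the
  variables u. As a relation between pairings it is independent of the choice made in
  \<open>U1\<close>, and it makes sense on the whole coordinate space, not just on v2 > 0.\<close>

definition FT :: "(r4 => complex) => (r4 => complex) => bool" where
 "FT \<phi> \<Phi> \<longleftrightarrow> (\<forall>i\<in>I4. innb \<phi> (e4 gz i) = innb \<Phi> (e4 gh i))"

lemma U1_unitary: "f \<in> L2s (lebesgue_on CPi) ==> U1 f \<in> L2s (lebesgue_on CPi)"
 "f \<in> L2s (lebesgue_on CPi) ==> g \<in> L2s (lebesgue_on CPi) ==> inn (lebesgue_on CPi) (U1 f) (U1 g) = inn (lebesgue_on CPi) f g"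
 "g \<in> L2s (lebesgue_on CPi) ==> \<exists>f\<in>L2s (lebesgue_on CPi). AE x in lebesgue_on CPi. U1 f x = g x"
 using U1_spec unfolding U1_spec_def unitary_map_def L2_sel by blast+

lemma U1_FT:
 assumes f: "f \<in> L2s (lebesgue_on CPi)" and r: "rep J CPi f \<phi>" and r': "rep J CPi (U1 f) \<Phi>"
 shows "FT \<phi> \<Phi>"
 unfolding FT_def
proof
 fix i assume i: "i \<in> I4"
 obtain z w A B where i': "i = (z, w, A, B)" by (cases i)
 have AB[measurable]: "A \<in> sets borel" "B \<in> sets borel" and AB2: "indicator A \<in> L2b" "indicator B \<in> L2b"
  using i unfolding i' I4_def by (auto intro: indicator_L2s)
 have e: "et gz i \<in> L2s (lebesgue_on CPi)" "et gh i \<in> L2s (lebesgue_on CPi)"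
  using total_et[OF total_e4_gz gz_measurable(1)] total_et[OF total_e4_gh gz_measurable(2)] i by (auto simp: total_def)
 have rB: "rep (%x. x) {0<..} (indicator B) (indicator (B \<inter> {0<..}))" by (auto simp: rep_def indicator_def)
 have "indicator (B \<inter> {0<..}) \<in> L2b"
  using pos4_I4[OF i] unfolding i' pos4_def I4_def by (auto intro: indicator_L2s)
 then have B: "indicator B \<in> carr (L2 {0<..})" unfolding L2_sel by (subst rep_L2s_iff[OF mpiso_id _ rB]) auto
 have A: "indicator A \<in> carr (L2 UNIV)" "gz z \<in> carr (L2 UNIV)" "gz w \<in> carr (L2 UNIV)"
  unfolding L2_sel lebesgue_on_UNIV_eq by (intro L2s_completion AB2 gz_L2s)+
 have a1: "AE x in lebesgue_on CPi. U1 (et gz i) x = tens (fourier_L2 (gz z)) (indicator A) (fourier_L2 (gz w)) (indicator B) x"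
  using U1_spec A B unfolding U1_spec_def i' et_def prod.case L2_sel(3) by blast
 have g: "AB x. fourier_L2 (gz z) x = gh z x" for z
  using fourier_L2_gz[of z] by (simp add: AE_completion_iff)
 have r1: "rep J CPi (tens (fourier_L2 (gz z)) (indicator A) (fourier_L2 (gz w)) (indicator B)) (e4 gh (pos4 i))"
  unfolding i' pos4_def e4_def prod.case by (rule rep_tens) (use g rB in auto)
 have a2: "AE x in lebesgue_on CPi. tens (fourier_L2 (gz z)) (indicator A) (fourier_L2 (gz w)) (indicator B) x = et gh i x"
  using rep_AE_iff[OF mpiso_J CPi_borel r1 rep_et[OF i gz_measurable(2)]] by auto
 have "innb \<phi> (e4 gz i) = inn (lebesgue_on CPi) f (et gz i)" by (rule inn_et[OF i r gz_measurable(1), symmetric])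
 also have "... = inn (lebesgue_on CPi) (U1 f) (U1 (et gz i))" by (rule U1_unitary(2)[OF f e(1), symmetric])
 also have "... = inn (lebesgue_on CPi) (U1 f) (et gh i)"
 proof (rule inn_cong_AE)
  show "AE x in lebesgue_on CPi. U1 (et gz i) x = et gh i x" using a1 a2 by eventually_elim simp
 qed (use U1_unitary(1)[OF f] U1_unitary(1)[OF e(1)] e(2) in \<open>auto simp: L2s_def\<close>)
 also have "... = innb \<Phi> (e4 gh i)" by (rule inn_et[OF i r' gz_measurable(2)])
 finally show "innb \<phi> (e4 gz i) = innb \<Phi> (e4 gh i)" .
qed

text \<open>The transform does not act on v: shrinking the sets in a test shows that the pairings of
  both sides agree over every rectangle in v, and \<open>slice_zero\<close> then admits any bounded
  Borel factor in v. This is how a nilpotent symbol passes through \<open>U1\<close>.\<close>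

lemma FT_mult:
 assumes \<phi>: "\<phi> \<in> L2b" and \<Phi>: "\<Phi> \<in> L2b" and FT: "FT \<phi> \<Phi>"
  and c[measurable]: "c \<in> BM" and cb: "!!v. cmod (c v) \<le> C"
 shows "FT (%x. c (snd x) * \<phi> x) (%x. c (snd x) * \<Phi> x)"
 unfolding FT_def
proof
 fix i assume i: "i \<in> I4"
 obtain z w A B where i': "i = (z, w, A, B)" by (cases i)
 have AB[measurable]: "A \<in> sets borel" "B \<in> sets borel" using i unfolding i' I4_def by auto
 have [measurable]: "\<phi> \<in> BM" "\<Phi> \<in> BM" using \<phi> \<Phi> by (auto simp: L2s_def)
 have i1: "intg (%x. \<phi> x * cnj (e4 gz i x))" by (rule L2s_integrable_inn[OF \<phi> e4_L2s(1)[OF i]])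
 have i2: "intg (%x. \<Phi> x * cnj (e4 gh i x))" by (rule L2s_integrable_inn[OF \<Phi> e4_L2s(2)[OF i]])
 let ?k = "%x. \<phi> x * cnj (e4 gz i x) - \<Phi> x * cnj (e4 gh i x)"
 have "(LB x. ?k x * c (snd x)) = 0"
 proof (rule slice_zero[where C = C])
  show "intg ?k" by (intro integrable_diff_B i1 i2)
  fix A' B' :: "real set" assume [measurable]: "A' \<in> sets borel" "B' \<in> sets borel"
  have j: "(z, w, A \<inter> A', B \<inter> B') \<in> I4" (is "?j \<in> _") by (rule inter_I4) (use i i' in auto)
  have "?k x * tp (indicator A') (indicator B') (snd x) = \<phi> x * cnj (e4 gz ?j x) - \<Phi> x * cnj (e4 gh ?j x)" for x
   by (auto simp: i' e4_def tp_def indicator_def)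
  then have "(LB x. ?k x * tp (indicator A') (indicator B') (snd x)) = innb \<phi> (e4 gz ?j) - innb \<Phi> (e4 gh ?j)"
   unfolding inn_def
   using int_diff[OF L2s_integrable_inn[OF \<phi> e4_L2s(1)[OF j]] L2s_integrable_inn[OF \<Phi> e4_L2s(2)[OF j]]]
   by presburger
  also have "... = 0" using FT j by (simp add: FT_def)
  finally show "(LB x. ?k x * tp (indicator A') (indicator B') (snd x)) = 0" .
 qed (use cb in auto)
 moreover have "(LB x. ?k x * c (snd x)) = innb (%x. c (snd x) * \<phi> x) (e4 gz i) - innb (%x. c (snd x) * \<Phi> x) (e4 gh i)"
 proof -
  have j1: "intg (%x. \<phi> x * cnj (e4 gz i x) * c (snd x))" by (rule integrable_bounded_mult[OF i1 _ cb]) simp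
  have j2: "intg (%x. \<Phi> x * cnj (e4 gh i x) * c (snd x))" by (rule integrable_bounded_mult[OF i2 _ cb]) simp
  have "(LB x. ?k x * c (snd x)) = (LB x. \<phi> x * cnj (e4 gz i x) * c (snd x)) - (LB x. \<Phi> x * cnj (e4 gh i x) * c (snd x))"
   unfolding left_diff_distrib by (rule int_diff[OF j1 j2])
  then show ?thesis unfolding inn_def by (simp add: mult_ac)
 qed
 ultimately show "innb (%x. c (snd x) * \<phi> x) (e4 gz i) = innb (%x. c (snd x) * \<Phi> x) (e4 gh i)" by simp
qed

lemma FT_unique:
 assumes "\<phi> \<in> L2b" "\<Phi> \<in> L2b" "\<Phi>' \<in> L2b" "FT \<phi> \<Phi>" "FT \<phi> \<Phi>'"
 shows "AB x. \<Phi> x = \<Phi>' x"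
 by (rule total_eqI[OF total_e4_gh assms(2,3)]) (use assms(4,5) in \<open>auto simp: FT_def\<close>)

text \<open>A unitary operator realising the relation on the whole coordinate space; Parseval and
  surjectivity are transferred from it by uniqueness.\<close>

lemma FT_T: "\<exists>T. (\<forall>f\<in>L2b. T f \<in> L2b \<and> (\<forall>i\<in>I4. innb (T f) (e4 gh i) = innb f (e4 gz i))) \<and>
  (\<forall>f\<in>L2b. \<forall>g\<in>L2b. innb (T f) (T g) = innb f g) \<and>
  (\<forall>g\<in>L2b. \<exists>f\<in>L2b. AB x. T f x = g x)"
 by (rule unitary_extension[OF total_e4_gz total_e4_gh inn_e4])

lemma FT_iso:
 assumes "\<phi> \<in> L2b" "\<Phi> \<in> L2b" "FT \<phi> \<Phi>" "\<phi>' \<in> L2b" "\<Phi>' \<in> L2b" "FT \<phi>' \<Phi>'"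
 shows "innb \<Phi> \<Phi>' = innb \<phi> \<phi>'"
proof -
 obtain T where T: "\<forall>f\<in>L2b. T f \<in> L2b \<and> (\<forall>i\<in>I4. innb (T f) (e4 gh i) = innb f (e4 gz i))"
  "\<forall>f\<in>L2b. \<forall>g\<in>L2b. innb (T f) (T g) = innb f g" using FT_T by (elim exE conjE) (rule that)
 have "AB x. T \<phi> x = \<Phi> x" by (rule FT_unique[of \<phi>]) (use T assms in \<open>auto simp: FT_def\<close>)
 moreover have "AB x. T \<phi>' x = \<Phi>' x" by (rule FT_unique[of \<phi>']) (use T assms in \<open>auto simp: FT_def\<close>)
 moreover have "T \<phi> \<in> L2b" "T \<phi>' \<in> L2b" using T(1) assms by auto
 ultimately have "innb (T \<phi>) (T \<phi>') = innb \<Phi> \<Phi>'"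
  using assms(2,5) by (intro inn_cong_AE) (auto dest!: L2sD(1))
 then show ?thesis using T(2) assms by simp
qed

lemma FT_surj:
 assumes \<Phi>: "\<Phi> \<in> L2b" shows "\<exists>\<phi>\<in>L2b. FT \<phi> \<Phi>"
proof -
 obtain T where T: "\<forall>f\<in>L2b. T f \<in> L2b \<and> (\<forall>i\<in>I4. innb (T f) (e4 gh i) = innb f (e4 gz i))"
  "\<forall>g\<in>L2b. \<exists>f\<in>L2b. AB x. T f x = g x" using FT_T by (elim exE conjE) (rule that)
 obtain \<phi> where \<phi>: "\<phi> \<in> L2b" "AB x. T \<phi> x = \<Phi> x" using T(2) \<Phi> by blast
 have "T \<phi> \<in> L2b" using T(1) \<phi> by auto
 then have "innb (T \<phi>) (e4 gh i) = innb \<Phi> (e4 gh i)" if "i \<in> I4" for i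
  using \<phi>(2) \<Phi> e4_L2s(2)[OF that] by (intro inn_cong_AE) (auto dest!: L2sD(1))
 then have "FT \<phi> \<Phi>" using T(1) \<phi>(1) by (auto simp: FT_def)
 with \<phi>(1) show ?thesis by blast
qed

section \<open>Pointwise inversion of the partial Fourier transform\<close>

definition Ck :: "nat => real set" where "Ck k = {1 / real (Suc k)..real k}"

lemma Ck: "Ck k \<in> sets borel" "emeasure lborel (Ck k) < \<infinity>" "mono Ck" "(\<Union>k. Ck k) = {0<..}"
proof -
 show "mono Ck"
 proof (rule monoI)
  fix a b :: nat assume "a \<le> b"
  then have "1 / real (Suc b) \<le> 1 / real (Suc a)" by (intro divide_left_mono) auto
  with \<open>a \<le> b\<close> show "Ck a \<le> Ck b" unfolding Ck_def by auto
 qed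
 show "(\<Union>k. Ck k) = {0<..}"
 proof (intro equalityI subsetI)
  fix x assume "x \<in> (\<Union>k. Ck k)"
  then obtain k where "1 / real (Suc k) \<le> x" by (auto simp: Ck_def)
  moreover have "0 < 1 / real (Suc k)" by simp
  ultimately have "0 < x" by (rule less_le_trans[rotated])
  then show "x \<in> {0<..}" by simp
 next
  fix x :: real assume x: "x \<in> {0<..}"
  obtain k1 where k1: "inverse (real (Suc k1)) < x" using reals_Archimedean[of x] x by auto
  obtain k2 where k2: "x \<le> real k2" using real_arch_simple by blast
  have "1 / real (Suc (max k1 k2)) \<le> 1 / real (Suc k1)" by (intro divide_left_mono) auto
  then have "x \<in> Ck (max k1 k2)" using k1 k2 by (auto simp: Ck_def inverse_eq_divide)
  then show "x \<in> (\<Union>k. Ck k)" by blast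
 qed
qed (auto simp: Ck_def emeasure_lborel_Icc_eq)

lemma gz_inverse_fourier:
 "intg (%u. exp (\<i> * cr (\<xi> * u)) * cnj (gz z u))"
 "(LB u. exp (\<i> * cr (\<xi> * u)) * cnj (gz z u)) = cr (sqrt (2 * pi)) * cnj (gh z \<xi>)"
proof -
 have e: "exp (\<i> * cr (\<xi> * u)) * cnj (gz z u) = cnj (gz (z - \<i> * \<xi>) u)" for u
  unfolding gz_def exp_cnj exp_add[symmetric] by (intro arg_cong[where f = exp]) (simp add: algebra_simps)
 show "intg (%u. exp (\<i> * cr (\<xi> * u)) * cnj (gz z u))" unfolding e by (simp add: gz_integral)
 have "(LB u. cnj (gz (z - \<i> * \<xi>) u)) = cnj (cr (sqrt (2 * pi)) * exp ((z - \<i> * \<xi>)\<^sup>2 / 2))"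
  by (subst int_cnj) (simp add: gz_integral)
 also have "exp ((z - \<i> * \<xi>)\<^sup>2 / 2) = gh z \<xi>"
  unfolding gh_def gz_def exp_add[symmetric] by (intro arg_cong[where f = exp]) (simp add: power2_eq_square field_simps)
 finally show "(LB u. exp (\<i> * cr (\<xi> * u)) * cnj (gz z u)) = cr (sqrt (2 * pi)) * cnj (gh z \<xi>)"
  unfolding e by simp
qed

definition ker :: "real \<times> real => real \<times> real => complex" where
 "ker \<xi> u = exp (\<i> * cr (fst \<xi> * fst u)) * exp (\<i> * cr (snd \<xi> * snd u))"

lemma ker_norm: "cmod (ker \<xi> u) = 1" by (simp add: ker_def norm_mult norm_exp_eq_Re)

lemma ker_measurable[measurable]: "(%x. ker (fst x) (snd x)) \<in> BM"
 unfolding ker_def by (intro borel_measurable_continuous_onI continuous_intros)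

lemma ker_measurable'[measurable (raw)]:
 assumes [measurable]: "f \<in> borel_measurable M" "g \<in> borel_measurable M"
 shows "(%x. ker (f x) (g x)) \<in> borel_measurable M"
 using measurable_compose[of "%x. (f x, g x)" M borel "%x. ker (fst x) (snd x)" borel] by simp

lemma ker_tp_gz:
 "intg (%u. ker \<xi> u * cnj (tp (gz z) (gz w) u))"
 "(LB u. ker \<xi> u * cnj (tp (gz z) (gz w) u)) = cr (2 * pi) * cnj (tp (gh z) (gh w) \<xi>)"
proof -
 have e: "ker \<xi> u * cnj (tp (gz z) (gz w) u) =
  tp (%u. exp (\<i> * cr (fst \<xi> * u)) * cnj (gz z u)) (%u. exp (\<i> * cr (snd \<xi> * u)) * cnj (gz w u)) u" for u
  by (simp add: ker_def tp_def)
 show "intg (%u. ker \<xi> u * cnj (tp (gz z) (gz w) u))" unfolding e by (intro tp_integral gz_inverse_fourier)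
 have "cr (sqrt (2 * pi)) * cr (sqrt (2 * pi)) = cr (2 * pi)" by (simp flip: of_real_mult)
 then show "(LB u. ker \<xi> u * cnj (tp (gz z) (gz w) u)) = cr (2 * pi) * cnj (tp (gh z) (gh w) \<xi>)"
  unfolding e tp_integral(2)[OF gz_inverse_fourier(1) gz_inverse_fourier(1)] gz_inverse_fourier(2)
  by (simp add: tp_def mult_ac)
qed

text \<open>For a non-integrable \<open>f\<close> the integral is 0 by convention, so the bound is
  unconditional; this allows estimating \<open>ift\<close> before its integrals are known to
  converge.\<close>

lemma norm_integral_le_nn:
 fixes f :: "'a => complex"
 shows "ennreal (cmod (LINT x|M. f x)) \<le> (\<integral>\<^sup>+x. ennreal (cmod (f x)) \<partial>M)"
 by (cases "integrable M f") (auto simp: not_integrable_integral_eq intro: integral_norm_bound_ennreal)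

definition ift :: "(r4 => complex) => r4 => complex" where
 "ift \<Phi> x = cr (1 / (2 * pi)) * (LB \<xi>. \<Phi> (\<xi>, snd x) * ker \<xi> (fst x))"

lemma ift_measurable[measurable]:
 assumes [measurable]: "\<Phi> \<in> BM"
 shows "ift \<Phi> \<in> BM"
proof -
 have [measurable]: "(%p. \<Phi> (snd p, sf p) * ker (snd p) (ff p)) \<in> borel_measurable (lborel \<Otimes>\<^sub>M (lborel :: (real \<times> real) measure))"
  unfolding lborel_prod by measurable
 have "(%x::r4. LB \<xi>. \<Phi> (\<xi>, snd x) * ker \<xi> (fst x)) \<in> borel_measurable lborel"
  by (rule lborel.borel_measurable_lebesgue_integral) (simp add: case_prod_beta')
 then show ?thesis unfolding ift_def[abs_def] by simp
qed

text \<open>Fubini moves the inverse kernel from \<open>\<Phi>\<close> to the Gaussian. The kernel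
  has modulus 1, so joint integrability reduces to that of the Gaussian in u and of
  \<open>\<Phi>\<close> over the region selected by \<open>b\<close>.\<close>

lemma ift_tests:
 assumes [measurable]: "\<Phi> \<in> BM" "b \<in> BM"
  and slab: "intg (%x. \<Phi> x * b (snd x))"
 shows "intg (%x. ift \<Phi> x * (cnj (tp (gz z) (gz w) (fst x)) * b (snd x)))"
  "(LB x. ift \<Phi> x * (cnj (tp (gz z) (gz w) (fst x)) * b (snd x))) =
  (LB x. \<Phi> x * (cnj (tp (gh z) (gh w) (fst x)) * b (snd x)))"
proof -
 define g where "g = tp (gz z) (gz w)"
 have gi: "intg g" unfolding g_def by (intro tp_integral gz_integral)
 then have [measurable]: "g \<in> BM" by auto
 define a where "a = cr (1 / (2 * pi))"
 define k where "k u y = a * (\<Phi> y * b (snd y) * (ker (fst y) u * cnj (g u)))" for u and y :: r4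
 have km[measurable]: "(%p. k (fst p) (snd p)) \<in> BM" unfolding k_def by measurable
 have ik: "integrable (lborel \<Otimes>\<^sub>M lborel) (%p. k (fst p) (snd p))"
 proof -
  have "intg (tp (%u. cnj (g u)) (%x. \<Phi> x * b (snd x)))"
   by (rule tp_integral(1)) (use gi slab in auto)
  then have "intg (%p. a * (tp (%u. cnj (g u)) (%x. \<Phi> x * b (snd x)) p * ker (fs p) (fst p)))"
   by (intro integrable_mult_right integrable_bounded_mult[where C = 1]) (auto simp: ker_norm)
  then show ?thesis by (simp add: k_def tp_def lborel_prod mult_ac)
 qed
 have ika: "AB u. intg (k u)"
  using lborel_pair.AE_integrable_fst'[OF ik] by simp
 have iy: "(LB y. k u y) = (LB v. ift \<Phi> (u, v) * (cnj (g u) * b v))" "intg (%v. ift \<Phi> (u, v) * (cnj (g u) * b v))"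
  if i: "intg (k u)" for u
 proof -
  have i': "integrable (lborel \<Otimes>\<^sub>M lborel) (%(\<xi>, v). k u (\<xi>, v))" using i by (simp add: lborel_prod)
  have e: "(LB \<xi>. k u (\<xi>, v)) = ift \<Phi> (u, v) * (cnj (g u) * b v)" for v
  proof -
   have "(LB \<xi>. k u (\<xi>, v)) = (LB \<xi>. a * (\<Phi> (\<xi>, v) * ker \<xi> u) * (cnj (g u) * b v))"
    unfolding k_def by (simp add: mult_ac)
   then show ?thesis unfolding ift_def a_def[symmetric] by simp
  qed
  show "(LB y. k u y) = (LB v. ift \<Phi> (u, v) * (cnj (g u) * b v))"
   using lborel_pair.integral_snd[OF i'] unfolding e by (simp add: lborel_prod)
  show "intg (%v. ift \<Phi> (u, v) * (cnj (g u) * b v))"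
   using lborel_pair.integrable_snd[OF i'] unfolding e .
 qed
 have nb: "(NN x. ennreal (cmod (ift \<Phi> x * (cnj (g (fst x)) * b (snd x))))) \<le> (\<integral>\<^sup>+p. ennreal (cmod (k (fst p) (snd p))) \<partial>(lborel \<Otimes>\<^sub>M lborel))"
 proof -
  have "(NN x. ennreal (cmod (ift \<Phi> x * (cnj (g (fst x)) * b (snd x))))) =
   (NN u. NN v. ennreal (cmod (ift \<Phi> (u, v) * (cnj (g u) * b v))))"
   by (subst lborel_prod[symmetric], subst lborel.nn_integral_fst[symmetric]) (auto simp: lborel_prod)
  also have "... \<le> (NN u. NN y. ennreal (cmod (k u y)))"
  proof (rule nn_integral_mono_AE, use ika in eventually_elim)
   fix u assume i: "intg (k u)"
   have m: "k u \<in> BM" using i by auto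
   have e: "ift \<Phi> (u, v) * (cnj (g u) * b v) = (LB \<xi>. k u (\<xi>, v))" for v
   proof -
    have "(LB \<xi>. k u (\<xi>, v)) = (LB \<xi>. a * (\<Phi> (\<xi>, v) * ker \<xi> u) * (cnj (g u) * b v))"
     unfolding k_def by (simp add: mult_ac)
    then show ?thesis unfolding ift_def a_def[symmetric] by simp
   qed
   have "(NN v. ennreal (cmod (ift \<Phi> (u, v) * (cnj (g u) * b v)))) \<le> (NN v. NN \<xi>. ennreal (cmod (k u (\<xi>, v))))"
    unfolding e by (intro nn_integral_mono norm_integral_le_nn)
   also have "... = (NN y. ennreal (cmod (k u y)))"
    using m by (subst lborel_pair.nn_integral_snd) (auto simp: case_prod_beta' lborel_prod)
   finally show "(NN v. ennreal (cmod (ift \<Phi> (u, v) * (cnj (g u) * b v)))) \<le> (NN y. ennreal (cmod (k u y)))" .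
  qed
  also have "... = (\<integral>\<^sup>+p. ennreal (cmod (k (fst p) (snd p))) \<partial>(lborel \<Otimes>\<^sub>M lborel))"
   by (subst lborel.nn_integral_fst[symmetric]) (auto simp: lborel_prod)
  finally show ?thesis .
 qed
 have "intg (%x. ift \<Phi> x * (cnj (g (fst x)) * b (snd x)))"
  unfolding integrable_iff_bounded
 proof
  show "(NN x. ennreal (cmod (ift \<Phi> x * (cnj (g (fst x)) * b (snd x))))) < \<infinity>"
   using nb ik unfolding integrable_iff_bounded by (auto intro: le_less_trans)
 qed measurable
 then show int: "intg (%x. ift \<Phi> x * (cnj (tp (gz z) (gz w) (fst x)) * b (snd x)))" unfolding g_def .
 have "(LB x. ift \<Phi> x * (cnj (g (fst x)) * b (snd x))) = (LB u. LB v. ift \<Phi> (u, v) * (cnj (g u) * b v))"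
  using lborel_pair.integral_fst'[of "%x. ift \<Phi> x * (cnj (g (fst x)) * b (snd x))"] int by (simp add: lborel_prod g_def)
 also have "... = (LB u. LB y. k u y)"
 proof (rule integral_cong_AE)
  show "AB u. (LB v. ift \<Phi> (u, v) * (cnj (g u) * b v)) = (LB y. k u y)"
   using ika by eventually_elim (simp add: iy)
  show "(%u. LB v. ift \<Phi> (u, v) * (cnj (g u) * b v)) \<in> borel_measurable lborel"
   by (rule lborel.borel_measurable_lebesgue_integral) (simp add: case_prod_beta' lborel_prod)
  show "(%u. LB y. k u y) \<in> borel_measurable lborel"
   by (rule lborel.borel_measurable_lebesgue_integral) (simp add: case_prod_beta' lborel_prod)
 qed
 also have "... = (LB y. LB u. k u y)"
  by (rule lborel_pair.Fubini_integral[symmetric]) (use ik in \<open>simp add: case_prod_beta'\<close>)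
 also have "... = (LB y. \<Phi> y * (cnj (tp (gh z) (gh w) (fst y)) * b (snd y)))"
 proof (intro int_cong refl)
  fix y :: r4
  have "(LB u. k u y) = a * (\<Phi> y * b (snd y) * (LB u. ker (fst y) u * cnj (g u)))"
   unfolding k_def by simp
  also have "(LB u. ker (fst y) u * cnj (g u)) = cr (2 * pi) * cnj (tp (gh z) (gh w) (fst y))"
   unfolding g_def by (rule ker_tp_gz(2))
  finally show "(LB u. k u y) = \<Phi> y * (cnj (tp (gh z) (gh w) (fst y)) * b (snd y))"
   by (simp add: a_def)
 qed
 finally show "(LB x. ift \<Phi> x * (cnj (tp (gz z) (gz w) (fst x)) * b (snd x))) =
  (LB x. \<Phi> x * (cnj (tp (gh z) (gh w) (fst x)) * b (snd x)))" unfolding g_def .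
qed

text \<open>The tests that identify \<open>\<phi>\<close> are supported in compact pieces of the
  half-plane of v. Integrability of \<open>\<Phi>\<close> over the corresponding slabs therefore
  replaces integrability over the whole space, which does not follow from square
  integrability.\<close>

lemma FT_inverse:
 assumes \<phi>: "\<phi> \<in> L2b" and \<Phi>: "\<Phi> \<in> L2b" and FT: "FT \<phi> \<Phi>"
  and slab: "!!k. intg (%x. \<Phi> x * tp (indicator (Qk k)) (indicator (Ck k)) (snd x))"
 shows "AB x. 0 < ss x --> \<phi> x = ift \<Phi> x"
proof -
 have [measurable]: "\<phi> \<in> BM" "\<Phi> \<in> BM" using \<phi> \<Phi> by (auto simp: L2s_def)
 have [measurable]: "Qk k \<in> sets borel" "Ck k \<in> sets borel" for k using Qk Ck by auto
 have "AB x. ss x \<in> (\<Union>k. Ck k) --> \<phi> x - ift \<Phi> x = 0"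
 proof (rule gaussian_tests_zero[OF _ Ck(1,2) _ Ck(3)])
  fix k
  have "tp (tp (gz 0) (gz 0)) (tp (indicator (Qk k)) (indicator (Ck k))) \<in> L2b"
   by (intro tp_L2s gz_L2s indicator_L2s Qk Ck)
  from L2s_integrable_mult[OF \<phi> this]
  have 1: "intg (%x. \<phi> x * (tp (gz 0) (gz 0) (fst x) * tp (indicator (Qk k)) (indicator (Ck k)) (snd x)))"
   by (simp add: tp_def[of "tp _ _"])
  have 2: "intg (%x. ift \<Phi> x * (tp (gz 0) (gz 0) (fst x) * tp (indicator (Qk k)) (indicator (Ck k)) (snd x)))"
   using ift_tests(1)[OF _ _ slab[of k], of 0 0] by (simp add: tp_def gz_def exp_cnj)
  show "intg (%x. (\<phi> x - ift \<Phi> x) * (tp (gz 0) (gz 0) (fst x) * tp (indicator (Qk k)) (indicator (Ck k)) (snd x)))"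
   unfolding left_diff_distrib by (rule integrable_diff_B[OF 1 2])
 next
  fix s r and A B :: "real set" and k
  let ?i = "(\<i> * cr s, \<i> * cr r, A, B)"
  assume i: "?i \<in> I4" and sub: "A \<subseteq> Qk k" "B \<subseteq> Ck k"
  have [measurable]: "A \<in> sets borel" "B \<in> sets borel" using i by (auto simp: I4_def)
  have "intg (%x. \<Phi> x * tp (indicator (Qk k)) (indicator (Ck k)) (snd x) * tp (indicator A) (indicator B) (snd x))"
   by (rule integrable_bounded_mult[OF slab, where C = 1]) (auto simp: tp_def indicator_def)
  moreover have "\<Phi> x * tp (indicator (Qk k)) (indicator (Ck k)) (snd x) * tp (indicator A) (indicator B) (snd x) = \<Phi> x * tp (indicator A) (indicator B) (snd x)" for x
   using sub by (auto simp: tp_def indicator_def)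
  ultimately have sl: "intg (%x. \<Phi> x * tp (indicator A) (indicator B) (snd x))" by simp
  have e: "cnj (e4 g ?i x) = cnj (tp (g (\<i> * cr s)) (g (\<i> * cr r)) (fst x)) * tp (indicator A) (indicator B) (snd x)" for x g
   by (auto simp: e4_def tp_def indicator_def)
  have "(LB x. (\<phi> x - ift \<Phi> x) * cnj (e4 gz ?i x)) = innb \<phi> (e4 gz ?i) - (LB x. ift \<Phi> x * cnj (e4 gz ?i x))"
   unfolding left_diff_distrib inn_def
   by (rule int_diff[OF L2s_integrable_inn[OF \<phi> e4_L2s(1)[OF i]]])
    (unfold e, rule ift_tests(1)[OF _ _ sl], auto)
  also have "(LB x. ift \<Phi> x * cnj (e4 gz ?i x)) = innb \<Phi> (e4 gh ?i)"
   unfolding inn_def e by (rule ift_tests(2)[OF _ _ sl]) auto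
  also have "innb \<phi> (e4 gz ?i) = innb \<Phi> (e4 gh ?i)" using FT i by (simp add: FT_def)
  finally show "(LB x. (\<phi> x - ift \<Phi> x) * cnj (e4 gz ?i x)) = 0" by simp
 qed
 then show ?thesis unfolding Ck(4) by (rule eventually_mono) auto
qed

section \<open>Laguerre polynomials by Rodrigues' formula\<close>

definition lagD :: "real poly => real poly" where "lagD p = pderiv p - p"
definition Lag :: "nat => real poly" where "Lag m = smult (1 / fact m) ((lagD ^^ m) (monom 1 m))"

text \<open>The factor exp(-t) conjugates differentiation into \<open>lagD\<close>, so Rodrigues'
  formula becomes an iteration on polynomials.\<close>

lemma deriv_exp_poly: "deriv (%t. exp (- t) * poly p t) = (%t. exp (- t) * poly (lagD p) t)"
proof
 fix t :: real
 have "((%t. exp (- t) * poly p t) has_real_derivative exp (- t) * poly (lagD p) t) (at t)"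
  by (auto intro!: derivative_eq_intros poly_DERIV simp: lagD_def algebra_simps)
 then show "deriv (%t. exp (- t) * poly p t) t = exp (- t) * poly (lagD p) t" by (rule DERIV_imp_deriv)
qed

lemma derivs_exp_poly: "(deriv ^^ j) (%t. exp (- t) * poly p t) = (%t. exp (- t) * poly ((lagD ^^ j) p) t)"
 by (induction j) (auto simp: deriv_exp_poly)

lemma laguerre_poly_eq: "laguerre_poly m y = poly (Lag m) y"
proof -
 have e: "(%t::real. exp (- t) * t ^ m) = (%t. exp (- t) * poly (monom 1 m) t)" by (simp add: poly_monom)
 show ?thesis unfolding laguerre_poly_def e derivs_exp_poly by (simp add: Lag_def exp_minus)
qed

lemma laguerre_fun_eq: "laguerre_fun m y = (-1) ^ m * poly (Lag m) y * exp (- y / 2)"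
 by (simp add: laguerre_fun_def laguerre_poly_eq)

lemma lagD_coeff: "coeff (lagD p) i = of_nat (Suc i) * coeff p (Suc i) - coeff p i"
 by (simp add: lagD_def coeff_pderiv)

lemma lagD_degree: "coeff ((lagD ^^ j) p) i = 0" if "degree p < i"
 using that
proof (induction j arbitrary: i)
 case (Suc j) then show ?case by (simp add: lagD_coeff)
qed (simp add: coeff_eq_0)

lemma lagD_lead: "coeff ((lagD ^^ j) p) (degree p) = (-1) ^ j * lead_coeff p"
 by (induction j) (auto simp: lagD_coeff lagD_degree)

text \<open>These low coefficients are the boundary terms at 0 of the repeated integration by parts
  in \<open>lint_rodrigues\<close>.\<close>

lemma lagD_low: "coeff ((lagD ^^ j) (monom 1 m)) i = 0" if "i + j < m"
 using that
proof (induction j arbitrary: i)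
 case (Suc j) then show ?case using Suc.IH[of i] Suc.IH[of "Suc i"] by (simp add: lagD_coeff)
qed simp

lemma Lag_coeff: "coeff (Lag m) m = (-1) ^ m / fact m" "m < i ==> coeff (Lag m) i = 0"
 using lagD_lead[of m "monom 1 m"] lagD_degree[of "monom 1 m" i m] by (auto simp: Lag_def degree_monom_eq)

lemma degree_Lag: "degree (Lag m) = m"
proof (rule antisym)
 show "degree (Lag m) \<le> m" using Lag_coeff(2) by (intro degree_le) auto
 show "m \<le> degree (Lag m)" using Lag_coeff(1)[of m] by (intro le_degree) auto
qed

text \<open>The integral of \<open>poly p y * exp (- y)\<close> over the positive half-line, written
  through its moments i!. Orthogonality is thus proved in polynomial algebra, and
  \<open>lint_integral\<close> supplies the analysis once.\<close>

definition lint :: "real poly => real" where "lint p = (\<Sum>i\<le>degree p. coeff p i * fact i)"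

lemma lint_ge: "degree p \<le> n ==> lint p = (\<Sum>i\<le>n. coeff p i * fact i)"
 unfolding lint_def by (intro sum.mono_neutral_left) (auto simp: coeff_eq_0)

lemma lint_add: "lint (p + q) = lint p + lint q"
proof -
 let ?n = "max (degree p) (degree q)"
 have "degree (p + q) \<le> ?n" by (rule degree_add_le_max)
 then show ?thesis by (subst (1 2 3) lint_ge[of _ ?n]) (auto simp: sum.distrib algebra_simps)
qed

lemma lint_smult: "lint (smult c p) = c * lint p"
 by (subst lint_ge[of _ "degree p"]) (auto simp: lint_def sum_distrib_left mult.assoc degree_smult_le)

lemma lint_diff: "lint (p - q) = lint p - lint q"
 using lint_add[of p "smult (-1) q"] lint_smult[of "-1" q] by simp

text \<open>exp(-y) times \<open>lagD r\<close> is the derivative of exp(-y) times \<open>r\<close>,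
  whose integral is minus the boundary value at 0.\<close>

lemma lint_lagD: "lint (lagD r) = - coeff r 0"
proof -
 have "lint (pderiv r) = (\<Sum>i\<le>degree r. coeff (pderiv r) i * fact i)"
  by (rule lint_ge) (simp add: degree_pderiv)
 also have "... = (\<Sum>i\<le>degree r. coeff r (Suc i) * fact (Suc i))"
  by (intro sum.cong) (auto simp: coeff_pderiv)
 also have "... = (\<Sum>i\<le>Suc (degree r). coeff r i * fact i) - coeff r 0"
  using sum.atMost_Suc_shift[of "%i. coeff r i * fact i" "degree r"] by simp
 also have "(\<Sum>i\<le>Suc (degree r). coeff r i * fact i) = lint r"
  by (rule lint_ge[symmetric]) simp
 finally show ?thesis unfolding lagD_def lint_diff by simp
qed

lemma lint_parts: "lint (p * lagD q) = - (coeff p 0 * coeff q 0) - lint (pderiv p * q)"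
proof -
 have "p * lagD q = lagD (p * q) - pderiv p * q"
  by (simp add: lagD_def pderiv_mult algebra_simps)
 then show ?thesis by (simp add: lint_diff lint_lagD coeff_mult_0)
qed

lemma lint_rodrigues: "j \<le> m ==> lint (p * (lagD ^^ j) (monom 1 m)) = (-1) ^ j * lint ((pderiv ^^ j) p * monom 1 m)"
proof (induction j arbitrary: p)
 case (Suc j)
 have "coeff ((lagD ^^ j) (monom 1 m)) 0 = 0" using Suc.prems by (intro lagD_low) simp
 then have "lint (p * (lagD ^^ Suc j) (monom 1 m)) = - lint (pderiv p * (lagD ^^ j) (monom 1 m))"
  by (simp add: lint_parts)
 also have "... = - ((-1) ^ j * lint ((pderiv ^^ j) (pderiv p) * monom 1 m))" using Suc by simp
 finally show ?case by (simp add: funpow_swap1)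
qed simp

lemma higher_pderiv_degree: "degree (p :: real poly) < j ==> (pderiv ^^ j) p = 0"
proof (induction j arbitrary: p)
 case (Suc j)
 show ?case
 proof (cases "degree p = 0")
  case True
  then have "pderiv p = 0" by (simp add: pderiv_eq_0_iff)
  moreover have "(pderiv ^^ j) 0 = (0 :: real poly)" by (induction j) auto
  ultimately show ?thesis by (simp add: funpow_swap1)
 next
  case False
  then have "(pderiv ^^ j) (pderiv p) = 0" using Suc by (intro Suc.IH) (simp add: degree_pderiv)
  then show ?thesis by (simp add: funpow_swap1)
 qed
qed simp

lemma lint_Lag_less: "degree p < k ==> lint (p * Lag k) = 0"
 using lint_rodrigues[of k k p] lint_smult[of 0 0] by (simp add: Lag_def lint_smult higher_pderiv_degree)

text \<open>The k-fold derivative of \<open>Lag k\<close> is the constant (-1)^k, the remaining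
  moment of y^k is k!, and the sign cancels against the one in
  \<open>lint_rodrigues\<close>.\<close>

lemma lint_Lag_self: "lint (Lag k * Lag k) = 1"
proof -
 have d: "degree ((pderiv ^^ j) p) = degree p - j" for j and p :: "real poly"
  by (induction j) (auto simp: degree_pderiv)
 have lc: "coeff ((pderiv ^^ j) p) i = pochhammer (of_nat (Suc i)) j * coeff p (i + j)" for j i and p :: "real poly"
  by (rule coeff_higher_pderiv)
 define D where "D = (pderiv ^^ k) (Lag k)"
 have "degree D = 0" using d[of k "Lag k"] degree_Lag[of k] by (simp add: D_def)
 then obtain a where "D = [:a:]" by (rule degree_eq_zeroE)
 then have D: "D = [: coeff D 0 :]" by simp
 have "coeff D 0 = fact k * ((-1) ^ k / fact k)"
  unfolding D_def lc by (simp add: Lag_coeff pochhammer_fact)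
 then have c0: "coeff D 0 = (-1) ^ k" by simp
 have "lint (Lag k * Lag k) = (1 / fact k) * lint (Lag k * (lagD ^^ k) (monom 1 k))"
  by (subst (2) Lag_def) (simp add: lint_smult)
 also have "... = (1 / fact k) * ((-1) ^ k * lint (D * monom 1 k))" by (simp add: lint_rodrigues D_def)
 also have "D * monom 1 k = smult ((-1) ^ k) (monom 1 k)" by (subst D) (simp add: c0)
 also have "lint (smult ((-1) ^ k) (monom 1 k)) = (-1) ^ k * fact k"
 proof -
  have "(\<Sum>i\<le>k. coeff (monom (1::real) k) i * fact i) = (\<Sum>i\<le>k. if i = k then fact k else 0)"
   by (intro sum.cong) auto
  then show ?thesis unfolding lint_smult by (simp add: lint_def degree_monom_eq)
 qed
 finally show ?thesis by (simp flip: power_mult_distrib)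
qed

lemma lint_Lag: "lint (Lag j * Lag k) = (if j = k then 1 else 0)"
 using lint_Lag_self lint_Lag_less[of "Lag j" k] lint_Lag_less[of "Lag k" j]
 by (cases j k rule: linorder_cases) (auto simp: degree_Lag mult.commute)

lemma power_exp_integral:
 "intg (%y. indicator {0<..} y * (y ^ k * exp (- y)) :: real)"
 "(LB y. indicator {0<..} y * (y ^ k * exp (- y))) = (fact k :: real)"
proof -
 have "(NN y. ennreal (indicator {0<..} y * (y ^ k * exp (- y)))) = (NN y. ennreal (y ^ k * exp (- y)) * indicator {0..} y)"
  using AE_lborel_singleton[of 0] by (intro nn_integral_cong_AE) (auto elim!: eventually_mono simp: indicator_def)
 also have "... = ennreal (fact k)"
  using nn_intergal_power_times_exp_Ici[of k] by simp
 finally have *: "(NN y. ennreal (indicator {0<..} y * (y ^ k * exp (- y)))) = ennreal (fact k)" .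
 have nn: "0 \<le> indicator {0<..} y * (y ^ k * exp (- y) :: real)" for y :: real by (simp add: indicator_def)
 show "intg (%y. indicator {0<..} y * (y ^ k * exp (- y)) :: real)"
  by (rule integrableI_nn_integral_finite[OF _ _ *]) (auto intro: nn)
 have "(LB y. indicator {0<..} y * (y ^ k * exp (- y)) :: real) = enn2real (NN y. ennreal (indicator {0<..} y * (y ^ k * exp (- y))))"
  by (rule integral_eq_nn_integral) (auto intro: nn)
 then show "(LB y. indicator {0<..} y * (y ^ k * exp (- y))) = (fact k :: real)" unfolding * by simp
qed

lemma lint_integral:
 "intg (%y. indicator {0<..} y * (poly p y * exp (- y)))"
 "(LB y. indicator {0<..} y * (poly p y * exp (- y))) = lint p"
proof -
 have e: "indicator {0<..} y * (poly p y * exp (- y)) = (\<Sum>i\<le>degree p. coeff p i * (indicator {0<..} y * (y ^ i * exp (- y))))" for y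
  unfolding poly_altdef by (simp add: sum_distrib_left sum_distrib_right mult_ac)
 show "intg (%y. indicator {0<..} y * (poly p y * exp (- y)))"
  unfolding e by (intro integrable_sum_B integrable_mult_right power_exp_integral)
 show "(LB y. indicator {0<..} y * (poly p y * exp (- y))) = lint p"
  unfolding e lint_def by (subst int_sum)
   (auto intro!: integrable_mult_right power_exp_integral(1) simp: power_exp_integral(2))
qed

definition lgp :: "nat => real => complex" where
 "lgp k y = indicator {0<..} y * cr (laguerre_fun k y)"

lemma lgp_measurable[measurable]: "lgp k \<in> BM" "laguerre_fun k \<in> BM"
proof -
 show [measurable]: "laguerre_fun k \<in> BM"
  unfolding laguerre_fun_eq by (intro borel_measurable_continuous_onI continuous_intros) auto
 show "lgp k \<in> BM" unfolding lgp_def by measurable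
qed

lemma lgp_mult: "lgp j y * cnj (lgp k y) = cr ((-1) ^ j * (-1) ^ k * (indicator {0<..} y * (poly (Lag j * Lag k) y * exp (- y))))"
proof -
 have "exp (- y / 2) * exp (- y / 2) = exp (- y)" by (simp flip: exp_add)
 then have "cr (exp (- y / 2)) * cr (exp (- y / 2)) = cr (exp (- y))" by (simp flip: of_real_mult)
 then show ?thesis unfolding lgp_def laguerre_fun_eq by (auto simp: indicator_def mult_ac)
qed

lemma lgp_L2s: "lgp k \<in> L2b"
proof -
 have "(cmod (lgp k y))\<^sup>2 = indicator {0<..} y * (poly (Lag k * Lag k) y * exp (- y))" for y
 proof -
  have "cr ((cmod (lgp k y))^2) = lgp k y * cnj (lgp k y)" by (rule complex_norm_square)
  also have "... = cr (indicator {0<..} y * (poly (Lag k * Lag k) y * exp (- y)))"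
   unfolding lgp_mult by (simp flip: power_mult_distrib)
  finally show ?thesis unfolding of_real_eq_iff .
 qed
 then show ?thesis unfolding L2s_def using lint_integral(1)[of "Lag k * Lag k"] by simp
qed

lemma inn_lgp: "innb (lgp j) (lgp k) = (if j = k then 1 else 0)"
 unfolding inn_def lgp_mult integral_complex_of_real integral_mult_right_zero lint_integral(2) lint_Lag
 by (simp flip: power_mult_distrib)

section \<open>The Hermite function of order zero\<close>

definition h0 :: "real => complex" where "h0 y = cr (hermite_fun 0 y)"

lemma hermite_0: "hermite_fun 0 y = exp (- (y\<^sup>2) / 2) / sqrt (sqrt pi)"
proof -
 have "exp (y\<^sup>2) * exp (- (y\<^sup>2)) = 1" by (simp flip: exp_add)
 then show ?thesis by (simp add: hermite_fun_def hermite_poly_def)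
qed

lemma h0_gz: "h0 = (%y. cr (1 / sqrt (sqrt pi)) * gz 0 y)"
 unfolding h0_def hermite_0 gz_def by (auto simp: fun_eq_iff exp_of_real[symmetric])

lemma h0_measurable[measurable]: "h0 \<in> BM" unfolding h0_gz by measurable

lemma h0_L2s: "h0 \<in> L2b" unfolding h0_gz by (intro L2s_scale gz_L2s)

lemma inn_h0: "innb h0 h0 = 1"
proof -
 have "sqrt (sqrt pi) * sqrt (sqrt pi) = sqrt pi" by simp
 then have "cr (sqrt (sqrt pi)) * cr (sqrt (sqrt pi)) = cr (sqrt pi)" by (simp flip: of_real_mult)
 then show ?thesis unfolding h0_gz inn_scale_left inn_scale_right inn_gz by (simp add: field_simps)
qed

text \<open>The change of variables \<open>\<psi>\<^sub>1 \<circ> \<psi>\<^sub>2\<close> and its inverse in real coordinates.\<close>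

definition rr :: "r4 => r4" where
 "rr x = (let s = sqrt \<bar>sf x\<bar> in
  ((s * (ff x + fs x), sf x), ((fs x - ff x) / (2 * s), ss x / (2 * \<bar>sf x\<bar>))))"

definition rinv :: "r4 => r4" where
 "rinv x = (let s = sqrt \<bar>sf x\<bar> in
  ((ff x / (2 * s) - s * fs x, sf x), (ff x / (2 * s) + s * fs x, 2 * \<bar>sf x\<bar> * ss x)))"

lemma rr_measurable[measurable]: "rr \<in> BM" "rinv \<in> BM"
 unfolding rr_def rinv_def Let_def by measurable

lemma rinv_rr: "sf x \<noteq> 0 ==> rinv (rr x) = x"
 by (cases x) (auto simp: rr_def rinv_def Let_def field_simps)

text \<open>The linear map has determinant 1; two one-dimensional affine substitutions with an
  exchange of order show this.\<close>

lemma nn_linear2: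
 fixes H :: "real => real => ennreal"
 assumes H[measurable]: "(%x. H (fst x) (snd x)) \<in> BM" and s: "s > 0"
 shows "(NN a. NN p. H (s * (a + p)) ((p - a) / (2 * s))) = (NN a. NN p. H a p)"
proof -
 have Hm[measurable (raw)]: "(%x. H (f x) (g x)) \<in> borel_measurable M" if "f \<in> borel_measurable M" "g \<in> borel_measurable M" for f g and M :: "'z measure"
  using measurable_compose[of "%x. (f x, g x)" M borel "%x. H (fst x) (snd x)" borel] that H by simp
 have "(NN a. NN p. H (s * (a + p)) ((p - a) / (2 * s))) = (NN a. ennreal (2 * s) * (NN p. H (s * (2 * a + 2 * s * p)) p))"
 proof (intro nn_integral_cong)
  fix a
  have "(NN p. H (s * (a + p)) ((p - a) / (2 * s))) = ennreal \<bar>2 * s\<bar> * (NN p. H (s * (a + (a + 2 * s * p))) ((a + 2 * s * p - a) / (2 * s)))"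
   by (rule nn_integral_real_affine) (use s in auto)
  also have "... = ennreal (2 * s) * (NN p. H (s * (2 * a + 2 * s * p)) p)" using s by (simp add: add.assoc[symmetric])
  finally show "(NN p. H (s * (a + p)) ((p - a) / (2 * s))) = ennreal (2 * s) * (NN p. H (s * (2 * a + 2 * s * p)) p)" .
 qed
 also have "... = ennreal (2 * s) * (NN a. NN p. H (s * (2 * a + 2 * s * p)) p)"
  by (rule nn_integral_cmult) measurable
 also have "(NN a. NN p. H (s * (2 * a + 2 * s * p)) p) = (NN p. NN a. H (s * (2 * a + 2 * s * p)) p)"
  by (rule nn_swap) measurable
 also have "ennreal (2 * s) * ... = (NN p. ennreal (2 * s) * (NN a. H (s * (2 * a + 2 * s * p)) p))"
  by (rule nn_integral_cmult[symmetric]) measurable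
 also have "... = (NN p. NN a. H a p)"
 proof (intro nn_integral_cong)
  fix p
  have "(NN a. H a p) = ennreal \<bar>2 * s\<bar> * (NN a. H (2 * s * s * p + 2 * s * a) p)"
   by (rule nn_integral_real_affine) (use s in auto)
  then show "ennreal (2 * s) * (NN a. H (s * (2 * a + 2 * s * p)) p) = (NN a. H a p)"
   using s by (simp add: algebra_simps)
 qed
 also have "... = (NN a. NN p. H a p)" by (rule nn_swap[symmetric]) measurable
 finally show ?thesis .
qed

lemma AE_lborel_nonzero: "AE x in (lborel :: r4 measure). sf x \<noteq> 0"
 by (rule AE_lift_fst[OF AE_lift_snd[OF AE_lborel_singleton]])

text \<open>The part acting on the first and third coordinates has determinant 1, so the Jacobian
  comes from the rescaling of the last coordinate alone. The exceptional points with
  \<open>sf x = 0\<close> form a null set.\<close>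

lemma nn_rr:
 fixes F :: "r4 => ennreal"
 assumes F[measurable]: "F \<in> BM"
 shows "(NN x. ennreal (1 / (2 * \<bar>sf x\<bar>)) * F (rr x)) = (NN x. F x)"
proof -
 define G where "G b \<xi> p = (NN q. F ((\<xi>, b), (p, q)))" for b \<xi> p
 have Gm: "(%x. G (fst x) (fs x) (ss x)) \<in> BM"
 proof -
  have "(%x::real \<times> real \<times> real. NN q. F ((fs x, fst x), (ss x, q))) \<in> borel_measurable lborel"
   by (rule lborel.borel_measurable_nn_integral) (simp add: case_prod_beta' lborel_prod)
  then show ?thesis by (simp add: G_def)
 qed
 have Gm'[measurable (raw)]: "(%x. G (f x) (g x) (h x)) \<in> borel_measurable M" if "f \<in> borel_measurable M" "g \<in> borel_measurable M" "h \<in> borel_measurable M" for f g h and M :: "'z measure"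
  using measurable_compose[of "%x. (f x, g x, h x)" M borel "%x. G (fst x) (fs x) (ss x)" borel] that Gm by simp
 have q: "ennreal (1 / (2 * \<bar>b\<bar>)) * (NN q. F ((\<xi>, b), (p, q / (2 * \<bar>b\<bar>)))) = G b \<xi> p" if "b \<noteq> 0" for b \<xi> p
 proof -
  have "(NN q. F ((\<xi>, b), (p, q / (2 * \<bar>b\<bar>)))) = ennreal \<bar>2 * \<bar>b\<bar>\<bar> * (NN q. F ((\<xi>, b), (p, (0 + 2 * \<bar>b\<bar> * q) / (2 * \<bar>b\<bar>))))"
   by (rule nn_integral_real_affine) (use that in auto)
  also have "... = ennreal (2 * \<bar>b\<bar>) * G b \<xi> p" using that by (simp add: G_def)
  finally show ?thesis using that by (simp add: mult.assoc[symmetric] flip: ennreal_mult)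
 qed
 have "(NN x. ennreal (1 / (2 * \<bar>sf x\<bar>)) * F (rr x)) =
  (NN a. NN b. NN p. NN q. ennreal (1 / (2 * \<bar>b\<bar>)) * F ((sqrt \<bar>b\<bar> * (a + p), b), ((p - a) / (2 * sqrt \<bar>b\<bar>), q / (2 * \<bar>b\<bar>))))"
  by (subst nn_R4) (measurable, simp add: rr_def Let_def)
 also have "... = (NN a. NN b. NN p. G b (sqrt \<bar>b\<bar> * (a + p)) ((p - a) / (2 * sqrt \<bar>b\<bar>)))"
 proof (rule nn_integral_cong, rule nn_integral_cong_AE, use AE_lborel_singleton[of 0] in eventually_elim)
  fix a b :: real assume b: "b \<noteq> 0"
  have "(NN q. ennreal (1 / (2 * \<bar>b\<bar>)) * F ((sqrt \<bar>b\<bar> * (a + p), b), ((p - a) / (2 * sqrt \<bar>b\<bar>), q / (2 * \<bar>b\<bar>)))) = G b (sqrt \<bar>b\<bar> * (a + p)) ((p - a) / (2 * sqrt \<bar>b\<bar>))" for p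
   by (subst nn_integral_cmult) (use q[OF b] in auto)
  then show "(NN p. NN q. ennreal (1 / (2 * \<bar>b\<bar>)) * F ((sqrt \<bar>b\<bar> * (a + p), b), ((p - a) / (2 * sqrt \<bar>b\<bar>), q / (2 * \<bar>b\<bar>)))) =
   (NN p. G b (sqrt \<bar>b\<bar> * (a + p)) ((p - a) / (2 * sqrt \<bar>b\<bar>)))" by simp
 qed
 also have "... = (NN b. NN a. NN p. G b (sqrt \<bar>b\<bar> * (a + p)) ((p - a) / (2 * sqrt \<bar>b\<bar>)))"
  by (rule nn_swap) measurable
 also have "... = (NN b. NN a. NN p. G b a p)"
 proof (intro nn_integral_cong_AE, use AE_lborel_singleton[of 0] in eventually_elim)
  fix b :: real assume b: "b \<noteq> 0"
  show "(NN a. NN p. G b (sqrt \<bar>b\<bar> * (a + p)) ((p - a) / (2 * sqrt \<bar>b\<bar>))) = (NN a. NN p. G b a p)"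
   by (rule nn_linear2) (measurable, use b in simp)
 qed
 also have "... = (NN a. NN b. NN p. G b a p)" by (rule nn_swap) measurable
 also have "... = (NN x. F x)" unfolding G_def by (rule nn_R4[OF F, symmetric])
 finally show ?thesis .
qed

text \<open>\<open>rr\<close> does not preserve the measure and collapses the null set where
  \<open>sf x = 0\<close>, so it is treated as a push-forward of a weighted measure and not as an
  \<open>mpiso\<close>.\<close>

lemma rr_distr: "distr (density lborel (%x. ennreal (1 / (2 * \<bar>sf x\<bar>)))) borel rr = lborel"
proof (rule measure_eqI)
 fix A :: "r4 set" assume "A \<in> sets (distr (density lborel (%x. ennreal (1 / (2 * \<bar>sf x\<bar>)))) borel rr)"
 then have [measurable]: "A \<in> sets borel" by simp
 have "emeasure (distr (density lborel (%x. ennreal (1 / (2 * \<bar>sf x\<bar>)))) borel rr) A = (\<integral>\<^sup>+x. indicator A x \<partial>(distr (density lborel (%x. ennreal (1 / (2 * \<bar>sf x\<bar>)))) borel rr))"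
  by simp
 also have "... = (NN x. ennreal (1 / (2 * \<bar>sf x\<bar>)) * indicator A (rr x))"
  by (subst nn_integral_distr) (auto simp: nn_integral_density)
 also have "... = emeasure lborel A" by (subst nn_rr) auto
 finally show "emeasure (distr (density lborel (%x. ennreal (1 / (2 * \<bar>sf x\<bar>)))) borel rr) A = emeasure lborel A" .
qed simp

lemma rr_integral:
 fixes F :: "r4 => complex"
 assumes F[measurable]: "F \<in> BM"
 shows "(LB x. (1 / (2 * \<bar>sf x\<bar>)) *\<^sub>R F (rr x)) = (LB x. F x)"
  "intg (%x. (1 / (2 * \<bar>sf x\<bar>)) *\<^sub>R F (rr x)) \<longleftrightarrow> intg F"
proof -
 have "(LB x. F x) = (LINT x|density lborel (%x. ennreal (1 / (2 * \<bar>sf x\<bar>))). F (rr x))"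
  by (subst rr_distr[symmetric], subst integral_distr) auto
 also have "... = (LB x. (1 / (2 * \<bar>sf x\<bar>)) *\<^sub>R F (rr x))" by (subst integral_density) auto
 finally show "(LB x. (1 / (2 * \<bar>sf x\<bar>)) *\<^sub>R F (rr x)) = (LB x. F x)" ..
 have "intg F \<longleftrightarrow> integrable (density lborel (%x. ennreal (1 / (2 * \<bar>sf x\<bar>)))) (%x. F (rr x))"
  by (subst rr_distr[symmetric], subst integrable_distr_eq) auto
 also have "... \<longleftrightarrow> intg (%x. (1 / (2 * \<bar>sf x\<bar>)) *\<^sub>R F (rr x))" by (subst integrable_density) auto
 finally show "intg (%x. (1 / (2 * \<bar>sf x\<bar>)) *\<^sub>R F (rr x)) \<longleftrightarrow> intg F" ..
qed

lemma rr_AE: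
 assumes "AB x. P x" shows "AB x. P (rr x)"
proof -
 have "AE x in distr (density lborel (%x. ennreal (1 / (2 * \<bar>sf x\<bar>)))) borel rr. P x" unfolding rr_distr by (rule assms)
 then have "AE x in density lborel (%x. ennreal (1 / (2 * \<bar>sf x\<bar>))). P (rr x)" by (rule AE_distrD[rotated]) measurable
 then have "AB x. 0 < ennreal (1 / (2 * \<bar>sf x\<bar>)) --> P (rr x)" by (subst (asm) AE_density) measurable
 then show ?thesis using AE_lborel_nonzero by eventually_elim simp
qed

section \<open>The operators \<open>V1\<close> and \<open>V2\<close> on representatives\<close>

definition vt :: "(r4 => complex) => r4 => complex" where
 "vt \<phi> x = cr (1 / sqrt (2 * \<bar>sf x\<bar>)) * \<phi> (rr x)"
definition vti :: "(r4 => complex) => r4 => complex" where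
 "vti \<phi> x = cr (sqrt (2 * \<bar>sf x\<bar>)) * \<phi> (rinv x)"

lemma vt_measurable[measurable]:
 assumes [measurable]: "\<phi> \<in> BM"
 shows "vt \<phi> \<in> BM" "vti \<phi> \<in> BM"
 unfolding vt_def vti_def by measurable

lemma vt_vti: "sf x \<noteq> 0 ==> vt (vti \<phi>) x = \<phi> x"
 unfolding vt_def vti_def by (simp add: rinv_rr) (simp add: rr_def Let_def)

lemma vt_mult: "vt \<phi> x * cnj (vt \<psi> x) = (1 / (2 * \<bar>sf x\<bar>)) *\<^sub>R (\<phi> (rr x) * cnj (\<psi> (rr x)))"
proof -
 have "sqrt (2 * \<bar>sf x\<bar>) * sqrt (2 * \<bar>sf x\<bar>) = 2 * \<bar>sf x\<bar>" by simp
 then have "(1 / sqrt (2 * \<bar>sf x\<bar>)) * (1 / sqrt (2 * \<bar>sf x\<bar>)) = 1 / (2 * \<bar>sf x\<bar>)" by (simp only: times_divide_times_eq mult_1)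
 then have "cr (1 / sqrt (2 * \<bar>sf x\<bar>)) * cr (1 / sqrt (2 * \<bar>sf x\<bar>)) = cr (1 / (2 * \<bar>sf x\<bar>))"
  by (simp only: of_real_mult[symmetric])
 then show ?thesis unfolding vt_def scaleR_conv_of_real by (simp only: complex_cnj_mult complex_cnj_complex_of_real mult_ac)
qed

lemma inn_vt:
 assumes [measurable]: "\<phi> \<in> BM" "\<psi> \<in> BM"
 shows "innb (vt \<phi>) (vt \<psi>) = innb \<phi> \<psi>"
 unfolding inn_def vt_mult by (rule rr_integral) measurable

lemma vt_L2s_iff:
 assumes [measurable]: "\<phi> \<in> BM"
 shows "vt \<phi> \<in> L2b \<longleftrightarrow> \<phi> \<in> L2b"
proof -
 have *: "intg (%x. (cmod (f x))^2) \<longleftrightarrow> intg (%x. f x * cnj (f x))" for f :: "r4 => complex"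
  unfolding complex_norm_square[symmetric] of_real_power[symmetric] by (metis complex_of_real_integrable_eq)
 show ?thesis unfolding L2s_def using * rr_integral(2)[of "%x. \<phi> x * cnj (\<phi> x)"] by (simp add: vt_mult)
qed

lemma vti_L2s: "\<phi> \<in> L2b ==> vti \<phi> \<in> L2b"
proof -
 assume \<phi>: "\<phi> \<in> L2b"
 then have [measurable]: "\<phi> \<in> BM" by (auto simp: L2s_def)
 have "AB x. vt (vti \<phi>) x = \<phi> x" using AE_lborel_nonzero by eventually_elim (rule vt_vti)
 then have "vt (vti \<phi>) \<in> L2b" using \<phi>
  by (intro L2s_bound[where g = "%x. (cmod (\<phi> x))^2"]) (auto simp: L2s_def elim!: eventually_mono)
 then show ?thesis by (subst (asm) vt_L2s_iff) auto
qed

lemma rep_V: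
 assumes r: "rep J CPi f \<phi>" shows "rep J CPi (V2 (V1 f)) (vt \<phi>)"
proof -
 have [measurable]: "\<phi> \<in> BM" using r by (auto simp: rep_def)
 have e: "V2 (V1 f) (J x) = cr (1 / sqrt (2 * \<bar>sf x\<bar>)) * f (J (rr x))" for x
  unfolding V2_def V1_def J_def psi1_def psi2_def rr_def Let_def by simp
 have "AB x. J (rr x) \<in> CPi --> f (J (rr x)) = \<phi> (rr x)" by (rule rr_AE) (use r in \<open>simp add: rep_def\<close>)
 then have "AB x. J x \<in> CPi --> V2 (V1 f) (J x) = vt \<phi> x"
  using AE_lborel_nonzero
 proof eventually_elim
  case (elim x)
  then have "J x \<in> CPi ==> J (rr x) \<in> CPi" by (simp add: J_CPi rr_def Let_def)
  then show ?case using elim unfolding e vt_def by auto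
 qed
 moreover have "vt \<phi> x = 0" if "J x \<notin> CPi" for x
 proof (cases "sf x = 0")
  case False
  then have "J (rr x) \<notin> CPi" using that by (simp add: J_CPi rr_def Let_def zero_less_divide_iff)
  then have "\<phi> (rr x) = 0" using r unfolding rep_def by blast
  then show ?thesis by (simp add: vt_def)
 qed (simp add: vt_def)
 ultimately show ?thesis unfolding rep_def by auto
qed

section \<open>The embedding \<open>R0\<close> and its adjoint\<close>

lemma RRp_borel[measurable]: "RRp \<in> sets borel"
proof -
 have "RRp = {x. 0 < snd x}" by (auto simp: RRp_def)
 also have "open ..." by (intro open_Collect_less continuous_intros)
 finally show ?thesis by simp
qed

lemma in_RRp: "x \<in> RRp \<longleftrightarrow> 0 < snd x" by (cases x) (auto simp: RRp_def)

definition rep2 :: "(real \<times> real => complex) => (real \<times> real => complex) => bool" where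
 "rep2 f g \<longleftrightarrow> rep (%x. x) RRp f g"

lemma rep2_ex: "f \<in> L2s (lebesgue_on RRp) ==> \<exists>g\<in>L2b. rep2 f g"
 using rep_ex[OF mpiso_id RRp_borel] rep_L2s_iff[OF mpiso_id RRp_borel] unfolding rep2_def by (metis L2sD(1))

lemma rep2_L2s: "rep2 f g ==> f \<in> L2s (lebesgue_on RRp) \<longleftrightarrow> g \<in> L2b"
 unfolding rep2_def by (rule rep_L2s_iff[OF mpiso_id RRp_borel])

lemma rep2_inn: "rep2 f g ==> rep2 f' g' ==> inn (lebesgue_on RRp) f f' = innb g g'"
 unfolding rep2_def by (rule rep_inn[OF mpiso_id RRp_borel])

lemma rep2D: "rep2 f g ==> g \<in> BM" "rep2 f g ==> snd x \<le> 0 ==> g x = 0"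
 "rep2 f g ==> AB x. 0 < snd x --> f x = g x"
 by (cases x; auto simp: rep2_def rep_def in_RRp)+

lemma L2_pow_sel: "carr (L2_pow n S) = {g. \<forall>k<n. g k \<in> L2s (lebesgue_on S)}"
 "ip (L2_pow n S) g g' = (\<Sum>k<n. inn (lebesgue_on S) (g k) (g' k))"
 "eqv (L2_pow n S) g g' \<longleftrightarrow> (\<forall>k<n. AE x in lebesgue_on S. g k x = g' k x)"
 by (auto simp: L2_pow_def L2_sel)

lemma L2_pow_rep:
 assumes "g \<in> carr (L2_pow n RRp)"
 shows "\<exists>gb. (\<forall>k. gb k \<in> L2b) \<and> (\<forall>k<n. rep2 (g k) (gb k))"
proof -
 have "\<forall>k. \<exists>h. h \<in> L2b \<and> (k < n --> rep2 (g k) h)"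
  using assms rep2_ex L2s_zero unfolding L2_pow_sel by blast
 then show ?thesis unfolding choice_iff by blast
qed

text \<open>Testing against the difference placed in the single component \<open>k\<close> isolates
  that component.\<close>

lemma L2_pow_eqI:
 assumes x: "x \<in> carr (L2_pow n RRp)" and y: "y \<in> carr (L2_pow n RRp)"
  and e: "!!x'. x' \<in> carr (L2_pow n RRp) ==> ip (L2_pow n RRp) x x' = ip (L2_pow n RRp) y x'"
 shows "eqv (L2_pow n RRp) x y"
 unfolding L2_pow_sel
proof (intro allI impI)
 fix k assume k: "k < n"
 let ?d = "%u. x k u - y k u"
 have xy: "x k \<in> L2s (lebesgue_on RRp)" "y k \<in> L2s (lebesgue_on RRp)" using x y k by (auto simp: L2_pow_sel)
 then have d: "?d \<in> L2s (lebesgue_on RRp)" by (rule L2s_diff)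
 define x' where "x' j = (if j = k then ?d else (%u. 0))" for j
 have x': "x' \<in> carr (L2_pow n RRp)" using d by (auto simp: L2_pow_sel x'_def L2s_zero)
 have s: "(\<Sum>j<n. inn (lebesgue_on RRp) (g j) (x' j)) = inn (lebesgue_on RRp) (g k) ?d" for g
 proof -
  have "(\<Sum>j<n. inn (lebesgue_on RRp) (g j) (x' j)) = (\<Sum>j<n. if j = k then inn (lebesgue_on RRp) (g k) ?d else 0)"
   by (intro sum.cong) (auto simp: x'_def inn_def)
  then show ?thesis using k by simp
 qed
 have "inn (lebesgue_on RRp) (x k) ?d = inn (lebesgue_on RRp) (y k) ?d"
  using e[OF x'] unfolding L2_pow_sel s .
 then have "inn (lebesgue_on RRp) ?d ?d = 0" using inn_diff_left[OF xy d] by simp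
 then have "n2 (lebesgue_on RRp) ?d = 0" unfolding inn_self by simp
 from n2_zeroD[OF d this] show "AE u in lebesgue_on RRp. x k u = y k u" by simp
qed

lemma ip_pow_cnj: "cnj (ip (L2_pow n S) g g') = ip (L2_pow n S) g' g"
 by (simp add: L2_pow_sel inn_cnj)

lemma ip_pow_cong:
 assumes "g \<in> carr (L2_pow n RRp)" "g2 \<in> carr (L2_pow n RRp)" "h \<in> carr (L2_pow n RRp)" "h2 \<in> carr (L2_pow n RRp)"
  "eqv (L2_pow n RRp) g g2" "eqv (L2_pow n RRp) h h2"
 shows "ip (L2_pow n RRp) g h = ip (L2_pow n RRp) g2 h2"
 unfolding L2_pow_sel by (intro sum.cong refl inn_cong_AE) (use assms in \<open>auto simp: L2_pow_sel dest!: L2sD(1)\<close>)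

lemma inn_sum_left: "(!!i. i \<in> A ==> f i \<in> L2s M) ==> h \<in> L2s M ==> inn M (%x. \<Sum>i\<in>A. f i x) h = (\<Sum>i\<in>A. inn M (f i) h)"
proof (induction A rule: infinite_finite_induct)
 case (insert a A) then show ?case by (simp add: inn_add_left L2s_sum)
qed (simp_all add: inn_def)

lemma inn_sum_right: "(!!i. i \<in> A ==> f i \<in> L2s M) ==> h \<in> L2s M ==> inn M h (%x. \<Sum>i\<in>A. f i x) = (\<Sum>i\<in>A. inn M h (f i))"
 using arg_cong[OF inn_sum_left[of A f M h], of cnj] by (simp add: inn_cnj)

definition hl :: "nat => real \<times> real => complex" where "hl k = tp h0 (lgp k)"

lemma hl_L2s: "hl k \<in> L2b" unfolding hl_def by (intro tp_L2s h0_L2s lgp_L2s)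
lemma inn_hl: "innb (hl j) (hl k) = (if j = k then 1 else 0)"
 unfolding hl_def by (simp add: inn_tp h0_L2s lgp_L2s inn_h0 inn_lgp)
lemma hl_measurable[measurable]: "hl k \<in> BM" unfolding hl_def by measurable

definition r0 :: "nat => (nat => real \<times> real => complex) => r4 => complex" where
 "r0 n g x = (\<Sum>k<n. tp (g k) (hl k) x)"

lemma r0_L2s: "(!!k. k < n ==> g k \<in> L2b) ==> r0 n g \<in> L2b"
 unfolding r0_def[abs_def] by (intro L2s_sum tp_L2s hl_L2s) auto

lemma rep_R0:
 assumes "!!k. k < n ==> rep2 (g k) (gb k)"
 shows "rep J CPi (R0 n g) (r0 n gb)"
proof -
 have "AE x in (lborel :: r4 measure). \<forall>k\<in>{..<n}. 0 < sf x --> g k (fst x) = gb k (fst x)"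
  by (intro AE_finite_allI AE_lift_fst) (use rep2D(3)[OF assms] in auto)
 then have "AB x. J x \<in> CPi --> R0 n g (J x) = r0 n gb x"
 proof eventually_elim
  case (elim x)
  show ?case
  proof
   assume "J x \<in> CPi"
   then have v: "0 < ss x" by (simp add: J_CPi)
   show "R0 n g (J x) = r0 n gb x"
   proof (cases "0 < sf x")
    case True
    have "R0 n g (J x) = (\<Sum>k<n. h0 (fs x) * (cr (laguerre_fun k (ss x)) * g k (fst x)))"
     using True by (simp add: R0_def J_def h0_def sum_distrib_left)
    also have "... = r0 n gb x" unfolding r0_def
     by (intro sum.cong refl) (use elim v True in \<open>simp add: tp_def hl_def lgp_def\<close>)
    finally show ?thesis .
   next
    case False
    then have "gb k (fst x) = 0" if "k < n" for k using rep2D(2)[OF assms[OF that]] by simp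
    then show ?thesis using False by (simp add: R0_def r0_def J_def tp_def)
   qed
  qed
 qed
 moreover have "r0 n gb \<in> BM"
  unfolding r0_def[abs_def] using rep2D(1)[OF assms] by (intro borel_measurable_sum tp_measurable hl_measurable) auto
 moreover have "J x \<notin> CPi ==> r0 n gb x = 0" for x by (simp add: r0_def tp_def hl_def lgp_def J_CPi)
 ultimately show ?thesis by (auto simp: rep_def)
qed

lemma inn_r0:
 assumes "!!k. k < n ==> g k \<in> L2b" "!!k. k < n ==> g' k \<in> L2b"
 shows "innb (r0 n g) (r0 n g') = (\<Sum>k<n. innb (g k) (g' k))"
proof -
 have "innb (r0 n g) (r0 n g') = (\<Sum>j<n. innb (tp (g j) (hl j)) (r0 n g'))"
  unfolding r0_def[of n g, abs_def] by (rule inn_sum_left) (auto intro!: tp_L2s hl_L2s r0_L2s assms)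
 also have "... = (\<Sum>j<n. \<Sum>k<n. innb (tp (g j) (hl j)) (tp (g' k) (hl k)))"
  unfolding r0_def[of n g', abs_def] by (intro sum.cong refl inn_sum_right) (auto intro!: tp_L2s hl_L2s assms)
 also have "... = (\<Sum>j<n. \<Sum>k<n. if j = k then innb (g j) (g' k) else 0)"
  by (intro sum.cong refl) (auto simp: inn_tp assms hl_L2s inn_hl)
 finally show ?thesis by simp
qed

lemma R0_carr: "g \<in> carr (L2_pow n RRp) ==> R0 n g \<in> L2s (lebesgue_on CPi)"
proof -
 assume "g \<in> carr (L2_pow n RRp)"
 then obtain gb where gb: "\<forall>k. gb k \<in> L2b" "\<forall>k<n. rep2 (g k) (gb k)" using L2_pow_rep by blast
 have "rep J CPi (R0 n g) (r0 n gb)" by (rule rep_R0) (use gb in auto)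
 then show ?thesis using rep_L2s_iff[OF mpiso_J CPi_borel] r0_L2s gb(1) by blast
qed

lemma R0_iso:
 assumes "g \<in> carr (L2_pow n RRp)" "g' \<in> carr (L2_pow n RRp)"
 shows "inn (lebesgue_on CPi) (R0 n g) (R0 n g') = ip (L2_pow n RRp) g g'"
proof -
 obtain gb where gb: "\<forall>k. gb k \<in> L2b" "\<forall>k<n. rep2 (g k) (gb k)" using L2_pow_rep[OF assms(1)] by blast
 obtain gb' where gb': "\<forall>k. gb' k \<in> L2b" "\<forall>k<n. rep2 (g' k) (gb' k)" using L2_pow_rep[OF assms(2)] by blast
 have "inn (lebesgue_on CPi) (R0 n g) (R0 n g') = innb (r0 n gb) (r0 n gb')"
  by (rule rep_inn[OF mpiso_J CPi_borel rep_R0 rep_R0]) (use gb gb' in auto)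
 also have "... = (\<Sum>k<n. innb (gb k) (gb' k))" by (rule inn_r0) (use gb gb' in auto)
 also have "... = ip (L2_pow n RRp) g g'" unfolding L2_pow_sel
  by (intro sum.cong refl rep2_inn[symmetric]) (use gb gb' in auto)
 finally show ?thesis .
qed

text \<open>The adjoint of tensoring with \<open>\<phi>\<close> integrates against
  \<open>\<phi>\<close> in the second variable; Cauchy-Schwarz on almost every slice bounds it in
  L2.\<close>

lemma adjoint_slice:
 fixes \<phi> :: "'b::euclidean_space => complex" and \<Psi> :: "'a::euclidean_space \<times> 'b => complex"
 assumes \<phi>: "\<phi> \<in> L2b" and \<Psi>: "\<Psi> \<in> L2b"
 defines "a \<equiv> %u. LB v. \<Psi> (u, v) * cnj (\<phi> v)"
 shows "a \<in> L2b" "g \<in> L2b ==> innb (tp g \<phi>) \<Psi> = innb g a"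
proof -
 have [measurable]: "\<phi> \<in> BM" "\<Psi> \<in> BM" using \<phi> \<Psi> by (auto simp: L2s_def)
 have i2: "integrable (lborel \<Otimes>\<^sub>M lborel) (%x. (cmod (\<Psi> x))^2)" using \<Psi> by (simp add: lborel_prod L2s_def)
 have ae: "AB u. (%v. \<Psi> (u, v)) \<in> L2b"
  using lborel_pair.AE_integrable_fst'[OF i2] by eventually_elim (simp add: L2s_def)
 have "(%u. LB v. \<Psi> (u, v) * cnj (\<phi> v)) \<in> borel_measurable lborel"
  by (rule lborel.borel_measurable_lebesgue_integral) (simp add: case_prod_beta' lborel_prod)
 then have am[measurable]: "a \<in> BM" by (simp add: a_def)
 show "a \<in> L2b"
 proof (rule L2s_bound)
  show "intg (%u. (LB v. (cmod (\<Psi> (u, v)))^2) * (n2 lborel \<phi> + 1))"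
   by (intro integrable_mult_left lborel_pair.integrable_fst' i2)
  show "AB u. (cmod (a u))^2 \<le> (LB v. (cmod (\<Psi> (u, v)))^2) * (n2 lborel \<phi> + 1)"
   using ae by eventually_elim (use inn_bound[OF _ \<phi>] in \<open>simp add: a_def inn_def n2_def\<close>)
 qed simp
 assume g: "g \<in> L2b"
 have i: "integrable (lborel \<Otimes>\<^sub>M lborel) (%x. tp g \<phi> x * cnj (\<Psi> x))"
  using L2s_integrable_inn[OF tp_L2s[OF g \<phi>] \<Psi>] by (simp add: lborel_prod)
 have "innb (tp g \<phi>) \<Psi> = (LB u. LB v. tp g \<phi> (u, v) * cnj (\<Psi> (u, v)))"
  using lborel_pair.integral_fst'[OF i] by (simp add: inn_def lborel_prod)
 also have "... = (LB u. g u * cnj (a u))"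
 proof (intro int_cong refl)
  fix u
  have "cnj (a u) = (LB v. \<phi> v * cnj (\<Psi> (u, v)))"
   unfolding a_def by (subst int_cnj[symmetric]) (simp add: mult.commute)
  then show "(LB v. tp g \<phi> (u, v) * cnj (\<Psi> (u, v))) = g u * cnj (a u)"
   by (simp add: tp_def mult.assoc)
 qed
 finally show "innb (tp g \<phi>) \<Psi> = innb g a" by (simp add: inn_def)
qed

text \<open>\<open>adj\<close> is a choice, so \<open>R\<close> acquires its defining property only
  through this witness.\<close>

lemma R0_adjoint_ex:
 assumes \<Psi>: "\<Psi> \<in> L2s (lebesgue_on CPi)"
 shows "\<exists>x. x \<in> carr (L2_pow n RRp) \<and> (\<forall>x'\<in>carr (L2_pow n RRp). ip (L2 CPi) (R0 n x') \<Psi> = ip (L2_pow n RRp) x' x)"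
proof -
 obtain \<psi> where r: "rep J CPi \<Psi> \<psi>" using rep_ex[OF mpiso_J CPi_borel] \<Psi> by (auto simp: L2s_def)
 have \<psi>: "\<psi> \<in> L2b" using rep_L2s_iff[OF mpiso_J CPi_borel r] \<Psi> by blast
 define a where "a k u = (LB v. \<psi> (u, v) * cnj (hl k v))" for k u
 have a: "a k \<in> L2b" for k unfolding a_def[abs_def] by (rule adjoint_slice(1)[OF hl_L2s \<psi>])
 \<comment> \<open>\<open>a k\<close> lives on the whole plane while \<open>R0\<close> sees only x2
   > 0; the truncation is the representative that vanishes elsewhere.\<close>
 define ab where "ab k u = indicator RRp u * a k u" for k u
 have ab: "ab k \<in> L2b" for k
  unfolding ab_def[abs_def] by (rule L2s_bounded_mult[OF a, where C = 1]) (auto simp: indicator_def)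
 have rp: "rep2 (a k) (ab k)" for k unfolding rep2_def rep_def using ab by (auto simp: ab_def indicator_def L2s_def)
 have "a \<in> carr (L2_pow n RRp)" using rep2_L2s[OF rp] ab by (auto simp: L2_pow_sel)
 moreover have "ip (L2 CPi) (R0 n x') \<Psi> = ip (L2_pow n RRp) x' a" if x': "x' \<in> carr (L2_pow n RRp)" for x'
 proof -
  obtain gb where gb: "\<forall>k. gb k \<in> L2b" "\<forall>k<n. rep2 (x' k) (gb k)" using L2_pow_rep[OF x'] by blast
  have "ip (L2 CPi) (R0 n x') \<Psi> = innb (r0 n gb) \<psi>"
   unfolding L2_sel by (rule rep_inn[OF mpiso_J CPi_borel rep_R0 r]) (use gb in auto)
  also have "... = (\<Sum>k<n. innb (tp (gb k) (hl k)) \<psi>)"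
   unfolding r0_def[abs_def] by (rule inn_sum_left) (use gb \<psi> in \<open>auto intro!: tp_L2s hl_L2s\<close>)
  also have "... = (\<Sum>k<n. innb (gb k) (a k))"
   by (intro sum.cong refl) (use gb adjoint_slice(2)[OF hl_L2s \<psi>] in \<open>auto simp: a_def[abs_def]\<close>)
  also have "... = (\<Sum>k<n. innb (gb k) (ab k))"
  proof (intro sum.cong refl)
   fix k assume "k \<in> {..<n}"
   then have "gb k u * cnj (a k u) = gb k u * cnj (ab k u)" for u
    using rep2D(2)[of "x' k" "gb k" u] gb(2) by (cases "0 < snd u") (auto simp: ab_def indicator_def in_RRp)
   then show "innb (gb k) (a k) = innb (gb k) (ab k)" unfolding inn_def by presburger
  qed
  also have "... = ip (L2_pow n RRp) x' a" unfolding L2_pow_sel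
   by (intro sum.cong refl) (use gb(2) rep2_inn[OF _ rp] in auto)
  finally show ?thesis .
 qed
 ultimately show ?thesis by blast
qed

text \<open>Later statements about \<open>U f\<close> go through these data: a representative
  \<open>\<phi>\<close> of \<open>f\<close>, its partial transform \<open>\<Phi>\<close>, and
  \<open>vt \<Phi>\<close> for \<open>U f\<close>. Thus \<open>U1\<close> enters only through the
  relation \<open>FT\<close>.\<close>

lemma U_rep:
 assumes f: "f \<in> L2s (lebesgue_on siegel)"
 shows "\<exists>\<phi> \<Phi>. rep Ks siegel f \<phi> \<and> rep J CPi (U f) (vt \<Phi>) \<and> FT \<phi> \<Phi> \<and> \<phi> \<in> L2b \<and> \<Phi> \<in> L2b \<and>
  U0 f \<in> L2s (lebesgue_on CPi) \<and> rep J CPi (U1 (U0 f)) \<Phi>"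
proof -
 obtain \<phi> where r: "rep Ks siegel f \<phi>" using rep_ex[OF mpiso_Ks siegel_borel] f by (auto simp: L2s_def)
 have \<phi>: "\<phi> \<in> L2b" using rep_L2s_iff[OF mpiso_Ks siegel_borel r] f by blast
 have r1: "rep J CPi (U0 f) \<phi>" by (rule rep_U0[OF r])
 have u0: "U0 f \<in> L2s (lebesgue_on CPi)" using rep_L2s_iff[OF mpiso_J CPi_borel r1] \<phi> by blast
 have u1: "U1 (U0 f) \<in> L2s (lebesgue_on CPi)" by (rule U1_unitary(1)[OF u0])
 obtain \<Phi> where r2: "rep J CPi (U1 (U0 f)) \<Phi>" using rep_ex[OF mpiso_J CPi_borel] u1 by (auto simp: L2s_def)
 have \<Phi>: "\<Phi> \<in> L2b" using rep_L2s_iff[OF mpiso_J CPi_borel r2] u1 by blast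
 have "FT \<phi> \<Phi>" by (rule U1_FT[OF u0 r1 r2])
 moreover have "rep J CPi (U f) (vt \<Phi>)" unfolding U_def by (rule rep_V[OF r2])
 ultimately show ?thesis using r \<phi> \<Phi> u0 r2 by blast
qed

lemma U_carr: "f \<in> L2s (lebesgue_on siegel) ==> U f \<in> L2s (lebesgue_on CPi)"
 using U_rep[of f] rep_L2s_iff[OF mpiso_J CPi_borel] vt_L2s_iff by (metis L2sD(1) measurable_lborel2)

lemma U_iso:
 assumes f: "f \<in> L2s (lebesgue_on siegel)" and g: "g \<in> L2s (lebesgue_on siegel)"
 shows "inn (lebesgue_on CPi) (U f) (U g) = inn (lebesgue_on siegel) f g"
proof -
 obtain \<phi> \<Phi> where 1: "rep Ks siegel f \<phi>" "rep J CPi (U f) (vt \<Phi>)" "FT \<phi> \<Phi>" "\<phi> \<in> L2b" "\<Phi> \<in> L2b" using U_rep[OF f] by blast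
 obtain \<phi>' \<Phi>' where 2: "rep Ks siegel g \<phi>'" "rep J CPi (U g) (vt \<Phi>')" "FT \<phi>' \<Phi>'" "\<phi>' \<in> L2b" "\<Phi>' \<in> L2b" using U_rep[OF g] by blast
 have "inn (lebesgue_on CPi) (U f) (U g) = innb (vt \<Phi>) (vt \<Phi>')" by (rule rep_inn[OF mpiso_J CPi_borel 1(2) 2(2)])
 also have "... = innb \<Phi> \<Phi>'" by (rule inn_vt) (use 1 2 in \<open>auto simp: L2s_def\<close>)
 also have "... = innb \<phi> \<phi>'" by (rule FT_iso) (use 1 2 in auto)
 also have "... = inn (lebesgue_on siegel) f g" by (rule rep_inn[OF mpiso_Ks siegel_borel 1(1) 2(1), symmetric])
 finally show ?thesis .
qed

text \<open>No measurability of \<open>c\<close> is assumed. Its Borel version is a slice of a Borel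
  representative of \<open>c_tilde\<close>: in the chart \<open>c_tilde\<close> does not depend on
  u, so almost every fixed u serves.\<close>

lemma nilpotent_symbol_borel:
 assumes L: "c_tilde \<in> Linf siegel"
  and eq: "!!zeta1 zeta2. (zeta1, zeta2) \<in> siegel ==> c_tilde (zeta1, zeta2) = c (Im zeta1, Im zeta2 - (cmod zeta1)\<^sup>2)"
 shows "\<exists>cb C. cb \<in> BM \<and> (\<forall>v. cmod (cb v) \<le> C) \<and> (AB v. 0 < snd v --> c v = cb v)"
proof -
 have cm: "c_tilde \<in> borel_measurable (lebesgue_on siegel)" using L by (auto simp: Linf_def)
 obtain C where C: "AE x in lebesgue_on siegel. cmod (c_tilde x) \<le> C" using L by (auto simp: Linf_def)
 obtain h where h: "rep Ks siegel c_tilde h" using rep_ex[OF mpiso_Ks siegel_borel cm] by blast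
 then have hm[measurable]: "h \<in> BM" by (simp add: rep_def)
 have ck: "c_tilde (Ks x) = c (snd x)" if "0 < ss x" for x
 proof -
  have "Ks x \<in> siegel" using that by (simp add: Ks_siegel)
  then show ?thesis using eq[of "fst (Ks x)" "snd (Ks x)"] by (simp add: Ks_def J_def kappa_def)
 qed
 have "AB x. Ks x \<in> siegel --> cmod (c_tilde (Ks x)) \<le> C" using C unfolding chart_AE_iff[OF mpiso_Ks siegel_borel] .
 moreover have "AB x. Ks x \<in> siegel --> c_tilde (Ks x) = h x" using h by (simp add: rep_def)
 ultimately have "AB x. 0 < ss x --> c (snd x) = h x \<and> cmod (h x) \<le> C"
  by eventually_elim (auto simp: Ks_siegel ck)
 then have "AE x in lborel \<Otimes>\<^sub>M lborel. 0 < ss x --> c (snd x) = h x \<and> cmod (h x) \<le> C" unfolding lborel_prod .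
 from lborel_pair.AE_pair[OF this]
 have "AB u. AB v. 0 < snd v --> c v = h (u, v) \<and> cmod (h (u, v)) \<le> C" by simp
 moreover have "ae_filter (lborel :: (real \<times> real) measure) \<noteq> bot" by (simp add: ae_filter_eq_bot_iff)
 ultimately have "\<exists>u. AB v. 0 < snd v --> c v = h (u, v) \<and> cmod (h (u, v)) \<le> C"
  by (intro eventually_happens')
 then obtain u where u: "AB v. 0 < snd v --> c v = h (u, v) \<and> cmod (h (u, v)) \<le> C" by (elim exE) (rule that)
 show ?thesis
 proof (intro exI conjI allI)
  \<comment> \<open>Truncation turns the essential bound into a bound at every point; nothing
    prevents \<open>C\<close> from being negative, whence the absolute value.\<close>
  let ?cb = "%v. if cmod (h (u, v)) \<le> \<bar>C\<bar> then h (u, v) else 0"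
  show "?cb \<in> BM" by measurable
  show "cmod (?cb v) \<le> \<bar>C\<bar>" for v by auto
  show "AB v. 0 < snd v --> c v = ?cb v" using u by eventually_elim auto
 qed
qed

lemma AE_affine:
 fixes P :: "real => bool"
 assumes "AB y. P y" "c \<noteq> 0"
 shows "AB y. P (t + c * y)"
proof -
 have "AE y in density (distr lborel borel (%x. t + c * x)) (%_. \<bar>c\<bar>). P y"
  by (subst lborel_real_affine[OF assms(2), of t, symmetric]) (rule assms(1))
 then have "AE y in distr lborel borel (%x. t + c * x). P y"
  by (subst (asm) AE_density) (use assms(2) in auto)
 then show ?thesis by (rule AE_distrD[rotated]) measurable
qed

section \<open>The matrix-valued function in coordinates\<close>

definition hll :: "nat => nat => real \<times> real => complex" where "hll j k v = hl k v * cnj (hl j v)"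

lemma hll_integrable: "intg (hll j k)"
 unfolding hll_def[abs_def] by (rule L2s_integrable_inn[OF hl_L2s hl_L2s])

text \<open>With u = (x1, x2), x2 > 0, and v = (y1, y2), the second component of
  \<open>rr (u, v)\<close> is the argument of \<open>c\<close> in \<open>gamma_c\<close>. A Borel
  \<open>cb\<close> makes this a single integral over the plane.\<close>

definition gam :: "(real \<times> real => complex) => nat => nat => real \<times> real => complex" where
 "gam cb j k u = (LB v. cb (snd (rr (u, v))) * hll j k v)"

lemma gam_measurable[measurable]:
 assumes [measurable]: "cb \<in> BM"
 shows "gam cb j k \<in> BM"
proof -
 have [measurable]: "hll j k \<in> BM" using hll_integrable[of j k] by auto
 have "gam cb j k \<in> borel_measurable lborel" unfolding gam_def[abs_def]
  by (rule lborel.borel_measurable_lebesgue_integral) (simp add: case_prod_beta' lborel_prod)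
 then show ?thesis by simp
qed

lemma gam_bound:
 assumes cb: "!!v. cmod (cb v) \<le> C"
 shows "cmod (gam cb j k u) \<le> C * (LB v. cmod (hll j k v))"
proof -
 have C: "0 \<le> C" using cb norm_ge_zero order_trans by blast
 show ?thesis
 proof (cases "intg (%v. cb (snd (rr (u, v))) * hll j k v)")
  case True
  have "cmod (gam cb j k u) \<le> (LB v. cmod (cb (snd (rr (u, v))) * hll j k v))"
   unfolding gam_def by (rule integral_norm_bound)
  also have "... \<le> (LB v. C * cmod (hll j k v))"
   by (rule integral_mono[OF integrable_norm[OF True] integrable_mult_right[OF integrable_norm[OF hll_integrable]]])
    (simp add: norm_mult mult_right_mono cb)
  finally show ?thesis by simp
 next
  case False
  then have "gam cb j k u = 0" by (simp add: gam_def not_integrable_integral_eq)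
  then show ?thesis using C by (simp add: integral_nonneg_AE)
 qed
qed

text \<open>\<open>gamma_c\<close> is an iterated Lebesgue integral of a function that is Borel only
  up to null sets. Affine substitutions preserve null sets in each variable, so \<open>c\<close> may
  be replaced by \<open>cb\<close> in both integrals before Fubini is applied.\<close>

lemma gamma_c_eq:
 assumes cb[measurable]: "cb \<in> BM" and b: "!!v. cmod (cb v) \<le> C"
  and ae: "AB v. 0 < snd v --> c v = cb v" and x: "0 < snd u"
 shows "gamma_c c u j k = gam cb j k u"
proof -
 obtain x1 x2 where u: "u = (x1, x2)" by (cases u)
 have x2: "x2 > 0" using x u by simp
 define s where "s = sqrt x2"
 have s: "s > 0" using x2 by (simp add: s_def)
 have "AE v in lborel \<Otimes>\<^sub>M lborel. 0 < snd v --> c v = cb v" using ae unfolding lborel_prod .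
 from lborel_pair.AE_pair[OF this] have "AB p. AB q. 0 < q --> c (p, q) = cb (p, q)" by simp
 from AE_affine[OF this, of "1 / (2 * s)" "- x1 / (2 * s)"] s
 have "AB p. AB q. 0 < q --> c ((- x1 + p) / (2 * s), q) = cb ((- x1 + p) / (2 * s), q)"
  by (simp add: diff_divide_distrib)
 then have ae2: "AB p. AB q. 0 < q --> c ((- x1 + p) / (2 * s), q / (2 * x2)) = cb ((- x1 + p) / (2 * s), q / (2 * x2))"
 proof eventually_elim
  case (elim p)
  from AE_affine[OF this, of "1 / (2 * x2)" 0] x2 show ?case by (simp add: zero_less_divide_iff)
 qed
 define w where "w p q = cr ((hermite_fun 0 p)\<^sup>2 * (laguerre_fun j q * laguerre_fun k q))" for p q
 have hw: "hll j k (p, q) = indicator {0<..} q * w p q" for p q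
  by (auto simp: hll_def hl_def tp_def h0_def lgp_def w_def power2_eq_square indicator_def)
 have [measurable]: "hll j k \<in> BM" using hll_integrable[of j k] by auto
 define F where "F p q = cb ((- x1 + p) / (2 * s), q / (2 * x2)) * hll j k (p, q)" for p q
 have Fm[measurable]: "(%v. F (fst v) (snd v)) \<in> BM" unfolding F_def by measurable
 have iF: "integrable (lborel \<Otimes>\<^sub>M lborel) (%v. F (fst v) (snd v))"
 proof -
  have "intg (%v. hll j k v * cb ((- x1 + fst v) / (2 * s), snd v / (2 * x2)))"
   by (rule integrable_bounded_mult[OF hll_integrable _ b]) measurable
  then show ?thesis by (simp add: F_def lborel_prod mult.commute)
 qed
 have Fp[measurable]: "F p \<in> BM" for p unfolding F_def by measurable
 have inner: "AB p. (LINT q|lebesgue_on {0<..}. c ((- x1 + p) / (2 * s), q / (2 * x2)) * w p q) = (LB q. F p q)"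
  using ae2
 proof eventually_elim
  case (elim p)
  have r: "rep (%x. x) {0<..} (%q. c ((- x1 + p) / (2 * s), q / (2 * x2)) * w p q) (F p)"
   unfolding rep_def using elim by (auto simp: F_def hw elim!: eventually_mono)
  show ?case by (rule rep_integral_gen(1)[OF mpiso_id _ rep_measurable[OF mpiso_id _ r]]) (use r in \<open>auto simp: rep_def\<close>)
 qed
 have Im[measurable]: "(%p. LB q. F p q) \<in> BM"
 proof -
  have "(%p. LB q. F p q) \<in> borel_measurable lborel"
   by (rule lborel.borel_measurable_lebesgue_integral) (simp add: case_prod_beta' lborel_prod)
  then show ?thesis by simp
 qed
 have r: "rep (%x. x) UNIV (%p. LINT q|lebesgue_on {0<..}. c ((- x1 + p) / (2 * s), q / (2 * x2)) * w p q) (%p. LB q. F p q)"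
  using inner by (auto simp: rep_def)
 have "gamma_c c u j k = (LINT p|lebesgue_on UNIV. LINT q|lebesgue_on {0<..}. c ((- x1 + p) / (2 * s), q / (2 * x2)) * w p q)"
  by (simp add: gamma_c_def u s_def w_def lebesgue_on_UNIV_eq)
 also have "... = (LB p. LB q. F p q)"
  by (rule rep_integral_gen(1)[OF mpiso_id _ rep_measurable[OF mpiso_id _ r]]) (use r in \<open>auto simp: rep_def\<close>)
 also have "... = (LB v. F (fst v) (snd v))"
  using lborel_pair.integral_fst'[OF iF] by (simp add: lborel_prod)
 also have "... = gam cb j k u"
  unfolding gam_def F_def by (intro int_cong refl) (use x2 in \<open>simp add: rr_def Let_def u s_def\<close>)
 finally show ?thesis .
qed

lemma rep2_mult_op:
 assumes cb: "cb \<in> BM" and b: "!!v. cmod (cb v) \<le> C"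
  and ae: "AB v. 0 < snd v --> c v = cb v" and g: "!!k. k < n ==> rep2 (g k) (gb k)"
 shows "rep2 (mult_op n (gamma_c c) g j) (%u. \<Sum>k<n. gam cb j k u * gb k u)"
proof -
 have "AB u. \<forall>k\<in>{..<n}. 0 < snd u --> g k u = gb k u"
  by (intro AE_finite_allI) (use rep2D(3)[OF g] in auto)
 then have "AB u. u \<in> RRp --> mult_op n (gamma_c c) g j u = (\<Sum>k<n. gam cb j k u * gb k u)"
  by eventually_elim (auto simp: mult_op_def in_RRp gamma_c_eq[OF cb b ae] intro!: sum.cong)
 moreover have "(%u. \<Sum>k<n. gam cb j k u * gb k u) \<in> BM"
  using rep2D(1)[OF g] gam_measurable[OF cb] by (intro borel_measurable_sum borel_measurable_times) auto
 moreover have "(\<Sum>k<n. gam cb j k u * gb k u) = 0" if "u \<notin> RRp" for u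
  using rep2D(2)[OF g] that by (auto simp: in_RRp not_less intro!: sum.neutral)
 ultimately show ?thesis unfolding rep2_def rep_def by auto
qed

lemma gam_mult1_L2s:
 assumes cb: "cb \<in> BM" and b: "!!v. cmod (cb v) \<le> C" and f: "f \<in> L2b"
 shows "(%u. gam cb j k u * f u) \<in> L2b"
proof (rule L2s_bounded_mult[OF f])
 show "gam cb j k \<in> borel_measurable lborel" using gam_measurable[OF cb] by simp
 show "AB u. cmod (gam cb j k u) \<le> C * (LB v. cmod (hll j k v))"
  by (intro AE_I2 gam_bound[OF b])
qed

lemma gam_mult_L2s:
 assumes cb: "cb \<in> BM" and b: "!!v. cmod (cb v) \<le> C" and g: "!!k. k < n ==> gb k \<in> L2b"
 shows "(%u. \<Sum>k<n. gam cb j k u * gb k u) \<in> L2b"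
proof (rule L2s_sum)
 fix k assume "k \<in> {..<n}"
 then show "(%u. gam cb j k u * gb k u) \<in> L2b"
  by (intro gam_mult1_L2s[OF cb b g]) auto
qed

text \<open>\<open>FT_mult\<close> moves the symbol across the transform and \<open>vt\<close>
  composes it with \<open>rr\<close>. On the range of \<open>R0\<close> the compression then pairs
  \<open>cb (snd (rr x))\<close> with the products \<open>hl k * cnj (hl j)\<close>, and integrating
  these over v yields \<open>gam\<close>.\<close>

lemma Mkey:
 assumes cb[measurable]: "cb \<in> BM" and b: "!!v. cmod (cb v) \<le> C"
  and ct: "c_tilde \<in> borel_measurable (lebesgue_on siegel)"
  and ctk: "AB x. 0 < ss x --> c_tilde (Ks x) = cb (snd x)"
  and ae: "AB v. 0 < snd v --> c v = cb v"
  and f: "f \<in> L2s (lebesgue_on siegel)" "g \<in> carr (L2_pow n RRp)" "AE z in lebesgue_on CPi. U f z = R0 n g z"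
  and f': "f' \<in> L2s (lebesgue_on siegel)" "g' \<in> carr (L2_pow n RRp)" "AE z in lebesgue_on CPi. U f' z = R0 n g' z"
 shows "(%zeta. c_tilde zeta * f zeta) \<in> L2s (lebesgue_on siegel)"
  "inn (lebesgue_on siegel) (%zeta. c_tilde zeta * f zeta) f' = ip (L2_pow n RRp) (mult_op n (gamma_c c) g) g'"
  "mult_op n (gamma_c c) g \<in> carr (L2_pow n RRp)"
proof -
 obtain \<phi> \<Phi> where 1: "rep Ks siegel f \<phi>" "rep J CPi (U f) (vt \<Phi>)" "FT \<phi> \<Phi>" "\<phi> \<in> L2b" "\<Phi> \<in> L2b" using U_rep[OF f(1)] by blast
 obtain \<phi>' \<Phi>' where 2: "rep Ks siegel f' \<phi>'" "rep J CPi (U f') (vt \<Phi>')" "FT \<phi>' \<Phi>'" "\<phi>' \<in> L2b" "\<Phi>' \<in> L2b" using U_rep[OF f'(1)] by blast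
 obtain gb where gb: "\<forall>k. gb k \<in> L2b" "\<forall>k<n. rep2 (g k) (gb k)" using L2_pow_rep[OF f(2)] by blast
 obtain gb' where gb': "\<forall>k. gb' k \<in> L2b" "\<forall>k<n. rep2 (g' k) (gb' k)" using L2_pow_rep[OF f'(2)] by blast
 have [measurable]: "\<phi> \<in> BM" "\<Phi> \<in> BM" "\<phi>' \<in> BM" "\<Phi>' \<in> BM"
  using 1 2 by (auto simp: L2s_def)
 have gbm[measurable]: "gb k \<in> BM" "gb' k \<in> BM" for k using gb gb' by (auto simp: L2s_def)
 have r0m[measurable]: "r0 n gb \<in> BM" "r0 n gb' \<in> BM"
  unfolding r0_def[abs_def] by measurable
 have rm: "rep Ks siegel (%zeta. c_tilde zeta * f zeta) (%x. cb (snd x) * \<phi> x)"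
 proof -
  have "AB x. Ks x \<in> siegel --> f (Ks x) = \<phi> x" using 1(1) by (simp add: rep_def)
  with ctk have "AB x. Ks x \<in> siegel --> c_tilde (Ks x) * f (Ks x) = cb (snd x) * \<phi> x"
   by eventually_elim (auto simp: Ks_siegel)
  then show ?thesis using 1(1) unfolding rep_def by auto
 qed
 have m2: "(%x. cb (snd x) * \<phi> x) \<in> L2b" "(%x. cb (snd x) * \<Phi> x) \<in> L2b"
  by (rule L2s_bounded_mult[where C = C]; use 1 b in auto)+
 show "(%zeta. c_tilde zeta * f zeta) \<in> L2s (lebesgue_on siegel)" using rep_L2s_iff[OF mpiso_Ks siegel_borel rm] m2 by blast
 have FTm: "FT (%x. cb (snd x) * \<phi> x) (%x. cb (snd x) * \<Phi> x)" by (rule FT_mult[OF 1(4,5,3) cb b])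
 have e1: "AB x. vt \<Phi> x = r0 n gb x"
  using rep_AE_iff[OF mpiso_J CPi_borel 1(2) rep_R0[of n g gb]] gb f(3) by auto
 have e2: "AB x. vt \<Phi>' x = r0 n gb' x"
  using rep_AE_iff[OF mpiso_J CPi_borel 2(2) rep_R0[of n g' gb']] gb' f'(3) by auto
 let ?m = "%x. cb (snd (rr x))"
 have vm: "vt (%x. cb (snd x) * \<Phi> x) x = ?m x * vt \<Phi> x" for x by (simp add: vt_def)
 have ml: "(%x. ?m x * tp (gb k) (hl k) x) \<in> L2b" for k
  by (rule L2s_bounded_mult[where C = C]) (use gb b in \<open>auto intro!: tp_L2s hl_L2s\<close>)
 have mk: "rep2 (mult_op n (gamma_c c) g j) (%u. \<Sum>k<n. gam cb j k u * gb k u)" for j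
  by (rule rep2_mult_op[OF cb b ae]) (use gb in auto)
 show "mult_op n (gamma_c c) g \<in> carr (L2_pow n RRp)"
  using rep2_L2s[OF mk] gam_mult_L2s[OF cb b, of n gb] gb by (auto simp: L2_pow_sel)
 have tm: "innb (%x. ?m x * tp (gb k) (hl k) x) (tp (gb' j) (hl j)) = innb (%u. gam cb j k u * gb k u) (gb' j)" for j k
 proof -
  have i: "integrable (lborel \<Otimes>\<^sub>M lborel) (%x. ?m x * tp (gb k) (hl k) x * cnj (tp (gb' j) (hl j) x))"
   using L2s_integrable_inn[OF ml, of "tp (gb' j) (hl j)"] gb' by (simp add: lborel_prod tp_L2s hl_L2s)
  have "innb (%x. ?m x * tp (gb k) (hl k) x) (tp (gb' j) (hl j)) =
   (LB u. LB v. ?m (u, v) * tp (gb k) (hl k) (u, v) * cnj (tp (gb' j) (hl j) (u, v)))"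
   using lborel_pair.integral_fst'[OF i] by (simp add: inn_def lborel_prod)
  also have "... = (LB u. LB v. (gb k u * cnj (gb' j u)) * (?m (u, v) * hll j k v))"
   by (simp add: tp_def hll_def mult_ac)
  also have "... = (LB u. gam cb j k u * gb k u * cnj (gb' j u))"
   unfolding integral_mult_right_zero by (simp add: gam_def mult_ac)
  finally show ?thesis by (simp add: inn_def)
 qed
 have "inn (lebesgue_on siegel) (%zeta. c_tilde zeta * f zeta) f' = innb (%x. cb (snd x) * \<phi> x) \<phi>'"
  by (rule rep_inn[OF mpiso_Ks siegel_borel rm 2(1)])
 also have "... = innb (%x. cb (snd x) * \<Phi> x) \<Phi>'" by (rule FT_iso[symmetric]) (use m2 FTm 2 in auto)
 also have "... = innb (vt (%x. cb (snd x) * \<Phi> x)) (vt \<Phi>')" by (rule inn_vt[symmetric]) measurable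
 also have "... = innb (%x. ?m x * r0 n gb x) (r0 n gb')"
  by (rule inn_cong_AE) (use e1 e2 in \<open>auto simp: vm elim: eventually_mono\<close>)
 also have "... = innb (%x. \<Sum>k<n. ?m x * tp (gb k) (hl k) x) (r0 n gb')" by (simp add: r0_def[of n gb] sum_distrib_left)
 also have "... = (\<Sum>k<n. innb (%x. ?m x * tp (gb k) (hl k) x) (r0 n gb'))"
  by (rule inn_sum_left) (use ml gb' in \<open>auto intro!: r0_L2s\<close>)
 also have "... = (\<Sum>k<n. \<Sum>j<n. innb (%x. ?m x * tp (gb k) (hl k) x) (tp (gb' j) (hl j)))"
  unfolding r0_def[of n gb', abs_def] by (intro sum.cong refl inn_sum_right) (use ml gb' in \<open>auto intro!: tp_L2s hl_L2s\<close>)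
 also have "... = (\<Sum>j<n. \<Sum>k<n. innb (%u. gam cb j k u * gb k u) (gb' j))" unfolding tm by (rule sum.swap)
 also have "... = (\<Sum>j<n. innb (%u. \<Sum>k<n. gam cb j k u * gb k u) (gb' j))"
 proof (intro sum.cong refl inn_sum_left[symmetric])
  show "(%u. gam cb j k u * gb k u) \<in> L2b" for j k
   by (rule gam_mult1_L2s[OF cb b]) (use gb in auto)
 qed (use gb' in auto)
 also have "... = ip (L2_pow n RRp) (mult_op n (gamma_c c) g) g'" unfolding L2_pow_sel
  by (intro sum.cong refl rep2_inn[symmetric] mk) (use gb' in auto)
 finally show "inn (lebesgue_on siegel) (%zeta. c_tilde zeta * f zeta) f' = ip (L2_pow n RRp) (mult_op n (gamma_c c) g) g'" .
qed

section \<open>From the range of \<open>U\<close> to the Toeplitz operator\<close>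

lemma poly_bergman_sel: "carr (poly_bergman 1 n) \<subseteq> L2s (lebesgue_on siegel)" "ip (poly_bergman 1 n) = inn (lebesgue_on siegel)"
 "eqv (poly_bergman 1 n) f g \<longleftrightarrow> (AE x in lebesgue_on siegel. f x = g x)"
 by (auto simp: poly_bergman_def L2_def L2s_def inn_def fun_eq_iff)

text \<open>The analytic content is confined to \<open>A\<close> and \<open>B\<close>:
  \<open>U\<close> maps the poly-Bergman-type space into the range of \<open>R0\<close>, and all of
  that range is reached. What remains is Hilbert space argument, in which the projection,
  \<open>R\<close> and \<open>R_star\<close> are choices that each need a witness.\<close>

lemma toeplitz_diagonalization:
 fixes n :: nat and c :: "real \<times> real => complex" and c_tilde :: "complex \<times> complex => complex"
 assumes ct: "c_tilde \<in> Linf siegel"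
  and ceq: "!!zeta1 zeta2. (zeta1, zeta2) \<in> siegel ==> c_tilde (zeta1, zeta2) = c (Im zeta1, Im zeta2 - (cmod zeta1)\<^sup>2)"
  and A: "!!f. f \<in> carr (poly_bergman 1 n) ==> \<exists>g\<in>carr (L2_pow n RRp). AE z in lebesgue_on CPi. U f z = R0 n g z"
  and B: "!!g. g \<in> carr (L2_pow n RRp) ==> \<exists>f\<in>carr (poly_bergman 1 n). AE z in lebesgue_on CPi. U f z = R0 n g z"
 shows "unitarily_equivalent (poly_bergman 1 n) (toeplitz n c_tilde)
     (L2_pow n RRp) (mult_op n (gamma_c c)) \<and>
    (\<forall>g\<in>carr (L2_pow n RRp).
     eqv (L2_pow n RRp) (mult_op n (gamma_c c) g)
      (R n (toeplitz n c_tilde (R_star n g))))"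
proof -
 let ?A2 = "carr (poly_bergman 1 n)" and ?X = "L2s (lebesgue_on siegel)" and ?P = "carr (L2_pow n RRp)"
 let ?S = "lebesgue_on siegel" and ?C = "lebesgue_on CPi" and ?ip = "ip (L2_pow n RRp)" and ?eq = "eqv (L2_pow n RRp)"
 let ?G = "mult_op n (gamma_c c)"
 have sub: "f \<in> ?X" if "f \<in> ?A2" for f using that poly_bergman_sel(1) by blast
 obtain cb C where cb: "cb \<in> BM" "!!v. cmod (cb v) \<le> C" "AB v. 0 < snd v --> c v = cb v"
  using nilpotent_symbol_borel[OF ct ceq] by blast
 have ctm: "c_tilde \<in> borel_measurable ?S" using ct by (auto simp: Linf_def)
 have ctk: "AB x. 0 < ss x --> c_tilde (Ks x) = cb (snd x)"
 proof -
  have "c_tilde (Ks x) = c (snd x)" if "0 < ss x" for x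
  proof -
   have "Ks x \<in> siegel" using that by (simp add: Ks_siegel)
   then show ?thesis using ceq[of "fst (Ks x)" "snd (Ks x)"] by (simp add: Ks_def J_def kappa_def)
  qed
  then show ?thesis using AE_lift_snd[OF cb(3)] by (auto elim: eventually_mono)
 qed
 have eq_trans': "?eq g g2" if "?eq g h" "?eq g2 h" for g g2 h
  unfolding L2_pow_sel(3)
 proof (intro allI impI)
  fix k assume "k < n"
  then have "AE x in lebesgue_on RRp. g k x = h k x" "AE x in lebesgue_on RRp. g2 k x = h k x" using that by (auto simp: L2_pow_sel)
  then show "AE x in lebesgue_on RRp. g k x = g2 k x" by eventually_elim simp
 qed
 have eq_trans2: "?eq g g2" if "?eq g h" "?eq h g2" for g g2 h
  unfolding L2_pow_sel(3)
 proof (intro allI impI)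
  fix k assume "k < n"
  then have "AE x in lebesgue_on RRp. g k x = h k x" "AE x in lebesgue_on RRp. h k x = g2 k x" using that by (auto simp: L2_pow_sel)
  then show "AE x in lebesgue_on RRp. g k x = g2 k x" by eventually_elim simp
 qed
 have congR: "inn ?C a b = inn ?C a' b'" if "a \<in> L2s ?C" "a' \<in> L2s ?C" "b \<in> L2s ?C" "b' \<in> L2s ?C"
  "AE z in ?C. a z = a' z" "AE z in ?C. b z = b' z" for a a' b b'
  using that by (intro inn_cong_AE) (auto dest: L2sD(1))
 have key: "inn ?S f f' = ?ip g g'" if "f \<in> ?X" "f' \<in> ?X" "g \<in> ?P" "g' \<in> ?P" "AE z in ?C. U f z = R0 n g z" "AE z in ?C. U f' z = R0 n g' z" for f f' g g'
 proof -
  have "inn ?S f f' = inn ?C (U f) (U f')" by (rule U_iso[symmetric]) (use that in auto)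
  also have "... = inn ?C (R0 n g) (R0 n g')" by (rule congR) (use that in \<open>auto intro: U_carr R0_carr\<close>)
  also have "... = ?ip g g'" by (rule R0_iso) (use that in auto)
  finally show ?thesis .
 qed
 have Rad: "R n f \<in> ?P" "g' \<in> ?P ==> inn ?C (R0 n g') (U f) = ?ip g' (R n f)" if f: "f \<in> ?X" for f g'
 proof -
  have "R n f \<in> ?P \<and> (\<forall>x'\<in>?P. ip (L2 CPi) (R0 n x') (U f) = ?ip x' (R n f))"
   unfolding R_def adj_def by (rule someI_ex[OF R0_adjoint_ex[OF U_carr[OF f]]])
  then show "R n f \<in> ?P" "g' \<in> ?P ==> inn ?C (R0 n g') (U f) = ?ip g' (R n f)" by (auto simp: L2_sel)
 qed
 have R2: "?eq (R n f) g" if f: "f \<in> ?X" and g: "g \<in> ?P" and e: "AE z in ?C. U f z = R0 n g z" for f g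
 proof (rule L2_pow_eqI[OF Rad(1)[OF f] g])
  fix g' assume g': "g' \<in> ?P"
  have "?ip g' (R n f) = inn ?C (R0 n g') (U f)" using Rad(2)[OF f g'] ..
  also have "... = inn ?C (R0 n g') (R0 n g)" by (rule congR) (use f g g' e in \<open>auto intro: U_carr R0_carr\<close>)
  also have "... = ?ip g' g" by (rule R0_iso[OF g' g])
  finally have "cnj (?ip g' (R n f)) = cnj (?ip g' g)" by simp
  then show "?ip (R n f) g' = ?ip g g'" unfolding ip_pow_cnj .
 qed
 have Mk: "(%zeta. c_tilde zeta * f zeta) \<in> ?X" "inn ?S (%zeta. c_tilde zeta * f zeta) f' = ?ip (?G g) g'" "?G g \<in> ?P"
  if "f \<in> ?X" "f' \<in> ?X" "g \<in> ?P" "g' \<in> ?P" "AE z in ?C. U f z = R0 n g z" "AE z in ?C. U f' z = R0 n g' z" for f f' g g'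
  using Mkey[OF cb(1,2) ctm ctk cb(3) that(1,3,5) that(2,4,6)] by auto
 have Gc: "?G g \<in> ?P" if g: "g \<in> ?P" for g
 proof -
  obtain f where "f \<in> ?A2" "AE z in ?C. U f z = R0 n g z" using B[OF g] by blast
  then show ?thesis using Mk(3)[of f f g g] sub g by auto
 qed
 \<comment> \<open>\<open>h\<close> agrees with an element \<open>f\<close> of the space only almost
   everywhere: \<open>R_star n g\<close> is chosen in all of L2 and need not be smooth
   itself.\<close>
 have T: "toeplitz n c_tilde h \<in> ?A2" "?eq (R n (toeplitz n c_tilde h)) (?G g)"
  if h: "h \<in> ?X" and f: "f \<in> ?A2" and hf: "AE z in ?S. h z = f z" and g: "g \<in> ?P" and e: "AE z in ?C. U f z = R0 n g z" for h f g
 proof -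
  let ?ch = "%zeta. c_tilde zeta * h zeta"
  have fX: "f \<in> ?X" using f sub by blast
  have cfX: "(%zeta. c_tilde zeta * f zeta) \<in> ?X" by (rule Mk(1)[OF fX fX g g e e])
  have chm: "?ch \<in> borel_measurable ?S" using ctm h by (auto simp: L2s_def)
  have chf: "AE z in ?S. ?ch z = c_tilde z * f z" using hf by eventually_elim simp
  have chX: "?ch \<in> ?X"
  proof (rule L2s_bound[OF chm])
   show "integrable ?S (%x. (cmod (c_tilde x * f x))^2)" using cfX by (auto simp: L2s_def)
   show "AE x in ?S. (cmod (?ch x))^2 \<le> (cmod (c_tilde x * f x))^2"
    using chf by (rule eventually_mono) (simp only: order_refl)
  qed
  have chq: "inn ?S ?ch q = ?ip (?G g) gq" if "q \<in> ?A2" "gq \<in> ?P" "AE z in ?C. U q z = R0 n gq z" for q gq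
  proof -
   have "inn ?S ?ch q = inn ?S (%zeta. c_tilde zeta * f zeta) q"
    by (rule inn_cong_AE) (use chX cfX chf sub[OF that(1)] in \<open>auto dest: L2sD(1)\<close>)
   also have "... = ?ip (?G g) gq" by (rule Mk(2)) (use fX sub that g e in auto)
   finally show ?thesis .
  qed
  \<comment> \<open>The witness for the projection is the element that \<open>U\<close> sends to
    \<open>R0 n (?G g)\<close>; its pairings with the space are those of the multiplied
    function.\<close>
  obtain p0 where p0: "p0 \<in> ?A2" "AE z in ?C. U p0 z = R0 n (?G g) z" using B[OF Gc[OF g]] by blast
  have pd: "inn ?S (%x. ?ch x - p x) q = inn ?S ?ch q - inn ?S p q" if "p \<in> ?A2" "q \<in> ?A2" for p q
   by (rule inn_diff_left[OF chX sub sub]) (use that in auto)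
  have ex: "\<exists>p. p \<in> ?A2 \<and> (\<forall>q\<in>?A2. ip (L2 siegel) (%x. ?ch x - p x) q = 0)"
  proof (intro exI[of _ p0] conjI ballI p0(1))
   fix q assume q: "q \<in> ?A2"
   obtain gq where gq: "gq \<in> ?P" "AE z in ?C. U q z = R0 n gq z" using A[OF q] by blast
   have "inn ?S p0 q = ?ip (?G g) gq" by (rule key) (use sub p0 q gq Gc[OF g] in auto)
   then show "ip (L2 siegel) (%x. ?ch x - p0 x) q = 0" unfolding L2_sel using pd[OF p0(1) q] chq[OF q gq] by simp
  qed
  define p where "p = toeplitz n c_tilde h"
  have p: "p \<in> ?A2 \<and> (\<forall>q\<in>?A2. ip (L2 siegel) (%x. ?ch x - p x) q = 0)"
   unfolding p_def toeplitz_def bergman_proj_def orth_proj_def by (rule someI_ex[OF ex])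
  then show "toeplitz n c_tilde h \<in> ?A2" by (simp add: p_def)
  have pX: "p \<in> ?X" using p sub by blast
  obtain gp where gp: "gp \<in> ?P" "AE z in ?C. U p z = R0 n gp z" using A[of p] p by blast
  have "?eq (R n p) gp" by (rule R2[OF pX gp])
  moreover have "?eq gp (?G g)"
  proof (rule L2_pow_eqI[OF gp(1) Gc[OF g]])
   fix g' assume g': "g' \<in> ?P"
   obtain q where q: "q \<in> ?A2" "AE z in ?C. U q z = R0 n g' z" using B[OF g'] by blast
   have "?ip gp g' = inn ?S p q" by (rule key[symmetric]) (use pX sub q gp g' in auto)
   also have "... = inn ?S ?ch q" using pd[of p q] p q unfolding L2_sel by auto
   also have "... = ?ip (?G g) g'" by (rule chq[OF q(1) g' q(2)])
   finally show "?ip gp g' = ?ip (?G g) g'" .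
  qed
  ultimately show "?eq (R n (toeplitz n c_tilde h)) (?G g)"
   unfolding p_def[symmetric] by (rule eq_trans2)
 qed
 have Rs: "\<exists>f\<in>?A2. (AE z in ?C. U f z = R0 n g z) \<and> R_star n g \<in> ?X \<and> (AE z in ?S. R_star n g z = f z)" if g: "g \<in> ?P" for g
 proof -
  obtain f where f: "f \<in> ?A2" "AE z in ?C. U f z = R0 n g z" using B[OF g] by blast
  have fX: "f \<in> ?X" using f sub by blast
  have adjf: "?ip (R n x') g = inn ?S x' f" if x': "x' \<in> ?X" for x'
  proof -
   have "?ip (R n x') g = cnj (?ip g (R n x'))" by (simp add: ip_pow_cnj)
   also have "... = cnj (inn ?C (R0 n g) (U x'))" using Rad(2)[OF x' g] by simp
   also have "... = inn ?C (U x') (R0 n g)" by (rule inn_cnj)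
   also have "... = inn ?C (U x') (U f)" by (rule congR) (use x' fX g f(2) in \<open>auto intro: U_carr R0_carr elim: eventually_mono\<close>)
   also have "... = inn ?S x' f" by (rule U_iso[OF x' fX])
   finally show ?thesis .
  qed
  have exf: "\<exists>y. y \<in> carr (L2 siegel) \<and> (\<forall>x'\<in>carr (L2 siegel). ?ip (R n x') g = ip (L2 siegel) x' y)"
   using fX adjf by (auto simp: L2_sel)
  have "R_star n g \<in> carr (L2 siegel) \<and> (\<forall>x'\<in>carr (L2 siegel). ?ip (R n x') g = ip (L2 siegel) x' (R_star n g))"
   unfolding R_star_def adj_def by (rule someI_ex[OF exf])
  then have r: "R_star n g \<in> ?X" "!!x'. x' \<in> ?X ==> inn ?S x' (R_star n g) = inn ?S x' f" using adjf by (auto simp: L2_sel)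
  have d: "(%x. R_star n g x - f x) \<in> ?X" by (rule L2s_diff[OF r(1) fX])
  have "inn ?S (%x. R_star n g x - f x) (%x. R_star n g x - f x) = 0"
   unfolding inn_diff_right[OF r(1) fX d] using r(2)[OF d] by simp
  then have "n2 ?S (%x. R_star n g x - f x) = 0" unfolding inn_self by simp
  from n2_zeroD[OF d this] have "AE z in ?S. R_star n g z = f z" by simp
  then show ?thesis using f r(1) by blast
 qed
 have Gcong: "?eq (?G g) (?G g')" if "?eq g g'" for g g'
 proof -
  have "AE x in lebesgue_on RRp. \<forall>k\<in>{..<n}. g k x = g' k x"
   by (intro AE_finite_allI) (use that in \<open>auto simp: L2_pow_sel\<close>)
  then show ?thesis unfolding L2_pow_sel(3)
   by (intro allI impI, elim eventually_mono) (auto simp: mult_op_def intro!: sum.cong)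
 qed
 have "unitary_map (poly_bergman 1 n) (L2_pow n RRp) (R n)"
  unfolding unitary_map_def poly_bergman_sel(2)
 proof (intro conjI ballI)
  fix x assume x: "x \<in> ?A2"
  show "R n x \<in> ?P" by (rule Rad(1)[OF sub[OF x]])
  fix x' assume x': "x' \<in> ?A2"
  obtain g where g: "g \<in> ?P" "AE z in ?C. U x z = R0 n g z" using A[OF x] by blast
  obtain g' where g': "g' \<in> ?P" "AE z in ?C. U x' z = R0 n g' z" using A[OF x'] by blast
  have "?ip (R n x) (R n x') = ?ip g g'"
   by (rule ip_pow_cong) (use Rad(1) sub x x' g g' R2 in auto)
  also have "... = inn ?S x x'" by (rule key[symmetric]) (use sub x x' g g' in auto)
  finally show "?ip (R n x) (R n x') = inn ?S x x'" .
 next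
  fix g assume g: "g \<in> ?P"
  obtain f where "f \<in> ?A2" "AE z in ?C. U f z = R0 n g z" using B[OF g] by blast
  then show "\<exists>x\<in>?A2. ?eq (R n x) g" using R2[of f g] sub g by blast
 qed
 moreover have "toeplitz n c_tilde x \<in> ?A2" "?eq (R n (toeplitz n c_tilde x)) (?G (R n x))" if x: "x \<in> ?A2" for x
 proof -
  obtain g where g: "g \<in> ?P" "AE z in ?C. U x z = R0 n g z" using A[OF x] by blast
  show "toeplitz n c_tilde x \<in> ?A2" by (rule T(1)[OF sub[OF x] x _ g]) simp
  have "?eq (R n (toeplitz n c_tilde x)) (?G g)" by (rule T(2)[OF sub[OF x] x _ g]) simp
  moreover have "?eq (?G (R n x)) (?G g)" by (rule Gcong[OF R2[OF sub[OF x] g]])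
  ultimately show "?eq (R n (toeplitz n c_tilde x)) (?G (R n x))"
   by (rule eq_trans')
 qed
 moreover have "?eq (?G g) (R n (toeplitz n c_tilde (R_star n g)))" if g: "g \<in> ?P" for g
 proof -
  obtain f where f: "f \<in> ?A2" "AE z in ?C. U f z = R0 n g z" "R_star n g \<in> ?X" "AE z in ?S. R_star n g z = f z" using Rs[OF g] by blast
  have "?eq (R n (toeplitz n c_tilde (R_star n g))) (?G g)" by (rule T(2)[OF f(3,1,4) g f(2)])
  then show ?thesis unfolding L2_pow_sel(3) by (auto elim: eventually_mono)
 qed
 ultimately show ?thesis unfolding unitarily_equivalent_def using Gc by blast
qed

section \<open>Calculus of smooth functions and d-bar operators\<close>

lemma Ck_Suc: "Ck_on (Suc k) S f ==> Ck_on k S f"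
proof (induction k arbitrary: f)
 case 0
 then show ?case by (auto intro!: continuous_at_imp_continuous_on differentiable_imp_continuous_within)
next
 case (Suc k) then show ?case by auto
qed

lemma frechet_cong:
 assumes "open S" "x \<in> S" "f differentiable (at x)" "!!y. y \<in> S ==> f y = g y"
 shows "frechet_derivative g (at x) = frechet_derivative f (at x)" "g differentiable (at x)"
proof -
 have "(f has_derivative frechet_derivative f (at x)) (at x)" using assms(3) by (simp add: frechet_derivative_works)
 then have "(g has_derivative frechet_derivative f (at x)) (at x)"
  by (rule has_derivative_transform_within_open[OF _ assms(1,2)]) (use assms(4) in auto)
 then show "frechet_derivative g (at x) = frechet_derivative f (at x)" "g differentiable (at x)"
  by (auto simp: frechet_derivative_at differentiable_def intro: sym)
qed

lemma Ck_cong: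
 assumes "open S" shows "Ck_on k S f ==> (!!y. y \<in> S ==> f y = g y) ==> Ck_on k S g"
proof (induction k arbitrary: f g)
 case 0 then show ?case by (auto cong: continuous_on_cong)
next
 case (Suc k)
 have d: "f differentiable (at x)" if "x \<in> S" for x using Suc.prems that by auto
 show ?case
 proof (simp, intro conjI ballI allI)
  show "g differentiable (at x)" if "x \<in> S" for x by (rule frechet_cong(2)[OF assms that d[OF that] Suc.prems(2)])
  show "Ck_on k S (%x. frechet_derivative g (at x) v)" for v
   by (rule Suc.IH[of "%x. frechet_derivative f (at x) v"])
    (use Suc.prems(1) in auto, metis frechet_cong(1)[OF assms _ d Suc.prems(2)])
 qed
qed

lemma frechet_eqI: "(f has_derivative D) (at x) ==> frechet_derivative f (at x) = D"
 by (metis frechet_derivative_at)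

lemma fd_works: "f differentiable (at x) ==> (f has_derivative frechet_derivative f (at x)) (at x)"
 by (simp add: frechet_derivative_works)

lemma Ck_const: "Ck_on k S (%x. c)"
 by (induction k arbitrary: c) auto

lemma Ck_linear:
 assumes "bounded_linear L" shows "Ck_on k S L"
proof (cases k)
 case 0 then show ?thesis using assms by (auto intro: linear_continuous_on)
next
 case (Suc j)
 have "(L has_derivative L) (at x)" for x using assms by (rule bounded_linear_imp_has_derivative)
 then have "frechet_derivative L (at x) = L" "L differentiable (at x)" for x by (auto simp: frechet_eqI differentiable_def)
 then show ?thesis unfolding Suc by (simp add: Ck_const)
qed

lemma Ck_add:
 assumes "open S" shows "Ck_on k S f ==> Ck_on k S g ==> Ck_on k S (%x. f x + g x)"
proof (induction k arbitrary: f g)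
 case 0 then show ?case by (auto intro: continuous_intros)
next
 case (Suc k)
 have d: "f differentiable (at x)" "g differentiable (at x)" if "x \<in> S" for x using Suc.prems that by auto
 have h: "((%x. f x + g x) has_derivative (%v. frechet_derivative f (at x) v + frechet_derivative g (at x) v)) (at x)" if "x \<in> S" for x
  by (intro has_derivative_add fd_works d that)
 show ?case
 proof (simp, intro conjI ballI allI)
  show "(%x. f x + g x) differentiable (at x)" if "x \<in> S" for x using h[OF that] by (auto simp: differentiable_def)
  show "Ck_on k S (%x. frechet_derivative (%x. f x + g x) (at x) v)" for v
  proof (rule Ck_cong[OF assms])
   show "Ck_on k S (%x. frechet_derivative f (at x) v + frechet_derivative g (at x) v)"
    by (rule Suc.IH) (use Suc.prems in auto)
  qed (simp add: frechet_eqI[OF h])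
 qed
qed

lemma Ck_mult:
 fixes f g :: "'a::real_normed_vector => complex"
 assumes "open S" shows "Ck_on k S f ==> Ck_on k S g ==> Ck_on k S (%x. f x * g x)"
proof (induction k arbitrary: f g)
 case 0 then show ?case by (auto intro: continuous_intros)
next
 case (Suc k)
 have d: "f differentiable (at x)" "g differentiable (at x)" if "x \<in> S" for x using Suc.prems that by auto
 have h: "((%x. f x * g x) has_derivative (%v. f x * frechet_derivative g (at x) v + frechet_derivative f (at x) v * g x)) (at x)" if "x \<in> S" for x
  by (intro has_derivative_mult fd_works d that)
 show ?case
 proof (simp, intro conjI ballI allI)
  show "(%x. f x * g x) differentiable (at x)" if "x \<in> S" for x using h[OF that] by (auto simp: differentiable_def)
  show "Ck_on k S (%x. frechet_derivative (%x. f x * g x) (at x) v)" for v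
  proof (rule Ck_cong[OF assms])
   show "Ck_on k S (%x. f x * frechet_derivative g (at x) v + frechet_derivative f (at x) v * g x)"
    by (intro Ck_add[OF assms] Suc.IH) (use Suc.prems Ck_Suc in auto)
  qed (simp add: frechet_eqI[OF h])
 qed
qed

lemma line_derivative:
 assumes "f differentiable (at (y + s *\<^sub>R v))"
 shows "((%s. f (y + s *\<^sub>R v)) has_vector_derivative frechet_derivative f (at (y + s *\<^sub>R v)) v) (at s)"
proof -
 have l: "((%s. y + s *\<^sub>R v) has_derivative (%h. h *\<^sub>R v)) (at s)" by (auto intro!: derivative_eq_intros)
 have "((%s. f (y + s *\<^sub>R v)) has_derivative (%h. frechet_derivative f (at (y + s *\<^sub>R v)) (h *\<^sub>R v))) (at s)"
  using diff_chain_at[OF l fd_works[OF assms]] by (simp add: comp_def)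
 moreover have "frechet_derivative f (at (y + s *\<^sub>R v)) (h *\<^sub>R v) = h *\<^sub>R frechet_derivative f (at (y + s *\<^sub>R v)) v" for h
  using linear_frechet_derivative[OF assms] by (rule linear_scale)
 ultimately show ?thesis by (simp add: has_vector_derivative_def)
qed

lemma smoothD:
 assumes "smooth_on S f"
 shows "x \<in> S ==> f differentiable (at x)" "smooth_on S (%x. frechet_derivative f (at x) v)" "Ck_on k S f"
proof -
 have C: "Ck_on (Suc k) S f" for k using assms by (simp add: smooth_on_def)
 show "x \<in> S ==> f differentiable (at x)" using C[of 0] by simp
 show "smooth_on S (%x. frechet_derivative f (at x) v)" using C by (simp add: smooth_on_def)
 show "Ck_on k S f" using assms by (simp add: smooth_on_def)
qed

lemma smooth_intros:
 fixes f g :: "complex \<times> complex => complex"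
 shows "smooth_on siegel (%x. c)"
  "smooth_on siegel f ==> smooth_on siegel g ==> smooth_on siegel (%x. f x + g x)"
  "smooth_on siegel f ==> smooth_on siegel g ==> smooth_on siegel (%x. f x * g x)"
 unfolding smooth_on_def by (auto intro: Ck_const Ck_add Ck_mult open_siegel)

lemma smooth_diff:
 fixes f g :: "complex \<times> complex => complex"
 assumes "smooth_on siegel f" "smooth_on siegel g" shows "smooth_on siegel (%x. f x - g x)"
 using smooth_intros(2)[OF assms(1) smooth_intros(3)[OF smooth_intros(1)[of "-1"] assms(2)]] by simp

lemma smooth_power:
 fixes f :: "complex \<times> complex => complex"
 shows "smooth_on siegel f ==> smooth_on siegel (%x. f x ^ m)"
 by (induction m) (auto intro: smooth_intros)

lemma smooth_sum:
 fixes f :: "'i => complex \<times> complex => complex"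
 shows "(!!i. i \<in> A ==> smooth_on siegel (f i)) ==> smooth_on siegel (%x. \<Sum>i\<in>A. f i x)"
 by (induction A rule: infinite_finite_induct) (auto intro: smooth_intros)

lemma smooth_cong: "smooth_on siegel f ==> (!!x. x \<in> siegel ==> f x = g x) ==> smooth_on siegel g"
 unfolding smooth_on_def using Ck_cong[OF open_siegel] by blast

lemma smooth_dbar:
 assumes "smooth_on siegel f" shows "smooth_on siegel (dbar1 f)" "smooth_on siegel (dbar2 f)"
proof -
 have "smooth_on siegel (%zeta. (1/2) * (frechet_derivative f (at zeta) (1, 0) + \<i> * frechet_derivative f (at zeta) (\<i>, 0)))"
  "smooth_on siegel (%zeta. (1/2) * (frechet_derivative f (at zeta) (0, 1) + \<i> * frechet_derivative f (at zeta) (0, \<i>)))"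
  by (intro smooth_intros smoothD(2)[OF assms])+
 then show "smooth_on siegel (dbar1 f)" "smooth_on siegel (dbar2 f)" unfolding dbar1_def[abs_def] dbar2_def[abs_def] by simp_all
qed

lemma smooth_dbar2_pow: "smooth_on siegel f ==> smooth_on siegel ((dbar2 ^^ m) f)"
 by (induction m) (auto intro: smooth_dbar)

lemma dbar_cong:
 assumes "smooth_on siegel f" "!!x. x \<in> siegel ==> f x = g x" "zeta \<in> siegel"
 shows "dbar1 g zeta = dbar1 f zeta" "dbar2 g zeta = dbar2 f zeta"
 unfolding dbar1_def dbar2_def
 by (simp_all add: frechet_cong(1)[OF open_siegel assms(3) smoothD(1)[OF assms(1,3)] assms(2)])

lemma dbar_arith:
 fixes f g :: "complex \<times> complex => complex"
 assumes f: "f differentiable (at zeta)" and g: "g differentiable (at zeta)"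
 shows "dbar1 (%x. f x + g x) zeta = dbar1 f zeta + dbar1 g zeta" "dbar2 (%x. f x + g x) zeta = dbar2 f zeta + dbar2 g zeta"
  "dbar1 (%x. f x * g x) zeta = f zeta * dbar1 g zeta + dbar1 f zeta * g zeta" "dbar2 (%x. f x * g x) zeta = f zeta * dbar2 g zeta + dbar2 f zeta * g zeta"
proof -
 have "((%x. f x + g x) has_derivative (%v. frechet_derivative f (at zeta) v + frechet_derivative g (at zeta) v)) (at zeta)"
  by (intro has_derivative_add fd_works f g)
 from frechet_eqI[OF this] show "dbar1 (%x. f x + g x) zeta = dbar1 f zeta + dbar1 g zeta" "dbar2 (%x. f x + g x) zeta = dbar2 f zeta + dbar2 g zeta"
  by (simp_all add: dbar1_def dbar2_def field_simps)
 have "((%x. f x * g x) has_derivative (%v. f zeta * frechet_derivative g (at zeta) v + frechet_derivative f (at zeta) v * g zeta)) (at zeta)"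
  by (intro has_derivative_mult fd_works f g)
 from frechet_eqI[OF this] show "dbar1 (%x. f x * g x) zeta = f zeta * dbar1 g zeta + dbar1 f zeta * g zeta" "dbar2 (%x. f x * g x) zeta = f zeta * dbar2 g zeta + dbar2 f zeta * g zeta"
  by (simp_all add: dbar1_def dbar2_def field_simps)
qed

lemma dbar_const: "dbar1 (%x. c) zeta = 0" "dbar2 (%x. c) zeta = 0"
 by (simp_all add: dbar1_def dbar2_def)

lemma dbar_cmult:
 assumes "f differentiable (at zeta)"
 shows "dbar1 (%x. c * f x) zeta = c * dbar1 f zeta" "dbar2 (%x. c * f x) zeta = c * dbar2 f zeta"
 using dbar_arith(3,4)[of "%x. c" zeta f] assms by (simp_all add: dbar_const)

lemma dbar_sum:
 fixes f :: "'i => complex \<times> complex => complex"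
 assumes "finite A" "!!i. i \<in> A ==> smooth_on siegel (f i)" "zeta \<in> siegel"
 shows "dbar1 (%x. \<Sum>i\<in>A. f i x) zeta = (\<Sum>i\<in>A. dbar1 (f i) zeta)" "dbar2 (%x. \<Sum>i\<in>A. f i x) zeta = (\<Sum>i\<in>A. dbar2 (f i) zeta)"
proof -
 have "(\<forall>i\<in>A. smooth_on siegel (f i)) --> dbar1 (%x. \<Sum>i\<in>A. f i x) zeta = (\<Sum>i\<in>A. dbar1 (f i) zeta) \<and> dbar2 (%x. \<Sum>i\<in>A. f i x) zeta = (\<Sum>i\<in>A. dbar2 (f i) zeta)"
  using assms(1)
 proof (induction A rule: finite_induct)
  case (insert a A)
  show ?case
  proof
   assume s: "\<forall>i\<in>insert a A. smooth_on siegel (f i)"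
   have "f a differentiable (at zeta)" by (rule smoothD(1)[OF _ assms(3)]) (use s in auto)
   moreover have "(%x. \<Sum>i\<in>A. f i x) differentiable (at zeta)" by (rule smoothD(1)[OF smooth_sum assms(3)]) (use s in auto)
   ultimately show "dbar1 (%x. \<Sum>i\<in>insert a A. f i x) zeta = (\<Sum>i\<in>insert a A. dbar1 (f i) zeta) \<and> dbar2 (%x. \<Sum>i\<in>insert a A. f i x) zeta = (\<Sum>i\<in>insert a A. dbar2 (f i) zeta)"
    using insert s by (simp add: dbar_arith)
  qed
 qed (simp add: dbar_const)
 then show "dbar1 (%x. \<Sum>i\<in>A. f i x) zeta = (\<Sum>i\<in>A. dbar1 (f i) zeta)" "dbar2 (%x. \<Sum>i\<in>A. f i x) zeta = (\<Sum>i\<in>A. dbar2 (f i) zeta)"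
  using assms(2) by auto
qed

section \<open>Polynomials in \<open>v2\<close> with holomorphic coefficients\<close>

definition v2 :: "complex \<times> complex => complex" where
 "v2 zeta = cr (Im (snd zeta) - (cmod (fst zeta))\<^sup>2)"

lemma v2_alt: "v2 zeta = cr (Im (snd zeta)) - fst zeta * cnj (fst zeta)"
 unfolding v2_def of_real_diff by (simp only: complex_norm_square)

lemma smooth_v2: "smooth_on siegel v2"
proof -
 have l: "bounded_linear (%zeta::complex \<times> complex. cr (Im (snd zeta)))" "bounded_linear (%zeta::complex \<times> complex. fst zeta)"
  "bounded_linear (%zeta::complex \<times> complex. cnj (fst zeta))"
  by (auto intro!: bounded_linear_intros bounded_linear_compose[OF bounded_linear_of_real] bounded_linear_compose[OF bounded_linear_Im] bounded_linear_compose[OF bounded_linear_cnj])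
 have "smooth_on siegel (%zeta::complex \<times> complex. cr (Im (snd zeta)) - fst zeta * cnj (fst zeta))"
  by (intro smooth_diff smooth_intros) (auto simp: smooth_on_def intro: Ck_linear l)
 then show ?thesis unfolding v2_alt[abs_def] .
qed

lemma dbar_v2: "dbar1 v2 zeta = - fst zeta" "dbar2 v2 zeta = \<i> / 2"
proof -
 have "(v2 has_derivative (%h. cr (Im (snd h)) - (fst zeta * cnj (fst h) + fst h * cnj (fst zeta)))) (at zeta)"
  unfolding v2_alt[abs_def]
  by (intro has_derivative_diff has_derivative_mult has_derivative_of_real has_derivative_Im has_derivative_cnj has_derivative_fst has_derivative_snd has_derivative_ident)
 from frechet_eqI[OF this] show "dbar1 v2 zeta = - fst zeta" "dbar2 v2 zeta = \<i> / 2"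
  by (simp_all add: dbar1_def dbar2_def field_simps)
qed

definition holo :: "(complex \<times> complex => complex) => bool" where
 "holo F \<longleftrightarrow> smooth_on siegel F \<and> (\<forall>zeta\<in>siegel. dbar1 F zeta = 0 \<and> dbar2 F zeta = 0)"

text \<open>\<open>v2\<close> is annihilated by \<open>dbar_tangential\<close>, and
  \<open>dbar2 v2\<close> is the constant i/2. Such sums therefore satisfy the tangential equation,
  and each \<open>dbar2\<close> lowers the degree in \<open>v2\<close> by one.\<close>

definition PB :: "nat => (complex \<times> complex => complex) => bool" where
 "PB m f \<longleftrightarrow> (\<exists>F. (\<forall>j<m. holo (F j)) \<and> (\<forall>zeta\<in>siegel. f zeta = (\<Sum>j<m. v2 zeta ^ j * F j zeta)))"

lemma holo_cmult: "holo F ==> holo (%x. c * F x)"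
 unfolding holo_def using dbar_cmult[OF smoothD(1)] by (auto intro: smooth_intros)

lemma dbar_v2_pow:
 assumes "zeta \<in> siegel"
 shows "dbar1 (%x. v2 x ^ j) zeta = - of_nat j * v2 zeta ^ (j - 1) * fst zeta" "dbar2 (%x. v2 x ^ j) zeta = of_nat j * v2 zeta ^ (j - 1) * (\<i> / 2)"
proof (induction j)
 case (Suc j)
 have d: "v2 differentiable (at zeta)" "(%x. v2 x ^ j) differentiable (at zeta)"
  by (auto intro: smoothD(1)[OF _ assms] smooth_power smooth_v2)
 have p: "v2 zeta * v2 zeta ^ (j - 1) * of_nat j = v2 zeta ^ j * of_nat j" by (cases j) auto
 case 1
 have "dbar1 (%x. v2 x ^ Suc j) zeta = v2 zeta * (- of_nat j * v2 zeta ^ (j - 1) * fst zeta) + (- fst zeta) * v2 zeta ^ j"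
  using dbar_arith(3)[OF d] Suc by (simp add: dbar_v2)
 also have "... = - (v2 zeta * v2 zeta ^ (j - 1) * of_nat j) * fst zeta - fst zeta * v2 zeta ^ j" by (simp add: algebra_simps)
 also have "... = - of_nat (Suc j) * v2 zeta ^ (Suc j - 1) * fst zeta" unfolding p by (simp add: algebra_simps)
 finally show ?case .
next
 case (Suc j)
 have d: "v2 differentiable (at zeta)" "(%x. v2 x ^ j) differentiable (at zeta)"
  by (auto intro: smoothD(1)[OF _ assms] smooth_power smooth_v2)
 have p: "v2 zeta * v2 zeta ^ (j - 1) * of_nat j = v2 zeta ^ j * of_nat j" by (cases j) auto
 case 2
 have "dbar2 (%x. v2 x ^ Suc j) zeta = v2 zeta * (of_nat j * v2 zeta ^ (j - 1) * (\<i> / 2)) + (\<i> / 2) * v2 zeta ^ j"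
  using dbar_arith(4)[OF d] Suc by (simp add: dbar_v2)
 also have "... = (v2 zeta * v2 zeta ^ (j - 1) * of_nat j) * (\<i> / 2) + (\<i> / 2) * v2 zeta ^ j" by (simp add: algebra_simps)
 also have "... = of_nat (Suc j) * v2 zeta ^ (Suc j - 1) * (\<i> / 2)" unfolding p by (simp add: algebra_simps)
 finally show ?case .
qed (simp_all add: dbar_const)

lemma dbar_v2_holo:
 assumes F: "holo F" and z: "zeta \<in> siegel"
 shows "dbar2 (%x. v2 x ^ j * F x) zeta = of_nat j * v2 zeta ^ (j - 1) * (\<i> / 2) * F zeta"
  "dbar_tangential (%x. v2 x ^ j * F x) zeta = 0"
proof -
 have d: "F differentiable (at zeta)" "(%x. v2 x ^ j) differentiable (at zeta)"
  using F by (auto intro: smoothD(1)[OF _ z] smooth_power smooth_v2 simp: holo_def)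
 show 1: "dbar2 (%x. v2 x ^ j * F x) zeta = of_nat j * v2 zeta ^ (j - 1) * (\<i> / 2) * F zeta"
  using dbar_arith(4)[OF d(2,1)] F z by (simp add: dbar_v2_pow holo_def)
 have 2: "dbar1 (%x. v2 x ^ j * F x) zeta = - of_nat j * v2 zeta ^ (j - 1) * fst zeta * F zeta"
  using dbar_arith(3)[OF d(2,1)] F z by (simp add: dbar_v2_pow holo_def)
 have "2 * \<i> * fst zeta * (of_nat j * v2 zeta ^ (j - 1) * (\<i> / 2) * F zeta) = (2 * \<i> * (\<i> / 2)) * (of_nat j * v2 zeta ^ (j - 1) * fst zeta * F zeta)"
  by (simp only: mult_ac)
 then show "dbar_tangential (%x. v2 x ^ j * F x) zeta = 0" unfolding dbar_tangential_def 1 2 by simp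
qed

lemma smooth_v2_holo: "holo F ==> smooth_on siegel (%x. v2 x ^ j * F x)"
 by (auto simp: holo_def intro!: smooth_intros smooth_power smooth_v2)

lemma PB_smooth: assumes "PB m f" shows "smooth_on siegel f" "zeta \<in> siegel ==> dbar_tangential f zeta = 0"
proof -
 obtain F where F: "!!j. j < m ==> holo (F j)" "!!zeta. zeta \<in> siegel ==> f zeta = (\<Sum>j<m. v2 zeta ^ j * F j zeta)" using assms by (auto simp: PB_def)
 have s: "smooth_on siegel (%zeta. \<Sum>j<m. v2 zeta ^ j * F j zeta)" using F by (intro smooth_sum smooth_v2_holo) auto
 then show "smooth_on siegel f" by (rule smooth_cong) (use F in auto)
 assume z: "zeta \<in> siegel"
 have "dbar_tangential f zeta = (\<Sum>j<m. dbar_tangential (%x. v2 x ^ j * F j x) zeta)"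
 proof -
  have c: "dbar1 f zeta = dbar1 (%zeta. \<Sum>j<m. v2 zeta ^ j * F j zeta) zeta" "dbar2 f zeta = dbar2 (%zeta. \<Sum>j<m. v2 zeta ^ j * F j zeta) zeta"
   by (rule dbar_cong[OF s _ z]; use F(2) in simp)+
  have "dbar1 f zeta = (\<Sum>j<m. dbar1 (%x. v2 x ^ j * F j x) zeta)" "dbar2 f zeta = (\<Sum>j<m. dbar2 (%x. v2 x ^ j * F j x) zeta)"
   unfolding c by (rule dbar_sum; use F(1) z smooth_v2_holo in auto)+
  then show ?thesis by (simp only: dbar_tangential_def sum_subtractf sum_distrib_left)
 qed
 also have "... = 0" using F(1) z by (intro sum.neutral) (auto intro!: dbar_v2_holo)
 finally show "dbar_tangential f zeta = 0" .
qed

lemma PB_dbar2: assumes "PB (Suc m) f" shows "PB m (dbar2 f)"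
proof -
 obtain F where F: "!!j. j < Suc m ==> holo (F j)" "!!zeta. zeta \<in> siegel ==> f zeta = (\<Sum>j<Suc m. v2 zeta ^ j * F j zeta)" using assms by (auto simp: PB_def)
 have s: "smooth_on siegel (%zeta. \<Sum>j<Suc m. v2 zeta ^ j * F j zeta)" using F by (intro smooth_sum smooth_v2_holo) auto
 have "dbar2 f zeta = (\<Sum>j<m. v2 zeta ^ j * (of_nat (Suc j) * (\<i> / 2) * F (Suc j) zeta))" if z: "zeta \<in> siegel" for zeta
 proof -
  have "dbar2 f zeta = (\<Sum>j<Suc m. dbar2 (%x. v2 x ^ j * F j x) zeta)"
  proof -
   have "dbar2 f zeta = dbar2 (%zeta. \<Sum>j<Suc m. v2 zeta ^ j * F j zeta) zeta"
    by (rule dbar_cong(2)[OF s _ z]) (use F(2) in simp)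
   also have "... = (\<Sum>j<Suc m. dbar2 (%x. v2 x ^ j * F j x) zeta)"
    by (rule dbar_sum) (use F(1) z smooth_v2_holo in auto)
   finally show ?thesis .
  qed
  also have "... = (\<Sum>j<Suc m. of_nat j * v2 zeta ^ (j - 1) * (\<i> / 2) * F j zeta)" using F(1) z by (intro sum.cong refl dbar_v2_holo) auto
  also have "... = (\<Sum>j<m. v2 zeta ^ j * (of_nat (Suc j) * (\<i> / 2) * F (Suc j) zeta))"
   unfolding sum.lessThan_Suc_shift by (simp add: mult_ac)
  finally show ?thesis .
 qed
 then show ?thesis unfolding PB_def
  by (intro exI[of _ "%j zeta. of_nat (Suc j) * (\<i> / 2) * F (Suc j) zeta"] conjI allI impI ballI holo_cmult F(1)) simp_all
qed

lemma PB_dbar2_pow: "PB m f ==> zeta \<in> siegel ==> (dbar2 ^^ m) f zeta = 0"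
proof (induction m arbitrary: f)
 case 0 then show ?case by (auto simp: PB_def)
next
 case (Suc m) then show ?case using Suc.IH[OF PB_dbar2] by (simp add: funpow_swap1)
qed

lemma poly_bergman_PB: "f \<in> L2s (lebesgue_on siegel) ==> PB n f ==> f \<in> carr (poly_bergman 1 n)"
 by (auto simp: poly_bergman_def L2_sel PB_smooth PB_dbar2_pow)

section \<open>Integration by parts and cutoff functions\<close>

lemma continuous_zero_extension:
 fixes F :: "'a::euclidean_space => complex"
 assumes S: "open S" and C: "compact C" "C \<subseteq> S" and F: "continuous_on S F" and z: "!!x. x \<notin> C ==> F x = 0"
 shows "continuous_on UNIV F"
proof -
 have "open (- C)" using C(1) compact_imp_closed by auto
 moreover have "continuous_on (- C) F" by (rule continuous_on_eq[OF continuous_on_const]) (use z in auto)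
 ultimately have "continuous_on (S \<union> - C) F" by (intro continuous_on_open_Un S F)
 moreover have "S \<union> - C = UNIV" using C(2) by auto
 ultimately show ?thesis by simp
qed

lemma integrable_continuous_compact:
 fixes F :: "'a::euclidean_space => complex"
 assumes "continuous_on UNIV F" "compact C" "!!x. x \<notin> C ==> F x = 0"
 shows "intg F"
proof -
 have "intg (%x. indicator C x *\<^sub>R F x)"
  by (rule borel_integrable_compact[OF assms(2)]) (use assms(1) continuous_on_subset in blast)
 moreover have "(%x. indicator C x *\<^sub>R F x) = F" using assms(3) by (auto simp: indicator_def fun_eq_iff)
 ultimately show ?thesis by simp
qed

text \<open>\<open>F (x + d) - F x\<close> has integral \<open>0\<close> and equals \<open>\<integral>\<^sub>0\<^sup>1 F' (x + s d) ds\<close>.\<close>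

lemma integral_directional_derivative:
 fixes F :: "'a::euclidean_space => complex"
 assumes S: "open S" and C: "compact C" "C \<subseteq> S"
  and F: "continuous_on S F" "!!x. x \<notin> C ==> F x = 0"
  and F': "continuous_on S F'" "!!x. x \<notin> C ==> F' x = 0"
  and d: "!!x. x \<in> S ==> ((%s. F (x + s *\<^sub>R d)) has_vector_derivative F' x) (at 0)"
 shows "intg F'" "(LB x. F' x) = 0"
proof -
 have cF: "continuous_on UNIV F" and cF': "continuous_on UNIV F'" using continuous_zero_extension[OF S C] F F' by auto
 have iF: "intg F" and iF': "intg F'" using integrable_continuous_compact[OF _ C(1)] cF cF' F F' by auto
 then have [measurable]: "F \<in> BM" "F' \<in> BM" by auto
 show "intg F'" by (rule iF')
 have oC: "open (- C)" using C(1) compact_imp_closed by auto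
 have d0: "((%s. F (x + s *\<^sub>R d)) has_vector_derivative F' x) (at 0)" for x
 proof (cases "x \<in> S")
  case False
  then have x: "x \<in> - C" using C by auto
  have "open ((%s. x + s *\<^sub>R d) -` (- C))" by (intro open_vimage oC continuous_intros)
  moreover have "0 \<in> (%s. x + s *\<^sub>R d) -` (- C)" using x by simp
  ultimately have "((%s. F (x + s *\<^sub>R d)) has_vector_derivative 0) (at 0)"
   by (intro has_vector_derivative_transform_within_open[OF has_vector_derivative_const[of 0]]) (use F(2) in auto)
  then show ?thesis using F'(2) x by simp
 qed (rule d)
 have ds: "((%s. F (x + s *\<^sub>R d)) has_vector_derivative F' (x + s *\<^sub>R d)) (at s)" for x s
 proof -
  have "((%r. F ((x + s *\<^sub>R d) + r *\<^sub>R d)) \<circ> (%r. r - s) has_vector_derivative (1 *\<^sub>R F' (x + s *\<^sub>R d))) (at s)"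
   by (rule vector_diff_chain_at) (use d0[of "x + s *\<^sub>R d"] in \<open>auto intro!: derivative_eq_intros\<close>)
  then show ?thesis by (simp add: comp_def algebra_simps)
 qed
 have ftc: "(LB s. indicator {0..1} s *\<^sub>R F' (x + s *\<^sub>R d)) = F (x + d) - F x" for x
 proof -
  have "(LB s. indicator {0..1} s *\<^sub>R F' (x + s *\<^sub>R d)) = F (x + 1 *\<^sub>R d) - F (x + 0 *\<^sub>R d)"
  proof (rule integral_FTC_Icc)
   show "continuous_on {0..1} (%s. F' (x + s *\<^sub>R d))"
    by (rule continuous_on_compose2[OF cF']) (auto intro!: continuous_intros)
   show "((%s. F (x + s *\<^sub>R d)) has_vector_derivative F' (x + s *\<^sub>R d)) (at s within {0..1})" for s
    by (rule has_vector_derivative_at_within[OF ds])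
  qed simp
  then show ?thesis by simp
 qed
 have tr: "(LB x. G (x + e)) = (LB x. G x)" "intg G ==> intg (%x. G (x + e))"
  if [measurable]: "G \<in> BM" for G :: "'a => complex" and e
 proof -
  have e: "distr lborel borel (%x. x + e) = lborel"
   by (rule trans[OF arg_cong[where f = "distr lborel borel"] lborel_distr_plus[of e]]) (simp add: fun_eq_iff add.commute)
  show "(LB x. G (x + e)) = (LB x. G x)"
   by (subst (2) e[symmetric], subst integral_distr) auto
  show "intg (%x. G (x + e))" if "intg G"
   using that by (subst (asm) e[symmetric], subst (asm) integrable_distr_eq) auto
 qed
 have int: "integrable (lborel \<Otimes>\<^sub>M lborel) (%p. indicator {0..1::real} (snd p) *\<^sub>R F' (fst p + snd p *\<^sub>R d))"
 proof -
  have n: "(NN x. ennreal (cmod (F' (x + s *\<^sub>R d)))) = (NN x. ennreal (cmod (F' x)))" for s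
   by (subst (2) lborel_distr_plus[of "s *\<^sub>R d", symmetric], subst nn_integral_distr) (auto simp: add.commute)
  have "(\<integral>\<^sup>+p. ennreal (cmod (indicator {0..1::real} (snd p) *\<^sub>R F' (fst p + snd p *\<^sub>R d))) \<partial>(lborel \<Otimes>\<^sub>M lborel)) =
   (NN s. NN x. ennreal (cmod (indicator {0..1::real} s *\<^sub>R F' (x + s *\<^sub>R d))))"
   by (subst lborel_pair.nn_integral_snd[symmetric]) auto
  also have "... = (NN s. indicator {0..1::real} s * (NN x. ennreal (cmod (F' x))))"
   by (intro nn_integral_cong) (auto simp: indicator_def n)
  also have "... = (NN x. ennreal (cmod (F' x)))" by (subst nn_integral_multc) auto
  also have "... < \<infinity>" using iF' unfolding integrable_iff_bounded by auto
  finally show ?thesis unfolding integrable_iff_bounded by auto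
 qed
 have "0 = (LB x. F (x + d) - F x)"
  using tr[of F d] iF by simp
 also have "... = (LB x. LB s. indicator {0..1} s *\<^sub>R F' (x + s *\<^sub>R d))" unfolding ftc ..
 also have "... = (LB s. LB x. indicator {0..1} s *\<^sub>R F' (x + s *\<^sub>R d))"
  by (rule lborel_pair.Fubini_integral[symmetric]) (use int in \<open>simp add: case_prod_beta'\<close>)
 also have "... = (LB s. indicator {0..1::real} s *\<^sub>R (LB x. F' x))"
  by (intro int_cong refl) (simp add: tr(1))
 also have "... = (LB x. F' x)" by simp
 finally show "(LB x. F' x) = 0" ..
qed

text \<open>Functions supported in [-1, 1] with m continuous derivatives. Finite smoothness
  suffices, since \<open>G4_moments\<close> differentiates n times, and it admits elementary
  examples.\<close>

primrec cut :: "nat => (real => complex) => bool" where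
 "cut 0 \<eta> \<longleftrightarrow> continuous_on UNIV \<eta> \<and> (\<forall>u. u \<notin> {-1..1} --> \<eta> u = 0)"
| "cut (Suc m) \<eta> \<longleftrightarrow> (continuous_on UNIV \<eta> \<and> (\<forall>u. u \<notin> {-1..1} --> \<eta> u = 0)) \<and> (\<exists>\<eta>'. (\<forall>u. (\<eta> has_vector_derivative \<eta>' u) (at u)) \<and> cut m \<eta>')"

lemma cut_Suc: "cut (Suc m) \<eta> ==> cut m \<eta>"
proof (induction m arbitrary: \<eta>)
 case (Suc m)
 then obtain \<eta>' where "\<forall>u. (\<eta> has_vector_derivative \<eta>' u) (at u)" "cut (Suc m) \<eta>'"
  and c: "continuous_on UNIV \<eta> \<and> (\<forall>u. u \<notin> {-1..1} --> \<eta> u = 0)" unfolding cut.simps(2)[of "Suc m"] by blast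
 from this(2) have "cut m \<eta>'" by (rule Suc.IH)
 then show ?case using \<open>\<forall>u. (\<eta> has_vector_derivative \<eta>' u) (at u)\<close> c unfolding cut.simps(2)[of m] by blast
qed simp

lemma cut_0: "cut m \<eta> ==> cut 0 \<eta>" by (cases m) auto

lemma max_power_deriv: "((%s. max 0 s ^ Suc (Suc m)) has_real_derivative real (Suc (Suc m)) * max 0 s ^ Suc m) (at s)" for s :: real
proof -
 consider "s > 0" | "s < 0" | "s = 0" by linarith
 then show ?thesis
 proof cases
  case 1
  have "((%s. s ^ Suc (Suc m)) has_real_derivative real (Suc (Suc m)) * max 0 s ^ Suc m) (at s)"
   using DERIV_pow[of "Suc (Suc m)" s UNIV] 1 by simp
  then show ?thesis by (rule DERIV_cong_ev[THEN iffD1, rotated 3, OF _ refl _ refl])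
   (use 1 in \<open>auto intro!: eventually_mono[OF eventually_gt_at_top]  eventually_nhds_in_open[of "{0<..}", THEN eventually_mono] \<close>)
 next
  case 2
  have "((%s. 0) has_real_derivative real (Suc (Suc m)) * max 0 s ^ Suc m) (at s)" using 2 by auto
  then show ?thesis
   by (rule DERIV_cong_ev[THEN iffD1, rotated 3, OF _ refl _ refl])
   (use 2 in \<open>auto intro!: eventually_nhds_in_open[of "{..<0}", THEN eventually_mono]\<close>)
 next
  case 3
  have "((%h. max 0 h ^ Suc (Suc m) / h) \<longlongrightarrow> 0) (at (0::real))"
  proof (rule Lim_null_comparison)
   show "\<forall>\<^sub>F h in at 0. norm (max 0 h ^ Suc (Suc m) / h) \<le> \<bar>h\<bar> ^ Suc m" for h :: real
   proof (intro always_eventually allI)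
    fix h :: real show "norm (max 0 h ^ Suc (Suc m) / h) \<le> \<bar>h\<bar> ^ Suc m"
    proof (cases "h > 0")
     case False
     then have "max 0 h = 0" by simp
     then show ?thesis by (simp del: power_Suc)
    qed (simp add: max_def)
   qed
   show "((%h. \<bar>h\<bar> ^ Suc m) \<longlongrightarrow> 0) (at (0::real))" by (auto intro!: tendsto_eq_intros)
  qed
  then show ?thesis using 3 by (simp add: DERIV_def)
 qed
qed

lemma one_minus_square_nonpos: "u < -1 \<or> 1 < u ==> 1 - u\<^sup>2 \<le> (0::real)"
proof -
 assume "u < -1 \<or> 1 < u"
 then have "1 < \<bar>u\<bar> ^ 2" by (intro one_less_power) auto
 then show ?thesis by simp
qed

lemma bump_support: "continuous_on UNIV (%u. cr (poly q u * max 0 (1 - u\<^sup>2) ^ Suc m)) \<and>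
 (\<forall>u. u \<notin> {-1..1} --> cr (poly q u * max 0 (1 - u\<^sup>2) ^ Suc m) = 0)"
proof (intro conjI allI impI)
 show "continuous_on UNIV (%u. cr (poly q u * max 0 (1 - u\<^sup>2) ^ Suc m))" by (intro continuous_intros)
 fix u :: real assume "u \<notin> {-1..1}"
 then have "max 0 (1 - u\<^sup>2) = 0" using one_minus_square_nonpos[of u] by auto
 then show "cr (poly q u * max 0 (1 - u\<^sup>2) ^ Suc m) = 0" by simp
qed

text \<open>Polynomial multiples of powers of \<open>max 0 (1 - u\<^sup>2)\<close> are closed under
  differentiation, each derivative costing one power; the arbitrary polynomial factor is what lets
  the induction run.\<close>

lemma cut_poly: "cut m (%u. cr (poly q u * max 0 (1 - u\<^sup>2) ^ Suc m))"
proof (induction m arbitrary: q)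
 case 0
 show ?case unfolding cut.simps by (rule bump_support)
next
 case (Suc m)
 define q' where "q' = pderiv q * [:1, 0, -1:] + smult (real (Suc (Suc m))) (q * [:0, -2:])"
 have alg: "poly q u * ((real (Suc (Suc m)) * M) * (- 2 * u)) + poly (pderiv q) u * ((1 - u\<^sup>2) * M) = poly q' u * M" for u M
  by (simp add: q'_def algebra_simps power2_eq_square)
 have d: "((%u. cr (poly q u * max 0 (1 - u\<^sup>2) ^ Suc (Suc m))) has_vector_derivative cr (poly q' u * max 0 (1 - u\<^sup>2) ^ Suc m)) (at u)" for u
 proof -
  have "((%u. max 0 (1 - u\<^sup>2) ^ Suc (Suc m)) has_real_derivative (real (Suc (Suc m)) * max 0 (1 - u\<^sup>2) ^ Suc m) * (- 2 * u)) (at u)"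
   by (rule DERIV_chain2[OF max_power_deriv]) (auto intro!: derivative_eq_intros)
  then have "((%u. poly q u * max 0 (1 - u\<^sup>2) ^ Suc (Suc m)) has_real_derivative
   poly q u * ((real (Suc (Suc m)) * max 0 (1 - u\<^sup>2) ^ Suc m) * (- 2 * u)) + poly (pderiv q) u * max 0 (1 - u\<^sup>2) ^ Suc (Suc m)) (at u)"
   by (intro DERIV_mult' poly_DERIV)
  moreover have "max 0 (1 - u\<^sup>2) ^ Suc (Suc m) = (1 - u\<^sup>2) * max 0 (1 - u\<^sup>2) ^ Suc m" by (auto simp: max_def)
  then have "poly q u * ((real (Suc (Suc m)) * max 0 (1 - u\<^sup>2) ^ Suc m) * (- 2 * u)) + poly (pderiv q) u * max 0 (1 - u\<^sup>2) ^ Suc (Suc m) = poly q' u * max 0 (1 - u\<^sup>2) ^ Suc m"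
   using alg[of u "max 0 (1 - u\<^sup>2) ^ Suc m"] by (simp only:)
  ultimately have "((%u. poly q u * max 0 (1 - u\<^sup>2) ^ Suc (Suc m)) has_real_derivative poly q' u * max 0 (1 - u\<^sup>2) ^ Suc m) (at u)"
   by (simp only:)
  then show ?thesis by (rule has_vector_derivative_of_real)
 qed
 show ?case unfolding cut.simps(2)
  by (rule conjI[OF bump_support], rule exI[of _ "%u. cr (poly q' u * max 0 (1 - u\<^sup>2) ^ Suc m)"])
   (intro conjI allI d Suc.IH)
qed

lemma ex_cut: "\<exists>\<eta>. cut m \<eta> \<and> \<eta> 0 = 1"
 using cut_poly[of m 1] by (intro exI[of _ "%u. cr (poly 1 u * max 0 (1 - u\<^sup>2) ^ Suc m)"]) simp

section \<open>Cutoffs with prescribed moments\<close>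

definition cc :: "real => real => (real => complex) => bool" where
 "cc \<alpha> \<beta> k \<longleftrightarrow> continuous_on UNIV k \<and> (\<forall>x. x \<notin> {\<alpha>..\<beta>} --> k x = 0)"

lemma cc_integrable: "cc \<alpha> \<beta> k ==> continuous_on UNIV q ==> intg (%x. k x * q x)"
 by (rule integrable_continuous_compact[of _ "{\<alpha>..\<beta>}"]) (auto simp: cc_def intro!: continuous_intros)

lemma cc_bounded: assumes "cc \<alpha> \<beta> k" shows "\<exists>B. \<forall>x. cmod (k x) \<le> B"
proof -
 have "continuous_on {\<alpha>..\<beta>} k" using assms continuous_on_subset by (auto simp: cc_def)
 then have "bounded (k ` {\<alpha>..\<beta>})" by (intro compact_imp_bounded compact_continuous_image) auto
 then obtain B where "\<forall>x\<in>{\<alpha>..\<beta>}. cmod (k x) \<le> B" by (auto simp: bounded_iff)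
 then have "cmod (k x) \<le> max B 0" for x
  by (cases "x \<in> {\<alpha>..\<beta>}") (use assms in \<open>auto simp: cc_def intro: max.coboundedI1 max.coboundedI2\<close>)
 then show ?thesis by blast
qed

text \<open>The vanishing integral is exactly what makes the primitive vanish to the right of the
  support.\<close>

lemma cc_primitive:
 assumes k: "cc \<alpha> \<beta> k" and z: "(LB x. k x) = 0"
 shows "\<exists>K. cc \<alpha> \<beta> K \<and> (\<forall>x. (K has_vector_derivative k x) (at x))"
proof -
 have ck: "continuous_on UNIV k" and k0: "!!x. x \<notin> {\<alpha>..\<beta>} ==> k x = 0" using k by (auto simp: cc_def)
 have ik: "intg k" using cc_integrable[OF k, of "%x. 1"] by simp
 \<comment> \<open>Starting one unit to the left of the support keeps \<alpha> itself in the
   interior of the interval, where the fundamental theorem gives a two-sided derivative.\<close>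
 define K where "K x = integral {\<alpha> - 1..x} k" for x
 have ki: "k integrable_on {a..b}" for a b by (rule integrable_continuous_real) (use ck continuous_on_subset in blast)
 have K1: "K x = 0" if "x < \<alpha>" for x
  unfolding K_def by (rule integral_unique, rule has_integral_is_0) (use that k0 in auto)
 have lk: "(k has_integral 0) UNIV" using has_integral_integral_lborel[OF ik] z by simp
 have K2: "K x = 0" if "x > \<beta>" for x
 proof -
  have "(k has_integral 0) {\<alpha> - 1..x}"
  proof -
   have "(%y. if y \<in> {\<alpha> - 1..x} then k y else 0) = k" using that k0 by (auto simp: fun_eq_iff)
   then show ?thesis using lk has_integral_restrict_UNIV[of "{\<alpha> - 1..x}" k 0] by simp
  qed
  then show ?thesis unfolding K_def by (rule integral_unique)
 qed
 have d: "(K has_vector_derivative k x) (at x)" for x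
 proof (cases "x < \<alpha>")
  case True
  have "((%x. 0) has_vector_derivative k x) (at x)" using True k0 by simp
  then show ?thesis by (rule has_vector_derivative_transform_within_open[of _ _ _ "{..<\<alpha>}"]) (use True K1 in auto)
 next
  case False
  have "((%x. integral {\<alpha> - 1..x} k) has_vector_derivative k x) (at x within {\<alpha> - 1..x + 1})"
   by (rule integral_has_vector_derivative) (use False ck continuous_on_subset in auto)
  then show ?thesis unfolding K_def by (subst (asm) at_within_interior) (use False in auto)
 qed
 have "continuous_on UNIV K" using d by (auto intro!: continuous_at_imp_continuous_on has_vector_derivative_continuous)
 then have "cc \<alpha> \<beta> K" using K1 K2 by (auto simp: cc_def not_le)
 then show ?thesis using d by blast
qed

lemma has_vector_derivative_shift:
 assumes "((%s. f s) has_vector_derivative f') (at x)"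
 shows "((%s. f (x + s)) has_vector_derivative f') (at 0)"
proof -
 have "(f \<circ> (%s. x + s) has_vector_derivative (1 *\<^sub>R f')) (at 0)"
  by (rule vector_diff_chain_at) (use assms in \<open>auto intro!: derivative_eq_intros\<close>)
 then show ?thesis by (simp add: comp_def)
qed

lemma cc_moment:
 assumes K: "cc \<alpha> \<beta> K" and k: "cc \<alpha> \<beta> k" and d: "!!x. (K has_vector_derivative k x) (at x)"
  and z: "(LB x. k x * of_real x ^ Suc j) = 0"
 shows "(LB x. K x * of_real x ^ j) = 0"
proof -
 let ?F' = "%x. K x * (of_nat (Suc j) * of_real x ^ j) + k x * of_real x ^ Suc j"
 have c: "continuous_on UNIV K" "continuous_on UNIV k" using K k by (auto simp: cc_def)
 have "((%x. cr (x ^ Suc j)) has_vector_derivative cr (of_nat (Suc j) * x ^ j)) (at x)" for x :: real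
  by (rule has_vector_derivative_of_real) (use DERIV_pow[of "Suc j" x UNIV] in simp)
 then have "((%x. K x * cr (x ^ Suc j)) has_vector_derivative K x * cr (of_nat (Suc j) * x ^ j) + k x * cr (x ^ Suc j)) (at x)" for x
  by (intro has_vector_derivative_mult d)
 from has_vector_derivative_shift[OF this]
 have d': "((%s. K (x + s *\<^sub>R 1) * cr (x + s *\<^sub>R 1) ^ Suc j) has_vector_derivative ?F' x) (at 0)" for x
  by (simp del: power_Suc of_nat_Suc)
 have "(LB x. ?F' x) = 0"
  by (rule integral_directional_derivative(2)[where S = UNIV and C = "{\<alpha>..\<beta>}" and F = "%x. K x * of_real x ^ Suc j" and d = 1])
   (use K k c d' in \<open>auto simp: cc_def intro!: continuous_intros simp del: power_Suc of_nat_Suc\<close>)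
 also have "(LB x. ?F' x) = (LB x. K x * (of_nat (Suc j) * of_real x ^ j)) + (LB x. k x * of_real x ^ Suc j)"
  by (intro int_add cc_integrable[OF K] cc_integrable[OF k] continuous_intros)
 also have "(LB x. K x * (of_nat (Suc j) * of_real x ^ j)) = of_nat (Suc j) * (LB x. K x * of_real x ^ j)"
  by (subst integral_mult_right_zero[symmetric]) (simp add: mult_ac)
 finally show ?thesis using z by (simp del: of_nat_Suc power_Suc)
qed

text \<open>Vanishing moments below n make \<open>b\<close> an n-th derivative within the same
  support: by parts, passing to the primitive shifts the moments down by one
  (\<open>cc_moment\<close>).\<close>

lemma cc_primitives:
 assumes "cc \<alpha> \<beta> b" "!!j. j < n ==> (LB x. b x * of_real x ^ j) = 0"
 shows "\<exists>k. k n = b \<and> (\<forall>m\<le>n. cc \<alpha> \<beta> (k m)) \<and> (\<forall>m<n. \<forall>x. (k m has_vector_derivative k (Suc m) x) (at x))"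
 using assms
proof (induction n arbitrary: b)
 case 0 then show ?case by (intro exI[of _ "%_. b"]) simp
next
 case (Suc n)
 obtain K where K: "cc \<alpha> \<beta> K" "!!x. (K has_vector_derivative b x) (at x)"
  using cc_primitive[OF Suc.prems(1)] Suc.prems(2)[of 0] by auto
 have "(LB x. K x * of_real x ^ j) = 0" if "j < n" for j
  by (rule cc_moment[OF K(1) Suc.prems(1) K(2)]) (use Suc.prems(2)[of "Suc j"] that in simp)
 from Suc.IH[OF K(1) this] obtain k where k: "k n = K" "\<forall>m\<le>n. cc \<alpha> \<beta> (k m)" "\<forall>m<n. \<forall>x. (k m has_vector_derivative k (Suc m) x) (at x)" by auto
 show ?case
 proof (intro exI[of _ "%m. if m = Suc n then b else k m"] conjI allI impI)
  fix m x assume m: "m < Suc n"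
  show "((if m = Suc n then b else k m) has_vector_derivative (if Suc m = Suc n then b else k (Suc m)) x) (at x)"
   by (cases "m = n") (use k K m in auto)
 qed (use k Suc.prems in \<open>auto simp: le_Suc_eq\<close>)
qed

text \<open>Functions biorthogonal to 1, x, ..., x^(n-1), supported inside the positive half-line.
  The inductive step needs a function \<open>e\<close> orthogonal to the lower powers but not to
  x^n.\<close>

lemma cc_duals:
 "\<exists>d. (\<forall>j<n. cc 1 2 (d j)) \<and> (\<forall>i<n. \<forall>j<n. (LB x. d j x * of_real x ^ i) = (if i = j then 1 else 0))"
proof (induction n)
 case (Suc n)
 then obtain d where d: "!!j. j < n ==> cc 1 2 (d j)"
  "!!i j. i < n ==> j < n ==> (LB x. d j x * of_real x ^ i) = (if i = j then 1 else 0)" by blast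
 define c where "c j = (LB x. d j x * of_real x ^ n)" for j
 \<comment> \<open>\<open>Q\<close> is x^n minus its expansion by the current duals; with this
   choice the moment of order n of \<open>e\<close> equals the integral of \<open>b\<close> times
   \<open>q\<close>.\<close>
 define Q where "Q = monom 1 n - (\<Sum>j<n. monom (c j) j)"
 define q where "q x = poly Q (cr x)" for x
 have q: "q x = of_real x ^ n - (\<Sum>j<n. c j * of_real x ^ j)" for x
  by (simp add: q_def Q_def poly_sum poly_monom)
 have "coeff Q n = 1" by (simp add: Q_def coeff_sum)
 then have Q0: "Q \<noteq> 0" by auto
 define w where "w x = max 0 ((x - 1) * (2 - x))" for x :: real
 have w0: "w x = 0" if "x \<notin> {1..2}" for x
  using that mult_neg_pos[of "x - 1" "2 - x"] mult_pos_neg[of "x - 1" "2 - x"] by (cases "x < 1") (simp_all add: w_def max_def not_le)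
 \<comment> \<open>The factor \<open>cnj (q x)\<close> turns that integral into the one of
   \<open>w\<close> times the squared modulus of \<open>q\<close>, positive because \<open>q\<close>
   has only finitely many zeros.\<close>
 define b where "b x = cr (w x) * cnj (q x)" for x
 have b: "cc 1 2 b" unfolding cc_def b_def w_def[abs_def] q
  using w0 by (auto simp: w_def intro!: continuous_intros)
 define e where "e x = b x - (\<Sum>j<n. (LB x. b x * of_real x ^ j) * d j x)" for x
 have cd: "continuous_on UNIV (d j)" if "j < n" for j using d(1)[OF that] by (simp add: cc_def)
 have e: "cc 1 2 e" using b d(1) unfolding cc_def e_def by (auto intro!: continuous_intros sum.neutral)
 have eint: "(LB x. e x * of_real x ^ i) = (LB x. b x * of_real x ^ i) - (\<Sum>j<n. (LB x. b x * of_real x ^ j) * (LB x. d j x * of_real x ^ i))" for i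
 proof -
  have ib: "intg (%x. b x * of_real x ^ i)" by (rule cc_integrable[OF b]) (intro continuous_intros)
  have id: "intg (%x. d j x * of_real x ^ i)" if "j < n" for j by (rule cc_integrable[OF d(1)[OF that]]) (intro continuous_intros)
  have "(LB x. e x * of_real x ^ i) = (LB x. b x * of_real x ^ i - (\<Sum>j<n. (LB x. b x * of_real x ^ j) * (d j x * of_real x ^ i)))"
   by (simp add: e_def left_diff_distrib sum_distrib_right mult.assoc)
  also have "... = (LB x. b x * of_real x ^ i) - (\<Sum>j<n. (LB x. (LB x. b x * of_real x ^ j) * (d j x * of_real x ^ i)))"
  proof -
   have ig: "intg (%x. (LB x. b x * of_real x ^ j) * (d j x * of_real x ^ i))" if "j \<in> {..<n}" for j
    by (rule integrable_mult_right) (use id that in auto)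
   have 1: "intg (%x. \<Sum>j<n. (LB x. b x * of_real x ^ j) * (d j x * of_real x ^ i))"
    by (rule integrable_sum_B) (rule ig)
   have 2: "(LB x. (\<Sum>j<n. (LB x. b x * of_real x ^ j) * (d j x * of_real x ^ i))) = (\<Sum>j<n. (LB x. (LB x. b x * of_real x ^ j) * (d j x * of_real x ^ i)))"
    by (rule int_sum) (rule ig)
   show ?thesis unfolding 2[symmetric] by (rule int_diff[OF ib 1])
  qed
  finally show ?thesis by simp
 qed
 have e1: "(LB x. e x * of_real x ^ i) = 0" if "i < n" for i
 proof -
  have "(\<Sum>j<n. (LB x. b x * of_real x ^ j) * (LB x. d j x * of_real x ^ i)) = (\<Sum>j<n. if i = j then (LB x. b x * of_real x ^ j) else 0)"
   by (intro sum.cong refl) (use d(2)[OF that] in simp)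
  then show ?thesis unfolding eint using that by simp
 qed
 define N where "N = (LB x. e x * of_real x ^ n)"
 have "N = (LB x. b x * q x)"
 proof -
  have ib: "intg (%x. b x * of_real x ^ i)" for i by (rule cc_integrable[OF b]) (intro continuous_intros)
  have "(LB x. b x * q x) = (LB x. b x * of_real x ^ n - (\<Sum>j<n. c j * (b x * of_real x ^ j)))"
   unfolding q by (simp add: algebra_simps sum_distrib_left)
  also have "... = (LB x. b x * of_real x ^ n) - (\<Sum>j<n. c j * (LB x. b x * of_real x ^ j))"
   by (subst int_diff, rule ib, intro integrable_sum_B integrable_mult_right ib)
    (simp add: int_sum ib)
  finally show ?thesis unfolding N_def eint c_def by (simp add: mult.commute)
 qed
 also have "... = cr (LB x. w x * (cmod (q x))^2)"
 proof -
  have "b x * q x = cr (w x * (cmod (q x))^2)" for x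
   unfolding b_def of_real_mult complex_norm_square[of "q x"] by (simp only: mult_ac)
  then show ?thesis by (simp only: integral_complex_of_real)
 qed
 finally have N: "N = cr (LB x. w x * (cmod (q x))^2)" .
 have N0: "N \<noteq> 0"
 proof
  assume "N = 0"
  then have z: "(LB x. w x * (cmod (q x))^2) = 0" unfolding N by simp
  have i: "intg (%x. w x * (cmod (q x))^2)"
  proof -
   have "intg (%x. b x * q x)" by (rule cc_integrable[OF b]) (auto simp: q intro!: continuous_intros)
   then have "intg (%x. cmod (b x * q x))" by (rule integrable_norm)
   moreover have "cmod (b x * q x) = w x * (cmod (q x))^2" for x by (simp add: b_def norm_mult power2_eq_square w_def)
   ultimately show ?thesis by simp
  qed
  have "AB x. w x * (cmod (q x))^2 = 0"
   using integral_nonneg_eq_0_iff_AE[OF i] z by (auto simp: w_def)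
  moreover have "finite {x. q x = 0}"
  proof -
   have "finite (cr -` {z. poly Q z = 0})" by (intro finite_vimageI poly_roots_finite Q0) (auto simp: inj_on_def)
   then show ?thesis by (simp add: q_def vimage_def)
  qed
  then have "AB x. x \<notin> {x. q x = 0}"
   by (intro AE_not_in null_setsI) (auto intro!: finite_imp_null_set_lborel[THEN null_setsD1] simp: finite_imp_closed)
  ultimately have "AB x. x \<notin> {1<..<2::real}" by eventually_elim (auto simp: w_def)
  then have "{1<..<2::real} \<in> null_sets lborel" by (subst AE_iff_null_sets) auto
  then have "emeasure lborel {1<..<2::real} = 0" by (rule null_setsD1)
  then show False by simp
 qed
 \<comment> \<open>A multiple of \<open>e / N\<close> removes the moment of order n from each old
   dual without touching its lower moments.\<close>
 define d' where "d' j x = (if j = n then e x / N else d j x - c j * (e x / N))" for j x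
 have ie: "intg (%x. e x * of_real x ^ i)" for i by (rule cc_integrable[OF e]) (intro continuous_intros)
 show ?case
 proof (intro exI[of _ d'] conjI allI impI)
  fix j assume "j < Suc n"
  then show "cc 1 2 (d' j)" using e d(1)[of j] unfolding cc_def d'_def[abs_def] by (cases "j = n") (auto intro!: continuous_intros N0)
 next
  fix i j assume i: "i < Suc n" and j: "j < Suc n"
  have 1: "(LB x. e x / N * of_real x ^ i) = (if i = n then 1 else 0)"
  proof -
   have "(LB x. e x / N * of_real x ^ i) = (LB x. inverse N * (e x * of_real x ^ i))" by (simp add: field_simps)
   also have "... = inverse N * (LB x. e x * of_real x ^ i)" by simp
   finally show ?thesis using e1[of i] i N0 by (auto simp: N_def[symmetric])
  qed
  have ie': "intg (%x. e x / N * of_real x ^ i)" using integrable_mult_right[OF ie[of i], of "inverse N"] by (simp add: field_simps)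
  show "(LB x. d' j x * of_real x ^ i) = (if i = j then 1 else 0)"
  proof (cases "j = n")
   case True then show ?thesis using 1 by (simp add: d'_def)
  next
   case False
   then have jn: "j < n" using j by simp
   have id: "intg (%x. d j x * of_real x ^ i)" by (rule cc_integrable[OF d(1)[OF jn]]) (intro continuous_intros)
   have "(LB x. d' j x * of_real x ^ i) = (LB x. d j x * of_real x ^ i - c j * (e x / N * of_real x ^ i))"
    using False by (simp add: d'_def algebra_simps)
   also have "... = (LB x. d j x * of_real x ^ i) - c j * (LB x. e x / N * of_real x ^ i)"
    by (subst int_diff[OF id integrable_mult_right[OF ie']]) simp
   finally show ?thesis unfolding 1 using jn i d(2)[of i j] by (auto simp: c_def)
  qed
 qed
qed simp

text \<open>Gaussians in zeta1 and zeta2 - i zeta1^2, holomorphic, so both d-bar operators pass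
  through them. For fixed v they decay like Gaussians in u, and the real shifts s and r become
  modulations of the partial transform.\<close>

definition Ew :: "real => real => complex \<times> complex => complex" where
 "Ew s r zeta = exp (- (fst zeta - of_real s)\<^sup>2 / 2 - (snd zeta - \<i> * (fst zeta)\<^sup>2 - of_real r)\<^sup>2 / 2)"

definition dEw :: "real => real => complex \<times> complex => complex \<times> complex => complex" where
 "dEw s r zeta h = Ew s r zeta * (- (fst zeta - of_real s) * fst h - (snd zeta - \<i> * (fst zeta)\<^sup>2 - of_real r) * (snd h - 2 * \<i> * fst zeta * fst h))"

lemma has_derivative_cexp:
 fixes f :: "'a::real_normed_vector => complex"
 assumes "(f has_derivative f') (at x)" shows "((%x. exp (f x)) has_derivative (%h. exp (f x) * f' h)) (at x)"
proof -
 have "(exp has_derivative (*) (exp (f x))) (at (f x))" using DERIV_exp[of "f x"] by (simp add: has_field_derivative_def)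
 from diff_chain_at[OF assms this] show ?thesis by (simp add: comp_def)
qed

lemma Ew_derivative: "(Ew s r has_derivative dEw s r zeta) (at zeta)"
proof -
 have "((%zeta. - (fst zeta - of_real s)\<^sup>2 / 2 - (snd zeta - \<i> * (fst zeta)\<^sup>2 - of_real r)\<^sup>2 / 2) has_derivative
  (%h. - (fst zeta - of_real s) * fst h - (snd zeta - \<i> * (fst zeta)\<^sup>2 - of_real r) * (snd h - 2 * \<i> * fst zeta * fst h))) (at zeta)"
  unfolding power2_eq_square
  by (rule has_derivative_eq_rhs, (rule derivative_intros | simp)+) (auto simp: fun_eq_iff field_simps)
 from has_derivative_cexp[OF this] show ?thesis unfolding Ew_def[abs_def] dEw_def .
qed

section \<open>Derivatives of the weighted function in the chart\<close>

definition dKs :: "r4 => r4 => complex \<times> complex" where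
 "dKs x e = (of_real (ff e) + \<i> * of_real (fs e),
  of_real (sf e) + \<i> * of_real (ss e + 2 * ff x * ff e + 2 * fs x * fs e))"

lemma Ks_eq: "Ks x = (of_real (ff x) + \<i> * of_real (fs x),
  of_real (sf x) + \<i> * of_real (ss x + (ff x)\<^sup>2 + (fs x)\<^sup>2))"
 by (simp add: Ks_def J_def kappa_def complex_eq_iff cmod_power2)

lemma Ks_derivative: "(Ks has_derivative dKs x) (at x)"
proof -
 have "((%x :: r4. (cr (ff x) + \<i> * cr (fs x),
  cr (sf x) + \<i> * cr (ss x + ff x * ff x + fs x * fs x))) has_derivative dKs x) (at x)"
  by (rule has_derivative_eq_rhs, (rule derivative_intros has_derivative_of_real | simp only:)+) (auto simp: fun_eq_iff dKs_def algebra_simps)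
 then show ?thesis by (simp add: Ks_eq[abs_def] power2_eq_square)
qed

lemma Ks_continuous: "continuous_on A Ks"
 by (rule continuous_at_imp_continuous_on) (intro ballI has_derivative_continuous[OF Ks_derivative])

definition S4 :: "r4 set" where "S4 = {x. 0 < ss x}"

lemma open_S4: "open S4" unfolding S4_def by (intro open_Collect_less continuous_intros)

lemma S4_siegel: "x \<in> S4 \<longleftrightarrow> Ks x \<in> siegel" by (simp add: S4_def Ks_siegel)

definition gm :: "real => real => (complex \<times> complex => complex) => r4 => complex" where
 "gm s r f x = f (Ks x) * Ew s r (Ks x)"

definition dgm :: "real => real => (complex \<times> complex => complex) => r4 => r4 => complex" where
 "dgm s r f x e = f (Ks x) * dEw s r (Ks x) (dKs x e) + frechet_derivative f (at (Ks x)) (dKs x e) * Ew s r (Ks x)"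

lemma gm_derivative:
 assumes "smooth_on siegel f" "x \<in> S4" shows "(gm s r f has_derivative dgm s r f x) (at x)"
proof -
 have "f differentiable (at (Ks x))" using smoothD(1)[OF assms(1)] assms(2) S4_siegel by blast
 then have "((%zeta. f zeta * Ew s r zeta) has_derivative (%h. f (Ks x) * dEw s r (Ks x) h + frechet_derivative f (at (Ks x)) h * Ew s r (Ks x))) (at (Ks x))"
  by (intro has_derivative_mult fd_works Ew_derivative)
 from diff_chain_at[OF Ks_derivative this] show ?thesis unfolding gm_def[abs_def] dgm_def[abs_def] by (simp add: comp_def)
qed

lemma frechet_dKs:
 assumes "f differentiable (at zeta)"
 shows "frechet_derivative f (at zeta) (dKs x e) = ff e *\<^sub>R frechet_derivative f (at zeta) (1, 0) + fs e *\<^sub>R frechet_derivative f (at zeta) (\<i>, 0)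
  + sf e *\<^sub>R frechet_derivative f (at zeta) (0, 1) + (ss e + 2 * ff x * ff e + 2 * fs x * fs e) *\<^sub>R frechet_derivative f (at zeta) (0, \<i>)"
proof -
 have l: "linear (frechet_derivative f (at zeta))" by (rule linear_frechet_derivative[OF assms])
 have "dKs x e = ff e *\<^sub>R (1, 0) + fs e *\<^sub>R (\<i>, 0) + sf e *\<^sub>R (0, 1) + (ss e + 2 * ff x * ff e + 2 * fs x * fs e) *\<^sub>R (0, \<i>)"
  by (simp add: dKs_def complex_eq_iff)
 then show ?thesis by (simp only: linear_add[OF l] linear_scale[OF l])
qed

lemma siegel_Ks_continuous: "continuous_on siegel g ==> continuous_on S4 (%x. g (Ks x))"
 by (rule continuous_on_compose2) (auto simp: S4_siegel intro: Ks_continuous)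

lemma Ew_continuous: "continuous_on A (%x. Ew s r (Ks x))"
proof -
 have "continuous_on UNIV (Ew s r)"
  by (rule continuous_at_imp_continuous_on) (intro ballI has_derivative_continuous[OF Ew_derivative])
 then show ?thesis by (rule continuous_on_compose2) (auto intro: Ks_continuous)
qed

lemma gm_continuous: assumes "smooth_on siegel f" shows "continuous_on S4 (gm s r f)" "continuous_on S4 (%x. dgm s r f x e)"
proof -
 have f: "continuous_on S4 (%x. f (Ks x))" by (rule siegel_Ks_continuous) (use smoothD(3)[OF assms, of 0] in simp)
 show "continuous_on S4 (gm s r f)" unfolding gm_def[abs_def] by (intro continuous_intros f Ew_continuous)
 have D: "continuous_on S4 (%x. frechet_derivative f (at (Ks x)) v)" for v
  by (rule siegel_Ks_continuous) (use smoothD(3)[OF smoothD(2)[OF assms], of 0 v] in simp)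
 have "continuous_on S4 (%x. frechet_derivative f (at (Ks x)) (dKs x e))"
 proof (rule continuous_on_eq)
  show "continuous_on S4 (%x. ff e *\<^sub>R frechet_derivative f (at (Ks x)) (1, 0) + fs e *\<^sub>R frechet_derivative f (at (Ks x)) (\<i>, 0)
   + sf e *\<^sub>R frechet_derivative f (at (Ks x)) (0, 1) + (ss e + 2 * ff x * ff e + 2 * fs x * fs e) *\<^sub>R frechet_derivative f (at (Ks x)) (0, \<i>))"
   by (intro continuous_intros D)
 qed (rule frechet_dKs[symmetric], use smoothD(1)[OF assms] S4_siegel in blast)
 moreover have "continuous_on S4 (%x. dEw s r (Ks x) (dKs x e))"
  unfolding dEw_def by (intro continuous_intros Ew_continuous) (auto simp: Ks_eq dKs_def intro!: continuous_intros)
 ultimately show "continuous_on S4 (%x. dgm s r f x e)" unfolding dgm_def by (intro continuous_intros f Ew_continuous)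
qed

abbreviation "eu1 \<equiv> ((1, 0), (0, 0)) :: r4"
abbreviation "eu2 \<equiv> ((0, 1), (0, 0)) :: r4"
abbreviation "ev1 \<equiv> ((0, 0), (1, 0)) :: r4"
abbreviation "ev2 \<equiv> ((0, 0), (0, 1)) :: r4"

text \<open>The terms from differentiating the weight cancel because it is holomorphic. The second
  identity contains no derivative along \<open>ev2\<close>, so cutoffs in v2 are untouched by the
  tangential equation.\<close>

lemma dgm_dbar:
 assumes "smooth_on siegel f" "x \<in> S4"
 shows "dgm s r f x eu2 + \<i> * dgm s r f x ev2 = 2 * gm s r (dbar2 f) x"
  "dgm s r f x eu1 + \<i> * dgm s r f x ev1 - 2 * \<i> * (of_real (ff x) + \<i> * of_real (fs x)) * dgm s r f x eu2 = 2 * gm s r (dbar_tangential f) x"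
proof -
 have d: "f differentiable (at (Ks x))" using smoothD(1)[OF assms(1)] assms(2) S4_siegel by blast
 note D = frechet_dKs[OF d]
 have z: "fst (Ks x) = of_real (ff x) + \<i> * of_real (fs x)" by (simp add: Ks_eq)
 show "dgm s r f x eu2 + \<i> * dgm s r f x ev2 = 2 * gm s r (dbar2 f) x"
  unfolding dgm_def D by (simp add: gm_def dbar2_def dEw_def dKs_def algebra_simps)
 let ?a = "frechet_derivative f (at (Ks x)) (1, 0)" and ?b = "frechet_derivative f (at (Ks x)) (\<i>, 0)"
 let ?c = "frechet_derivative f (at (Ks x)) (0, 1)" and ?d = "frechet_derivative f (at (Ks x)) (0, \<i>)"
 have 1: "dEw s r (Ks x) (dKs x eu1) + \<i> * dEw s r (Ks x) (dKs x ev1) - 2 * \<i> * fst (Ks x) * dEw s r (Ks x) (dKs x eu2) = 0"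
  unfolding dEw_def z by (simp add: dKs_def algebra_simps)
 have 2: "frechet_derivative f (at (Ks x)) (dKs x eu1) + \<i> * frechet_derivative f (at (Ks x)) (dKs x ev1) - 2 * \<i> * fst (Ks x) * frechet_derivative f (at (Ks x)) (dKs x eu2)
  = 2 * dbar_tangential f (Ks x)"
  unfolding D dbar_tangential_def dbar1_def dbar2_def z by (simp add: scaleR_conv_of_real algebra_simps add_divide_distrib)
 have "dgm s r f x eu1 + \<i> * dgm s r f x ev1 - 2 * \<i> * fst (Ks x) * dgm s r f x eu2 =
  f (Ks x) * (dEw s r (Ks x) (dKs x eu1) + \<i> * dEw s r (Ks x) (dKs x ev1) - 2 * \<i> * fst (Ks x) * dEw s r (Ks x) (dKs x eu2)) +
  (frechet_derivative f (at (Ks x)) (dKs x eu1) + \<i> * frechet_derivative f (at (Ks x)) (dKs x ev1) - 2 * \<i> * fst (Ks x) * frechet_derivative f (at (Ks x)) (dKs x eu2)) * Ew s r (Ks x)"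
  by (simp add: dgm_def algebra_simps)
 also have "... = 2 * gm s r (dbar_tangential f) x" unfolding 1 2 by (simp add: gm_def)
 finally show "dgm s r f x eu1 + \<i> * dgm s r f x ev1 - 2 * \<i> * (of_real (ff x) + \<i> * of_real (fs x)) * dgm s r f x eu2 = 2 * gm s r (dbar_tangential f) x"
  unfolding z .
qed

lemma gm_parts:
 assumes f: "smooth_on siegel f" and C: "compact C" "C \<subseteq> S4"
  and X: "continuous_on UNIV X" "!!x. x \<notin> C ==> X x = 0" and X': "continuous_on UNIV X'" "!!x. x \<notin> C ==> X' x = 0"
  and d: "!!x. ((%t. X (x + t *\<^sub>R e)) has_vector_derivative X' x) (at 0)"
 shows "intg (%x. dgm s r f x e * X x)" "intg (%x. gm s r f x * X' x)"
  "(LB x. dgm s r f x e * X x) = - (LB x. gm s r f x * X' x)"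
proof -
 have c: "continuous_on S4 X" "continuous_on S4 X'" using X X' continuous_on_subset by blast+
 note g = gm_continuous[OF f, of s r]
 have z: "continuous_on UNIV F ==> (!!x. x \<notin> C ==> F x = 0) ==> intg F" for F :: "r4 => complex"
  by (rule integrable_continuous_compact[OF _ C(1)])
 show 1: "intg (%x. dgm s r f x e * X x)"
  by (rule z, rule continuous_zero_extension[OF open_S4 C]) (use X in \<open>auto intro!: continuous_intros g c\<close>)
 show 2: "intg (%x. gm s r f x * X' x)"
  by (rule z, rule continuous_zero_extension[OF open_S4 C]) (use X' in \<open>auto intro!: continuous_intros g c\<close>)
 have "(LB x. gm s r f x * X' x + dgm s r f x e * X x) = 0"
 proof (rule integral_directional_derivative(2)[OF open_S4 C, where F = "%x. gm s r f x * X x" and d = e])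
  fix x assume x: "x \<in> S4"
  have "((%t. gm s r f (x + t *\<^sub>R e)) has_vector_derivative frechet_derivative (gm s r f) (at (x + 0 *\<^sub>R e)) e) (at 0)"
   by (rule line_derivative) (use gm_derivative[OF f x] in \<open>auto simp: differentiable_def\<close>)
  then have "((%t. gm s r f (x + t *\<^sub>R e)) has_vector_derivative dgm s r f x e) (at 0)"
   by (simp add: frechet_eqI[OF gm_derivative[OF f x]])
  from has_vector_derivative_mult[OF this d[of x]]
  show "((%t. gm s r f (x + t *\<^sub>R e) * X (x + t *\<^sub>R e)) has_vector_derivative gm s r f x * X' x + dgm s r f x e * X x) (at 0)" by simp
 qed (use X X' in \<open>auto intro!: continuous_intros g c\<close>)
 then show "(LB x. dgm s r f x e * X x) = - (LB x. gm s r f x * X' x)"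
  unfolding int_add[OF 2 1] by (simp add: eq_neg_iff_add_eq_0 add.commute)
qed

section \<open>Weak form of the two equations\<close>

definition T4 :: "(real => complex) => (real => complex) => (real => complex) => (real => complex) => r4 => complex" where
 "T4 p q a b = tp (tp p q) (tp a b)"

lemma T4_continuous:
 assumes "continuous_on UNIV p" "continuous_on UNIV q" "continuous_on UNIV a" "continuous_on UNIV b"
 shows "continuous_on UNIV (T4 p q a b)"
proof -
 have c: "continuous_on UNIV (%x::r4. p (ff x))" "continuous_on UNIV (%x::r4. q (sf x))"
  "continuous_on UNIV (%x::r4. a (fs x))" "continuous_on UNIV (%x::r4. b (ss x))"
  by (rule continuous_on_compose2[OF assms(1)] continuous_on_compose2[OF assms(2)] continuous_on_compose2[OF assms(3)] continuous_on_compose2[OF assms(4)];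
    auto intro!: continuous_intros)+
 show ?thesis unfolding T4_def tp_def[abs_def] by (intro continuous_intros c)
qed

lemma T4_deriv:
 "(!!x. (p has_vector_derivative p' x) (at x)) ==> ((%t. T4 p q a b (x + t *\<^sub>R eu1)) has_vector_derivative T4 p' q a b x) (at 0)"
 "(!!x. (q has_vector_derivative q' x) (at x)) ==> ((%t. T4 p q a b (x + t *\<^sub>R eu2)) has_vector_derivative T4 p q' a b x) (at 0)"
 "(!!x. (a has_vector_derivative a' x) (at x)) ==> ((%t. T4 p q a b (x + t *\<^sub>R ev1)) has_vector_derivative T4 p q a' b x) (at 0)"
 "(!!x. (b has_vector_derivative b' x) (at x)) ==> ((%t. T4 p q a b (x + t *\<^sub>R ev2)) has_vector_derivative T4 p q a b' x) (at 0)"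
proof -
 have *: "((%t. c * g (y + t)) has_vector_derivative c * g' y) (at 0)" if "!!x. (g has_vector_derivative g' x) (at x)" for c y and g g' :: "real => complex"
  by (rule bounded_linear.has_vector_derivative[OF bounded_linear_mult_right has_vector_derivative_shift[OF that]])
 show "(!!x. (p has_vector_derivative p' x) (at x)) ==> ((%t. T4 p q a b (x + t *\<^sub>R eu1)) has_vector_derivative T4 p' q a b x) (at 0)"
  using *[of p p' "q (sf x) * (a (fs x) * b (ss x))" "ff x"] by (simp add: T4_def tp_def mult_ac)
 show "(!!x. (q has_vector_derivative q' x) (at x)) ==> ((%t. T4 p q a b (x + t *\<^sub>R eu2)) has_vector_derivative T4 p q' a b x) (at 0)"
  using *[of q q' "p (ff x) * (a (fs x) * b (ss x))" "sf x"] by (simp add: T4_def tp_def mult_ac)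
 show "(!!x. (a has_vector_derivative a' x) (at x)) ==> ((%t. T4 p q a b (x + t *\<^sub>R ev1)) has_vector_derivative T4 p q a' b x) (at 0)"
  using *[of a a' "p (ff x) * (q (sf x) * b (ss x))" "fs x"] by (simp add: T4_def tp_def mult_ac)
 show "(!!x. (b has_vector_derivative b' x) (at x)) ==> ((%t. T4 p q a b (x + t *\<^sub>R ev2)) has_vector_derivative T4 p q a b' x) (at 0)"
  using *[of b b' "p (ff x) * (q (sf x) * a (fs x))" "ss x"] by (simp add: T4_def tp_def mult_ac)
qed

definition box4 :: "real => real => real => real => real => r4 set" where
 "box4 \<rho> \<alpha> \<beta> \<alpha>' \<beta>' = ({-\<rho>..\<rho>} \<times> {-\<rho>..\<rho>}) \<times> ({\<alpha>..\<beta>} \<times> {\<alpha>'..\<beta>'})"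

lemma box4: "compact (box4 \<rho> \<alpha> \<beta> \<alpha>' \<beta>')" "0 < \<alpha>' ==> box4 \<rho> \<alpha> \<beta> \<alpha>' \<beta>' \<subseteq> S4"
 unfolding box4_def by (intro compact_Times compact_Icc) (auto simp: S4_def)

lemma T4_box:
 assumes "cc (-\<rho>) \<rho> p" "cc (-\<rho>) \<rho> q" "cc \<alpha> \<beta> a" "cc \<alpha>' \<beta>' b" "x \<notin> box4 \<rho> \<alpha> \<beta> \<alpha>' \<beta>'"
 shows "T4 p q a b x = 0"
proof -
 have "ff x \<notin> {-\<rho>..\<rho>} \<or> sf x \<notin> {-\<rho>..\<rho>} \<or> fs x \<notin> {\<alpha>..\<beta>} \<or> ss x \<notin> {\<alpha>'..\<beta>'}"
  using assms(5) unfolding box4_def by (cases x) auto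
 then show ?thesis using assms(1-4) unfolding T4_def tp_def cc_def by fastforce
qed

lemma T4_cont': "cc (-\<rho>) \<rho> p ==> cc (-\<rho>) \<rho> q ==> cc \<alpha> \<beta> a ==> cc \<alpha>' \<beta>' b ==> continuous_on UNIV (T4 p q a b)"
 by (intro T4_continuous) (auto simp: cc_def)

definition W4 where "W4 s r f p q a b = (LB x. gm s r f x * T4 p q a b x)"

lemma W4_step2:
 assumes f: "smooth_on siegel f" and pos: "0 < \<alpha>'"
  and c: "cc (-\<rho>) \<rho> p" "cc (-\<rho>) \<rho> q" "cc (-\<rho>) \<rho> q'" "cc \<alpha> \<beta> a" "cc \<alpha>' \<beta>' b" "cc \<alpha>' \<beta>' b'"
  and q': "!!x. (q has_vector_derivative q' x) (at x)" and b': "!!x. (b has_vector_derivative b' x) (at x)"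
 shows "2 * W4 s r (dbar2 f) p q a b = - W4 s r f p q' a b - \<i> * W4 s r f p q a b'"
proof -
 let ?X = "T4 p q a b"
 note B = box4(1)[of \<rho> \<alpha> \<beta> \<alpha>' \<beta>'] box4(2)[OF pos, of \<rho> \<alpha> \<beta> \<beta>']
 note X = T4_cont'[OF c(1,2,4,5)] T4_box[OF c(1,2,4,5)]
 note P = gm_parts[OF f B X T4_cont'[OF c(1,3,4,5)] T4_box[OF c(1,3,4,5)] T4_deriv(2)[OF q'], of s r]
 note Q = gm_parts[OF f B X T4_cont'[OF c(1,2,4,6)] T4_box[OF c(1,2,4,6)] T4_deriv(4)[OF b'], of s r]
 have e: "2 * (gm s r (dbar2 f) x * ?X x) = dgm s r f x eu2 * ?X x + \<i> * (dgm s r f x ev2 * ?X x)" for x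
 proof (cases "x \<in> S4")
  case True
  have "dgm s r f x eu2 * ?X x + \<i> * (dgm s r f x ev2 * ?X x) = (dgm s r f x eu2 + \<i> * dgm s r f x ev2) * ?X x" by (simp add: algebra_simps)
  then show ?thesis unfolding dgm_dbar(1)[OF f True, of s r] by (simp add: mult.assoc)
 next
  case False then have "?X x = 0" using X(2) B(2) by blast
  then show ?thesis by simp
 qed
 have "2 * W4 s r (dbar2 f) p q a b = (LB x. 2 * (gm s r (dbar2 f) x * ?X x))" unfolding W4_def by simp
 also have "... = (LB x. dgm s r f x eu2 * ?X x) + (LB x. \<i> * (dgm s r f x ev2 * ?X x))"
  unfolding e by (rule int_add[OF P(1) integrable_mult_right[OF Q(1)]])
 also have "... = - W4 s r f p q' a b - \<i> * W4 s r f p q a b'" unfolding W4_def using P(3) Q(3) by simp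
 finally show ?thesis .
qed

text \<open>The variable coefficient u1 + i v1 is absorbed into the test function, whose factors
  remain of the same kind after multiplication by u1 or v1.\<close>

lemma W4_step1:
 assumes f: "smooth_on siegel f" and t: "!!zeta. zeta \<in> siegel ==> dbar_tangential f zeta = 0" and pos: "0 < \<alpha>'"
  and c: "cc (-\<rho>) \<rho> p" "cc (-\<rho>) \<rho> p'" "cc (-\<rho>) \<rho> q" "cc (-\<rho>) \<rho> q'" "cc \<alpha> \<beta> a" "cc \<alpha> \<beta> a'" "cc \<alpha>' \<beta>' b"
  and p': "!!x. (p has_vector_derivative p' x) (at x)" and q': "!!x. (q has_vector_derivative q' x) (at x)" and a': "!!x. (a has_vector_derivative a' x) (at x)"
 shows "0 = W4 s r f p' q a b + \<i> * W4 s r f p q a' b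
  - 2 * \<i> * (W4 s r f (%u. of_real u * p u) q' a b + \<i> * W4 s r f p q' (%v. of_real v * a v) b)"
proof -
 let ?X = "T4 p q a b"
 let ?Y = "T4 (%u. of_real u * p u) q a b" and ?Z = "T4 p q (%v. of_real v * a v) b"
 have c': "cc (-\<rho>) \<rho> (%u. of_real u * p u)" "cc \<alpha> \<beta> (%v. of_real v * a v)"
  using c(1,5) unfolding cc_def by (auto intro!: continuous_intros)
 note B = box4(1)[of \<rho> \<alpha> \<beta> \<alpha>' \<beta>'] box4(2)[OF pos, of \<rho> \<alpha> \<beta> \<beta>']
 note X = T4_cont'[OF c(1,3,5,7)] T4_box[OF c(1,3,5,7)]
 note P = gm_parts[OF f B X T4_cont'[OF c(2,3,5,7)] T4_box[OF c(2,3,5,7)] T4_deriv(1)[OF p'], of s r]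
 note Q = gm_parts[OF f B X T4_cont'[OF c(1,3,6,7)] T4_box[OF c(1,3,6,7)] T4_deriv(3)[OF a'], of s r]
 note Y = gm_parts[OF f B T4_cont'[OF c'(1) c(3,5,7)] T4_box[OF c'(1) c(3,5,7)] T4_cont'[OF c'(1) c(4,5,7)] T4_box[OF c'(1) c(4,5,7)] T4_deriv(2)[OF q'], of s r]
 note Z = gm_parts[OF f B T4_cont'[OF c(1,3) c'(2) c(7)] T4_box[OF c(1,3) c'(2) c(7)] T4_cont'[OF c(1,4) c'(2) c(7)] T4_box[OF c(1,4) c'(2) c(7)] T4_deriv(2)[OF q'], of s r]
 have YZ: "?Y x = of_real (ff x) * ?X x" "?Z x = of_real (fs x) * ?X x" for x by (simp_all add: T4_def tp_def)
 have e: "(dgm s r f x eu1 * ?X x + \<i> * (dgm s r f x ev1 * ?X x)) - 2 * \<i> * (dgm s r f x eu2 * ?Y x + \<i> * (dgm s r f x eu2 * ?Z x)) = 0" for x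
 proof (cases "x \<in> S4")
  case True
  then have "gm s r (dbar_tangential f) x = 0" using t S4_siegel by (auto simp: gm_def)
  with dgm_dbar(2)[OF f True, of s r]
  have z: "dgm s r f x eu1 + \<i> * dgm s r f x ev1 - 2 * \<i> * (of_real (ff x) + \<i> * of_real (fs x)) * dgm s r f x eu2 = 0" by simp
  have "(dgm s r f x eu1 * ?X x + \<i> * (dgm s r f x ev1 * ?X x)) - 2 * \<i> * (dgm s r f x eu2 * ?Y x + \<i> * (dgm s r f x eu2 * ?Z x)) =
   (dgm s r f x eu1 + \<i> * dgm s r f x ev1 - 2 * \<i> * (of_real (ff x) + \<i> * of_real (fs x)) * dgm s r f x eu2) * ?X x"
   unfolding YZ by (simp add: algebra_simps)
  then show ?thesis unfolding z by simp
 next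
  case False then have "?X x = 0" using X(2) B(2) by blast
  then show ?thesis unfolding YZ by simp
 qed
 have 1: "intg (%x. dgm s r f x eu1 * ?X x + \<i> * (dgm s r f x ev1 * ?X x))"
  by (intro integrable_add_B integrable_mult_right P(1) Q(1))
 have 2: "intg (%x. dgm s r f x eu2 * ?Y x + \<i> * (dgm s r f x eu2 * ?Z x))"
  by (intro integrable_add_B integrable_mult_right Y(1) Z(1))
 have "0 = (LB x. (dgm s r f x eu1 * ?X x + \<i> * (dgm s r f x ev1 * ?X x)) - 2 * \<i> * (dgm s r f x eu2 * ?Y x + \<i> * (dgm s r f x eu2 * ?Z x)))"
  unfolding e by simp
 also have "... = (LB x. dgm s r f x eu1 * ?X x + \<i> * (dgm s r f x ev1 * ?X x)) - 2 * \<i> * (LB x. dgm s r f x eu2 * ?Y x + \<i> * (dgm s r f x eu2 * ?Z x))"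
  unfolding int_diff[OF 1 integrable_mult_right[OF 2]] by simp
 also have "(LB x. dgm s r f x eu1 * ?X x + \<i> * (dgm s r f x ev1 * ?X x)) = - W4 s r f p' q a b - \<i> * W4 s r f p q a' b"
 proof -
  have "(LB x. dgm s r f x eu1 * ?X x) = - W4 s r f p' q a b" "(LB x. dgm s r f x ev1 * ?X x) = - W4 s r f p q a' b"
   unfolding W4_def by (rule P(3) Q(3); assumption)+
  then show ?thesis by (subst int_add[OF P(1) integrable_mult_right[OF Q(1)]]) simp_all
 qed
 also have "(LB x. dgm s r f x eu2 * ?Y x + \<i> * (dgm s r f x eu2 * ?Z x)) =
  - W4 s r f (%u. of_real u * p u) q' a b - \<i> * W4 s r f p q' (%v. of_real v * a v) b"
 proof -
  have "(LB x. dgm s r f x eu2 * ?Y x) = - W4 s r f (%u. of_real u * p u) q' a b"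
   "(LB x. dgm s r f x eu2 * ?Z x) = - W4 s r f p q' (%v. of_real v * a v) b"
   unfolding W4_def by (rule Y(3) Z(3); assumption)+
  then show ?thesis by (subst int_add[OF Y(1) integrable_mult_right[OF Z(1)]]) simp_all
 qed
 finally show ?thesis by (simp add: algebra_simps)
qed

text \<open>Integrability over all u and over compact pieces of the half-plane of v: the condition
  under which cutoffs in u can be removed.\<close>

definition slab :: "(r4 => complex) => bool" where
 "slab h \<longleftrightarrow> (\<forall>k. intg (%x. h x * tp (indicator (Qk k)) (indicator (Ck k)) (snd x)))"

lemma Qk_sup: "\<exists>k. \<forall>j\<ge>k. {\<alpha>..\<beta>} \<subseteq> Qk j"
proof -
 obtain k where "max \<bar>\<alpha>\<bar> \<bar>\<beta>\<bar> \<le> real k" using real_arch_simple by blast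
 then show ?thesis by (intro exI[of _ k]) (auto simp: Qk_def)
qed

lemma Ck_sup: assumes "0 < \<alpha>" shows "\<exists>k. \<forall>j\<ge>k. {\<alpha>..\<beta>} \<subseteq> Ck j"
proof -
 obtain k where k: "max (1 / \<alpha>) \<beta> \<le> real k" using real_arch_simple by blast
 have "1 / real (Suc j) \<le> \<alpha>" if "j \<ge> k" for j
 proof -
  have "1 / \<alpha> \<le> real (Suc j)" using k that by simp
  then show ?thesis using assms by (simp add: field_simps)
 qed
 then show ?thesis using k by (intro exI[of _ k]) (force simp: Ck_def)
qed

lemma slab_mult:
 assumes h: "slab h" and a: "cc \<alpha> \<beta> a" and b: "cc \<alpha>' \<beta>' b" and pos: "0 < \<alpha>'"
  and g: "g \<in> BM" and gb: "!!x. cmod (g x) \<le> B"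
 shows "intg (%x. h x * (g x * tp a b (snd x)))"
proof -
 obtain k1 k2 where k: "\<forall>j\<ge>k1. {\<alpha>..\<beta>} \<subseteq> Qk j" "\<forall>j\<ge>k2. {\<alpha>'..\<beta>'} \<subseteq> Ck j" using Qk_sup Ck_sup[OF pos] by blast
 let ?k = "max k1 k2"
 have ab: "a \<in> BM" "b \<in> BM" using a b by (auto simp: cc_def intro: borel_measurable_continuous_onI)
 obtain A where A: "!!x. cmod (a x) \<le> A" using cc_bounded[OF a] by blast
 obtain A' where A': "!!x. cmod (b x) \<le> A'" using cc_bounded[OF b] by blast
 have "intg (%x. (h x * tp (indicator (Qk ?k)) (indicator (Ck ?k)) (snd x)) * (g x * tp a b (snd x)))"
 proof (rule integrable_bounded_mult[where C = "B * (A * A')"])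
  show "intg (%x. h x * tp (indicator (Qk ?k)) (indicator (Ck ?k)) (snd x))" using h by (simp add: slab_def)
  have [measurable]: "tp a b \<in> BM" using ab by (rule tp_measurable)
  show "(%x. g x * tp a b (snd x)) \<in> borel_measurable lborel" using g by measurable
  have "0 \<le> B" "0 \<le> A" using gb A norm_ge_zero order_trans by blast+
  then show "cmod (g x * tp a b (snd x)) \<le> B * (A * A')" for x
   unfolding norm_mult tp_def by (intro mult_mono gb A A') auto
 qed
 moreover have "(h x * tp (indicator (Qk ?k)) (indicator (Ck ?k)) (snd x)) * (g x * tp a b (snd x)) = h x * (g x * tp a b (snd x))" for x
 proof (cases "fs x \<in> {\<alpha>..\<beta>} \<and> ss x \<in> {\<alpha>'..\<beta>'}")
  case True
  then have "fs x \<in> Qk ?k" "ss x \<in> Ck ?k" using k by (meson max.cobounded1 max.cobounded2 subsetD)+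
  then show ?thesis by (simp add: tp_def)
 next
  case False
  then have "tp a b (snd x) = 0" using a b by (auto simp: tp_def cc_def)
  then show ?thesis by simp
 qed
 ultimately show ?thesis by simp
qed

section \<open>Removal of the cutoffs in u\<close>

abbreviation rsc :: "nat => (real => complex) => real => complex" where
 "rsc N p \<equiv> (%u. p (u / real (Suc N)))"

definition G4 where "G4 s r f a b = (LB x. gm s r f x * tp a b (snd x))"

text \<open>The widened cutoffs tend boundedly to the constants \<open>p 0\<close> and
  \<open>q 0\<close>, and slab integrability provides the majorant.\<close>

lemma W4_limit:
 assumes h: "slab (gm s r f)" and a: "cc \<alpha> \<beta> a" and b: "cc \<alpha>' \<beta>' b" and pos: "0 < \<alpha>'" and p: "cut 0 p" and q: "cut 0 q"
 shows "(%N. W4 s r f (rsc N p) (rsc N q) a b) \<longlonglongrightarrow> p 0 * q 0 * G4 s r f a b"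
proof -
 have cp: "cc (-1) 1 p" "cc (-1) 1 q" using p q by (auto simp: cc_def)
 obtain P where P: "!!x. cmod (p x) \<le> P" using cc_bounded[OF cp(1)] by blast
 obtain Q where Q: "!!x. cmod (q x) \<le> Q" using cc_bounded[OF cp(2)] by blast
 have P0: "0 \<le> P" using P norm_ge_zero order_trans by blast
 have cpc: "continuous_on UNIV p" "continuous_on UNIV q" using cp by (auto simp: cc_def)
 then have [measurable]: "p \<in> BM" "q \<in> BM" by (auto intro: borel_measurable_continuous_onI)
 have base: "intg (%x. gm s r f x * (1 * tp a b (snd x)))" by (rule slab_mult[OF h a b pos, where B = 1]) auto
 then have mb[measurable]: "(%x. gm s r f x * tp a b (snd x)) \<in> BM" by auto
 have n0: "(%N. y / real (Suc N)) \<longlonglongrightarrow> 0" for y using LIMSEQ_Suc[OF lim_const_over_n[of y]] by simp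
 have lp: "(%N. g (y / real (Suc N))) \<longlonglongrightarrow> g 0" if "continuous_on UNIV g" for y and g :: "real => complex"
  using that n0 by (auto simp: continuous_on_eq_continuous_at intro: isCont_tendsto_compose)
 have e: "gm s r f x * T4 (rsc N p) (rsc N q) a b x = (p (ff x / real (Suc N)) * q (sf x / real (Suc N))) * (gm s r f x * tp a b (snd x))" for x N
  by (simp add: T4_def tp_def)
 have "(%N. LB x. (p (ff x / real (Suc N)) * q (sf x / real (Suc N))) * (gm s r f x * tp a b (snd x)))
  \<longlonglongrightarrow> (LB x. (p 0 * q 0) * (gm s r f x * tp a b (snd x)))"
 proof (rule integral_dominated_convergence[where w = "%x. P * Q * cmod (gm s r f x * tp a b (snd x))"])
  show "intg (%x. P * Q * cmod (gm s r f x * tp a b (snd x)))" using base by (intro integrable_mult_right integrable_norm) simp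
  show "AB x. (%N. (p (ff x / real (Suc N)) * q (sf x / real (Suc N))) * (gm s r f x * tp a b (snd x)))
   \<longlonglongrightarrow> (p 0 * q 0) * (gm s r f x * tp a b (snd x))"
   by (intro AE_I2 tendsto_intros lp cpc)
  show "AB x. cmod ((p (ff x / real (Suc N)) * q (sf x / real (Suc N))) * (gm s r f x * tp a b (snd x))) \<le> P * Q * cmod (gm s r f x * tp a b (snd x))" for N
   unfolding norm_mult[of "p _ * q _"] unfolding norm_mult[of "p _"] by (intro AE_I2 mult_right_mono mult_mono P Q P0) auto
 qed measurable
 then show ?thesis unfolding W4_def e G4_def by simp
qed

lemma rsc_cc: "cut 0 p ==> cc (- real (Suc N)) (real (Suc N)) (rsc N p)"
 unfolding cc_def cut.simps
 by (auto simp: field_simps intro!: continuous_on_compose2[of UNIV p] continuous_intros)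

lemma rsc_deriv: "(!!x. (p has_vector_derivative p' x) (at x)) ==> (rsc N p has_vector_derivative of_real (1 / real (Suc N)) * rsc N p' x) (at x)"
proof -
 assume d: "!!x. (p has_vector_derivative p' x) (at x)"
 have "(p \<circ> (%u. u / real (Suc N)) has_vector_derivative ((1 / real (Suc N)) *\<^sub>R p' (x / real (Suc N)))) (at x)"
  by (rule vector_diff_chain_at[OF _ d]) (auto intro!: derivative_eq_intros simp del: of_nat_Suc)
 then show ?thesis by (simp add: comp_def scaleR_conv_of_real del: of_nat_Suc)
qed

lemma W4_scale:
 "W4 s r f (%u. c * p u) q a b = c * W4 s r f p q a b" "W4 s r f p (%u. c * q u) a b = c * W4 s r f p q a b"
 unfolding W4_def integral_mult_right_zero[symmetric] by (simp_all add: T4_def tp_def mult_ac)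

text \<open>Each derivative of a widened cutoff contributes 1 / (N + 1), so in the limit of the weak
  equation only the term with the derivative in v1 is left.\<close>

lemma G4_tangential:
 assumes f: "smooth_on siegel f" and t: "!!zeta. zeta \<in> siegel ==> dbar_tangential f zeta = 0" and h: "slab (gm s r f)" and pos: "0 < \<alpha>'"
  and c: "cc \<alpha> \<beta> a" "cc \<alpha> \<beta> a'" "cc \<alpha>' \<beta>' b" and a': "!!x. (a has_vector_derivative a' x) (at x)"
 shows "G4 s r f a' b = 0"
proof -
 obtain \<eta> where \<eta>: "cut 1 \<eta>" "\<eta> 0 = 1" using ex_cut by blast
 obtain \<eta>' where \<eta>': "!!u. (\<eta> has_vector_derivative \<eta>' u) (at u)" "cut 0 \<eta>'" using \<eta>(1) by auto
 have c0: "cut 0 \<eta>" using \<eta>(1) by (rule cut_0)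
 have c1: "cut 0 (%u. of_real u * \<eta> u)" using c0 by (auto intro!: continuous_intros)
 have va: "cc \<alpha> \<beta> (%v. of_real v * a v)" using c(1) unfolding cc_def by (auto intro!: continuous_intros)
 let ?e = "%N. cr (1 / real (Suc N))"
 have cd: "cc (- real (Suc N)) (real (Suc N)) (%u. ?e N * rsc N \<eta>' u)" for N
  using rsc_cc[OF \<eta>'(2), of N] unfolding cc_def by (auto intro!: continuous_intros simp del: of_nat_Suc)
 have e0: "?e \<longlonglongrightarrow> 0" using tendsto_of_real[OF LIMSEQ_Suc[OF lim_const_over_n[of 1]], where 'a = complex] by simp
 have "0 = ?e N * W4 s r f (rsc N \<eta>') (rsc N \<eta>) a b + \<i> * W4 s r f (rsc N \<eta>) (rsc N \<eta>) a' b
  - 2 * \<i> * (W4 s r f (rsc N (%u. of_real u * \<eta> u)) (rsc N \<eta>') a b + \<i> * (?e N * W4 s r f (rsc N \<eta>) (rsc N \<eta>') (%v. of_real v * a v) b))" for N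
 proof -
  \<comment> \<open>The coefficient u1 grows like the width of the cutoff and exactly cancels the
    factor 1 / (N + 1). This term still tends to 0, because u times \<open>\<eta> u\<close> vanishes
    at u = 0.\<close>
  have m: "W4 s r f (%u. of_real u * rsc N \<eta> u) (%u. ?e N * rsc N \<eta>' u) a b = W4 s r f (rsc N (%u. of_real u * \<eta> u)) (rsc N \<eta>') a b"
  proof -
   have "(%u. cr u * rsc N \<eta> u) = (%u. of_real (real (Suc N)) * rsc N (%u. of_real u * \<eta> u) u)" by (simp add: fun_eq_iff del: of_nat_Suc)
   then show ?thesis by (simp only: W4_scale) (simp del: of_nat_Suc)
  qed
  show ?thesis
   using W4_step1[OF f t pos rsc_cc[OF c0, of N] cd[of N] rsc_cc[OF c0, of N] cd[of N] c rsc_deriv[OF \<eta>'(1), of N] rsc_deriv[OF \<eta>'(1), of N] a', where s = s and r = r]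
   unfolding m by (simp only: W4_scale)
 qed
 then have "(%N. ?e N * W4 s r f (rsc N \<eta>') (rsc N \<eta>) a b + \<i> * W4 s r f (rsc N \<eta>) (rsc N \<eta>) a' b
  - 2 * \<i> * (W4 s r f (rsc N (%u. of_real u * \<eta> u)) (rsc N \<eta>') a b + \<i> * (?e N * W4 s r f (rsc N \<eta>) (rsc N \<eta>') (%v. of_real v * a v) b))) \<longlonglongrightarrow> 0"
  by (simp only: tendsto_const[of "0::complex"])
 moreover have "(%N. ?e N * W4 s r f (rsc N \<eta>') (rsc N \<eta>) a b + \<i> * W4 s r f (rsc N \<eta>) (rsc N \<eta>) a' b
  - 2 * \<i> * (W4 s r f (rsc N (%u. of_real u * \<eta> u)) (rsc N \<eta>') a b + \<i> * (?e N * W4 s r f (rsc N \<eta>) (rsc N \<eta>') (%v. of_real v * a v) b)))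
  \<longlonglongrightarrow> 0 * (\<eta>' 0 * \<eta> 0 * G4 s r f a b) + \<i> * (\<eta> 0 * \<eta> 0 * G4 s r f a' b)
  - 2 * \<i> * ((of_real 0 * \<eta> 0) * \<eta>' 0 * G4 s r f a b + \<i> * (0 * (\<eta> 0 * \<eta>' 0 * G4 s r f (%v. of_real v * a v) b)))"
  by (intro tendsto_add tendsto_diff tendsto_mult tendsto_const e0 W4_limit[OF h c(1,3) pos \<eta>'(2) c0]
    W4_limit[OF h c(2,3) pos c0 c0] W4_limit[OF h c(1,3) pos c1 \<eta>'(2)] W4_limit[OF h va c(3) pos c0 \<eta>'(2)])
 ultimately show ?thesis using LIMSEQ_unique \<eta>(2) by fastforce
qed

text \<open>\<open>b\<close> is the n-th derivative of a compactly supported \<open>k 0\<close>.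
  Moving the n operators \<open>dbar2\<close> onto the test function leaves in the limit only
  derivatives in v2, which turn \<open>k 0\<close> into \<open>b\<close>, while the side being
  transformed is 0.\<close>

lemma G4_moments:
 assumes f: "smooth_on siegel f" and z: "!!zeta. zeta \<in> siegel ==> (dbar2 ^^ n) f zeta = 0" and h: "slab (gm s r f)" and pos: "0 < \<alpha>'"
  and a: "cc \<alpha> \<beta> a" and b: "cc \<alpha>' \<beta>' b" and mom: "!!j. j < n ==> (LB x. b x * of_real x ^ j) = 0"
 shows "G4 s r f a b = 0"
proof -
 obtain k where k: "k n = b" "\<forall>m\<le>n. cc \<alpha>' \<beta>' (k m)" "\<forall>m<n. \<forall>x. (k m has_vector_derivative k (Suc m) x) (at x)" using cc_primitives[OF b mom] by blast
 obtain \<eta> where \<eta>: "cut n \<eta>" "\<eta> 0 = 1" using ex_cut by blast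
 have \<eta>0: "cut 0 \<eta>" using \<eta>(1) by (rule cut_0)
 let ?e = "%N. cr (1 / real (Suc N))"
 have e0: "?e \<longlonglongrightarrow> 0" using tendsto_of_real[OF LIMSEQ_Suc[OF lim_const_over_n[of 1]], where 'a = complex] by simp
 \<comment> \<open>The induction allows any starting index i and any cutoff \<open>q\<close>,
   because a step replaces either \<open>k i\<close> by \<open>k (Suc i)\<close> or \<open>q\<close>
   by its derivative; the latter term carries the factor 1 / (N + 1). The powers of 2 clear the
   halves in \<open>dbar2\<close>.\<close>
 have lim: "cut m q ==> i + m \<le> n ==> (%N. 2 ^ m * W4 s r ((dbar2 ^^ m) f) (rsc N \<eta>) (rsc N q) a (k i)) \<longlonglongrightarrow> (- \<i>) ^ m * (\<eta> 0 * q 0 * G4 s r f a (k (i + m)))" for m q i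
 proof (induction m arbitrary: q i)
  case 0
  have "cc \<alpha>' \<beta>' (k i)" using k(2) 0 by auto
  then show ?case using W4_limit[OF h a _ pos \<eta>0, of _ "k i" q] 0 by simp
 next
  case (Suc m)
  obtain q' where q': "!!u. (q has_vector_derivative q' u) (at u)" "cut m q'" using Suc.prems(1) by auto
  have cq: "cut m q" using Suc.prems(1) by (rule cut_Suc)
  have cd: "cc (- real (Suc N)) (real (Suc N)) (%u. ?e N * rsc N q' u)" for N
   using rsc_cc[OF cut_0[OF q'(2)], of N] unfolding cc_def by (auto intro!: continuous_intros simp del: of_nat_Suc)
  have ki: "cc \<alpha>' \<beta>' (k i)" "cc \<alpha>' \<beta>' (k (Suc i))" "!!x. (k i has_vector_derivative k (Suc i) x) (at x)"
   using k(2,3) Suc.prems(2) by auto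
  have "2 ^ Suc m * W4 s r ((dbar2 ^^ Suc m) f) (rsc N \<eta>) (rsc N q) a (k i) =
   - ?e N * (2 ^ m * W4 s r ((dbar2 ^^ m) f) (rsc N \<eta>) (rsc N q') a (k i)) - \<i> * (2 ^ m * W4 s r ((dbar2 ^^ m) f) (rsc N \<eta>) (rsc N q) a (k (Suc i)))" for N
  proof -
   have "2 * W4 s r (dbar2 ((dbar2 ^^ m) f)) (rsc N \<eta>) (rsc N q) a (k i) =
    - (?e N * W4 s r ((dbar2 ^^ m) f) (rsc N \<eta>) (rsc N q') a (k i)) - \<i> * W4 s r ((dbar2 ^^ m) f) (rsc N \<eta>) (rsc N q) a (k (Suc i))"
    using W4_step2[OF smooth_dbar2_pow[OF f, of m] pos rsc_cc[OF \<eta>0, of N] rsc_cc[OF cut_0[OF cq], of N] cd[of N] a ki(1,2) rsc_deriv[OF q'(1), of N] ki(3), where s = s and r = r]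
    unfolding W4_scale .
   then have "2 ^ m * (2 * W4 s r (dbar2 ((dbar2 ^^ m) f)) (rsc N \<eta>) (rsc N q) a (k i)) =
    2 ^ m * (- (?e N * W4 s r ((dbar2 ^^ m) f) (rsc N \<eta>) (rsc N q') a (k i)) - \<i> * W4 s r ((dbar2 ^^ m) f) (rsc N \<eta>) (rsc N q) a (k (Suc i)))" by (simp only:)
   then show ?thesis by (simp add: algebra_simps del: of_nat_Suc)
  qed
  moreover have "(%N. - ?e N * (2 ^ m * W4 s r ((dbar2 ^^ m) f) (rsc N \<eta>) (rsc N q') a (k i)) - \<i> * (2 ^ m * W4 s r ((dbar2 ^^ m) f) (rsc N \<eta>) (rsc N q) a (k (Suc i))))
   \<longlonglongrightarrow> - 0 * ((- \<i>) ^ m * (\<eta> 0 * q' 0 * G4 s r f a (k (i + m)))) - \<i> * ((- \<i>) ^ m * (\<eta> 0 * q 0 * G4 s r f a (k (Suc i + m))))"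
   using Suc.prems(2) by (intro tendsto_diff tendsto_mult tendsto_minus tendsto_const e0 Suc.IH q'(2) cq) auto
  ultimately show ?case by (simp add: mult.assoc)
 qed
 have "W4 s r ((dbar2 ^^ n) f) (rsc N \<eta>) (rsc N \<eta>) a (k 0) = 0" for N
 proof -
  have k0: "cc \<alpha>' \<beta>' (k 0)" using k(2) by auto
  have z0: "gm s r ((dbar2 ^^ n) f) x * T4 (rsc N \<eta>) (rsc N \<eta>) a (k 0) x = 0" for x
  proof (cases "x \<in> S4")
   case True then show ?thesis using z S4_siegel by (auto simp: gm_def)
  next
   case False
   then show ?thesis using T4_box[OF rsc_cc[OF \<eta>0] rsc_cc[OF \<eta>0] a k0] box4(2)[OF pos] by (metis mult_zero_right subsetD)
  qed
  show ?thesis unfolding W4_def z0 by simp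
 qed
 then have "(%N. 0) \<longlonglongrightarrow> (- \<i>) ^ n * (\<eta> 0 * \<eta> 0 * G4 s r f a (k (0 + n)))" using lim[OF \<eta>(1), of 0] by simp
 then have "(- \<i>) ^ n * (\<eta> 0 * \<eta> 0 * G4 s r f a (k (0 + n))) = 0" using LIMSEQ_unique tendsto_const by metis
 then show ?thesis using \<eta>(2) k(1) by simp
qed

section \<open>The shear of frequencies and the transforms of the weights\<close>

lemma mpiso_swap: "mpiso (%x :: 'a::euclidean_space \<times> 'b::euclidean_space. (snd x, fst x)) (%x. (snd x, fst x))"
proof (rule mpisoI)
 fix F :: "'b \<times> 'a => ennreal" assume [measurable]: "F \<in> BM"
 have 1: "(\<integral>\<^sup>+x. F (snd x, fst x) \<partial>(lborel :: ('a \<times> 'b) measure)) = (NN a. NN b. F (b, a))"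
  by (subst lborel_prod[symmetric], subst lborel.nn_integral_fst[symmetric]) (auto simp: lborel_prod)
 have 2: "(NN x. F x) = (NN a. NN b. F (b, a))"
  by (subst lborel_prod[symmetric], subst lborel_pair.nn_integral_snd[symmetric]) (auto simp: lborel_prod)
 show "(NN x. F (snd x, fst x)) = (NN x. F x)" unfolding 1 2 ..
qed auto

text \<open>Dual to the coordinate u2 + 2 u1 v1: the phase xi u1 + t u2 equals (xi - 2 t v1) u1 + t
  (u2 + 2 u1 v1).\<close>

definition tau :: "r4 => r4" where
 "tau x = ((ff x - 2 * sf x * fs x, sf x), snd x)"
definition tau' :: "r4 => r4" where
 "tau' x = ((ff x + 2 * sf x * fs x, sf x), snd x)"

lemma mpiso_tau: "mpiso tau tau'"
proof -
 have p: "mpiso (%x :: r4. (fst (snd x, fst x), (ss (snd x, fst x), fs (snd x, fst x)))) (%y. (snd (fst y, (ss y, fs y)), fst (fst y, (ss y, fs y))))"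
  using mpiso_comp[OF mpiso_swap mpiso_pair[OF mpiso_id mpiso_swap]] by simp
 let ?s = "%(u :: real \<times> real) t. - 2 * t * fst u"
 have s: "mpiso (shear ?s) (shear (%u p. - ?s u p))" by (rule mpiso_shear) measurable
 show ?thesis using mpiso_comp[OF mpiso_comp[OF p s] mpiso_sym[OF p]] by (simp add: shear_def tau_def[abs_def] tau'_def[abs_def])
qed

lemma tau_measurable[measurable]: "tau \<in> BM" "tau' \<in> BM"
 using mpiso_tau by (auto simp: mpiso_def)

lemma mpiso_tau2: "mpiso (%x :: real \<times> real. (fst x - c * snd x, snd x)) (%x. (fst x + c * snd x, snd x))"
proof (rule mpisoI)
 fix F :: "real \<times> real => ennreal" assume [measurable]: "F \<in> BM"
 have e: "(NN a. F (a - c * b, b)) = (NN a. F (a, b))" for b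
  by (subst nn_integral_real_affine[of "%a. F (a, b)" 1 "- c * b"]) (auto simp: add.commute)
 have "(NN x. F (fst x - c * snd x, snd x)) = (NN a. NN b. F (a - c * b, b))" by (subst nn_R2) auto
 also have "... = (NN b. NN a. F (a - c * b, b))" by (rule nn_swap) measurable
 also have "... = (NN b. NN a. F (a, b))" unfolding e ..
 also have "... = (NN a. NN b. F (a, b))" by (rule nn_swap[symmetric]) measurable
 also have "... = (NN x. F x)" by (rule nn_R2[symmetric]) measurable
 finally show "(NN x. F (fst x - c * snd x, snd x)) = (NN x. F x)" .
qed auto

lemma gz_ex: "gz z x * ex u x = gz (z + \<i> * of_real u) x"
 by (simp add: gz_def ex_def exp_add[symmetric] algebra_simps)

lemma gz_cnj_real: "cnj (gz (of_real c - \<i> * of_real s) x) = of_real (exp (- x\<^sup>2 / 2 + c * x)) * ex s x"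
proof -
 have "cnj (gz (of_real c - \<i> * of_real s) x) = exp (of_real (- x\<^sup>2 / 2 + c * x) + \<i> * of_real (s * x))"
  by (simp add: gz_def exp_cnj algebra_simps)
 then show ?thesis by (simp only: exp_add ex_def exp_of_real)
qed

text \<open>The exponentials with rates K and -K together dominate every rate between them, so one
  integrable majorant serves all v in a compact piece.\<close>

definition wg :: "real => real => complex" where "wg K x = gz (of_real K) x + gz (of_real (- K)) x"

lemma wg_props: "wg K \<in> L2b" "intg (wg K)" "\<bar>c\<bar> \<le> K ==> exp (- x\<^sup>2 / 2 + c * x) \<le> cmod (wg K x)"
proof -
 show "wg K \<in> L2b" unfolding wg_def[abs_def] by (intro L2s_add gz_L2s)
 show "intg (wg K)" unfolding wg_def[abs_def] by (intro integrable_add_B gz_integral)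
 assume c: "\<bar>c\<bar> \<le> K"
 have "gz (of_real K) x = of_real (exp (- x\<^sup>2 / 2 + K * x))" for K by (simp add: gz_def exp_of_real[symmetric])
 then have e: "wg K x = of_real (exp (- x\<^sup>2 / 2 + K * x) + exp (- x\<^sup>2 / 2 + - K * x))" unfolding wg_def by (simp del: of_real_minus)
 have w: "cmod (wg K x) = exp (- x\<^sup>2 / 2 + K * x) + exp (- x\<^sup>2 / 2 + - K * x)"
  unfolding e norm_of_real by (rule abs_of_nonneg) (simp add: add_nonneg_nonneg)
 have "c * x \<le> \<bar>c\<bar> * \<bar>x\<bar>" by (metis abs_ge_self abs_mult)
 also have "... \<le> K * \<bar>x\<bar>" by (rule mult_right_mono[OF c]) simp
 finally have cx: "c * x \<le> K * \<bar>x\<bar>" .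
 show "exp (- x\<^sup>2 / 2 + c * x) \<le> cmod (wg K x)"
 proof (cases "x \<ge> 0")
  case True
  then have "exp (- x\<^sup>2 / 2 + c * x) \<le> exp (- x\<^sup>2 / 2 + K * x)" using cx by simp
  then show ?thesis unfolding w by (simp add: add_increasing2)
 next
  case False
  then have "exp (- x\<^sup>2 / 2 + c * x) \<le> exp (- x\<^sup>2 / 2 + - K * x)" using cx by simp
  then show ?thesis unfolding w by (simp add: add_increasing)
 qed
qed

lemma wg_measurable[measurable]: "wg K \<in> BM" using wg_props(1) by (auto simp: L2s_def)

text \<open>In sheared frequencies, the partial transform of H(v) times the conjugate weight;
  \<open>chat_tau\<close> confirms this by inverting it.\<close>

definition chat :: "real => real => (real \<times> real => complex) => r4 => complex" where
 "chat s r H y = H (snd y) * tp (gz (of_real (fs y) - \<i> * of_real s)) (gz (of_real (ss y + 2 * (fs y)\<^sup>2) - \<i> * of_real r)) (fst y)"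

text \<open>The modulus of the Gaussian factor of \<open>chat\<close>. It is independent of s and r,
  which enter only as modulations.\<close>

definition wt :: "r4 => real" where
 "wt y = exp (- (ff y)\<^sup>2 / 2 + fs y * ff y) * exp (- (sf y)\<^sup>2 / 2 + (ss y + 2 * (fs y)\<^sup>2) * sf y)"

lemma wt_measurable[measurable]: "wt \<in> BM" unfolding wt_def[abs_def] by measurable

lemma chat_measurable[measurable]:
 assumes [measurable]: "H \<in> BM" shows "chat s r H \<in> BM"
 unfolding chat_def[abs_def] tp_def gz_def by measurable

lemma chat_cnj: "cnj (chat s r H y) = of_real (wt y) * (ex s (ff y) * ex r (sf y)) * cnj (H (snd y))"
 unfolding chat_def tp_def complex_cnj_mult gz_cnj_real wt_def by (simp only: of_real_mult mult_ac)

definition adm :: "nat => (real \<times> real => complex) => bool" where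
 "adm k H \<longleftrightarrow> H \<in> BM \<and> (\<exists>B. \<forall>v. cmod (H v) \<le> B * cmod (tp (indicator (Qk k)) (indicator (Ck k)) v :: complex))"

lemma integrable_indicator_complex:
 assumes "A \<in> sets borel" "emeasure lborel A < \<infinity>" shows "integrable (lborel :: 'a::euclidean_space measure) (indicator A :: 'a => complex)"
proof -
 have "intg (%x :: 'a. indicator A x *\<^sub>R (1 :: complex))" by (intro integrable_scaleR_left integrable_real_indicator) (use assms in auto)
 moreover have "(%x :: 'a. indicator A x *\<^sub>R (1 :: complex)) = indicator A" by (auto simp: indicator_def fun_eq_iff)
 ultimately show ?thesis by simp
qed

lemma chat_bound:
 assumes "adm k H"
 shows "chat s r H \<in> L2b" "intg (chat s r H)"
proof -
 have [measurable]: "H \<in> BM" using assms by (simp add: adm_def)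
 obtain B where B: "!!v. cmod (H v) \<le> B * cmod (tp (indicator (Qk k)) (indicator (Ck k)) v :: complex)" using assms by (auto simp: adm_def)
 define D where "D = tp (tp (wg (real k)) (wg (real k + 2 * (real k)\<^sup>2))) (tp (indicator (Qk k)) (indicator (Ck k)))"
 have Di: "intg D" and DL: "D \<in> L2b" unfolding D_def
  using Qk Ck(1,2) by (auto intro!: tp_integral tp_L2s wg_props indicator_L2s integrable_indicator_complex)
 have b: "cmod (chat s r H y) \<le> cmod (of_real B * D y)" for y
 proof (cases "fs y \<in> Qk k \<and> ss y \<in> Ck k")
  case True
  then have v1: "\<bar>fs y\<bar> \<le> real k" and v2: "0 \<le> ss y" "ss y \<le> real k"
   by (auto simp: Qk_def Ck_def intro: order_trans[rotated])
  have "(fs y)\<^sup>2 \<le> (real k)\<^sup>2" using v1 by (metis abs_ge_zero power2_abs power_mono)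
  then have v3: "\<bar>ss y + 2 * (fs y)\<^sup>2\<bar> \<le> real k + 2 * (real k)\<^sup>2" using v2 by (simp add: abs_le_iff add_mono)
  have "cmod (chat s r H y) \<le> (B * 1) * (cmod (wg (real k) (ff y)) * cmod (wg (real k + 2 * (real k)\<^sup>2) (sf y)))"
   unfolding chat_def tp_def norm_mult norm_gz
  proof (intro mult_mono)
   show "cmod (H (snd y)) \<le> B * 1" using B[of "snd y"] True by (simp add: tp_def)
   then show "0 \<le> B * 1" using norm_ge_zero order_trans by blast
   show "exp (- (ff y)\<^sup>2 / 2 + Re (cr (fs y) - \<i> * cr s) * ff y) \<le> cmod (wg (real k) (ff y))"
    using wg_props(3)[OF v1, of "ff y"] by simp
   show "exp (- (sf y)\<^sup>2 / 2 + Re (cr (ss y + 2 * (fs y)\<^sup>2) - \<i> * cr r) * sf y) \<le> cmod (wg (real k + 2 * (real k)\<^sup>2) (sf y))"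
    using wg_props(3)[OF v3, of "sf y"] by simp
  qed auto
  also have "... \<le> \<bar>B\<bar> * (cmod (wg (real k) (ff y)) * cmod (wg (real k + 2 * (real k)\<^sup>2) (sf y)))"
   by (intro mult_right_mono) auto
  also have "... = cmod (of_real B * D y)" using True by (simp add: D_def tp_def norm_mult)
  finally show ?thesis .
 next
  case False
  then have "H (snd y) = 0" using B[of "snd y"] by (auto simp: tp_def)
  then show ?thesis by (simp add: chat_def)
 qed
 show "intg (chat s r H)"
  by (rule integrable_bd[OF integrable_mult_right[OF Di, of "of_real B"]]) (use b in auto)
 have "(%y. of_real B * D y) \<in> L2b" by (rule L2s_scale[OF DL])
 then show "chat s r H \<in> L2b"
  by (intro L2s_bound[where g = "%y. (cmod (of_real B * D y))^2"]) (use b in \<open>auto simp: L2s_def power_mono simp del: norm_mult\<close>)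
qed

text \<open>For fixed v the inverse integral splits, after a translation of the first frequency by 2
  t v1, into two Gaussian integrals whose exponents are the conjugates of the squares in
  \<open>Ew\<close>.\<close>

lemma chat_tau:
 assumes "adm k H"
 shows "(%x. chat s r H (tau x)) \<in> L2b" "slab (%x. chat s r H (tau x))"
  "ift (%x. chat s r H (tau x)) x = H (snd x) * cnj (Ew s r (Ks x))"
proof -
 have [measurable]: "H \<in> BM" using assms by (simp add: adm_def)
 note cb = chat_bound[OF assms, of s r]
 have "intg (%x. (cmod (chat s r H (tau x)))^2)"
  using mpiso_integral(2)[OF mpiso_tau, of "%y. (cmod (chat s r H y))^2"] cb(1) by (simp add: L2s_def)
 then show "(%x. chat s r H (tau x)) \<in> L2b" by (simp add: L2s_def)
 have i: "intg (%x. chat s r H (tau x))" using mpiso_integral(2)[OF mpiso_tau, of "chat s r H"] cb(2) by simp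
 have [measurable]: "Qk k \<in> sets borel" "Ck k \<in> sets borel" for k using Qk Ck by auto
 show "slab (%x. chat s r H (tau x))" unfolding slab_def
  by (intro allI integrable_bounded_mult[OF i, where C = 1]) (auto simp: tp_def indicator_def)
 obtain u1 u2 v1 v2 where x: "x = ((u1, u2), (v1, v2))" by (metis surj_pair)
 let ?c = "2 * v1"
 let ?G = "%l. chat s r H (l, (v1, v2)) * ker (fst l + ?c * snd l, snd l) (u1, u2)"
 have "(LB \<xi>. chat s r H (tau (\<xi>, (v1, v2))) * ker \<xi> (u1, u2)) = (LB \<xi>. ?G (fst \<xi> - ?c * snd \<xi>, snd \<xi>))"
  by (intro int_cong refl) (simp add: tau_def mult_ac)
 also have "... = (LB l. ?G l)" by (rule mpiso_integral(1)[OF mpiso_tau2]) measurable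
 also have "... = (LB l. H (v1, v2) * tp (gz (of_real v1 - \<i> * of_real s + \<i> * of_real u1)) (gz (of_real (v2 + 2 * v1\<^sup>2) - \<i> * of_real r + \<i> * of_real (u2 + ?c * u1))) l)"
 proof (intro int_cong refl)
  fix l :: "real \<times> real"
  have k: "ker (fst l + ?c * snd l, snd l) (u1, u2) = ex u1 (fst l) * ex (u2 + ?c * u1) (snd l)"
   by (simp add: ker_def ex_def exp_add[symmetric] algebra_simps)
  show "?G l = H (v1, v2) * tp (gz (of_real v1 - \<i> * of_real s + \<i> * of_real u1)) (gz (of_real (v2 + 2 * v1\<^sup>2) - \<i> * of_real r + \<i> * of_real (u2 + ?c * u1))) l"
   unfolding k chat_def tp_def gz_ex[symmetric] by (simp only: fst_conv snd_conv mult_ac)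
 qed
 also have "... = H (v1, v2) * ((of_real (sqrt (2 * pi)) * exp ((of_real v1 - \<i> * of_real s + \<i> * of_real u1)\<^sup>2 / 2)) *
  (of_real (sqrt (2 * pi)) * exp ((of_real (v2 + 2 * v1\<^sup>2) - \<i> * of_real r + \<i> * of_real (u2 + ?c * u1))\<^sup>2 / 2)))"
  by (subst integral_mult_right_zero, subst tp_integral(2)) (simp_all only: gz_integral)
 also have "... = H (v1, v2) * (of_real (2 * pi) * cnj (Ew s r (Ks x)))"
 proof -
  have a: "(of_real v1 - \<i> * of_real s + \<i> * of_real u1)\<^sup>2 / 2 = cnj (- (fst (Ks x) - of_real s)\<^sup>2 / 2)"
   by (simp add: x Ks_eq power2_eq_square algebra_simps)
  have b: "(of_real (v2 + 2 * v1\<^sup>2) - \<i> * of_real r + \<i> * of_real (u2 + ?c * u1))\<^sup>2 / 2 = cnj (- (snd (Ks x) - \<i> * (fst (Ks x))\<^sup>2 - of_real r)\<^sup>2 / 2)"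
  proof -
   have "snd (Ks x) - \<i> * (fst (Ks x))\<^sup>2 = of_real (u2 + ?c * u1) + \<i> * of_real (v2 + 2 * v1\<^sup>2)"
    by (simp add: x Ks_eq power2_eq_square algebra_simps)
   then show ?thesis by (simp add: power2_eq_square algebra_simps)
  qed
  have c: "cr (sqrt (2 * pi)) * cr (sqrt (2 * pi)) = of_real (2 * pi)" by (simp flip: of_real_mult)
  have "cnj (Ew s r (Ks x)) = exp (cnj (- (fst (Ks x) - of_real s)\<^sup>2 / 2)) * exp (cnj (- (snd (Ks x) - \<i> * (fst (Ks x))\<^sup>2 - of_real r)\<^sup>2 / 2))"
   unfolding Ew_def exp_cnj exp_add[symmetric] by simp
  then show ?thesis unfolding a b c[symmetric] by (simp only: mult_ac)
 qed
 finally show "ift (%x. chat s r H (tau x)) x = H (snd x) * cnj (Ew s r (Ks x))"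
  unfolding ift_def by (simp add: x)
qed

definition Th :: "(r4 => complex) => r4 => complex" where "Th \<Phi> y = \<Phi> (tau' y) * of_real (wt y)"

text \<open>Parseval for \<open>\<phi>\<close> and the inverse transform of \<open>chat\<close>.
  Tests of \<open>f\<close> by the weights thereby become Fourier integrals of
  \<open>Th \<Phi>\<close>, in which the modulus \<open>wt\<close> has been collected.\<close>

lemma parseval_adm:
 assumes f: "smooth_on siegel f" and r: "rep Ks siegel f \<phi>" and L: "\<phi> \<in> L2b" "\<Phi> \<in> L2b" and FT: "FT \<phi> \<Phi>" and H: "adm k H"
 shows "intg (%x. gm s r f x * cnj (H (snd x)))" "intg (%y. Th \<Phi> y * cnj (H (snd y)))"
  "(LB x. gm s r f x * cnj (H (snd x))) = (LB y. Th \<Phi> y * (ex s (ff y) * ex r (sf y)) * cnj (H (snd y)))"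
proof -
 have [measurable]: "H \<in> BM" using H by (simp add: adm_def)
 have [measurable]: "\<phi> \<in> BM" "\<Phi> \<in> BM" using L by (auto simp: L2s_def)
 define X where "X s r = (%x. chat s r H (tau x))" for s r
 have XL: "X s r \<in> L2b" and Xs: "slab (X s r)" and Xi: "ift (X s r) x = H (snd x) * cnj (Ew s r (Ks x))" for s r x
  unfolding X_def using chat_tau[OF H] by auto
 obtain \<phi>' where \<phi>': "\<phi>' \<in> L2b" "FT \<phi>' (X s r)" using FT_surj[OF XL] by blast
 have inv: "AB x. 0 < ss x --> \<phi>' x = H (snd x) * cnj (Ew s r (Ks x))"
  using FT_inverse[OF \<phi>'(1) XL \<phi>'(2)] Xs unfolding slab_def Xi by blast
 have H0: "H (snd x) = 0" if "ss x \<le> 0" for x :: r4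
 proof -
  have "0 < 1 / real (Suc k)" by simp
  then have "ss x \<notin> Ck k" using that unfolding Ck_def atLeastAtMost_iff by linarith
  then have "(tp (indicator (Qk k)) (indicator (Ck k)) (snd x) :: complex) = 0" by (simp add: tp_def)
  then show ?thesis using H unfolding adm_def by (metis mult_zero_right norm_le_zero_iff norm_zero)
 qed
 have ae: "AB x. gm s r f x * cnj (H (snd x)) = \<phi> x * cnj (\<phi>' x)"
 proof -
  have "AB x. Ks x \<in> siegel --> f (Ks x) = \<phi> x" using r by (simp add: rep_def)
  then show ?thesis using inv
  proof eventually_elim
   case (elim x)
   show ?case
   proof (cases "0 < ss x")
    case True then show ?thesis using elim by (simp add: gm_def Ks_siegel mult_ac)
   next
    case False
    then have "\<phi> x = 0" using r unfolding rep_def Ks_siegel by blast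
    then show ?thesis using H0[of x] False by simp
   qed
  qed
 qed
 have i1: "intg (%x. \<phi> x * cnj (\<phi>' x))" by (rule L2s_integrable_inn[OF L(1) \<phi>'(1)])
 have gmm: "(%x. gm s r f x * cnj (H (snd x))) \<in> borel_measurable lborel"
 proof -
  have "(%x. indicator S4 x *\<^sub>R gm s r f x) \<in> BM"
   by (rule borel_measurable_continuous_on_indicator[OF _ gm_continuous(1)[OF f]]) (use open_S4 in simp)
  then have "(%x. (indicator S4 x *\<^sub>R gm s r f x) * cnj (H (snd x))) \<in> borel_measurable lborel" by measurable
  moreover have "(indicator S4 x *\<^sub>R gm s r f x) * cnj (H (snd x)) = gm s r f x * cnj (H (snd x))" for x
   using H0[of x] by (cases "x \<in> S4") (auto simp: S4_def)
  ultimately show ?thesis by simp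
 qed
 show gi: "intg (%x. gm s r f x * cnj (H (snd x)))"
  by (rule integrable_cong_AE_imp[OF i1 gmm]) (use ae in \<open>auto elim: eventually_mono\<close>)
 have e: "\<Phi> x * cnj (X s r x) = (%y. Th \<Phi> y * (ex s (ff y) * ex r (sf y)) * cnj (H (snd y))) (tau x)" for x s r
 proof -
  have "tau' (tau x) = x" using mpiso_tau unfolding mpiso_def by blast
  then show ?thesis by (simp add: X_def chat_cnj Th_def mult_ac)
 qed
 have Thm[measurable]: "Th \<Phi> \<in> BM" unfolding Th_def[abs_def] by measurable
 have "intg (%x. \<Phi> x * cnj (X 0 0 x))" by (rule L2s_integrable_inn[OF L(2) XL])
 then have "intg (%y. Th \<Phi> y * (ex 0 (ff y) * ex 0 (sf y)) * cnj (H (snd y)))"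
  unfolding e by (subst (asm) mpiso_integral(2)[OF mpiso_tau]) auto
 then show "intg (%y. Th \<Phi> y * cnj (H (snd y)))" by (simp add: ex_def)
 have "(LB x. gm s r f x * cnj (H (snd x))) = innb \<phi> \<phi>'"
  unfolding inn_def by (rule integral_cong_AE[OF borel_measurable_integrable[OF gi] borel_measurable_integrable[OF i1] ae])
 also have "... = innb \<Phi> (X s r)" by (rule FT_iso[OF L FT \<phi>'(1) XL \<phi>'(2), symmetric])
 also have "... = (LB y. Th \<Phi> y * (ex s (ff y) * ex r (sf y)) * cnj (H (snd y)))"
  unfolding inn_def e by (rule mpiso_integral(1)[OF mpiso_tau]) measurable
 finally show "(LB x. gm s r f x * cnj (H (snd x))) = (LB y. Th \<Phi> y * (ex s (ff y) * ex r (sf y)) * cnj (H (snd y)))" .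
qed

section \<open>Recovering a polynomial in v2 from its moments\<close>

abbreviation "ex2 s r u \<equiv> ex s (fst u) * ex r (snd u)"

lemma ex2_norm: "cmod (ex2 s r u) = 1" by (simp add: norm_mult ex_props)

lemma L1_fourier_zero_4:
 fixes h :: "r4 => complex"
 assumes h: "intg h" and z: "!!s r s' r'. (LB x. h x * tp (tp (ex s) (ex r)) (tp (ex s') (ex r')) x) = 0"
 shows "AB x. h x = 0"
 using separating_tensor[OF separating_tensor[OF separating_ex separating_ex] separating_tensor[OF separating_ex separating_ex]] h z
 unfolding separating_def by blast

lemma adm_indicator: "adm k (%v. cnj (tp (indicator (Qk k)) (indicator (Ck k)) v))"
proof -
 have [measurable]: "Qk k \<in> sets borel" "Ck k \<in> sets borel" for k using Qk Ck by auto
 show ?thesis unfolding adm_def by (intro conjI exI[of _ 1]) (auto simp: complex_mod_cnj)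
qed

lemma adm_cc:
 assumes a: "cc \<alpha> \<beta> a" and b: "cc \<alpha>' \<beta>' b" and pos: "0 < \<alpha>'"
 shows "\<exists>k. adm k (%v. cnj (tp a b v))"
proof -
 obtain k1 k2 where k: "\<forall>j\<ge>k1. {\<alpha>..\<beta>} \<subseteq> Qk j" "\<forall>j\<ge>k2. {\<alpha>'..\<beta>'} \<subseteq> Ck j" using Qk_sup Ck_sup[OF pos] by blast
 let ?k = "max k1 k2"
 have [measurable]: "a \<in> BM" "b \<in> BM" using a b by (auto simp: cc_def intro: borel_measurable_continuous_onI)
 obtain A where A: "!!x. cmod (a x) \<le> A" using cc_bounded[OF a] by blast
 obtain A' where A': "!!x. cmod (b x) \<le> A'" using cc_bounded[OF b] by blast
 have "cmod (cnj (tp a b v)) \<le> (A * A') * cmod (tp (indicator (Qk ?k)) (indicator (Ck ?k)) v :: complex)" for v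
 proof (cases "fst v \<in> {\<alpha>..\<beta>} \<and> snd v \<in> {\<alpha>'..\<beta>'}")
  case True
  then have "fst v \<in> Qk ?k" "snd v \<in> Ck ?k" using k by (meson max.cobounded1 max.cobounded2 subsetD)+
  moreover have "cmod (a (fst v)) * cmod (b (snd v)) \<le> A * A'" by (intro mult_mono A A') (use A norm_ge_zero order_trans in blast)+
  ultimately show ?thesis by (simp add: tp_def norm_mult)
 next
  case False
  then have "tp a b v = 0" using a b by (auto simp: tp_def cc_def)
  moreover have "0 \<le> A" "0 \<le> A'" using A A' norm_ge_zero order_trans by blast+
  ultimately show ?thesis by simp
 qed
 then show ?thesis unfolding adm_def by (intro exI[of _ ?k] conjI exI[of _ "A * A'"]) auto
qed

lemma cc_mono: "cc \<alpha> \<beta> k ==> \<alpha>2 \<le> \<alpha> ==> \<beta> \<le> \<beta>2 ==> cc \<alpha>2 \<beta>2 k" by (auto simp: cc_def)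

text \<open>Continuous cutoffs, positive inside, take the place of indicators because their products
  with exponentials must again be test functions \<open>cc\<close>.\<close>

lemma exhaust_square: "cc (- real (Suc k)) (real (Suc k)) (%v. of_real (max 0 ((real (Suc k))\<^sup>2 - v\<^sup>2)))"
proof -
 have "max 0 ((real (Suc k))\<^sup>2 - v\<^sup>2) = 0" if "v \<notin> {- real (Suc k)..real (Suc k)}" for v
 proof -
  have "\<bar>real (Suc k)\<bar> \<le> \<bar>v\<bar>" using that by auto
  then show ?thesis unfolding abs_le_square_iff by simp
 qed
 then show ?thesis unfolding cc_def by (auto intro!: continuous_intros simp del: of_nat_Suc)
qed

lemma exhaust_pos: "cc (1 / real (Suc k)) (real (Suc k)) (%v. of_real (max 0 ((v - 1 / real (Suc k)) * (real (Suc k) - v))))"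
proof -
 have k: "1 / real (Suc k) \<le> real (Suc k)" by (rule order_trans[of _ 1]) (auto simp: divide_le_eq)
 have "max 0 ((v - 1 / real (Suc k)) * (real (Suc k) - v)) = 0" if "v \<notin> {1 / real (Suc k)..real (Suc k)}" for v
 proof (cases "v < 1 / real (Suc k)")
  case True
  then have "(v - 1 / real (Suc k)) * (real (Suc k) - v) \<le> 0" using k by (intro mult_nonpos_nonneg) auto
  then show ?thesis by simp
 next
  case False
  then have "real (Suc k) < v" using that by auto
  then have "(v - 1 / real (Suc k)) * (real (Suc k) - v) \<le> 0" using k by (intro mult_nonneg_nonpos) auto
  then show ?thesis by simp
 qed
 then show ?thesis unfolding cc_def by (auto intro!: continuous_intros simp del: of_nat_Suc)
qed

definition II :: "(r4 => complex) => real => real => (real => complex) => (real => complex) => complex" where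
 "II \<Theta> s r a b = (LB y. \<Theta> y * (ex2 s r (fst y) * tp a b (snd y)))"

text \<open>By \<open>T\<close> the pairing depends on \<open>a\<close> only through its integral,
  by \<open>M\<close> on \<open>b\<close> only through its moments below n. It therefore coincides
  with the pairing of the sum of v2^j G_j(u), where G_j integrates \<open>\<Theta>\<close> against
  the fixed functions \<open>a0\<close> and \<open>d j\<close>; Fourier uniqueness in all four
  variables identifies the two functions.\<close>

lemma polynomial_structure:
 assumes h: "slab \<Theta>"
  and T: "!!s r \<alpha> \<beta> \<alpha>' \<beta>' a a' b. 0 < \<alpha>' ==> cc \<alpha> \<beta> a ==> cc \<alpha> \<beta> a' ==> cc \<alpha>' \<beta>' b ==> (!!x. (a has_vector_derivative a' x) (at x)) ==> II \<Theta> s r a' b = 0"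
  and M: "!!s r \<alpha> \<beta> \<alpha>' \<beta>' a b. 0 < \<alpha>' ==> cc \<alpha> \<beta> a ==> cc \<alpha>' \<beta>' b ==> (!!j. j < n ==> (LB x. b x * of_real x ^ j) = 0) ==> II \<Theta> s r a b = 0"
 shows "\<exists>G. (\<forall>j<n. G j \<in> BM) \<and>
  (AB y. 0 < ss y --> \<Theta> y = (\<Sum>j<n. of_real (ss y) ^ j * G j (fst y)))"
proof -
 have i: "intg (%y. \<Theta> y * (ex2 s r (fst y) * tp a b (snd y)))" if "cc \<alpha> \<beta> a" "cc \<alpha>' \<beta>' b" "0 < \<alpha>'" for s r \<alpha> \<beta> \<alpha>' \<beta>' a b
  by (rule slab_mult[OF h that, where B = 1]) (auto simp: ex2_norm)
 obtain d0 where "\<forall>j<1. cc 1 2 (d0 j)" "\<forall>i<1. \<forall>j<1. (LB x. d0 j x * of_real x ^ i) = (if i = j then 1 else 0)" using cc_duals by blast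
 then obtain a0 where a0: "cc 1 2 a0" "(LB x. a0 x) = 1" by auto
 obtain d where d: "!!j. j < n ==> cc 1 2 (d j)"
  "!!i j. i < n ==> j < n ==> (LB x. d j x * of_real x ^ i) = (if i = j then 1 else 0)" using cc_duals[of n] by blast
 \<comment> \<open>\<open>a\<close> minus its integral times \<open>a0\<close> has mean zero, hence
   a compactly supported primitive to which \<open>T\<close> applies.\<close>
 have Ia: "II \<Theta> s r a b = (LB x. a x) * II \<Theta> s r a0 b" if a: "cc \<alpha> \<beta> a" and b: "cc \<alpha>' \<beta>' b" "0 < \<alpha>'" for s r \<alpha> \<beta> \<alpha>' \<beta>' a b
 proof -
  define c where "c = (LB x. a x)"
  let ?a = "%x. a x - c * a0 x"
  have m: "cc (min \<alpha> 1) (max \<beta> 2) a" "cc (min \<alpha> 1) (max \<beta> 2) a0" using a a0 by (auto intro: cc_mono)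
  then have ca: "cc (min \<alpha> 1) (max \<beta> 2) ?a" unfolding cc_def by (auto intro!: continuous_intros)
  have int: "intg a" "intg a0" using cc_integrable[OF a, of "%_. 1"] cc_integrable[OF a0(1), of "%_. 1"] by auto
  then have "(LB x. ?a x) = 0" using a0(2) by (simp add: c_def)
  from cc_primitive[OF ca this] obtain A where A: "cc (min \<alpha> 1) (max \<beta> 2) A" "!!x. (A has_vector_derivative ?a x) (at x)" by blast
  have "0 = II \<Theta> s r ?a b" using T[OF b(2) A(1) ca b(1) A(2)] ..
  also have "... = (LB y. \<Theta> y * (ex2 s r (fst y) * tp a b (snd y)) - c * (\<Theta> y * (ex2 s r (fst y) * tp a0 b (snd y))))"
   unfolding II_def by (simp add: tp_def algebra_simps)
  also have "... = II \<Theta> s r a b - c * II \<Theta> s r a0 b"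
   unfolding II_def by (subst int_diff[OF i[OF a b] integrable_mult_right[OF i[OF a0(1) b]]]) simp
  finally show ?thesis by (simp add: c_def)
 qed
 \<comment> \<open>Subtracting the dual functions kills the moments below n, so \<open>M\<close>
   applies; the minimum with 1 keeps the joint support inside the positive half-line.\<close>
 have Ib: "II \<Theta> s r a0 b = (\<Sum>j<n. (LB x. b x * of_real x ^ j) * II \<Theta> s r a0 (d j))" if b: "cc \<alpha>' \<beta>' b" "0 < \<alpha>'" for s r \<alpha>' \<beta>' b
 proof -
  define c where "c j = (LB x. b x * of_real x ^ j)" for j
  let ?b = "%x. b x - (\<Sum>j<n. c j * d j x)"
  have p: "0 < min \<alpha>' 1" using b by simp
  have m: "cc (min \<alpha>' 1) (max \<beta>' 2) b" "!!j. j < n ==> cc (min \<alpha>' 1) (max \<beta>' 2) (d j)"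
   by (rule cc_mono[OF b(1)] cc_mono[OF d(1)]; simp)+
  then have cb: "cc (min \<alpha>' 1) (max \<beta>' 2) ?b" unfolding cc_def by (auto intro!: continuous_intros sum.neutral)
  have z: "(LB x. ?b x * of_real x ^ l) = 0" if l: "l < n" for l
  proof -
   have ib: "intg (%x. b x * of_real x ^ l)" by (rule cc_integrable[OF b(1)]) (intro continuous_intros)
   have ig: "intg (%x. c j * (d j x * of_real x ^ l))" if "j \<in> {..<n}" for j
    by (intro integrable_mult_right cc_integrable[OF d(1)] continuous_intros) (use that in auto)
   have 1: "intg (%x. \<Sum>j<n. c j * (d j x * of_real x ^ l))" by (rule integrable_sum_B) (rule ig)
   have 2: "(LB x. (\<Sum>j<n. c j * (d j x * of_real x ^ l))) = (\<Sum>j<n. (LB x. c j * (d j x * of_real x ^ l)))"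
    by (rule int_sum) (rule ig)
   have "(LB x. ?b x * of_real x ^ l) = (LB x. b x * of_real x ^ l - (\<Sum>j<n. c j * (d j x * of_real x ^ l)))"
    by (simp add: left_diff_distrib sum_distrib_right mult.assoc)
   also have "... = c l - (\<Sum>j<n. c j * (LB x. d j x * of_real x ^ l))"
    by (subst int_diff[OF ib 1]) (simp add: 2 c_def[of l, symmetric])
   also have "(\<Sum>j<n. c j * (LB x. d j x * of_real x ^ l)) = (\<Sum>j<n. if l = j then c j else 0)"
    by (intro sum.cong refl) (use d(2)[OF l] in auto)
   finally show ?thesis using l by simp
  qed
  have ig: "intg (%y. c j * (\<Theta> y * (ex2 s r (fst y) * tp a0 (d j) (snd y))))" if "j \<in> {..<n}" for j
   by (intro integrable_mult_right i[OF a0(1) d(1)]) (use that in auto)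
  have 1: "intg (%y. \<Sum>j<n. c j * (\<Theta> y * (ex2 s r (fst y) * tp a0 (d j) (snd y))))" by (rule integrable_sum_B) (rule ig)
  have 2: "(LB y. (\<Sum>j<n. c j * (\<Theta> y * (ex2 s r (fst y) * tp a0 (d j) (snd y))))) = (\<Sum>j<n. (LB y. c j * (\<Theta> y * (ex2 s r (fst y) * tp a0 (d j) (snd y)))))"
   by (rule int_sum) (rule ig)
  have "0 = II \<Theta> s r a0 ?b" using M[OF p a0(1) cb z] by simp
  also have "... = (LB y. \<Theta> y * (ex2 s r (fst y) * tp a0 b (snd y)) - (\<Sum>j<n. c j * (\<Theta> y * (ex2 s r (fst y) * tp a0 (d j) (snd y)))))"
   unfolding II_def by (intro int_cong refl) (simp add: tp_def right_diff_distrib sum_distrib_left mult_ac)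
  also have "... = II \<Theta> s r a0 b - (\<Sum>j<n. c j * II \<Theta> s r a0 (d j))"
   unfolding II_def by (subst int_diff[OF i[OF a0(1) b] 1]) (simp add: 2)
  finally show ?thesis by (simp add: c_def)
 qed
 define G where "G j u = (LB v. \<Theta> (u, v) * tp a0 (d j) v)" for j u
 have Gi: "intg (G j)" and GI: "(LB u. G j u * ex2 s r u) = II \<Theta> s r a0 (d j)" if j: "j < n" for j s r
 proof -
  have k: "intg (%y. \<Theta> y * (1 * tp a0 (d j) (snd y)))" by (rule slab_mult[OF h a0(1) d(1)[OF j], where B = 1]) auto
  then have k: "intg (%y. \<Theta> y * tp a0 (d j) (snd y))" by simp
  show "intg (G j)" using integral_mult_fst(1)[OF k, of "%_. 0" 0] by (simp add: G_def[abs_def])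
  show "(LB u. G j u * ex2 s r u) = II \<Theta> s r a0 (d j)"
  proof -
   have "(LB x. \<Theta> x * tp a0 (d j) (snd x) * ex2 s r (fst x)) = (LB u. (LB v. \<Theta> (u, v) * tp a0 (d j) (snd (u, v))) * ex2 s r u)"
    by (rule integral_mult_fst(2)[OF k, where B = 1]) (auto simp: norm_mult ex_props)
   then show ?thesis by (simp add: G_def II_def mult_ac)
  qed
 qed
 define h' where "h' y = \<Theta> y - (\<Sum>j<n. of_real (ss y) ^ j * G j (fst y))" for y
 let ?a = "%k v. cr (max 0 ((real (Suc k))\<^sup>2 - v\<^sup>2))" and ?b = "%k v. cr (max 0 ((v - 1 / real (Suc k)) * (real (Suc k) - v)))"
 have z: "AB y. h' y * tp (?a k) (?b k) (snd y) = 0" for k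
 proof -
  note ca = exhaust_square[of k] and cb = exhaust_pos[of k]
  have p: "0 < 1 / real (Suc k)" by simp
  have vb: "cc (1 / real (Suc k)) (real (Suc k)) (%v. of_real v ^ j * (?b k v * ex r v))" for j r
   using cb ex_props(2)[of UNIV r] unfolding cc_def by (auto intro!: continuous_intros simp del: of_nat_Suc)
  have va: "cc (- real (Suc k)) (real (Suc k)) (%v. ?a k v * ex s v)" for s
   using ca ex_props(2)[of UNIV s] unfolding cc_def by (auto intro!: continuous_intros simp del: of_nat_Suc)
  have cint: "cc \<alpha> \<beta> q ==> intg q" for \<alpha> \<beta> q using cc_integrable[of \<alpha> \<beta> q "%_. 1"] by auto
  have ii: "intg (tp (%u. G j u * ex2 s r u) (tp (%v. ?a k v * ex s' v) (%v. of_real v ^ j * (?b k v * ex r' v))))" (is "integrable _ (?F s r s' r' j)") if "j \<in> {..<n}" for j s r s' r'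
  proof (intro tp_integral cint[OF va] cint[OF vb])
   show "intg (%u. G j u * ex2 s r u)" by (rule integrable_bounded_mult[OF Gi, where C = 1]) (use that in \<open>auto simp: ex2_norm\<close>)
  qed
  let ?L = "%s r s' r' y. \<Theta> y * (ex2 s r (fst y) * tp (%v. ?a k v * ex s' v) (%v. of_real v ^ 0 * (?b k v * ex r' v)) (snd y))"
  have e: "h' y * tp (?a k) (?b k) (snd y) * ex2 s r (fst y) * ex2 s' r' (snd y) = ?L s r s' r' y - (\<Sum>j<n. ?F s r s' r' j y)" for s r s' r' y
  proof -
   have alg: "h' y * (A * B) * (X1 * X2) * (Y1 * Y2) = \<Theta> y * ((X1 * X2) * ((A * Y1) * (of_real (ss y) ^ 0 * (B * Y2)))) -
    (\<Sum>j<n. (G j (fst y) * (X1 * X2)) * ((A * Y1) * (of_real (ss y) ^ j * (B * Y2))))" for A B X1 X2 Y1 Y2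
   proof -
    let ?Z = "A * B * X1 * X2 * Y1 * Y2"
    have "h' y * (A * B) * (X1 * X2) * (Y1 * Y2) = h' y * ?Z" by (simp only: mult_ac)
    also have "... = \<Theta> y * ?Z - (\<Sum>j<n. of_real (ss y) ^ j * G j (fst y) * ?Z)"
     by (simp only: h'_def left_diff_distrib sum_distrib_right)
    also have "... = \<Theta> y * ((X1 * X2) * ((A * Y1) * (of_real (ss y) ^ 0 * (B * Y2)))) -
    (\<Sum>j<n. (G j (fst y) * (X1 * X2)) * ((A * Y1) * (of_real (ss y) ^ j * (B * Y2))))"
     by (intro arg_cong2[where f = minus] sum.cong refl) (simp_all only: mult_ac power_0 mult_1)
    finally show ?thesis .
   qed
   show ?thesis unfolding tp_def by (rule alg)
  qed
  have iL: "intg (?L s r s' r')" for s r s' r' by (rule i[OF va vb p])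
  have iF: "intg (%y. \<Sum>j<n. ?F s r s' r' j y)" for s r s' r' by (rule integrable_sum_B) (rule ii)
  have sF: "(LB y. (\<Sum>j<n. ?F s r s' r' j y)) = (\<Sum>j<n. (LB y. ?F s r s' r' j y))" for s r s' r'
   by (rule int_sum) (rule ii)
  show ?thesis
  proof (rule L1_fourier_zero_4)
   have "intg (%y. ?L 0 0 0 0 y - (\<Sum>j<n. ?F 0 0 0 0 j y))" by (rule integrable_diff_B[OF iL iF])
   then show "intg (%y. h' y * tp (?a k) (?b k) (snd y))" unfolding e[symmetric] by (simp add: ex_def)
   fix s r s' r'
   have "(LB y. h' y * tp (?a k) (?b k) (snd y) * ex2 s r (fst y) * ex2 s' r' (snd y)) = (LB y. ?L s r s' r' y) - (\<Sum>j<n. (LB y. ?F s r s' r' j y))"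
    unfolding e by (subst int_diff[OF iL iF]) (simp only: sF)
   also have "(LB y. ?L s r s' r' y) = (LB x. ?a k x * ex s' x) * (\<Sum>j<n. (LB x. (of_real x ^ 0 * (?b k x * ex r' x)) * of_real x ^ j) * II \<Theta> s r a0 (d j))"
    using Ia[OF va[of s'] vb[of 0 r'] p, of s r] Ib[OF vb[of 0 r'] p, of s r] by (simp only: II_def)
   also have "(\<Sum>j<n. (LB y. ?F s r s' r' j y)) = (\<Sum>j<n. II \<Theta> s r a0 (d j) * ((LB x. ?a k x * ex s' x) * (LB x. of_real x ^ j * (?b k x * ex r' x))))"
   proof (intro sum.cong refl)
    fix j assume j: "j \<in> {..<n}"
    have gi: "intg (%u. G j u * ex2 s r u)" by (rule integrable_bounded_mult[OF Gi, where C = 1]) (use j in \<open>auto simp: ex2_norm\<close>)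
    have "(LB y. ?F s r s' r' j y) = (LB u. G j u * ex2 s r u) * (LB v. tp (%v. ?a k v * ex s' v) (%v. of_real v ^ j * (?b k v * ex r' v)) v)"
     by (rule tp_integral(2)[OF gi tp_integral(1)[OF cint[OF va] cint[OF vb]]])
    also have "(LB v. tp (%v. ?a k v * ex s' v) (%v. of_real v ^ j * (?b k v * ex r' v)) v) = (LB x. ?a k x * ex s' x) * (LB x. of_real x ^ j * (?b k x * ex r' x))"
     by (rule tp_integral(2)[OF cint[OF va] cint[OF vb]])
    finally show "(LB y. ?F s r s' r' j y) = II \<Theta> s r a0 (d j) * ((LB x. ?a k x * ex s' x) * (LB x. of_real x ^ j * (?b k x * ex r' x)))"
     using GI[of j s r] j by simp
   qed
   finally have "(LB y. h' y * tp (?a k) (?b k) (snd y) * ex2 s r (fst y) * ex2 s' r' (snd y)) = 0"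
    by (simp add: sum_distrib_left mult_ac del: of_nat_Suc)
   then show "(LB y. h' y * tp (?a k) (?b k) (snd y) * tp (tp (ex s) (ex r)) (tp (ex s') (ex r')) y) = 0"
    unfolding tp_def[of "tp (ex s) (ex r)"] tp_def[of "ex s"] tp_def[of "ex s'"] mult.assoc .
  qed
 qed
 have "AB y. \<forall>k. h' y * tp (?a k) (?b k) (snd y) = 0" using z by (simp only: AE_all_countable) blast
 then have "AB y. 0 < ss y --> \<Theta> y = (\<Sum>j<n. of_real (ss y) ^ j * G j (fst y))"
 proof eventually_elim
  case (elim y)
  show ?case
  proof
   assume v: "0 < ss y"
   obtain k where k: "max \<bar>fs y\<bar> (max (ss y) (1 / ss y)) \<le> real k" using real_arch_simple by blast
   have 1: "\<bar>fs y\<bar> < \<bar>real (Suc k)\<bar>" "ss y < real (Suc k)" "1 / ss y < real (Suc k)" using k by auto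
   have "(fs y)\<^sup>2 < (real (Suc k))\<^sup>2" using 1(1) by (simp add: abs_square_less_1 del: of_nat_Suc) (metis abs_le_square_iff abs_of_nat not_le)
   then have "0 < max 0 ((real (Suc k))\<^sup>2 - (fs y)\<^sup>2)" by linarith
   then have a: "?a k (fs y) \<noteq> 0" unfolding of_real_eq_0_iff by linarith
   have "1 / real (Suc k) < ss y" using 1(3) v by (simp add: field_simps)
   then have "0 < (ss y - 1 / real (Suc k)) * (real (Suc k) - ss y)" using 1(2) by (intro mult_pos_pos) auto
   then have "0 < max 0 ((ss y - 1 / real (Suc k)) * (real (Suc k) - ss y))" by linarith
   then have b: "?b k (ss y) \<noteq> 0" unfolding of_real_eq_0_iff by linarith
   have "h' y * (?a k (fs y) * ?b k (ss y)) = 0" using elim[rule_format, of k] by (simp only: tp_def)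
   then have "h' y = 0" using a b unfolding mult_eq_0_iff by blast
   then show "\<Theta> y = (\<Sum>j<n. of_real (ss y) ^ j * G j (fst y))" by (simp add: h'_def)
  qed
 qed
 moreover have "G j \<in> BM" if "j < n" for j using Gi[OF that] by auto
 ultimately show ?thesis by blast
qed

section \<open>Exclusion of negative frequencies\<close>

lemma poly_lower:
 fixes P :: "complex poly" assumes "P \<noteq> 0"
 shows "\<exists>c>0. \<exists>N. \<forall>v::real. N \<le> v --> c \<le> cmod (poly P (of_real v))"
proof (cases P)
 case (pCons a q)
 show ?thesis
 proof (cases "q = 0")
  case True
  then have "a \<noteq> 0" using pCons assms by auto
  then show ?thesis using True pCons by (intro exI[of _ "cmod a"]) auto
 next
  case False
  from poly_infinity[OF this, of 1 a] obtain r where r: "!!z. r \<le> norm z ==> 1 \<le> norm (poly (pCons a q) z)" by blast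
  have "1 \<le> cmod (poly P (of_real v))" if "\<bar>r\<bar> \<le> v" for v :: real
   unfolding pCons(1) by (rule r) (use that in auto)
  then show ?thesis by (intro exI[of _ 1]) auto
 qed
qed

text \<open>For \<open>t < 0\<close> the weight grows exponentially in \<open>v\<^sub>2\<close>, which no nonzero polynomial compensates.\<close>

lemma negative_frequencies:
 fixes \<Xi> :: "real \<times> real => complex"
 assumes L: "intg (%v. (cmod (\<Xi> v))^2)"
  and S: "AB v. 0 < snd v --> \<Xi> v * of_real (wt (u, v)) = (\<Sum>j<n. of_real (snd v) ^ j * G j)"
  and t: "snd u < 0"
 shows "(\<Sum>j<n. of_real w ^ j * G j) = 0"
proof -
 define P where "P = (\<Sum>j<n. monom (G j) j)"
 have P: "poly P (of_real w) = (\<Sum>j<n. of_real w ^ j * G j)" for w by (simp add: P_def poly_sum poly_monom mult.commute)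
 have "P = 0"
 proof (rule ccontr)
  assume "P \<noteq> 0"
  then obtain c N where c: "c > 0" "!!v. N \<le> v ==> c \<le> cmod (poly P (of_real v))" using poly_lower by blast
  define K where "K = (c / exp \<bar>fst u\<bar>)\<^sup>2"
  have K: "K > 0" using c by (simp add: K_def)
  define N' where "N' = max N 1"
  have I: "(NN v. ennreal ((cmod (\<Xi> v))^2)) < \<infinity>" using L unfolding integrable_iff_bounded by simp
  \<comment> \<open>On this strip of area m the polynomial has modulus at least \<open>c\<close> and
    the weight is at most \<open>exp \<bar>fst u\<bar>\<close>, so the squared modulus of
    \<open>\<Xi>\<close> is at least \<open>K\<close>; and m is arbitrary.\<close>
  have le: "ennreal (K * real m) \<le> (NN v. ennreal ((cmod (\<Xi> v))^2))" for m :: nat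
  proof -
   have "emeasure (lborel :: (real \<times> real) measure) ({0..1} \<times> {N'..N' + real m}) = emeasure lborel {0..1::real} * emeasure lborel {N'..N' + real m}"
    by (subst lborel_prod[symmetric], rule lborel.emeasure_pair_measure_Times) auto
   then have "ennreal (K * real m) = (\<integral>\<^sup>+v. ennreal K * indicator ({0..1} \<times> {N'..N' + real m}) v \<partial>(lborel :: (real \<times> real) measure))"
    using K by (subst nn_integral_cmult_indicator) (auto simp: ennreal_mult'' intro!: borel_closed closed_Times)
   also have "... \<le> (NN v. ennreal ((cmod (\<Xi> v))^2))"
   proof (rule nn_integral_mono_AE, use S in eventually_elim)
    fix v :: "real \<times> real"
    assume e: "0 < snd v --> \<Xi> v * of_real (wt (u, v)) = (\<Sum>j<n. of_real (snd v) ^ j * G j)"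
    show "ennreal K * indicator ({0..1} \<times> {N'..N' + real m}) v \<le> ennreal ((cmod (\<Xi> v))^2)"
    proof (cases "v \<in> {0..1} \<times> {N'..N' + real m}")
     case True
     then have v: "0 \<le> fst v" "fst v \<le> 1" "N \<le> snd v" "1 \<le> snd v" by (auto simp: N'_def)
     have "wt (u, v) \<le> exp \<bar>fst u\<bar> * 1"
      unfolding wt_def fst_conv snd_conv
     proof (intro mult_mono)
      have "fst v * fst u \<le> \<bar>fst v\<bar> * \<bar>fst u\<bar>" by (metis abs_ge_self abs_mult)
      also have "... \<le> 1 * \<bar>fst u\<bar>" using v by (intro mult_right_mono) auto
      finally have "- (fst u)\<^sup>2 / 2 + fst v * fst u \<le> \<bar>fst u\<bar>" using zero_le_power2[of "fst u"] by linarith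
      then show "exp (- (fst u)\<^sup>2 / 2 + fst v * fst u) \<le> exp \<bar>fst u\<bar>" by simp
      have "(snd v + 2 * (fst v)\<^sup>2) * snd u \<le> 0" using v t by (intro mult_nonneg_nonpos) (auto intro: add_nonneg_nonneg)
      then have "- (snd u)\<^sup>2 / 2 + (snd v + 2 * (fst v)\<^sup>2) * snd u \<le> 0" using zero_le_power2[of "snd u"] by linarith
      then show "exp (- (snd u)\<^sup>2 / 2 + (snd v + 2 * (fst v)\<^sup>2) * snd u) \<le> 1" by simp
     qed auto
     then have w: "wt (u, v) \<le> exp \<bar>fst u\<bar>" by simp
     have w0: "0 < wt (u, v)" by (simp add: wt_def)
     have "c \<le> cmod (\<Xi> v * of_real (wt (u, v)))" using c(2)[OF v(3)] e v(4) unfolding P by auto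
     also have "... = cmod (\<Xi> v) * wt (u, v)" using w0 by (simp add: norm_mult)
     also have "... \<le> cmod (\<Xi> v) * exp \<bar>fst u\<bar>" by (intro mult_left_mono w) simp
     finally have "c / exp \<bar>fst u\<bar> \<le> cmod (\<Xi> v)" by (simp add: divide_le_eq)
     then have "K \<le> (cmod (\<Xi> v))^2" unfolding K_def using c by (intro power_mono) auto
     then show ?thesis using True by (simp add: ennreal_leI)
    qed simp
   qed
   finally show ?thesis .
  qed
  obtain r where r: "(NN v. ennreal ((cmod (\<Xi> v))^2)) = ennreal r" "0 \<le> r" using I by (auto simp: less_top_ennreal)
  obtain m :: nat where "r / K < real m" using reals_Archimedean2 by blast
  then have "r < K * real m" using K by (simp add: divide_less_eq mult.commute)
  then show False using le[of m] r K by (simp add: ennreal_le_iff)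
 qed
 then show ?thesis unfolding P[symmetric] by simp
qed

section \<open>The image of the poly-Bergman-type space\<close>

definition mon :: "nat => real => complex" where
 "mon j y = indicator {0<..} y * of_real (y ^ j * exp (- y / 2))"

text \<open>Leading coefficients of the Laguerre polynomials do not vanish, so the triangular change
  of basis can be inverted.\<close>

lemma mon_span: "j < n ==> \<exists>M. \<forall>y. mon j y = (\<Sum>k<n. M k * lgp k y)"
proof (induction j rule: less_induct)
 case (less j)
 define c where "c i = cr (coeff (Lag j) i)" for i
 have c: "c j \<noteq> 0" by (simp add: c_def Lag_coeff)
 have "\<forall>i. \<exists>M. i < j --> (\<forall>y. mon i y = (\<Sum>k<n. M k * lgp k y))" using less by auto
 then obtain M where M: "!!i y. i < j ==> mon i y = (\<Sum>k<n. M i k * lgp k y)" by metis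
 have l: "lgp j y = (-1) ^ j * (c j * mon j y + (\<Sum>i<j. c i * mon i y))" for y
 proof -
  have "poly (Lag j) y = (\<Sum>i\<le>j. coeff (Lag j) i * y ^ i)" by (simp add: poly_altdef degree_Lag)
  also have "... = coeff (Lag j) j * y ^ j + (\<Sum>i<j. coeff (Lag j) i * y ^ i)" by (simp add: lessThan_Suc_atMost[symmetric])
  finally have "poly (Lag j) y * exp (- y / 2) = coeff (Lag j) j * (y ^ j * exp (- y / 2)) + (\<Sum>i<j. coeff (Lag j) i * (y ^ i * exp (- y / 2)))"
   by (simp add: distrib_right sum_distrib_right mult.assoc)
  then have "cr (poly (Lag j) y * exp (- y / 2)) = c j * of_real (y ^ j * exp (- y / 2)) + (\<Sum>i<j. c i * of_real (y ^ i * exp (- y / 2)))"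
   by (simp only: c_def of_real_add of_real_mult of_real_sum)
  moreover have "cr ((-1) ^ j) = (-1) ^ j" by simp
  ultimately show ?thesis unfolding lgp_def laguerre_fun_eq mon_def
   by (cases "0 < y") (simp_all add: mult.assoc del: of_real_power)
 qed
 define M' where "M' k = inverse (c j) * ((if k = j then (-1) ^ j else 0) - (\<Sum>i<j. c i * M i k))" for k
 have "mon j y = (\<Sum>k<n. M' k * lgp k y)" for y
 proof -
  have "(\<Sum>k<n. M' k * lgp k y) = inverse (c j) * ((\<Sum>k<n. (if k = j then (-1) ^ j else 0) * lgp k y) - (\<Sum>k<n. \<Sum>i<j. c i * M i k * lgp k y))"
   by (simp add: M'_def sum_distrib_left sum_distrib_right left_diff_distrib right_diff_distrib sum_subtractf mult.assoc)
  also have "(\<Sum>k<n. (if k = j then (-1) ^ j else 0) * lgp k y) = (\<Sum>k<n. if k = j then (-1) ^ j * lgp k y else 0)" by (intro sum.cong) auto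
  also have "... = (-1) ^ j * lgp j y" using less.prems by simp
  also have "(\<Sum>k<n. \<Sum>i<j. c i * M i k * lgp k y) = (\<Sum>i<j. c i * mon i y)"
   by (subst sum.swap) (intro sum.cong refl, simp add: M sum_distrib_left mult.assoc)
  also have "(-1) ^ j * lgp j y = c j * mon j y + (\<Sum>i<j. c i * mon i y)" unfolding l
   by (simp add: mult.assoc[symmetric] power_mult_distrib[symmetric])
  finally show ?thesis using c by simp
 qed
 then show ?case by blast
qed

text \<open>In the variables given by \<open>rr\<close> and \<open>tau\<close> the reciprocal weight
  splits into a function of (x1, x2) times exp(-y1^2 / 2) exp(-y2 / 2): the Gaussian of
  \<open>h0\<close> and the exponential of the Laguerre functions.\<close>

lemma wt_rr:
 assumes "0 < sf x"
 defines "l \<equiv> 2 * sqrt (sf x) * ff x"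
 shows "tau (rr x) = ((l, sf x), snd (rr x))"
  "1 / wt (tau (rr x)) = exp (l\<^sup>2 / 2 + (sf x)\<^sup>2 / 2 + (ff x)\<^sup>2 / 2) * (exp (- (fs x)\<^sup>2 / 2) * exp (- ss x / 2))"
  "ss (rr x) = ss x / (2 * sf x)"
proof -
 obtain a t p q where x: "x = ((a, t), (p, q))" by (metis surj_pair)
 define s where "s = sqrt t"
 have t: "0 < t" using assms by (simp add: x)
 have s: "0 < s" "s * s = t" using t by (auto simp: s_def)
 have rr: "rr x = ((s * (a + p), t), ((p - a) / (2 * s), q / (2 * t)))" using t by (simp add: x rr_def s_def Let_def)
 have l: "l = 2 * s * a" by (simp add: l_def x s_def)
 have "s * (a + p) - 2 * t * ((p - a) / (2 * s)) = l" unfolding l s(2)[symmetric] using s(1) by (simp add: field_simps)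
 then show 1: "tau (rr x) = ((l, sf x), snd (rr x))" unfolding rr tau_def by (simp add: x)
 have e1: "(p - a) / (2 * s) * l = a * p - a\<^sup>2" unfolding l using s(1) by (simp add: field_simps power2_eq_square)
 have e2: "(q / (2 * t) + 2 * ((p - a) / (2 * s))\<^sup>2) * t = q / 2 + (p - a)\<^sup>2 / 2"
  using s t by (simp add: power_divide power_mult_distrib power2_eq_square[of s] field_simps)
 have "wt (tau (rr x)) = exp ((- l\<^sup>2 / 2 + (a * p - a\<^sup>2)) + (- t\<^sup>2 / 2 + (q / 2 + (p - a)\<^sup>2 / 2)))"
 proof -
  have T: "tau (rr x) = ((l, t), ((p - a) / (2 * s), q / (2 * t)))" unfolding 1 unfolding rr by (simp add: x)
  show ?thesis unfolding T wt_def fst_conv snd_conv e1 e2 exp_add[symmetric] ..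
 qed
 then have "1 / wt (tau (rr x)) = exp (- ((- l\<^sup>2 / 2 + (a * p - a\<^sup>2)) + (- t\<^sup>2 / 2 + (q / 2 + (p - a)\<^sup>2 / 2))))"
  by (simp only: exp_minus inverse_eq_divide)
 also have "- ((- l\<^sup>2 / 2 + (a * p - a\<^sup>2)) + (- t\<^sup>2 / 2 + (q / 2 + (p - a)\<^sup>2 / 2))) = (l\<^sup>2 / 2 + t\<^sup>2 / 2 + a\<^sup>2 / 2) + (- p\<^sup>2 / 2 + - q / 2)"
  by (simp add: power2_eq_square field_simps)
 finally show "1 / wt (tau (rr x)) = exp (l\<^sup>2 / 2 + (sf x)\<^sup>2 / 2 + (ff x)\<^sup>2 / 2) * (exp (- (fs x)\<^sup>2 / 2) * exp (- ss x / 2))"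
  by (simp only: exp_add x fst_conv snd_conv)
 show "ss (rr x) = ss x / (2 * sf x)" unfolding rr by (simp add: x)
qed

lemma poly_bergman_image:
 assumes f: "f \<in> carr (poly_bergman 1 n)"
 shows "\<exists>g\<in>carr (L2_pow n RRp). AE z in lebesgue_on CPi. U f z = R0 n g z"
proof -
 have fX: "f \<in> L2s (lebesgue_on siegel)" and sm: "smooth_on siegel f" and tan: "!!zeta. zeta \<in> siegel ==> dbar_tangential f zeta = 0"
  and db: "!!zeta. zeta \<in> siegel ==> (dbar2 ^^ n) f zeta = 0"
  using f by (auto simp: poly_bergman_def L2_sel)
 obtain \<phi> \<Phi> where r: "rep Ks siegel f \<phi>" and rU: "rep J CPi (U f) (vt \<Phi>)" and FT: "FT \<phi> \<Phi>" and L: "\<phi> \<in> L2b" "\<Phi> \<in> L2b"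
  and rP: "rep J CPi (U1 (U0 f)) \<Phi>" using U_rep[OF fX] by blast
 have [measurable]: "\<Phi> \<in> BM" using L by (auto simp: L2s_def)
 note par = parseval_adm[OF sm r L FT]
 have sl: "slab (gm s r f)" for s r unfolding slab_def using par(1)[OF adm_indicator, of s r] by simp
 have slT: "slab (Th \<Phi>)" unfolding slab_def using par(2)[OF adm_indicator] by simp
 have IG: "II (Th \<Phi>) s r a b = G4 s r f a b" if c: "cc \<alpha> \<beta> a" "cc \<alpha>' \<beta>' b" "0 < \<alpha>'" for s r a b \<alpha> \<beta> \<alpha>' \<beta>'
 proof -
  obtain k where "adm k (%v. cnj (tp a b v))" using adm_cc[OF c] by blast
  from par(3)[OF this, of s r] show ?thesis by (simp add: II_def G4_def mult.assoc)
 qed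
 have "\<exists>G. (\<forall>j<n. G j \<in> BM) \<and>
  (AB y. 0 < ss y --> Th \<Phi> y = (\<Sum>j<n. of_real (ss y) ^ j * G j (fst y)))"
 proof (rule polynomial_structure[OF slT])
  show "II (Th \<Phi>) s r a' b = 0" if c: "0 < \<alpha>'" "cc \<alpha> \<beta> a" "cc \<alpha> \<beta> a'" "cc \<alpha>' \<beta>' b" "!!x. (a has_vector_derivative a' x) (at x)" for s r \<alpha> \<beta> \<alpha>' \<beta>' a a' b
   unfolding IG[OF c(3,4,1)] by (rule G4_tangential[OF sm tan sl c(1-4) c(5)])
  show "II (Th \<Phi>) s r a b = 0" if c: "0 < \<alpha>'" "cc \<alpha> \<beta> a" "cc \<alpha>' \<beta>' b" "!!j. j < n ==> (LB x. b x * of_real x ^ j) = 0" for s r \<alpha> \<beta> \<alpha>' \<beta>' a b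
   unfolding IG[OF c(2,3,1)] by (rule G4_moments[OF sm db sl c(1-3) c(4)])
 qed
 then obtain G where S: "AB y. 0 < ss y --> Th \<Phi> y = (\<Sum>j<n. of_real (ss y) ^ j * G j (fst y))" by blast
 have XL: "(%y. \<Phi> (tau' y)) \<in> L2b"
  using mpiso_integral(2)[OF mpiso_sym[OF mpiso_tau], of "%y. (cmod (\<Phi> y))^2"] L(2) by (simp add: L2s_def)
 \<comment> \<open>Slices of the sheared transform are square integrable for almost every frequency,
   and there the growth argument applies.\<close>
 have neg: "AB u. snd u < 0 --> (\<forall>w. (\<Sum>j<n. cr w ^ j * G j u) = 0)"
 proof -
  have "integrable (lborel \<Otimes>\<^sub>M lborel) (%y. (cmod (\<Phi> (tau' y)))^2)" using XL by (simp add: L2s_def lborel_prod)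
  from lborel_pair.AE_integrable_fst'[OF this]
  have 1: "AB u. intg (%v. (cmod (\<Phi> (tau' (u, v))))\<^sup>2)" .
  have "AE y in lborel \<Otimes>\<^sub>M lborel. 0 < ss y --> Th \<Phi> y = (\<Sum>j<n. of_real (ss y) ^ j * G j (fst y))" using S by (simp only: lborel_prod)
  from lborel_pair.AE_pair[OF this]
  have 2: "AB u. AB v. 0 < snd v --> Th \<Phi> (u, v) = (\<Sum>j<n. of_real (snd v) ^ j * G j u)" by simp
  from 1 2 show ?thesis
  proof eventually_elim
   case (elim u)
   show ?case using negative_frequencies[OF elim(1), where u = u and n = n and G = "%j. G j u"] elim(2) unfolding Th_def by blast
  qed
 qed
 have tt: "tau' (tau x) = x" for x using mpiso_tau unfolding mpiso_def by blast
 have "AB y. (0 < ss y --> Th \<Phi> y = (\<Sum>j<n. of_real (ss y) ^ j * G j (fst y))) \<and>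
  (sf y < 0 --> (\<forall>w. (\<Sum>j<n. cr w ^ j * G j (fst y)) = 0))"
  using S AE_lift_fst[OF neg] by eventually_elim blast
 from rr_AE[OF mpiso_AE[OF mpiso_tau this]]
 have S2: "AB x. (0 < ss (tau (rr x)) --> Th \<Phi> (tau (rr x)) = (\<Sum>j<n. of_real (ss (tau (rr x))) ^ j * G j (fst (tau (rr x))))) \<and>
  (sf (tau (rr x)) < 0 --> (\<forall>w. (\<Sum>j<n. cr w ^ j * G j (fst (tau (rr x)))) = 0))" .
 define l where "l u = 2 * sqrt (snd u) * fst u" for u :: "real \<times> real"
 \<comment> \<open>Everything in \<open>vt \<Phi>\<close> that depends on (x1, x2) alone: the
   normalisation of \<open>vt\<close>, its share of the reciprocal weight, the powers of 2 x2 from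
   v2 = y2 / (2 x2), and the constant of \<open>h0\<close>.\<close>
 define D where "D j u = (if 0 < snd u then of_real (sqrt (sqrt pi) * (1 / sqrt (2 * \<bar>snd u\<bar>)) * exp ((l u)\<^sup>2 / 2 + (snd u)\<^sup>2 / 2 + (fst u)\<^sup>2 / 2) / (2 * snd u) ^ j) * G j (l u, snd u) else 0)" for j u
 have S3: "AB x. vt \<Phi> x = (\<Sum>j<n. D j (fst x) * tp h0 (mon j) (snd x))"
  using S2 AE_lborel_nonzero
 proof eventually_elim
  case (elim x)
  show ?case
  proof (cases "0 < ss x")
   case False
   then have "vt \<Phi> x = 0" using rU unfolding rep_def J_CPi by blast
   then show ?thesis using False by (simp add: tp_def mon_def)
  next
   case y: True
   have pos: "0 < ss (tau (rr x))" using y elim(2) by (simp add: tau_def rr_def Let_def)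
   have w0: "wt (tau (rr x)) \<noteq> 0" by (simp add: wt_def)
   have P: "\<Phi> (rr x) = of_real (1 / wt (tau (rr x))) * (\<Sum>j<n. of_real (ss (tau (rr x))) ^ j * G j (fst (tau (rr x))))"
    using elim(1) pos w0 unfolding Th_def tt by (simp add: field_simps)
   show ?thesis
   proof (cases "0 < sf x")
    case False
    then have "sf (tau (rr x)) < 0" using elim(2) by (simp add: tau_def rr_def Let_def)
    then have "\<Phi> (rr x) = 0" using elim(1) P by simp
    then show ?thesis using False by (simp add: vt_def D_def)
   next
    case True
    note W = wt_rr[OF True]
    have f: "fst (tau (rr x)) = (l (fst x), sf x)" unfolding W(1) l_def by simp
    have s: "ss (tau (rr x)) = ss x / (2 * sf x)" unfolding W(1) snd_conv by (rule W(3))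
    have h: "cr (exp (- (fs x)\<^sup>2 / 2)) = of_real (sqrt (sqrt pi)) * h0 (fs x)"
     by (simp add: h0_def hermite_0)
    have "vt \<Phi> x = of_real (1 / sqrt (2 * \<bar>sf x\<bar>)) * (of_real (exp ((l (fst x))\<^sup>2 / 2 + (sf x)\<^sup>2 / 2 + (ff x)\<^sup>2 / 2) * (exp (- (fs x)\<^sup>2 / 2) * exp (- ss x / 2)))
     * (\<Sum>j<n. of_real (ss x / (2 * sf x)) ^ j * G j (l (fst x), sf x)))"
     unfolding vt_def P W(2) f s l_def by simp
    also have "... = (\<Sum>j<n. D j (fst x) * tp h0 (mon j) (snd x))"
    proof -
     have "of_real (1 / sqrt (2 * \<bar>sf x\<bar>)) * (of_real (exp ((l (fst x))\<^sup>2 / 2 + (sf x)\<^sup>2 / 2 + (ff x)\<^sup>2 / 2) * (exp (- (fs x)\<^sup>2 / 2) * exp (- ss x / 2)))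
      * (of_real (ss x / (2 * sf x)) ^ j * G j (l (fst x), sf x))) = D j (fst x) * tp h0 (mon j) (snd x)" for j
      unfolding of_real_mult h using True y by (simp add: D_def tp_def mon_def power_divide mult_ac)
     then show ?thesis by (simp only: sum_distrib_left)
    qed
    finally show ?thesis .
   qed
  qed
 qed
 have "\<forall>j. \<exists>M. j < n --> (\<forall>y. mon j y = (\<Sum>k<n. M k * lgp k y))" using mon_span by blast
 then obtain M where M: "!!j y. j < n ==> mon j y = (\<Sum>k<n. M j k * lgp k y)" by metis
 define C where "C k u = (\<Sum>j<n. D j u * M j k)" for k u
 have S4: "AB x. vt \<Phi> x = (\<Sum>k<n. C k (fst x) * hl k (snd x))"
  using S3
 proof eventually_elim
  case (elim x)
  have "(\<Sum>j<n. D j (fst x) * tp h0 (mon j) (snd x)) = (\<Sum>j<n. \<Sum>k<n. D j (fst x) * M j k * hl k (snd x))"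
   by (intro sum.cong refl) (simp add: tp_def M hl_def sum_distrib_left mult_ac)
  also have "... = (\<Sum>k<n. C k (fst x) * hl k (snd x))" by (subst sum.swap) (simp add: C_def sum_distrib_right)
  finally show ?case using elim by simp
 qed
 have PL: "vt \<Phi> \<in> L2b" using vt_L2s_iff L(2) by auto
 \<comment> \<open>The coefficients \<open>C k\<close> come without any integrability. Pairing with
   the orthonormal \<open>hl k\<close> recovers them as functions \<open>a k\<close> known to be in
   L2.\<close>
 define a where "a k u = (LB v. vt \<Phi> (u, v) * cnj (hl k v))" for k u
 have aL: "a k \<in> L2b" for k unfolding a_def[abs_def] by (rule adjoint_slice(1)[OF hl_L2s PL])
 have aC: "AB u. \<forall>k<n. a k u = C k u"
 proof -
  have "AE x in lborel \<Otimes>\<^sub>M lborel. vt \<Phi> x = (\<Sum>k<n. C k (fst x) * hl k (snd x))" using S4 by (simp only: lborel_prod)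
  from lborel_pair.AE_pair[OF this]
  have "AB u. AB v. vt \<Phi> (u, v) = (\<Sum>k<n. C k u * hl k v)" by simp
  then show ?thesis
  proof eventually_elim
   case (elim u)
   show ?case
   proof (intro allI impI)
    fix k assume k: "k < n"
    have "a k u = innb (%v. \<Sum>i<n. C i u * hl i v) (hl k)"
     unfolding a_def inn_def by (rule integral_cong_AE) (use elim in \<open>auto elim: eventually_mono\<close>)
    also have "... = (\<Sum>i<n. innb (%v. C i u * hl i v) (hl k))" by (rule inn_sum_left) (auto intro!: L2s_scale hl_L2s)
    also have "... = (\<Sum>i<n. if i = k then C i u else 0)" by (intro sum.cong refl) (simp add: inn_scale_left inn_hl)
    finally show "a k u = C k u" using k by simp
   qed
  qed
 qed
 define g where "g k u = indicator {u. 0 < snd u} u * a k u" for k and u :: "real \<times> real"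
 have [measurable]: "a k \<in> BM" for k using aL[of k] by (auto simp: L2s_def)
 have Bm[measurable]: "{u :: real \<times> real. 0 < snd u} \<in> sets borel" by measurable
 have gL: "g k \<in> L2b" for k unfolding g_def[abs_def]
  by (rule L2s_bounded_mult[OF aL, where C = 1]) (auto simp: indicator_def)
 have rg: "rep2 (g k) (g k)" for k
  unfolding rep2_def rep_def using gL[of k] by (auto simp: L2s_def in_RRp g_def)
 have gc: "g \<in> carr (L2_pow n RRp)" using rep2_L2s[OF rg] gL by (simp add: L2_pow_sel)
 have "AB x. vt \<Phi> x = r0 n g x"
  using S4 AE_lift_fst[OF aC]
 proof eventually_elim
  case (elim x)
  have "C k (fst x) = g k (fst x)" if "k < n" for k
  proof (cases "0 < sf x")
   case True then show ?thesis using elim(2) that by (simp add: g_def)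
  next
   case False then show ?thesis by (simp add: g_def C_def D_def)
  qed
  then show ?case using elim(1) by (simp add: r0_def tp_def)
 qed
 then have "AE z in lebesgue_on CPi. U f z = R0 n g z"
  using rep_AE_iff[OF mpiso_J CPi_borel rU rep_R0[of n g g, OF rg]] by blast
 then show ?thesis using gc by blast
qed

section \<open>Laplace integrals over the frequencies\<close>

definition kk :: "real => real => real \<times> real => real" where "kk p Y u = exp (- fst u * p - snd u * Y)"

text \<open>Densities whose Laplace integrals are absolutely bounded, uniformly for |p| <= P and Y -
  2 p^2 >= \<kappa>. The uniformity allows the point (p, Y) to be moved, and thereby differentiation
  under the integral.\<close>

definition admB :: "(real \<times> real => complex) => bool" where
 "admB B \<longleftrightarrow> B \<in> BM \<and> (\<forall>u. snd u \<le> 0 --> B u = 0) \<and>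
  (\<forall>\<kappa>>0. \<forall>P. \<exists>N\<ge>0. \<forall>p Y. \<bar>p\<bar> \<le> P --> \<kappa> \<le> Y - 2 * p\<^sup>2 --> (NN u. ennreal (cmod (B u) * kk p Y u)) \<le> ennreal N)"

lemma admBD:
 assumes "admB B"
 shows "B \<in> BM" "snd u \<le> 0 ==> B u = 0"
  "0 < \<kappa> ==> \<exists>N\<ge>0. \<forall>p Y. \<bar>p\<bar> \<le> P --> \<kappa> \<le> Y - 2 * p\<^sup>2 --> (NN u. ennreal (cmod (B u) * kk p Y u)) \<le> ennreal N"
 using assms unfolding admB_def by blast+

abbreviation l1 :: "real \<times> real => real" where "l1 u \<equiv> \<bar>fst u\<bar> + \<bar>snd u\<bar>"

lemma kk_nonneg: "0 \<le> kk p Y u" by (simp add: kk_def)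

text \<open>The extra exponential is paid for by lowering Y by c and moving p by c in the direction
  given by the sign of the first frequency; adding both directions avoids a case distinction
  later.\<close>

lemma kk_shift: "0 < snd u ==> exp (c * l1 u) * kk p Y u \<le> kk (p - c) (Y - c) u + kk (p + c) (Y - c) u"
proof -
 assume t: "0 < snd u"
 show ?thesis
 proof (cases "0 \<le> fst u")
  case True
  then have "exp (c * l1 u) * kk p Y u = kk (p - c) (Y - c) u" using t by (simp add: kk_def exp_add[symmetric] algebra_simps)
  then show ?thesis by (simp add: kk_def)
 next
  case False
  then have "exp (c * l1 u) * kk p Y u = kk (p + c) (Y - c) u" using t by (simp add: kk_def exp_add[symmetric] algebra_simps)
  then show ?thesis by (simp add: kk_def)
 qed
qed

lemma kk_measurable[measurable]: "kk p Y \<in> BM" unfolding kk_def[abs_def] by measurable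

text \<open>The move costs at most c + 4 P c + 2 c^2 of Y - 2 p^2, hence at most (3 + 4 P) c as c <=
  1; the choice of \<open>c\<close> keeps this below \<kappa> / 2.\<close>

lemma shifted_point:
 fixes p P Y \<kappa> :: real
 assumes "0 < \<kappa>" "\<bar>p\<bar> \<le> P" "\<kappa> \<le> Y - 2 * p\<^sup>2" "\<bar>e\<bar> = 1"
 defines "c \<equiv> min 1 (\<kappa> / (2 * (3 + 4 * \<bar>P\<bar>)))"
 shows "0 < c" "\<bar>p + e * c\<bar> \<le> \<bar>P\<bar> + 1" "\<kappa> / 2 \<le> (Y - c) - 2 * (p + e * c)\<^sup>2"
proof -
 have P: "0 \<le> P" using assms(2) by linarith
 show c: "0 < c" using assms(1) by (simp add: c_def)
 have c1: "c \<le> 1" by (simp add: c_def)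
 have c2: "c * (3 + 4 * P) \<le> \<kappa> / 2"
 proof -
  have "c * (3 + 4 * P) \<le> \<kappa> / (2 * (3 + 4 * \<bar>P\<bar>)) * (3 + 4 * P)" using P by (intro mult_right_mono) (auto simp: c_def)
  also have "... = \<kappa> / 2" using P by (simp add: field_simps)
  finally show ?thesis .
 qed
 have "\<bar>p + e * c\<bar> \<le> \<bar>p\<bar> + \<bar>e * c\<bar>" by (rule abs_triangle_ineq)
 also have "\<bar>e * c\<bar> = c" using assms(4) c by (simp add: abs_mult)
 finally show "\<bar>p + e * c\<bar> \<le> \<bar>P\<bar> + 1" using assms(2) c1 by linarith
 have e2: "e * e = 1" using assms(4) by (metis abs_mult_self_eq mult_1)
 have "(p + e * c)\<^sup>2 = p\<^sup>2 + 2 * (e * p) * c + (e * e) * (c * c)" by (simp add: power2_eq_square algebra_simps)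
 also have "... \<le> p\<^sup>2 + 2 * P * c + c"
 proof -
  have "e * p \<le> \<bar>e\<bar> * \<bar>p\<bar>" by (metis abs_ge_self abs_mult)
  then have "e * p \<le> P" using assms(2,4) by simp
  then have "2 * (e * p) * c \<le> 2 * P * c" using c by (intro mult_right_mono) auto
  moreover have "c * c \<le> c" using c c1 by (simp add: mult_left_le)
  ultimately show ?thesis unfolding e2 by simp
 qed
 finally show "\<kappa> / 2 \<le> (Y - c) - 2 * (p + e * c)\<^sup>2" using assms(3) c2 by (simp add: algebra_simps)
qed

lemma admB_core:
 assumes B: "admB B" and \<kappa>: "\<kappa> > 0"
 shows "\<exists>c>0. \<exists>N\<ge>0. \<forall>p Y. \<bar>p\<bar> \<le> P --> \<kappa> \<le> Y - 2 * p\<^sup>2 --> (NN u. ennreal (cmod (B u) * (exp (c * l1 u) * kk p Y u))) \<le> ennreal N"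
proof -
 have [measurable]: "B \<in> BM" and B0: "!!u. snd u \<le> 0 ==> B u = 0" using B by (auto simp: admB_def)
 have "\<exists>N\<ge>0. \<forall>p Y. \<bar>p\<bar> \<le> \<bar>P\<bar> + 1 --> \<kappa> / 2 \<le> Y - 2 * p\<^sup>2 --> (NN u. ennreal (cmod (B u) * kk p Y u)) \<le> ennreal N"
  by (rule admBD(3)[OF B]) (use \<kappa> in simp)
 then obtain N where N: "N \<ge> 0" "!!p Y. \<bar>p\<bar> \<le> \<bar>P\<bar> + 1 ==> \<kappa> / 2 \<le> Y - 2 * p\<^sup>2 ==> (NN u. ennreal (cmod (B u) * kk p Y u)) \<le> ennreal N" by blast
 define c where "c = min 1 (\<kappa> / (2 * (3 + 4 * \<bar>P\<bar>)))"
 have "(NN u. ennreal (cmod (B u) * (exp (c * l1 u) * kk p Y u))) \<le> ennreal (N + N)" if "\<bar>p\<bar> \<le> P" "\<kappa> \<le> Y - 2 * p\<^sup>2" for p Y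
 proof -
  have "(NN u. ennreal (cmod (B u) * (exp (c * l1 u) * kk p Y u)))
   \<le> (NN u. ennreal (cmod (B u) * kk (p - c) (Y - c) u) + ennreal (cmod (B u) * kk (p + c) (Y - c) u))"
  proof (intro nn_integral_mono)
   fix u :: "real \<times> real"
   have "cmod (B u) * (exp (c * l1 u) * kk p Y u) \<le> cmod (B u) * (kk (p - c) (Y - c) u + kk (p + c) (Y - c) u)"
   proof (cases "0 < snd u")
    case True show ?thesis by (intro mult_left_mono kk_shift[OF True]) simp
   qed (simp add: B0)
   also have "... = cmod (B u) * kk (p - c) (Y - c) u + cmod (B u) * kk (p + c) (Y - c) u" by (simp add: distrib_left)
   finally show "ennreal (cmod (B u) * (exp (c * l1 u) * kk p Y u)) \<le> ennreal (cmod (B u) * kk (p - c) (Y - c) u) + ennreal (cmod (B u) * kk (p + c) (Y - c) u)"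
    by (metis ennreal_leI ennreal_plus kk_nonneg mult_nonneg_nonneg norm_ge_zero)
  qed
  also have "... = (NN u. ennreal (cmod (B u) * kk (p - c) (Y - c) u)) + (NN u. ennreal (cmod (B u) * kk (p + c) (Y - c) u))"
   by (rule nn_integral_add) measurable
  also have "... \<le> ennreal N + ennreal N"
   using N(2)[OF shifted_point(2,3)[OF \<kappa> that, of "-1", folded c_def]] N(2)[OF shifted_point(2,3)[OF \<kappa> that, of 1, folded c_def]]
   by (intro add_mono) simp_all
  finally show ?thesis unfolding ennreal_plus[OF N(1) N(1)] .
 qed
 moreover have "0 < c" using \<kappa> by (simp add: c_def)
 ultimately show ?thesis using N(1) by (intro exI[of _ c] conjI exI[of _ "N + N"]) auto
qed

text \<open>Bounds at the moved points yield a spare exponential (\<open>admB_core\<close>), which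
  absorbs any factor of subexponential growth. In particular the class is stable under
  multiplication by the frequencies.\<close>

lemma admB_mult:
 assumes B: "admB B" and g[measurable]: "g \<in> BM" and gb: "!!c. c > 0 ==> \<exists>C. \<forall>u. cmod (g u) \<le> C * exp (c * l1 u)"
 shows "admB (%u. g u * B u)"
 unfolding admB_def
proof (intro conjI allI impI)
 have [measurable]: "B \<in> BM" using B by (auto simp: admB_def)
 show "(%u. g u * B u) \<in> BM" by measurable
 show "g u * B u = 0" if "snd u \<le> 0" for u using admBD(2)[OF B that] by simp
 fix \<kappa> P :: real assume \<kappa>: "\<kappa> > 0"
 obtain c N where c: "c > 0" "N \<ge> 0" "!!p Y. \<bar>p\<bar> \<le> P ==> \<kappa> \<le> Y - 2 * p\<^sup>2 ==> (NN u. ennreal (cmod (B u) * (exp (c * l1 u) * kk p Y u))) \<le> ennreal N"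
  using admB_core[OF B \<kappa>, of P] by blast
 obtain C where C: "!!u. cmod (g u) \<le> C * exp (c * l1 u)" using gb[OF c(1)] by blast
 have C0: "0 \<le> C" using order_trans[OF norm_ge_zero C[of 0]] by simp
 have "(NN u. ennreal (cmod (g u * B u) * kk p Y u)) \<le> ennreal (C * N)" if "\<bar>p\<bar> \<le> P" "\<kappa> \<le> Y - 2 * p\<^sup>2" for p Y
 proof -
  have "(NN u. ennreal (cmod (g u * B u) * kk p Y u)) \<le> (NN u. ennreal C * ennreal (cmod (B u) * (exp (c * l1 u) * kk p Y u)))"
  proof (intro nn_integral_mono)
   fix u :: "real \<times> real"
   have "cmod (g u * B u) * kk p Y u = cmod (g u) * (cmod (B u) * kk p Y u)" by (simp add: norm_mult)
   also have "... \<le> (C * exp (c * l1 u)) * (cmod (B u) * kk p Y u)" by (intro mult_right_mono C) (simp add: kk_def)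
   also have "... = C * (cmod (B u) * (exp (c * l1 u) * kk p Y u))" by (simp only: mult_ac)
   finally show "ennreal (cmod (g u * B u) * kk p Y u) \<le> ennreal C * ennreal (cmod (B u) * (exp (c * l1 u) * kk p Y u))"
    using C0 by (simp add: ennreal_mult[symmetric] kk_def ennreal_leI)
  qed
  also have "... = ennreal C * (NN u. ennreal (cmod (B u) * (exp (c * l1 u) * kk p Y u)))" by (rule nn_integral_cmult) measurable
  also have "... \<le> ennreal C * ennreal N" by (intro mult_left_mono c(3) that) simp
  finally show ?thesis using C0 c(2) by (simp add: ennreal_mult)
 qed
 then show "\<exists>N\<ge>0. \<forall>p Y. \<bar>p\<bar> \<le> P --> \<kappa> \<le> Y - 2 * p\<^sup>2 --> (NN u. ennreal (cmod (g u * B u) * kk p Y u)) \<le> ennreal N"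
  using C0 c(2) by (intro exI[of _ "C * N"]) auto
qed

lemma admB_coord: assumes B: "admB B" shows "admB (%u. of_real (fst u) * B u)" "admB (%u. of_real (snd u) * B u)"
proof -
 have *: "\<bar>x\<bar> \<le> 1 / c * exp (c * l1 u)" if "c > 0" "\<bar>x\<bar> \<le> l1 u" for c x and u :: "real \<times> real"
 proof -
  have "c * \<bar>x\<bar> \<le> c * l1 u" using that by (intro mult_left_mono) auto
  also have "... \<le> exp (c * l1 u)" using exp_ge_add_one_self[of "c * l1 u"] by linarith
  finally show ?thesis using that(1) by (simp add: field_simps)
 qed
 have "\<exists>C. \<forall>u. cmod (of_real (fst u)) \<le> C * exp (c * l1 u)" "\<exists>C. \<forall>u. cmod (of_real (snd u)) \<le> C * exp (c * l1 u)" if "c > 0" for c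
  unfolding norm_of_real by (intro exI[of _ "1 / c"] allI * that; simp)+
 then show "admB (%u. of_real (fst u) * B u)" "admB (%u. of_real (snd u) * B u)" by (auto intro!: admB_mult[OF B])
qed

definition lk :: "complex => complex => real \<times> real => complex" where
 "lk a b u = exp (\<i> * (of_real (fst u) * a + of_real (snd u) * b))"

definition Lap :: "(real \<times> real => complex) => complex => complex => complex" where
 "Lap B a b = (LB u. B u * lk a b u)"

lemma lk_norm: "cmod (lk a b u) = kk (Im a) (Im b) u" by (simp add: lk_def kk_def norm_exp_eq_Re)

lemma lk_measurable[measurable]: "lk a b \<in> BM" unfolding lk_def[abs_def] by measurable

lemma admB_weight:
 assumes B: "admB B" and ab: "2 * (Im a)\<^sup>2 < Im b"
 shows "\<exists>c>0. intg (%u. cmod (B u) * (exp (c * l1 u) * kk (Im a) (Im b) u))"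
proof -
 have [measurable]: "B \<in> BM" using B by (auto simp: admB_def)
 obtain c N where c: "c > 0" "N \<ge> 0" "!!p Y. \<bar>p\<bar> \<le> \<bar>Im a\<bar> ==> Im b - 2 * (Im a)\<^sup>2 \<le> Y - 2 * p\<^sup>2 ==> (NN u. ennreal (cmod (B u) * (exp (c * l1 u) * kk p Y u))) \<le> ennreal N"
  using admB_core[OF B, of "Im b - 2 * (Im a)\<^sup>2" "\<bar>Im a\<bar>"] ab by auto
 have "(NN u. ennreal (cmod (B u) * (exp (c * l1 u) * kk (Im a) (Im b) u))) < \<infinity>"
  using c(3)[of "Im a" "Im b"] by (simp add: order_le_less_trans[OF _ ennreal_less_top])
 then have "intg (%u. cmod (B u) * (exp (c * l1 u) * kk (Im a) (Im b) u))"
  unfolding integrable_iff_bounded by (simp add: kk_def)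
 then show ?thesis using c(1) by blast
qed

lemma admB_integrable:
 assumes B: "admB B" and ab: "2 * (Im a)\<^sup>2 < Im b"
 shows "intg (%u. B u * lk a b u)"
proof -
 have [measurable]: "B \<in> BM" using B by (auto simp: admB_def)
 obtain c where c: "c > 0" "intg (%u. cmod (B u) * (exp (c * l1 u) * kk (Im a) (Im b) u))" using admB_weight[OF assms] by blast
 show ?thesis
 proof (rule integrable_bd[OF c(2)])
  have "cmod (B u * lk a b u) \<le> norm (cmod (B u) * (exp (c * l1 u) * kk (Im a) (Im b) u))" for u :: "real \<times> real"
  proof -
   have "1 * kk (Im a) (Im b) u \<le> exp (c * l1 u) * kk (Im a) (Im b) u" using c(1) by (intro mult_right_mono) (auto simp: kk_def)
   then have "cmod (B u) * kk (Im a) (Im b) u \<le> cmod (B u) * (exp (c * l1 u) * kk (Im a) (Im b) u)" by (intro mult_left_mono) auto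
   then show ?thesis by (simp add: norm_mult lk_norm kk_def)
  qed
  then show "AB u. cmod (B u * lk a b u) \<le> norm (cmod (B u) * (exp (c * l1 u) * kk (Im a) (Im b) u))" by simp
 qed measurable
qed

lemma has_derivative_quadratic:
 fixes f :: "'a::real_normed_vector => 'b::real_normed_vector"
 assumes D: "bounded_linear D" and d: "\<delta> > 0" and b: "!!h. norm h < \<delta> ==> norm (f (x + h) - f x - D h) \<le> K * (norm h)\<^sup>2"
 shows "(f has_derivative D) (at x)"
 unfolding has_derivative_at
proof
 have "((%h. norm (f (x + h) - f x - D h) / norm h) \<longlongrightarrow> 0) (at 0)"
 proof (rule Lim_null_comparison)
  show "\<forall>\<^sub>F h in at 0. norm (norm (f (x + h) - f x - D h) / norm h) \<le> K * norm h"
   unfolding eventually_at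
  proof (intro exI[of _ \<delta>] conjI d ballI impI)
   fix h :: 'a assume h: "h \<noteq> 0 \<and> dist h 0 < \<delta>"
   then have "norm (f (x + h) - f x - D h) / norm h \<le> K * (norm h)\<^sup>2 / norm h" by (intro divide_right_mono b) auto
   then show "norm (norm (f (x + h) - f x - D h) / norm h) \<le> K * norm h" using h by (simp add: power2_eq_square)
  qed
  show "((%h. K * norm h) \<longlongrightarrow> 0) (at 0)" by (auto intro!: tendsto_eq_intros)
 qed
 then show "(%h. norm (f (x + h) - f x - D h) / norm h) \<midarrow>0\<rightarrow> 0" .
qed (rule D)

text \<open>The remainder exp w - 1 - w is bounded by |w|^2 exp |w|, with |w| at most
  \<open>l1 u\<close> times the norm of the increment. Half of the spare exponent c controls exp |w|
  for increments below c / 2, the other half controls the square of \<open>l1 u\<close>.\<close>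

lemma Lap_derivative:
 assumes B: "admB B" and ab: "2 * (Im a)\<^sup>2 < Im b"
 shows "((%x. Lap B (fst x) (snd x)) has_derivative
  (%h. \<i> * Lap (%u. of_real (fst u) * B u) a b * fst h + \<i> * Lap (%u. of_real (snd u) * B u) a b * snd h)) (at (a, b))"
proof -
 have [measurable]: "B \<in> BM" using B by (auto simp: admB_def)
 obtain c where c: "c > 0" and W: "intg (%u. cmod (B u) * (exp (c * l1 u) * kk (Im a) (Im b) u))" (is "integrable _ ?W")
  using admB_weight[OF assms] by blast
 note i0 = admB_integrable[OF B ab] and i1 = admB_integrable[OF admB_coord(1)[OF B] ab] and i2 = admB_integrable[OF admB_coord(2)[OF B] ab]
 \<comment> \<open>From x^2 / 2 <= exp x at x = c / 2 times \<open>l1 u\<close>.\<close>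
 define K where "K = 8 / c\<^sup>2"
 show ?thesis
 proof (rule has_derivative_quadratic[where \<delta> = "c / 2" and K = "K * (LB u. ?W u)"])
  show "bounded_linear (%h. \<i> * Lap (%u. of_real (fst u) * B u) a b * fst h + \<i> * Lap (%u. of_real (snd u) * B u) a b * snd h)"
   by (intro bounded_linear_intros bounded_linear_const_mult bounded_linear_fst bounded_linear_snd)
  show "0 < c / 2" using c by simp
  fix h :: "complex \<times> complex" assume h: "norm h < c / 2"
  have h12: "cmod (fst h) \<le> norm h" "cmod (snd h) \<le> norm h" using norm_fst_le[of "fst h" "snd h"] norm_snd_le[of "snd h" "fst h"] by simp_all
  define w where "w u = \<i> * (of_real (fst u) * fst h + of_real (snd u) * snd h)" for u :: "real \<times> real"
  have wn: "cmod (w u) \<le> l1 u * norm h" for u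
  proof -
   have "cmod (w u) \<le> \<bar>fst u\<bar> * cmod (fst h) + \<bar>snd u\<bar> * cmod (snd h)" unfolding w_def norm_mult
    by (simp add: norm_mult[symmetric] order_trans[OF norm_triangle_ineq] norm_mult)
   also have "... \<le> \<bar>fst u\<bar> * norm h + \<bar>snd u\<bar> * norm h" by (intro add_mono mult_left_mono h12) auto
   finally show ?thesis by (simp add: algebra_simps)
  qed
  have we: "exp (cmod (w u)) \<le> exp (c / 2 * l1 u)" for u
  proof -
   have "l1 u * norm h \<le> l1 u * (c / 2)" using h by (intro mult_left_mono) auto
   then show ?thesis using wn[of u] by (simp add: mult.commute)
  qed
  have lkw: "lk (a + fst h) (b + snd h) u = lk a b u * exp (w u)" for u
   by (simp add: lk_def w_def exp_add[symmetric] algebra_simps)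
  have k0: "0 \<le> kk p Y u" for p Y u by (simp add: kk_def)
  have iw: "intg (%u. B u * lk (a + fst h) (b + snd h) u)"
  proof (rule integrable_bd[OF W])
   have "cmod (B u * lk (a + fst h) (b + snd h) u) \<le> norm (?W u)" for u
   proof -
    have "cmod (exp (w u)) \<le> exp (cmod (w u))" by (simp add: complex_Re_le_cmod)
    also have "... \<le> exp (c * l1 u)" by (rule order_trans[OF we]) (use c in \<open>simp add: mult_right_mono\<close>)
    finally have "cmod (B u) * (cmod (exp (w u)) * kk (Im a) (Im b) u) \<le> ?W u" by (intro mult_left_mono mult_right_mono k0) auto
    then show ?thesis unfolding lkw norm_mult lk_norm by (simp add: mult_ac kk_def)
   qed
   then show "AB u. cmod (B u * lk (a + fst h) (b + snd h) u) \<le> norm (?W u)" by simp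
  qed measurable
  define Rm where "Rm u = B u * lk (a + fst h) (b + snd h) u - B u * lk a b u - (\<i> * fst h * (of_real (fst u) * B u * lk a b u) + \<i> * snd h * (of_real (snd u) * B u * lk a b u))" for u
  have iR: "intg Rm" unfolding Rm_def
   by (intro integrable_diff_B integrable_add_B integrable_mult_right iw i0 i1 i2)
  have eq: "Lap B (fst ((a, b) + h)) (snd ((a, b) + h)) - Lap B (fst (a, b)) (snd (a, b)) - (\<i> * Lap (%u. of_real (fst u) * B u) a b * fst h + \<i> * Lap (%u. of_real (snd u) * B u) a b * snd h)
   = (LB u. Rm u)"
  proof -
   note j = integrable_mult_right[OF i1, of "\<i> * fst h"] integrable_mult_right[OF i2, of "\<i> * snd h"]
   have "(LB u. Rm u) = Lap B (a + fst h) (b + snd h) - Lap B a b - (\<i> * fst h * Lap (%u. of_real (fst u) * B u) a b + \<i> * snd h * Lap (%u. of_real (snd u) * B u) a b)"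
    unfolding Rm_def Lap_def int_diff[OF integrable_diff_B[OF iw i0] integrable_add_B[OF j]]
     int_diff[OF iw i0] int_add[OF j] integral_mult_right_zero ..
   then show ?thesis by (simp add: mult_ac)
  qed
  have Rb: "cmod (Rm u) \<le> K * (norm h)\<^sup>2 * ?W u" for u
  proof -
   have "Rm u = B u * lk a b u * (exp (w u) - (1 + w u))" unfolding Rm_def lkw w_def by (simp add: algebra_simps)
   then have "cmod (Rm u) = cmod (B u) * kk (Im a) (Im b) u * cmod (exp (w u) - (1 + w u))" by (simp add: norm_mult lk_norm)
   also have "... \<le> cmod (B u) * kk (Im a) (Im b) u * (K * (norm h)\<^sup>2 * exp (c * l1 u))"
   proof (intro mult_left_mono)
    have "cmod (exp (w u) - (1 + w u)) \<le> exp \<bar>Re (w u)\<bar> * cmod (w u) ^ 2" using Taylor_exp[of "w u" 1] by (simp add: numeral_2_eq_2)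
    also have "... \<le> exp (c / 2 * l1 u) * (l1 u * norm h) ^ 2"
     by (intro mult_mono power_mono wn order_trans[OF _ we]) (auto simp: abs_Re_le_cmod)
    also have "... = exp (c / 2 * l1 u) * (l1 u)\<^sup>2 * (norm h)\<^sup>2" by (simp add: power_mult_distrib)
    also have "... \<le> exp (c / 2 * l1 u) * (K * exp (c / 2 * l1 u)) * (norm h)\<^sup>2"
    proof (intro mult_right_mono mult_left_mono)
     have "1 + c / 2 * l1 u + (c / 2 * l1 u)\<^sup>2 / 2 \<le> exp (c / 2 * l1 u)" by (rule exp_lower_Taylor_quadratic) (use c in auto)
     then have "(c / 2 * l1 u)\<^sup>2 / 2 \<le> exp (c / 2 * l1 u)" using c by (smt (verit) abs_ge_zero mult_nonneg_nonneg divide_nonneg_nonneg)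
     moreover have "(c / 2 * l1 u)\<^sup>2 / 2 = c\<^sup>2 * (l1 u)\<^sup>2 / 8" by (simp add: power_mult_distrib power_divide)
     moreover have "y \<le> 8 / c\<^sup>2 * E" if "c\<^sup>2 * y / 8 \<le> E" for y E using c that by (simp add: field_simps)
     ultimately show "(l1 u)\<^sup>2 \<le> K * exp (c / 2 * l1 u)" unfolding K_def by metis
    qed auto
    also have "... = K * (norm h)\<^sup>2 * (exp (c / 2 * l1 u) * exp (c / 2 * l1 u))" by (simp only: mult_ac)
    also have "exp (c / 2 * l1 u) * exp (c / 2 * l1 u) = exp (c * l1 u)" by (simp add: exp_add[symmetric])
    finally show "cmod (exp (w u) - (1 + w u)) \<le> K * (norm h)\<^sup>2 * exp (c * l1 u)" .
   qed (simp add: kk_def)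
   also have "... = K * (norm h)\<^sup>2 * ?W u" by (simp only: mult_ac)
   finally show ?thesis .
  qed
  have "cmod (LB u. Rm u) \<le> (LB u. cmod (Rm u))" by (rule integral_norm_bound)
  also have "... \<le> (LB u. K * (norm h)\<^sup>2 * ?W u)" by (intro integral_mono integrable_norm iR integrable_mult_right W Rb)
  also have "... = K * (norm h)\<^sup>2 * (LB u. ?W u)" by simp
  also have "... = K * (LB u. ?W u) * (norm h)\<^sup>2" by (simp only: mult_ac)
  finally show "norm (Lap B (fst ((a, b) + h)) (snd ((a, b) + h)) - Lap B (fst (a, b)) (snd (a, b)) - (\<i> * Lap (%u. of_real (fst u) * B u) a b * fst h + \<i> * Lap (%u. of_real (snd u) * B u) a b * snd h))
   \<le> K * (LB u. ?W u) * (norm h)\<^sup>2" unfolding eq .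
 qed
qed

text \<open>The substitution maps the Siegel domain into Im b > 2 (Im a)^2, where the Laplace
  integrals converge; being holomorphic it preserves holomorphy.\<close>

definition Lf :: "(real \<times> real => complex) => complex \<times> complex => complex" where
 "Lf B zeta = Lap B (fst zeta) (snd zeta - \<i> * (fst zeta)\<^sup>2)"

lemma siegel_tube: "zeta \<in> siegel ==> 2 * (Im (fst zeta))\<^sup>2 < Im (snd zeta - \<i> * (fst zeta)\<^sup>2)"
 by (cases zeta) (simp add: siegel_def cmod_power2, simp add: power2_eq_square)

lemma Lf_derivative:
 assumes B: "admB B" and z: "zeta \<in> siegel"
 shows "(Lf B has_derivative (%h. \<i> * Lf (%u. of_real (fst u) * B u) zeta * fst h + \<i> * Lf (%u. of_real (snd u) * B u) zeta * (snd h - 2 * \<i> * fst zeta * fst h))) (at zeta)"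
proof -
 have "((%zeta. (fst zeta, snd zeta - \<i> * (fst zeta)\<^sup>2)) has_derivative (%h. (fst h, snd h - 2 * \<i> * fst zeta * fst h))) (at zeta)"
  unfolding power2_eq_square
  by (rule has_derivative_eq_rhs, (rule derivative_intros | simp)+) (auto simp: fun_eq_iff algebra_simps)
 from diff_chain_at[OF this Lap_derivative[OF B siegel_tube[OF z]]]
 show ?thesis by (simp add: comp_def Lf_def[abs_def])
qed

text \<open>Differentiation multiplies the density by a frequency, which stays in
  \<open>admB\<close>, so the induction runs over all densities at once.\<close>

lemma Lf_Ck: "admB B ==> Ck_on k siegel (Lf B)"
proof (induction k arbitrary: B)
 case 0
 then show ?case using has_derivative_continuous[OF Lf_derivative[OF 0]] by (auto intro!: continuous_at_imp_continuous_on)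
next
 case (Suc k)
 note d = Lf_derivative[OF Suc.prems]
 show ?case unfolding Ck_on.simps
 proof (intro conjI ballI allI)
  show "Lf B differentiable (at x)" if "x \<in> siegel" for x using d[OF that] by (auto simp: differentiable_def)
  fix v
  have f: "Ck_on k siegel (%x :: complex \<times> complex. fst x)" by (rule Ck_linear[OF bounded_linear_fst])
  have "Ck_on k siegel (%x. \<i> * Lf (%u. of_real (fst u) * B u) x * fst v + \<i> * Lf (%u. of_real (snd u) * B u) x * (snd v + (- 2 * \<i> * fst v) * fst x))"
   by (intro Ck_add Ck_mult Ck_const open_siegel Suc.IH admB_coord Suc.prems f)
  then show "Ck_on k siegel (%x. frechet_derivative (Lf B) (at x) v)"
   by (rule Ck_cong[OF open_siegel]) (simp add: frechet_eqI[OF d] mult_ac)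
 qed
qed

lemma Lf_holo: assumes "admB B" shows "holo (Lf B)"
proof -
 have "dbar1 (Lf B) zeta = 0 \<and> dbar2 (Lf B) zeta = 0" if "zeta \<in> siegel" for zeta
  unfolding dbar1_def dbar2_def frechet_eqI[OF Lf_derivative[OF assms that]] by (simp add: algebra_simps)
 then show ?thesis using Lf_Ck[OF assms] by (simp add: holo_def smooth_on_def)
qed

section \<open>Preimages of single monomials\<close>

definition dB :: "nat => (real \<times> real => complex) => real \<times> real => complex" where
 "dB j A u = (if 0 < snd u then of_real (sqrt (2 * snd u) * (2 * snd u) ^ j / sqrt (sqrt pi) * exp (- (fst u)\<^sup>2 / (8 * snd u))) * A (fst u / (2 * sqrt (snd u)), snd u) else 0)"

lemma dB_measurable[measurable]:
 assumes [measurable]: "A \<in> BM" shows "dB j A \<in> BM"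
 unfolding dB_def[abs_def] by measurable

text \<open>In sheared frequencies, the transform that \<open>vt\<close> carries to \<open>A\<close>
  times \<open>h0\<close> times \<open>mon j\<close>: a power of v2, the modulus of the Laplace
  kernel, and the density \<open>dB\<close>, free of v. The Gaussian in \<open>dB\<close> comes from
  \<open>h0\<close>, the powers of 2 t from y2 = 2 t v2 and from the normalisation of
  \<open>V1\<close>.\<close>

definition pb :: "nat => (real \<times> real => complex) => r4 => complex" where
 "pb j A y = indicator {0<..} (ss y) * of_real (ss y ^ j * kk (fs y) (ss y + 2 * (fs y)\<^sup>2) (fst y)) * dB j A (fst y)"

lemma vti_mon:
 assumes A: "!!u. snd u \<le> 0 ==> A u = 0"
 shows "vti (tp A (tp h0 (mon j))) x = pb j A (tau x)"
proof -
 obtain \<xi> t p q where x: "x = ((\<xi>, t), (p, q))" by (metis surj_pair)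
 show ?thesis
 proof (cases "0 < t")
  case False
  then show ?thesis using A by (simp add: vti_def rinv_def Let_def x tp_def pb_def dB_def tau_def)
 next
  case t: True
  define s where "s = sqrt t"
  have s: "0 < s" "t = s * s" using t by (auto simp: s_def)
  define l where "l = \<xi> - 2 * t * p"
  have a: "\<xi> / (2 * s) - s * p = l / (2 * s)" unfolding l_def s(2) using s(1) by (simp add: field_simps)
  \<comment> \<open>Completing the square separates the sheared frequency l from v: the remaining
    terms form the exponent of \<open>kk\<close>.\<close>
  have b: "- (\<xi> / (2 * s) + s * p)\<^sup>2 / 2 + - (2 * t * q) / 2 = - l\<^sup>2 / (8 * t) + (- l * p - t * (q + 2 * p\<^sup>2))"
  proof -
   have "\<xi> / (2 * s) + s * p = l / (2 * s) + 2 * s * p" unfolding l_def s(2) using s(1) by (simp add: field_simps)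
   then show ?thesis unfolding s(2) using s(1) by (simp add: power2_eq_square field_simps)
  qed
  have e: "exp (- (\<xi> / (2 * s) + s * p)\<^sup>2 / 2) * exp (- (2 * t * q) / 2) = exp (- l\<^sup>2 / (8 * t)) * kk p (q + 2 * p\<^sup>2) (l, t)"
   unfolding kk_def exp_add[symmetric] b by (simp add: algebra_simps)
  have i: "indicator {0<..} (2 * t * q) = (indicator {0<..} q :: complex)" using t by (auto simp: indicator_def zero_less_mult_iff)
  have gen1: "of_real a * (Z * (of_real (b / r) * (w * of_real (k * d)))) = of_real (a * k / r * (b * d)) * (Z * w)"
   and gen2: "of_real (a * (k * m) / r * (b * d)) * (Z * w) = w * of_real (m * d) * (of_real (a * k / r * b) * Z)" for a b r k d m :: real and Z w :: complex
   by (simp_all add: divide_inverse mult_ac)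
  have "vti (tp A (tp h0 (mon j))) x = of_real (sqrt (2 * t)) * (A (l / (2 * s), t) *
   (of_real (exp (- (\<xi> / (2 * s) + s * p)\<^sup>2 / 2) / sqrt (sqrt pi)) * (indicator {0<..} q * of_real ((2 * t * q) ^ j * exp (- (2 * t * q) / 2)))))"
   using t by (simp add: x vti_def rinv_def Let_def s_def[symmetric] tp_def a h0_def hermite_0 mon_def i)
  also have "... = of_real (sqrt (2 * t) * ((2 * t) ^ j * q ^ j) / sqrt (sqrt pi) * (exp (- (\<xi> / (2 * s) + s * p)\<^sup>2 / 2) * exp (- (2 * t * q) / 2))) * (A (l / (2 * s), t) * indicator {0<..} q)"
   unfolding power_mult_distrib[of "2 * t" q j] by (rule gen1)
  also have "... = pb j A (tau x)" unfolding e using t by (simp only: gen2) (simp add: x pb_def tau_def dB_def l_def s_def)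
  finally show ?thesis .
 qed
qed

lemma power_exp_bound:
 fixes \<kappa> :: real assumes \<kappa>: "0 < \<kappa>"
 shows "\<exists>C\<ge>0. \<forall>t>0. 2 * sqrt t * (2 * t) ^ m * exp (- 2 * t * \<kappa>) \<le> C"
proof -
 define M where "M = (2 / \<kappa>) ^ m * real m ^ m"
 have M: "0 \<le> M" using \<kappa> by (simp add: M_def)
 have "2 * sqrt t * (2 * t) ^ m * exp (- 2 * t * \<kappa>) \<le> (1 + 1 / \<kappa>) * M" if t: "t > 0" for t
 proof -
  have "2 * sqrt t \<le> 1 + t" using zero_le_power2[of "sqrt t - 1"] t by (simp add: power2_eq_square algebra_simps)
  also have "... \<le> (1 + 1 / \<kappa>) * (1 + \<kappa> * t)" using \<kappa> t by (simp add: field_simps)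
  also have "... \<le> (1 + 1 / \<kappa>) * exp (\<kappa> * t)" using \<kappa> by (intro mult_left_mono exp_ge_add_one_self) auto
  finally have 1: "2 * sqrt t \<le> (1 + 1 / \<kappa>) * exp (\<kappa> * t)" .
  have 2: "(2 * t) ^ m \<le> M * exp (\<kappa> * t)"
  proof (cases "m = 0")
   case True then show ?thesis using \<kappa> t by (simp add: M_def)
  next
   case False
   have "(\<kappa> * t / real m) ^ m \<le> (1 + \<kappa> * t / real m) ^ m" using \<kappa> t by (intro power_mono) auto
   also have "... \<le> exp (\<kappa> * t)" using \<kappa> t False by (intro exp_ge_one_plus_x_over_n_power_n) (auto intro: order_trans[of _ 0])
   finally have "M * (\<kappa> * t / real m) ^ m \<le> M * exp (\<kappa> * t)" using M by (rule mult_left_mono)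
   moreover have "M * (\<kappa> * t / real m) ^ m = (2 * t) ^ m"
    unfolding M_def power_mult_distrib[symmetric] using \<kappa> False by (simp add: field_simps)
   ultimately show ?thesis by simp
  qed
  have "(2 * sqrt t) * (2 * t) ^ m \<le> ((1 + 1 / \<kappa>) * exp (\<kappa> * t)) * (M * exp (\<kappa> * t))" by (rule mult_mono[OF 1 2]) (use t \<kappa> in auto)
  then have "(2 * sqrt t) * (2 * t) ^ m * exp (- 2 * t * \<kappa>) \<le> ((1 + 1 / \<kappa>) * exp (\<kappa> * t)) * (M * exp (\<kappa> * t)) * exp (- 2 * t * \<kappa>)" by (rule mult_right_mono) simp
  also have "... = (1 + 1 / \<kappa>) * M * (exp (\<kappa> * t) * exp (\<kappa> * t) * exp (- 2 * t * \<kappa>))" by (simp only: mult_ac)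
  also have "exp (\<kappa> * t) * exp (\<kappa> * t) * exp (- 2 * t * \<kappa>) = 1" by (simp add: exp_add[symmetric] algebra_simps)
  finally show ?thesis by simp
 qed
 then show ?thesis using M \<kappa> by (intro exI[of _ "(1 + 1 / \<kappa>) * M"]) auto
qed

text \<open>With the first frequency written as 2 sqrt(t) x, the Gaussian of \<open>dB\<close> and
  the kernel combine to exp(-(x + 2 sqrt(t) p)^2 / 2 - t (Y - 2 p^2)). This is at most exp(-t
  \<kappa>), whose square absorbs the powers of t.\<close>

lemma dB_weighted_L2:
 assumes A: "A \<in> L2b" and \<kappa>: "0 < \<kappa>"
 shows "\<exists>C\<ge>0. \<forall>p Y. \<kappa> \<le> Y - 2 * p\<^sup>2 --> (NN u. ennreal ((cmod (dB j A u) * kk p Y u)\<^sup>2)) \<le> ennreal C"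
proof -
 have [measurable]: "A \<in> BM" using A by (auto simp: L2s_def)
 obtain C where C: "C \<ge> 0" "!!t. t > 0 ==> 2 * sqrt t * (2 * t) ^ (2 * j + 1) * exp (- 2 * t * \<kappa>) \<le> C" using power_exp_bound[OF \<kappa>] by blast
 have "(NN u. ennreal ((cmod (dB j A u) * kk p Y u)\<^sup>2)) \<le> ennreal (C / sqrt pi * n2 lborel A)" if Y: "\<kappa> \<le> Y - 2 * p\<^sup>2" for p Y
 proof -
  let ?f = "%l t. ennreal ((cmod (dB j A (l, t)) * kk p Y (l, t))\<^sup>2)"
  have inner: "(NN l. ?f l t) \<le> ennreal (C / sqrt pi) * (NN x. ennreal ((cmod (A (x, t)))^2))" for t
  proof (cases "0 < t")
   case False then show ?thesis by (simp add: dB_def)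
  next
   case t: True
   define s where "s = sqrt t"
   have s: "0 < s" "t = s * s" using t by (auto simp: s_def)
   have "(NN l. ?f l t) = ennreal \<bar>2 * s\<bar> * (NN x. ?f (0 + 2 * s * x) t)"
    by (rule nn_integral_real_affine) (use s in auto)
   also have "... = (NN x. ennreal (2 * s) * ?f (2 * s * x) t)" using s by (subst nn_integral_cmult) auto
   also have "... \<le> (NN x. ennreal (C / sqrt pi) * ennreal ((cmod (A (x, t)))^2))"
   proof (intro nn_integral_mono)
    fix x :: real
    have "exp (- (2 * s * x)\<^sup>2 / (8 * t)) * kk p Y (2 * s * x, t) = exp (- (x + 2 * s * p)\<^sup>2 / 2 - t * (Y - 2 * p\<^sup>2))"
     unfolding kk_def exp_add[symmetric] s(2) using s(1) by (simp add: power2_eq_square field_simps)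
    also have "... \<le> exp (- t * \<kappa>)"
    proof -
     have "t * \<kappa> \<le> t * (Y - 2 * p\<^sup>2)" using Y t by (intro mult_left_mono) auto
     moreover have gen: "- a / 2 - d \<le> - b" if "0 \<le> a" "b \<le> d" for a b d :: real using that by simp
     ultimately have "- (x + 2 * s * p)\<^sup>2 / 2 - t * (Y - 2 * p\<^sup>2) \<le> - (t * \<kappa>)" by (intro gen) auto
     then show ?thesis by (simp only: exp_le_cancel_iff mult_minus_left)
    qed
    finally have k: "exp (- (2 * s * x)\<^sup>2 / (8 * t)) * kk p Y (2 * s * x, t) \<le> exp (- t * \<kappa>)" .
    let ?w = "sqrt (2 * t) * (2 * t) ^ j / sqrt (sqrt pi)"
    have d: "cmod (dB j A (2 * s * x, t)) * kk p Y (2 * s * x, t) = ?w * (exp (- (2 * s * x)\<^sup>2 / (8 * t)) * kk p Y (2 * s * x, t)) * cmod (A (x, t))"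
    proof -
     have 1: "dB j A (2 * s * x, t) = of_real (?w * exp (- (2 * s * x)\<^sup>2 / (8 * t))) * A (x, t)"
      unfolding dB_def fst_conv snd_conv s_def[symmetric] using t s(1) by simp
     have "0 \<le> ?w * exp (- (2 * s * x)\<^sup>2 / (8 * t))" using t by simp
     then show ?thesis unfolding 1 norm_mult norm_of_real by (simp only: abs_of_nonneg mult_ac)
    qed
    also have "... \<le> ?w * exp (- t * \<kappa>) * cmod (A (x, t))"
     by (intro mult_right_mono mult_left_mono k) (use t in auto)
    finally have "(cmod (dB j A (2 * s * x, t)) * kk p Y (2 * s * x, t))\<^sup>2 \<le> (?w * exp (- t * \<kappa>) * cmod (A (x, t)))\<^sup>2"
     by (intro power_mono) (auto simp: kk_nonneg)
    also have "... = (2 * t) ^ (2 * j + 1) / sqrt pi * exp (- 2 * t * \<kappa>) * (cmod (A (x, t)))^2"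
    proof -
     have "(exp (- t * \<kappa>))\<^sup>2 = exp (- 2 * t * \<kappa>)" by (simp add: power2_eq_square exp_add[symmetric])
     moreover have "?w\<^sup>2 = (2 * t) ^ (2 * j + 1) / sqrt pi" using t by (simp add: power_mult_distrib power_divide power_mult[symmetric] mult.commute[of j])
     ultimately show ?thesis by (simp only: power_mult_distrib)
    qed
    finally have "2 * s * (cmod (dB j A (2 * s * x, t)) * kk p Y (2 * s * x, t))\<^sup>2 \<le> 2 * s * ((2 * t) ^ (2 * j + 1) / sqrt pi * exp (- 2 * t * \<kappa>) * (cmod (A (x, t)))^2)"
     using s(1) by (intro mult_left_mono) auto
    also have "... = (2 * s * (2 * t) ^ (2 * j + 1) * exp (- 2 * t * \<kappa>)) * ((cmod (A (x, t)))^2 / sqrt pi)" by (simp add: divide_inverse mult_ac)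
    also have "... \<le> C * ((cmod (A (x, t)))^2 / sqrt pi)" unfolding s_def by (intro mult_right_mono C(2)[OF t]) auto
    finally show "ennreal (2 * s) * ?f (2 * s * x) t \<le> ennreal (C / sqrt pi) * ennreal ((cmod (A (x, t)))^2)"
     using s(1) C(1) by (simp add: ennreal_mult[symmetric] ennreal_leI)
   qed
   also have "... = ennreal (C / sqrt pi) * (NN x. ennreal ((cmod (A (x, t)))^2))" by (rule nn_integral_cmult) measurable
   finally show ?thesis .
  qed
  have "(NN u. ennreal ((cmod (dB j A u) * kk p Y u)\<^sup>2)) = (NN t. NN l. ?f l t)"
   by (subst nn_R2, measurable, rule nn_swap) measurable
  also have "... \<le> (NN t. ennreal (C / sqrt pi) * (NN x. ennreal ((cmod (A (x, t)))^2)))" by (intro nn_integral_mono inner)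
  also have "... = ennreal (C / sqrt pi) * (NN t. NN x. ennreal ((cmod (A (x, t)))^2))" by (rule nn_integral_cmult) measurable
  also have "(NN t. NN x. ennreal ((cmod (A (x, t)))^2)) = (NN u. ennreal ((cmod (A u))^2))"
   by (subst nn_R2, measurable, rule nn_swap[symmetric]) measurable
  also have "... = ennreal (n2 lborel A)" by (rule n2_ennreal[OF A])
  finally show ?thesis using C(1) by (simp add: ennreal_mult[symmetric] n2_nonneg)
 qed
 then show ?thesis using C(1) n2_nonneg[of lborel A] by (intro exI[of _ "C / sqrt pi * n2 lborel A"]) auto
qed

lemma exp_abs_integrable:
 fixes a :: real assumes a: "0 < a" shows "intg (%x. exp (- a * \<bar>x\<bar>))"
proof -
 let ?f = "%y :: real. indicator {0<..} y * (y ^ 0 * exp (- y)) :: real"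
 have f: "intg ?f" by (rule power_exp_integral(1))
 have "intg (%x. ?f (0 + a * x) + ?f (0 + (- a) * x))"
  by (intro integrable_add_B lborel_integrable_real_affine f) (use a in auto)
 then show ?thesis
 proof (rule integrable_bd)
  show "AB x. norm (exp (- a * \<bar>x\<bar>)) \<le> norm (?f (0 + a * x) + ?f (0 + (- a) * x))"
   using AE_lborel_singleton[of 0]
  proof eventually_elim
   case (elim x)
   then show ?case using a by (cases "0 < x") (auto simp: indicator_def zero_less_mult_iff mult_less_0_iff)
  qed
 qed measurable
qed

text \<open>Weighted L2 bounds give L1 bounds by pairing with the square integrable
  \<open>D\<close>; the reciprocal of \<open>D\<close> is absorbed by moving the point as in
  \<open>kk_shift\<close>.\<close>

lemma admB_dB:
 assumes A: "A \<in> L2b" shows "admB (dB j A)"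
 unfolding admB_def
proof (intro conjI allI impI)
 have [measurable]: "A \<in> BM" using A by (auto simp: L2s_def)
 show "dB j A \<in> BM" by measurable
 show "dB j A u = 0" if "snd u \<le> 0" for u using that by (simp add: dB_def)
 fix \<kappa> P :: real assume \<kappa>: "0 < \<kappa>"
 define c where "c = min 1 (\<kappa> / (2 * (3 + 4 * \<bar>P\<bar>)))"
 have c: "0 < c" using \<kappa> by (simp add: c_def)
 obtain C where C: "C \<ge> 0" "!!p Y. \<kappa> / 2 \<le> Y - 2 * p\<^sup>2 ==> (NN u. ennreal ((cmod (dB j A u) * kk p Y u)\<^sup>2)) \<le> ennreal C"
  using dB_weighted_L2[OF A, of "\<kappa> / 2" j] \<kappa> by auto
 define D where "D u = exp (- c * l1 u)" for u :: "real \<times> real"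
 have iD: "intg (%u. (D u)\<^sup>2)"
 proof -
  have e: "intg (%x. cr (exp (- (2 * c) * \<bar>x\<bar>)))"
   by (rule integrable_of_real, rule exp_abs_integrable) (use c in simp)
  have "intg (%u. cmod (tp (%x. cr (exp (- (2 * c) * \<bar>x\<bar>))) (%x. cr (exp (- (2 * c) * \<bar>x\<bar>))) u))"
   by (rule integrable_norm) (rule tp_integral(1)[OF e e])
  moreover have "cmod (tp (%x. cr (exp (- (2 * c) * \<bar>x\<bar>))) (%x. cr (exp (- (2 * c) * \<bar>x\<bar>))) u) = (D u)\<^sup>2" for u :: "real \<times> real"
   by (simp add: tp_def norm_mult D_def power2_eq_square exp_add[symmetric] algebra_simps)
  ultimately show ?thesis by simp
 qed
 define N where "N = C + C + (LB u. (D u)\<^sup>2)"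
 have "(NN u. ennreal (cmod (dB j A u) * kk p Y u)) \<le> ennreal N" if pY: "\<bar>p\<bar> \<le> P" "\<kappa> \<le> Y - 2 * p\<^sup>2" for p Y
 proof -
  let ?B = "%u. cmod (dB j A u)"
  have "(NN u. ennreal (?B u * kk p Y u))
   \<le> (NN u. (ennreal ((?B u * kk (p - c) (Y - c) u)\<^sup>2) + ennreal ((?B u * kk (p + c) (Y - c) u)\<^sup>2)) + ennreal ((D u)\<^sup>2))"
  proof (intro nn_integral_mono)
   fix u :: "real \<times> real"
   have "?B u * kk p Y u \<le> (?B u * kk (p - c) (Y - c) u)\<^sup>2 + (?B u * kk (p + c) (Y - c) u)\<^sup>2 + (D u)\<^sup>2"
   proof (cases "0 < snd u")
    case False then show ?thesis by (simp add: dB_def)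
   next
    case True
    have am: "x * y \<le> x\<^sup>2 / 2 + y\<^sup>2 / 2" for x y :: real using zero_le_power2[of "x - y"] by (simp add: power2_eq_square algebra_simps)
    have D1: "D u * exp (c * l1 u) = 1" by (simp add: D_def exp_add[symmetric])
    have "?B u * kk p Y u = ?B u * D u * (exp (c * l1 u) * kk p Y u)" using D1 by (simp add: mult_ac)
    also have "... \<le> ?B u * D u * (kk (p - c) (Y - c) u + kk (p + c) (Y - c) u)"
     by (intro mult_left_mono kk_shift[OF True]) (simp add: D_def)
    also have "... = (?B u * kk (p - c) (Y - c) u) * D u + (?B u * kk (p + c) (Y - c) u) * D u" by (simp add: algebra_simps)
    also have "... \<le> (?B u * kk (p - c) (Y - c) u)\<^sup>2 + (?B u * kk (p + c) (Y - c) u)\<^sup>2 + (D u)\<^sup>2"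
     using am[of "?B u * kk (p - c) (Y - c) u" "D u"] am[of "?B u * kk (p + c) (Y - c) u" "D u"]
      zero_le_power2[of "?B u * kk (p - c) (Y - c) u"] zero_le_power2[of "?B u * kk (p + c) (Y - c) u"] by linarith
    finally show ?thesis .
   qed
   then show "ennreal (?B u * kk p Y u) \<le> (ennreal ((?B u * kk (p - c) (Y - c) u)\<^sup>2) + ennreal ((?B u * kk (p + c) (Y - c) u)\<^sup>2)) + ennreal ((D u)\<^sup>2)"
    using ennreal_leI by fastforce
  qed
  also have "... = ((NN u. ennreal ((?B u * kk (p - c) (Y - c) u)\<^sup>2)) + (NN u. ennreal ((?B u * kk (p + c) (Y - c) u)\<^sup>2))) + (NN u. ennreal ((D u)\<^sup>2))"
   by (subst nn_integral_add, measurable, simp add: D_def, subst nn_integral_add) (auto simp: D_def)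
  also have "(NN u. ennreal ((D u)\<^sup>2)) = ennreal (LB u. (D u)\<^sup>2)" by (rule nn_integral_eq_integral[OF iD]) simp
  also have "((NN u. ennreal ((?B u * kk (p - c) (Y - c) u)\<^sup>2)) + (NN u. ennreal ((?B u * kk (p + c) (Y - c) u)\<^sup>2))) + ennreal (LB u. (D u)\<^sup>2)
   \<le> (ennreal C + ennreal C) + ennreal (LB u. (D u)\<^sup>2)"
   using C(2)[OF shifted_point(3)[OF \<kappa> pY, of "-1", folded c_def]] C(2)[OF shifted_point(3)[OF \<kappa> pY, of 1, folded c_def]]
   by (intro add_mono order_refl) simp_all
  also have "... = ennreal N" unfolding N_def using C(1) by (simp add: ennreal_plus[symmetric] integral_nonneg_AE del: ennreal_plus)
  finally show ?thesis .
 qed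
 moreover have "0 \<le> N" unfolding N_def using C(1) by (simp add: integral_nonneg_AE)
 ultimately show "\<exists>N\<ge>0. \<forall>p Y. \<bar>p\<bar> \<le> P --> \<kappa> \<le> Y - 2 * p\<^sup>2 --> (NN u. ennreal (cmod (dB j A u) * kk p Y u)) \<le> ennreal N" by blast
qed

lemma pb_measurable[measurable]:
 assumes [measurable]: "A \<in> BM" shows "pb j A \<in> BM"
 unfolding pb_def[abs_def] kk_def by measurable

lemma pb_slab:
 assumes A: "A \<in> L2b" shows "slab (%x. pb j A (tau x))"
 unfolding slab_def
proof
 fix k
 have [measurable]: "A \<in> BM" using A by (auto simp: L2s_def)
 have [measurable]: "Qk k \<in> sets borel" "Ck k \<in> sets borel" using Qk Ck by auto
 let ?i = "tp (indicator (Qk k)) (indicator (Ck k)) :: real \<times> real => complex"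
 obtain N where N: "N \<ge> 0" "!!p Y. \<bar>p\<bar> \<le> real k ==> 1 / real (Suc k) \<le> Y - 2 * p\<^sup>2 ==> (NN u. ennreal (cmod (dB j A u) * kk p Y u)) \<le> ennreal N"
  using admBD(3)[OF admB_dB[OF A, of j], of "1 / real (Suc k)" "real k"] by auto
 have inner: "(NN u. ennreal (cmod (pb j A (u, v) * ?i v))) \<le> ennreal (real k ^ j * N) * ennreal (cmod (?i v))" for v
 proof (cases "fst v \<in> Qk k \<and> snd v \<in> Ck k")
  case False then show ?thesis by (auto simp: tp_def)
 next
  case True
  have "0 < 1 / real (Suc k)" by simp
  moreover have v: "\<bar>fst v\<bar> \<le> real k" "1 / real (Suc k) \<le> snd v" "snd v \<le> real k" using True by (auto simp: Qk_def Ck_def)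
  ultimately have v0: "0 < snd v" by linarith
  have i: "?i v = 1" using True by (simp add: tp_def)
  have "cmod (pb j A (u, v) * ?i v) = snd v ^ j * (cmod (dB j A u) * kk (fst v) (snd v + 2 * (fst v)\<^sup>2) u)" for u
   using v0 by (simp add: pb_def norm_mult i kk_nonneg abs_mult norm_power)
  then have "(NN u. ennreal (cmod (pb j A (u, v) * ?i v))) = (NN u. ennreal (snd v ^ j) * ennreal (cmod (dB j A u) * kk (fst v) (snd v + 2 * (fst v)\<^sup>2) u))"
   using v0 by (simp add: ennreal_mult kk_nonneg)
  also have "... = ennreal (snd v ^ j) * (NN u. ennreal (cmod (dB j A u) * kk (fst v) (snd v + 2 * (fst v)\<^sup>2) u))" by (rule nn_integral_cmult) measurable
  also have "... \<le> ennreal (real k ^ j) * ennreal N" using v v0 by (intro mult_mono N(2) ennreal_leI power_mono) auto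
  finally show ?thesis using N(1) by (simp add: i ennreal_mult)
 qed
 have "intg (%y. pb j A y * ?i (snd y))" unfolding integrable_iff_bounded
 proof
  have "(NN y. ennreal (cmod (pb j A y * ?i (snd y)))) = (NN v. NN u. ennreal (cmod (pb j A (u, v) * ?i v)))"
   by (subst lborel_prod[symmetric], subst lborel_pair.nn_integral_snd[symmetric]) (auto simp: lborel_prod)
  also have "... \<le> (NN v. ennreal (real k ^ j * N) * ennreal (cmod (?i v)))" by (intro nn_integral_mono inner)
  also have "... = ennreal (real k ^ j * N) * (NN v. ennreal (cmod (?i v)))" by (rule nn_integral_cmult) measurable
  also have "... < \<infinity>"
  proof -
   have "intg ?i" by (intro tp_integral integrable_indicator_complex Qk Ck)
   then show ?thesis unfolding integrable_iff_bounded by (simp add: ennreal_mult_less_top)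
  qed
  finally show "(NN y. ennreal (cmod (pb j A y * ?i (snd y)))) < \<infinity>" .
 qed measurable
 then have "intg (%x. (%y. pb j A y * ?i (snd y)) (tau x))" by (subst mpiso_integral(2)[OF mpiso_tau]) measurable
 then show "intg (%x. pb j A (tau x) * ?i (snd x))" by (simp add: tau_def)
qed

text \<open>On sheared frequencies the real kernel \<open>kk\<close> times the Fourier phase is the
  holomorphic kernel \<open>lk\<close> at zeta1 and zeta2 - i zeta1^2.\<close>

lemma ift_pb:
 assumes A: "A \<in> L2b" and q: "0 < ss x"
 shows "ift (%x. pb j A (tau x)) x = v2 (Ks x) ^ j * (of_real (1 / (2 * pi)) * Lf (dB j A) (Ks x))"
proof -
 have [measurable]: "A \<in> BM" using A by (auto simp: L2s_def)
 obtain u1 u2 p q where x: "x = ((u1, u2), (p, q))" by (metis surj_pair)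
 have q: "0 < q" using q by (simp add: x)
 let ?c = "2 * p"
 let ?G = "%l. pb j A (l, (p, q)) * ker (fst l + ?c * snd l, snd l) (u1, u2)"
 let ?a = "fst (Ks x)" and ?b = "snd (Ks x) - \<i> * (fst (Ks x))\<^sup>2"
 have b: "?b = of_real (u2 + ?c * u1) + \<i> * of_real (q + 2 * p\<^sup>2)" by (simp add: x Ks_eq power2_eq_square algebra_simps)
 have k: "of_real (kk p (q + 2 * p\<^sup>2) l) * ker (fst l + ?c * snd l, snd l) (u1, u2) = lk ?a ?b l" for l
 proof -
  have "of_real (kk p (q + 2 * p\<^sup>2) l) = exp (cr (- fst l * p - snd l * (q + 2 * p\<^sup>2)))" unfolding kk_def by (rule exp_of_real[symmetric])
  then show ?thesis unfolding b by (simp add: lk_def ker_def exp_add[symmetric] x Ks_eq algebra_simps)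
 qed
 have v: "v2 (Ks x) = of_real q" by (simp add: v2_def Ks_eq x cmod_power2)
 have "(LB \<xi>. pb j A (tau (\<xi>, (p, q))) * ker \<xi> (u1, u2)) = (LB \<xi>. ?G (fst \<xi> - ?c * snd \<xi>, snd \<xi>))"
  by (intro int_cong refl) (simp add: tau_def mult_ac)
 also have "... = (LB l. ?G l)" by (rule mpiso_integral(1)[OF mpiso_tau2]) measurable
 also have "... = (LB l. of_real q ^ j * (dB j A l * lk ?a ?b l))"
  by (intro int_cong refl) (unfold k[symmetric], use q in \<open>simp add: pb_def mult_ac\<close>)
 also have "... = of_real q ^ j * Lf (dB j A) (Ks x)" by (simp add: Lf_def Lap_def)
 finally show ?thesis unfolding ift_def v by (simp add: x)
qed

section \<open>Preimages of the range of \<open>R0\<close>\<close>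

lemma mon_L2s: "mon j \<in> L2b"
proof -
 obtain M where "!!y. mon j y = (\<Sum>k<Suc j. M k * lgp k y)" using mon_span[of j "Suc j"] by auto
 then have "mon j = (%y. \<Sum>k<Suc j. M k * lgp k y)" by auto
 moreover have "(%y. \<Sum>k<Suc j. M k * lgp k y) \<in> L2b" by (intro L2s_sum L2s_scale lgp_L2s)
 ultimately show ?thesis by simp
qed

text \<open>Surjectivity of the transform supplies a square integrable preimage without a formula;
  pointwise inversion identifies it with a power of \<open>v2\<close> times a Laplace integral.
  Square integrability is thus never checked on the integral itself.\<close>

lemma monomial_preimage:
 fixes A :: "real \<times> real => complex" and j :: nat
 assumes A: "A \<in> L2b" and z: "!!u. snd u \<le> 0 ==> A u = 0"
 defines "\<Phi> \<equiv> vti (tp A (tp h0 (mon j)))"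
 shows "\<Phi> \<in> L2b"
  "\<exists>\<phi>\<in>L2b. FT \<phi> \<Phi> \<and> (AB x. 0 < ss x --> \<phi> x = v2 (Ks x) ^ j * (of_real (1 / (2 * pi)) * Lf (dB j A) (Ks x)))"
proof -
 show L: "\<Phi> \<in> L2b" unfolding \<Phi>_def by (intro vti_L2s tp_L2s A h0_L2s mon_L2s)
 have e: "\<Phi> = (%x. pb j A (tau x))" unfolding \<Phi>_def using vti_mon[OF z] by auto
 obtain \<phi> where \<phi>: "\<phi> \<in> L2b" "FT \<phi> \<Phi>" using FT_surj[OF L] by blast
 have "AB x. 0 < ss x --> \<phi> x = ift \<Phi> x"
  by (rule FT_inverse[OF \<phi>(1) L \<phi>(2)]) (use pb_slab[OF A] in \<open>simp add: e slab_def\<close>)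
 then have "AB x. 0 < ss x --> \<phi> x = v2 (Ks x) ^ j * (of_real (1 / (2 * pi)) * Lf (dB j A) (Ks x))"
  by eventually_elim (simp add: e ift_pb[OF A])
 then show "\<exists>\<phi>\<in>L2b. FT \<phi> \<Phi> \<and> (AB x. 0 < ss x --> \<phi> x = v2 (Ks x) ^ j * (of_real (1 / (2 * pi)) * Lf (dB j A) (Ks x)))"
  using \<phi> by blast
qed

lemma FT_sum:
 assumes "!!i. i \<in> I ==> \<phi> i \<in> L2b" "!!i. i \<in> I ==> \<Phi> i \<in> L2b" "!!i. i \<in> I ==> FT (\<phi> i) (\<Phi> i)"
 shows "FT (%x. \<Sum>i\<in>I. c i * \<phi> i x) (%x. \<Sum>i\<in>I. c i * \<Phi> i x)"
 unfolding FT_def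
proof
 fix k assume k: "k \<in> I4"
 have "innb (%x. \<Sum>i\<in>I. c i * \<phi> i x) (e4 gz k) = (\<Sum>i\<in>I. c i * innb (\<phi> i) (e4 gz k))"
  by (subst inn_sum_left) (auto intro!: L2s_scale assms e4_L2s k simp: inn_scale_left)
 also have "... = (\<Sum>i\<in>I. c i * innb (\<Phi> i) (e4 gh k))" by (intro sum.cong refl) (use assms(3) k in \<open>simp add: FT_def\<close>)
 also have "... = innb (%x. \<Sum>i\<in>I. c i * \<Phi> i x) (e4 gh k)"
  by (subst inn_sum_left) (auto intro!: L2s_scale assms e4_L2s k simp: inn_scale_left)
 finally show "innb (%x. \<Sum>i\<in>I. c i * \<phi> i x) (e4 gz k) = innb (%x. \<Sum>i\<in>I. c i * \<Phi> i x) (e4 gh k)" .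
qed

lemma holo_sum: "finite I ==> (!!i. i \<in> I ==> holo (F i)) ==> holo (%zeta. \<Sum>i\<in>I. F i zeta)"
 unfolding holo_def by (auto intro!: smooth_sum simp: dbar_sum)

lemma lgp_mon: "k < n ==> lgp k y = (\<Sum>i<n. ((-1) ^ k * of_real (coeff (Lag k) i)) * mon i y)"
proof -
 assume k: "k < n"
 have "poly (Lag k) y = (\<Sum>i\<le>k. coeff (Lag k) i * y ^ i)" by (simp add: poly_altdef degree_Lag)
 also have "... = (\<Sum>i<n. coeff (Lag k) i * y ^ i)" by (rule sum.mono_neutral_left) (use k Lag_coeff(2)[of k] in auto)
 finally have p: "poly (Lag k) y = (\<Sum>i<n. coeff (Lag k) i * y ^ i)" .
 have "cr ((-1) ^ k * poly (Lag k) y * exp (- y / 2)) = (\<Sum>i<n. of_real ((-1) ^ k * coeff (Lag k) i) * of_real (y ^ i * exp (- y / 2)))"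
  unfolding p of_real_mult[symmetric] of_real_sum[symmetric] by (simp add: sum_distrib_left sum_distrib_right mult_ac)
 then show ?thesis unfolding lgp_def laguerre_fun_eq mon_def by (cases "0 < y") simp_all
qed

lemma poly_bergman_preimage:
 assumes g: "g \<in> carr (L2_pow n RRp)"
 shows "\<exists>f\<in>carr (poly_bergman 1 n). AE z in lebesgue_on CPi. U f z = R0 n g z"
proof -
 obtain gb where gb: "!!k. gb k \<in> L2b" "!!k. k < n ==> rep2 (g k) (gb k)" using L2_pow_rep[OF g] by blast
 have gz0: "gb k u = 0" if "k < n" "snd u \<le> 0" for k u using rep2D(2)[OF gb(2)[OF that(1)] that(2)] .
 \<comment> \<open>Pairs of a component k and a power i: each Laguerre function is expanded into
   monomials.\<close>
 define I where "I = {..<n} \<times> {..<n}"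
 define c where "c i = ((-1) ^ fst i * cr (coeff (Lag (fst i)) (snd i)))" for i :: "nat \<times> nat"
 define \<Phi>i where "\<Phi>i i = vti (tp (gb (fst i)) (tp h0 (mon (snd i))))" for i :: "nat \<times> nat"
 define Fi where "Fi i zeta = of_real (1 / (2 * pi)) * Lf (dB (snd i) (gb (fst i))) zeta" for i zeta
 have \<Phi>iL: "\<Phi>i i \<in> L2b" if "i \<in> I" for i
  unfolding \<Phi>i_def by (rule monomial_preimage(1)[OF gb(1)]) (use that gz0 in \<open>auto simp: I_def\<close>)
 have "\<forall>i. \<exists>\<phi>. i \<in> I --> \<phi> \<in> L2b \<and> FT \<phi> (\<Phi>i i) \<and> (AB x. 0 < ss x --> \<phi> x = v2 (Ks x) ^ snd i * Fi i (Ks x))"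
 proof (intro allI)
  fix i
  have "\<exists>\<phi>\<in>L2b. FT \<phi> (\<Phi>i i) \<and> (AB x. 0 < ss x --> \<phi> x = v2 (Ks x) ^ snd i * Fi i (Ks x))" if "i \<in> I"
   unfolding \<Phi>i_def Fi_def by (rule monomial_preimage(2)[OF gb(1)]) (use that gz0 in \<open>auto simp: I_def\<close>)
  then show "\<exists>\<phi>. i \<in> I --> \<phi> \<in> L2b \<and> FT \<phi> (\<Phi>i i) \<and> (AB x. 0 < ss x --> \<phi> x = v2 (Ks x) ^ snd i * Fi i (Ks x))" by blast
 qed
 then obtain \<phi>i where "\<forall>i. i \<in> I --> \<phi>i i \<in> L2b \<and> FT (\<phi>i i) (\<Phi>i i) \<and> (AB x. 0 < ss x --> \<phi>i i x = v2 (Ks x) ^ snd i * Fi i (Ks x))"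
  unfolding choice_iff by (elim exE)
 then have \<phi>i: "!!i. i \<in> I ==> \<phi>i i \<in> L2b" "!!i. i \<in> I ==> FT (\<phi>i i) (\<Phi>i i)"
  "!!i. i \<in> I ==> AB x. 0 < ss x --> \<phi>i i x = v2 (Ks x) ^ snd i * Fi i (Ks x)" by blast+
 define \<Phi> where "\<Phi> = vti (r0 n gb)"
 have r0L: "r0 n gb \<in> L2b" by (rule r0_L2s) (rule gb(1))
 have \<Phi>L: "\<Phi> \<in> L2b" unfolding \<Phi>_def by (rule vti_L2s[OF r0L])
 have \<Phi>e: "\<Phi> = (%x. \<Sum>i\<in>I. c i * \<Phi>i i x)"
 proof
  fix x
  have "r0 n gb y = (\<Sum>i\<in>I. c i * tp (gb (fst i)) (tp h0 (mon (snd i))) y)" for y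
  proof -
   have "r0 n gb y = (\<Sum>k<n. \<Sum>i<n. c (k, i) * tp (gb k) (tp h0 (mon i)) y)"
    unfolding r0_def by (intro sum.cong refl) (simp add: tp_def hl_def lgp_mon[of _ n] c_def sum_distrib_left mult_ac)
   then show ?thesis unfolding I_def sum.cartesian_product by (simp add: case_prod_beta')
  qed
  then show "\<Phi> x = (\<Sum>i\<in>I. c i * \<Phi>i i x)" unfolding \<Phi>_def \<Phi>i_def vti_def by (simp add: sum_distrib_left mult_ac)
 qed
 define \<phi> where "\<phi> x = (\<Sum>i\<in>I. c i * \<phi>i i x)" for x
 have \<phi>L: "\<phi> \<in> L2b" unfolding \<phi>_def[abs_def] by (intro L2s_sum L2s_scale \<phi>i(1))
 have FT: "FT \<phi> \<Phi>" unfolding \<Phi>e \<phi>_def[abs_def] by (rule FT_sum) (use \<phi>i \<Phi>iL in auto)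
 define f where "f zeta = (\<Sum>j<n. v2 zeta ^ j * (\<Sum>k<n. c (k, j) * Fi (k, j) zeta))" for zeta
 have Fh: "holo (Fi i)" for i unfolding Fi_def by (intro holo_cmult Lf_holo admB_dB gb(1))
 have PB: "PB n f" unfolding PB_def
 proof (rule exI[of _ "%j zeta. \<Sum>k<n. c (k, j) * Fi (k, j) zeta"], intro conjI allI impI ballI)
  show "holo (%zeta. \<Sum>k<n. c (k, j) * Fi (k, j) zeta)" for j by (rule holo_sum) (auto intro: holo_cmult Fh)
 qed (simp add: f_def)
 have "AB x. \<forall>i\<in>I. 0 < ss x --> \<phi>i i x = v2 (Ks x) ^ snd i * Fi i (Ks x)"
  by (rule AE_finite_allI) (use \<phi>i(3) in \<open>auto simp: I_def\<close>)
 then have fae: "AB x. 0 < ss x --> f (Ks x) = \<phi> x"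
 proof eventually_elim
  case (elim x)
  show ?case
  proof
   assume p: "0 < ss x"
   have "\<phi> x = (\<Sum>i\<in>I. c i * (v2 (Ks x) ^ snd i * Fi i (Ks x)))" unfolding \<phi>_def by (intro sum.cong refl) (use elim p in auto)
   also have "... = (\<Sum>k<n. \<Sum>j<n. c (k, j) * (v2 (Ks x) ^ j * Fi (k, j) (Ks x)))" unfolding I_def sum.cartesian_product by (simp add: case_prod_beta')
   also have "... = f (Ks x)" unfolding f_def by (subst sum.swap) (simp add: sum_distrib_left mult_ac)
   finally show "f (Ks x) = \<phi> x" ..
  qed
 qed
 \<comment> \<open>\<open>\<phi>\<close> was obtained without control over its values for v2 <= 0.
   Multiplication by this indicator makes it a representative of \<open>f\<close>, and the transform
   stays the same because \<open>\<Phi>\<close> already vanishes there.\<close>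
 define h where "h v = (indicator {0<..} (snd v) :: complex)" for v :: "real \<times> real"
 have [measurable]: "h \<in> BM" unfolding h_def[abs_def] by measurable
 have hb: "cmod (h v) \<le> 1" for v by (simp add: h_def indicator_def)
 define \<psi> where "\<psi> x = h (snd x) * \<phi> x" for x
 have \<psi>L: "\<psi> \<in> L2b" unfolding \<psi>_def[abs_def] by (rule L2s_bounded_mult[OF \<phi>L, where C = 1]) (use hb in auto)
 have r: "rep Ks siegel f \<psi>" unfolding rep_def Ks_siegel
 proof (intro conjI allI impI)
  show "\<psi> \<in> BM" using \<psi>L by (simp add: L2s_def)
  show "\<psi> x = 0" if "\<not> 0 < ss x" for x using that by (simp add: \<psi>_def h_def)
  show "AB x. 0 < ss x --> f (Ks x) = \<psi> x" using fae by eventually_elim (simp add: \<psi>_def h_def)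
 qed
 have fL: "f \<in> L2s (lebesgue_on siegel)" using rep_L2s_iff[OF mpiso_Ks siegel_borel r] \<psi>L by blast
 have fA: "f \<in> carr (poly_bergman 1 n)" using poly_bergman_PB fL PB by blast
 have "(%x. h (snd x) * \<Phi> x) = \<Phi>"
 proof
  fix x :: r4
  show "h (snd x) * \<Phi> x = \<Phi> x"
  proof (cases "0 < ss x")
   case False
   then have "\<not> 0 < 2 * \<bar>sf x\<bar> * ss x" by (simp add: zero_less_mult_iff)
   then have "\<Phi> x = 0" unfolding \<Phi>_def vti_def r0_def by (simp add: rinv_def Let_def tp_def hl_def lgp_def)
   then show ?thesis by simp
  qed (simp add: h_def)
 qed
 moreover have "FT (%x. h (snd x) * \<phi> x) (%x. h (snd x) * \<Phi> x)" by (rule FT_mult[OF \<phi>L \<Phi>L FT _ hb]) measurable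
 ultimately have FT2: "FT \<psi> \<Phi>" unfolding \<psi>_def[abs_def] by simp
 \<comment> \<open>\<open>U f\<close> is described by some representative of \<open>f\<close> and
   its transform; uniqueness of the transform identifies the latter with the given
   \<open>\<Phi>\<close>.\<close>
 obtain \<phi>' \<Phi>' where U: "rep Ks siegel f \<phi>'" "rep J CPi (U f) (vt \<Phi>')" "FT \<phi>' \<Phi>'" "\<phi>' \<in> L2b" "\<Phi>' \<in> L2b" using U_rep[OF fL] by blast
 have "AB x. \<phi>' x = \<psi> x" using rep_AE_iff[OF mpiso_Ks siegel_borel U(1) r] by simp
 then have "innb \<psi> (e4 gz i) = innb \<phi>' (e4 gz i)" if "i \<in> I4" for i
  using e4_L2s(1)[OF that] \<psi>L U(4) by (intro inn_cong_AE) (auto simp: L2s_def elim: eventually_mono)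
 then have "FT \<psi> \<Phi>'" using U(3) by (simp add: FT_def)
 from FT_unique[OF \<psi>L U(5) \<Phi>L this FT2] have "AB x. \<Phi>' x = \<Phi> x" .
 from rr_AE[OF this] AE_lborel_nonzero have "AB x. vt \<Phi>' x = r0 n gb x"
 proof eventually_elim
  case (elim x)
  have "vt \<Phi>' x = vt \<Phi> x" using elim(1) by (simp add: vt_def)
  then show ?case using vt_vti[OF elim(2)] by (simp add: \<Phi>_def)
 qed
 then have "AE z in lebesgue_on CPi. U f z = R0 n g z" using rep_AE_iff[OF mpiso_J CPi_borel U(2) rep_R0[of n g gb, OF gb(2)]] by blast
 then show ?thesis using fA by blast
qed

theorem theorem3p1:
 fixes n :: nat
  and c :: "real \<times> real \<Rightarrow> complex"
  and c_tilde :: "complex \<times> complex \<Rightarrow> complex"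
 assumes "n \<ge> 1"
  and "c_tilde \<in> Linf siegel"
  and "\<And>\<zeta>1 \<zeta>2. (\<zeta>1, \<zeta>2) \<in> siegel \<Longrightarrow>
     c_tilde (\<zeta>1, \<zeta>2) = c (Im \<zeta>1, Im \<zeta>2 - (cmod \<zeta>1)\<^sup>2)"
 shows "unitarily_equivalent (poly_bergman 1 n) (toeplitz n c_tilde)
     (L2_pow n RRp) (mult_op n (gamma_c c)) \<and>
    (\<forall>g\<in>carr (L2_pow n RRp).
     eqv (L2_pow n RRp) (mult_op n (gamma_c c) g)
      (R n (toeplitz n c_tilde (R_star n g))))"
 by (rule toeplitz_diagonalization[OF assms(2,3) poly_bergman_image poly_bergman_preimage])

end
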